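(* For any nonnegative integers $p,q$ there is an isomorphism of $(\mathfrak{gl}_\infty,\mathfrak S_p\times\mathfrak S_q)$-modules $$\mathbf V^{\{p,q\}}\;\cong\;\bigoplus_{|\lambda|=p}\ \bigoplus_{|\mu|=q}\boldsymbol\Gamma_{\lambda;\mu}\otimes(H_\lambda\otimes H_\mu).$$ For any partitions $\lambda,\mu$, the $\mathfrak{gl}_\infty$-module $\boldsymbol\Gamma_{\lambda;\mu}$ is an irreducible highest weight module with highest weight $\chi=\sum_{i\in\mathbb N}\lambda_i\,\varepsilon_i-\sum_{i\in\mathbb N}\mu_i\,\varepsilon_{-i}$. Furthermore, $\boldsymbol\Gamma_{\lambda;\mu}$ is irreducible when regarded by restriction as an $\mathfrak{sl}_\infty$-module.
   Context: $\Bbbk$ is a field of characteristic zero; everything is over $\Bbbk$. $\mathbb N$ is the set of positive integers. Let $\mathbf V,\mathbf V_*$ be countably infinite-dimensional vector spaces with a non-degenerate pairing $\langle\cdot,\cdot\rangle:\mathbf V\otimes\mathbf V_*\to\Bbbk$ (we also write $\langle u^*,v\rangle=\langle v,u^*\rangle$). $\mathfrak{gl}_\infty$ is the space $\mathbf V\otimes\mathbf V_*$ with Lie bracket $[u\otimes u^*,v\otimes v^*]=\langle u^*,v\rangle\,u\otimes v^*-\langle v^*,u\rangle\,v\otimes u^*$; $\mathfrak{sl}_\infty$ is the kernel of $\langle\cdot,\cdot\rangle$, a Lie subalgebra. Fix dual bases $\{\xi_i\}$ of $\mathbf V$ and $\{\xi_i^*\}$ of $\mathbf V_*$ indexed by $\mathfrak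 I=\mathbb Z\setminus\{0\}$, with $\langle\xi_j^*,\xi_i\rangle=\delta_{i,j}$ (such bases exist), and put $E_{i,j}=\xi_i\otimes\xi_j^*$. $\mathfrak{gl}_\infty$ acts on $\mathbf V$ by $(u\otimes u^* )v=\langle u^*,v\rangle u$, on $\mathbf V_*$ by $(u\otimes u^* )v^*=-\langle v^*,u\rangle u^*$, and on $\mathbf V^{\otimes(p,q)}=\mathbf V^{\otimes p}\otimes\mathbf V_*^{\otimes q}$ by the Leibniz rule. $\mathfrak S_p\times\mathfrak S_q$ acts by permuting the factors, commuting with $\mathfrak{gl}_\infty$; a $(\mathfrak{gl}_\infty,\mathfrak S_p\times\mathfrak S_q)$-module is a space with commuting actions of both. For $I=(i,j)$ with $1\le i\le p$, $1\le j\le q$, the contraction $\Phi_I:\mathbf V^{\otimes(p,q)}\to\mathbf V^{\otimes(p-1,q-1)}$ sends $v_1\otimes\dots\otimes v_p\otimes v_1^*\otimes\dots\otimes v_q^*$ to $\langle v_j^*,v_i\rangle$ times the tensor with $v_i$ and $v_j^*$ omitted. Set $\mathbf V^{\{p,q\}}=\bigcap_I\ker\Phi_I$, with $\mathbf V^{\{p,0\}}=\mathbf V^{\otimes p}$ and $\mathbf V^{\{0,q\}}=\mathbf V_*^{\otimes q}$. A partition is a finite nonincreasing sequence of positive integers $\lambda=(\lambda_1\ge\dots\ge\lambda_k)$, $|\lambda|=\sum\lambda_i$, with $\lambda_i=0$ for $i>k$. For $|\lambda|=d$, $c_\lambda\in\Bbbk[\mathfrak S_d]$ is the Young symmetrizer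 of the standard tableau of shape $\lambda$ (numbered consecutively along rows): the product of the sum of the elements of the row stabilizer and the signed sum of the elements of the column stabilizer. $H_\lambda=\Bbbk[\mathfrak S_d]c_\lambda$ is the corresponding irreducible $\mathfrak S_d$-module, and $\mathbb S_\lambda V=\operatorname{im}(c_\lambda:V^{\otimes d}\to V^{\otimes d})$ for a vector space $V$. For $|\lambda|=p$, $|\mu|=q$ define the $\mathfrak{gl}_\infty$-module $$\boldsymbol\Gamma_{\lambda;\mu}=\mathbf V^{\{p,q\}}\cap(\mathbb S_\lambda\mathbf V\otimes\mathbb S_\mu\mathbf V_* )\subset\mathbf V^{\otimes(p,q)}.$$ Highest weight modules: $\mathfrak h_{\mathfrak{gl}}=\bigoplus_{i\in\mathfrak I}\Bbbk E_{i,i}$, and $\varepsilon_i\in\mathfrak h_{\mathfrak{gl}}^*$ is given by $\varepsilon_i(E_{j,j})=\delta_{i,j}$; $E_{i,j}$ ($i\neq j$) is the root vector of root $\varepsilon_i-\varepsilon_j$. The positive roots are the $\varepsilon_i-\varepsilon_j$ with $0<i<j$, or $i<j<0$, or $j<0<i$; $\mathfrak n_{\mathfrak{gl}}$ is the span of the positive root vectors. A $\mathfrak{gl}_\infty$-module is a highest weight module with highest weight $\chi\in\mathfrak h_{\mathfrak{gl}}^*$ if it is generated by a nonzero vector $v$ with $\mathfrak n_{\mathfrak{gl}}v=0$ and $Hv=\chi(H)v$ for all $H\in\mathfrak h_{\mathfrak{gl}}$. *)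

theory Defs
  imports Complex_Main "HOL-Library.Poly_Mapping" "HOL-Combinatorics.Permutations"
begin

section \<open>Free vector spaces, tensor products and direct sums\<close>

text \<open>A vector space with basis \<open>A\<close> over \<open>'k\<close> is represented by finitely supported
  functions \<open>'a \<Rightarrow>\<^sub>0 'k\<close> with support in \<open>A\<close>.\<close>

definition pscale :: "'k::field \<Rightarrow> ('a \<Rightarrow>\<^sub>0 'k) \<Rightarrow> 'a \<Rightarrow>\<^sub>0 'k" where
  "pscale c = Poly_Mapping.map ((*) c)"

lemma lookup_pscale [simp]: "Poly_Mapping.lookup (pscale c f) a = c * Poly_Mapping.lookup f a"
  by (cases "Poly_Mapping.lookup f a = 0") (simp_all add: pscale_def Poly_Mapping.map.rep_eq)

lemma vector_space_pscale: "vector_space pscale"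
  by unfold_locales (auto intro!: poly_mapping_eqI simp: Poly_Mapping.lookup_add algebra_simps)

interpretation pvs: vector_space pscale
  by (rule vector_space_pscale)

text \<open>The tensor product of the spaces with bases \<open>'a\<close> and \<open>'b\<close> is the space with basis
  \<open>'a \<times> 'b\<close>; over a field, \<open>M \<otimes> N\<close> is a subspace of it for all subspaces \<open>M\<close>, \<open>N\<close>.\<close>

definition tprod :: "('a \<Rightarrow>\<^sub>0 'k::field) \<Rightarrow> ('b \<Rightarrow>\<^sub>0 'k) \<Rightarrow> ('a \<times> 'b) \<Rightarrow>\<^sub>0 'k" where
  "tprod f g = Abs_poly_mapping (\<lambda>(a, b). Poly_Mapping.lookup f a * Poly_Mapping.lookup g b)"

definition tensor_subspace ::
    "('a \<Rightarrow>\<^sub>0 'k::field) set \<Rightarrow> ('b \<Rightarrow>\<^sub>0 'k) set \<Rightarrow> (('a \<times> 'b) \<Rightarrow>\<^sub>0 'k) set" where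
  "tensor_subspace M N = module.span pscale {tprod m n | m n. m \<in> M \<and> n \<in> N}"

text \<open>\<open>F \<otimes> G\<close> for linear maps \<open>F\<close> and \<open>G\<close>.\<close>

definition tmap :: "(('a \<Rightarrow>\<^sub>0 'k::field) \<Rightarrow> ('c \<Rightarrow>\<^sub>0 'k)) \<Rightarrow> (('b \<Rightarrow>\<^sub>0 'k) \<Rightarrow> ('d \<Rightarrow>\<^sub>0 'k))
    \<Rightarrow> (('a \<times> 'b) \<Rightarrow>\<^sub>0 'k) \<Rightarrow> ('c \<times> 'd) \<Rightarrow>\<^sub>0 'k" where
  "tmap F G t = (\<Sum>(a, b)\<in>Poly_Mapping.keys t.
     pscale (Poly_Mapping.lookup t (a, b)) (tprod (F (Poly_Mapping.single a 1)) (G (Poly_Mapping.single b 1))))"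

definition direct_sum :: "'i set \<Rightarrow> ('i \<Rightarrow> 'm set) \<Rightarrow> ('i \<Rightarrow>\<^sub>0 'm::zero) set" where
  "direct_sum A M = {f. Poly_Mapping.keys f \<subseteq> A \<and> (\<forall>i\<in>A. Poly_Mapping.lookup f i \<in> M i)}"

section \<open>Modules\<close>

definition linear_on :: "('k \<Rightarrow> 'm \<Rightarrow> 'm) \<Rightarrow> ('k \<Rightarrow> 'n \<Rightarrow> 'n) \<Rightarrow> 'm set
    \<Rightarrow> ('m::ab_group_add \<Rightarrow> 'n::ab_group_add) \<Rightarrow> bool" where
  "linear_on s1 s2 M f \<longleftrightarrow>
     (\<forall>x\<in>M. \<forall>y\<in>M. f (x + y) = f x + f y) \<and> (\<forall>c. \<forall>x\<in>M. f (s1 c x) = s2 c (f x))"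

text \<open>\<open>M\<close> is a module over the Lie algebra with underlying space \<open>L\<close> and bracket \<open>br\<close>.\<close>

definition lie_module :: "('k::field \<Rightarrow> 'l::ab_group_add \<Rightarrow> 'l) \<Rightarrow> ('l \<Rightarrow> 'l \<Rightarrow> 'l) \<Rightarrow> 'l set
    \<Rightarrow> ('k \<Rightarrow> 'm::ab_group_add \<Rightarrow> 'm) \<Rightarrow> ('l \<Rightarrow> 'm \<Rightarrow> 'm) \<Rightarrow> 'm set \<Rightarrow> bool" where
  "lie_module sL br L sM a M \<longleftrightarrow>
     module.subspace sM M \<and>
     (\<forall>X\<in>L. \<forall>m\<in>M. a X m \<in> M) \<and>
     (\<forall>X\<in>L. linear_on sM sM M (a X)) \<and>
     (\<forall>m\<in>M. linear_on sL sM L (\<lambda>X. a X m)) \<and>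
     (\<forall>X\<in>L. \<forall>Y\<in>L. \<forall>m\<in>M. a (br X Y) m = a X (a Y m) - a Y (a X m))"

definition submodule :: "'l set \<Rightarrow> ('k::field \<Rightarrow> 'm::ab_group_add \<Rightarrow> 'm) \<Rightarrow> ('l \<Rightarrow> 'm \<Rightarrow> 'm)
    \<Rightarrow> 'm set \<Rightarrow> 'm set \<Rightarrow> bool" where
  "submodule L s a M N \<longleftrightarrow> N \<subseteq> M \<and> module.subspace s N \<and> (\<forall>X\<in>L. \<forall>n\<in>N. a X n \<in> N)"

definition irreducible_lie_module :: "('k::field \<Rightarrow> 'l::ab_group_add \<Rightarrow> 'l) \<Rightarrow> ('l \<Rightarrow> 'l \<Rightarrow> 'l)
    \<Rightarrow> 'l set \<Rightarrow> ('k \<Rightarrow> 'm::ab_group_add \<Rightarrow> 'm) \<Rightarrow> ('l \<Rightarrow> 'm \<Rightarrow> 'm) \<Rightarrow> 'm set \<Rightarrow> bool" where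
  "irreducible_lie_module sL br L s a M \<longleftrightarrow>
     lie_module sL br L s a M \<and> M \<noteq> {0} \<and> (\<forall>N. submodule L s a M N \<longrightarrow> N = {0} \<or> N = M)"

section \<open>Dual pairs and mixed tensors\<close>

record ('k, 'v, 'w) dual_pair =
  scV :: "'k \<Rightarrow> 'v \<Rightarrow> 'v"
  scW :: "'k \<Rightarrow> 'w \<Rightarrow> 'w"
  pair :: "'v \<Rightarrow> 'w \<Rightarrow> 'k"
  xi :: "int \<Rightarrow> 'v"
  xid :: "int \<Rightarrow> 'w"

text \<open>\<open>'v\<close> plays the role of \<open>V\<close> and \<open>'w\<close> that of \<open>V\<^sub>*\<close>. The dual bases are indexed by the
  nonzero integers, so both spaces have countably infinite dimension.\<close>

definition dual_system :: "('k::field, 'v::ab_group_add, 'w::ab_group_add) dual_pair \<Rightarrow> bool" where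
  "dual_system P \<longleftrightarrow>
     vector_space (scV P) \<and> vector_space (scW P) \<and>
     (\<forall>w. Vector_Spaces.linear (scV P) (*) (\<lambda>v. pair P v w)) \<and>
     (\<forall>v. Vector_Spaces.linear (scW P) (*) (\<lambda>w. pair P v w)) \<and>
     (\<forall>v. (\<forall>w. pair P v w = 0) \<longrightarrow> v = 0) \<and>
     (\<forall>w. (\<forall>v. pair P v w = 0) \<longrightarrow> w = 0) \<and>
     inj_on (xi P) (- {0}) \<and> \<not> module.dependent (scV P) (xi P ` (- {0})) \<and>
     module.span (scV P) (xi P ` (- {0})) = UNIV \<and>
     inj_on (xid P) (- {0}) \<and> \<not> module.dependent (scW P) (xid P ` (- {0})) \<and>
     module.span (scW P) (xid P ` (- {0})) = UNIV \<and>
     (\<forall>i\<in>- {0}. \<forall>j\<in>- {0}. pair P (xi P i) (xid P j) = (if i = j then 1 else 0))"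

text \<open>The \<open>d\<close>-th tensor power of a space with basis \<open>(b i)\<close>, \<open>i \<noteq> 0\<close>, is the space with basis
  the words \<open>[i\<^sub>1, \<dots>, i\<^sub>d]\<close>, which stand for \<open>b i\<^sub>1 \<otimes> \<dots> \<otimes> b i\<^sub>d\<close>. If \<open>\<phi> i\<close> is the \<open>i\<close>-th coordinate
  function, \<open>ptens \<phi> [v\<^sub>1, \<dots>, v\<^sub>d]\<close> is the pure tensor \<open>v\<^sub>1 \<otimes> \<dots> \<otimes> v\<^sub>d\<close>.\<close>

definition wordset :: "nat \<Rightarrow> int list set" where
  "wordset d = {is. length is = d \<and> 0 \<notin> set is}"

definition tensor_power :: "nat \<Rightarrow> (int list \<Rightarrow>\<^sub>0 'k::field) set" where
  "tensor_power d = {t. Poly_Mapping.keys t \<subseteq> wordset d}"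

definition ptens :: "(int \<Rightarrow> 'v \<Rightarrow> 'k::field) \<Rightarrow> 'v list \<Rightarrow> int list \<Rightarrow>\<^sub>0 'k" where
  "ptens \<phi> vs = Abs_poly_mapping (\<lambda>is. if is \<in> wordset (length vs)
     then (\<Prod>a<length vs. \<phi> (is ! a) (vs ! a)) else 0)"

definition coordV :: "('k, 'v, 'w) dual_pair \<Rightarrow> int \<Rightarrow> 'v \<Rightarrow> 'k" where
  "coordV P i v = pair P v (xid P i)"

definition coordW :: "('k, 'v, 'w) dual_pair \<Rightarrow> int \<Rightarrow> 'w \<Rightarrow> 'k" where
  "coordW P i w = pair P (xi P i) w"

text \<open>The space of mixed tensors \<open>V\<^bsup>\<otimes>p\<^esup> \<otimes> V\<^sub>*\<^bsup>\<otimes>q\<^esup>\<close>. The lemmas \<open>multilinear_tens\<close>,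
  \<open>lift_tens\<close> and \<open>mixed_eq_span\<close> below show that it is the tensor product, with
  \<open>tens P vs ws\<close> the pure tensors.\<close>

definition mixed :: "nat \<Rightarrow> nat \<Rightarrow> ((int list \<times> int list) \<Rightarrow>\<^sub>0 'k::field) set" where
  "mixed p q = {t. Poly_Mapping.keys t \<subseteq> wordset p \<times> wordset q}"

definition tens :: "('k::field, 'v, 'w) dual_pair \<Rightarrow> 'v list \<Rightarrow> 'w list
    \<Rightarrow> (int list \<times> int list) \<Rightarrow>\<^sub>0 'k" where
  "tens P vs ws = tprod (ptens (coordV P) vs) (ptens (coordW P) ws)"

text \<open>\<open>lift P s f\<close> is the linear map to a space with scalar multiplication \<open>s\<close> that sends
  \<open>tens P vs ws\<close> to \<open>f vs ws\<close>, for multilinear \<open>f\<close> (lemma \<open>lift_tens\<close>).\<close>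

definition lift :: "('k::field, 'v, 'w) dual_pair \<Rightarrow> ('k \<Rightarrow> 'm \<Rightarrow> 'm::ab_group_add)
    \<Rightarrow> ('v list \<Rightarrow> 'w list \<Rightarrow> 'm) \<Rightarrow> ((int list \<times> int list) \<Rightarrow>\<^sub>0 'k) \<Rightarrow> 'm" where
  "lift P s f t = (\<Sum>(is, js)\<in>Poly_Mapping.keys t. s (Poly_Mapping.lookup t (is, js)) (f (map (xi P) is) (map (xid P) js)))"

definition multilinear :: "('k::field, 'v::ab_group_add, 'w::ab_group_add) dual_pair
    \<Rightarrow> ('k \<Rightarrow> 'm \<Rightarrow> 'm::ab_group_add) \<Rightarrow> nat \<Rightarrow> nat \<Rightarrow> ('v list \<Rightarrow> 'w list \<Rightarrow> 'm) \<Rightarrow> bool" where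
  "multilinear P s p q f \<longleftrightarrow> (\<forall>vs ws. length vs = p \<longrightarrow> length ws = q \<longrightarrow>
     (\<forall>a<p. Vector_Spaces.linear (scV P) s (\<lambda>x. f (vs[a := x]) ws)) \<and>
     (\<forall>b<q. Vector_Spaces.linear (scW P) s (\<lambda>y. f vs (ws[b := y]))))"

subsection \<open>The space of mixed tensors is the tensor product\<close>

lemma lookup_tprod [simp]:
  "Poly_Mapping.lookup (tprod f g) (a, b) = Poly_Mapping.lookup f a * Poly_Mapping.lookup g b"
proof -
  have "finite {x. (case x of (a, b) \<Rightarrow> Poly_Mapping.lookup f a * Poly_Mapping.lookup g b) \<noteq> 0}"
    by (rule finite_subset[of _ "Poly_Mapping.keys f \<times> Poly_Mapping.keys g"])
      (auto simp: in_keys_iff)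
  then show ?thesis
    unfolding tprod_def by (subst Abs_poly_mapping_inverse) auto
qed

locale coord_basis = vector_space s for s :: "'k::field \<Rightarrow> 'v::ab_group_add \<Rightarrow> 'v" +
  fixes b :: "int \<Rightarrow> 'v" and \<phi> :: "int \<Rightarrow> 'v \<Rightarrow> 'k"
  assumes span_b: "span (b ` (- {0})) = UNIV"
    and linear_coord: "Vector_Spaces.linear s (*) (\<phi> i)"
    and coord_b: "i \<noteq> 0 \<Longrightarrow> j \<noteq> 0 \<Longrightarrow> \<phi> i (b j) = (if i = j then 1 else 0)"
begin

definition supp :: "'v \<Rightarrow> int set" where
  "supp v = {i. i \<noteq> 0 \<and> \<phi> i v \<noteq> 0}"

lemma coord_sum: "\<phi> i (\<Sum>a\<in>A. s (c a) (f a)) = (\<Sum>a\<in>A. c a * \<phi> i (f a))"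
proof -
  interpret l: Vector_Spaces.linear s "(*)" "\<phi> i" by (rule linear_coord)
  show ?thesis by (simp add: l.sum l.scale)
qed

lemma finite_supp: "finite (supp v)"
  and expand: "finite S \<Longrightarrow> 0 \<notin> S \<Longrightarrow> supp v \<subseteq> S \<Longrightarrow> v = (\<Sum>i\<in>S. s (\<phi> i v) (b i))"
proof -
  have inj: "inj_on b (- {0})"
    by (rule inj_onI) (metis ComplD coord_b insertCI one_neq_zero)
  have "v \<in> span (b ` (- {0}))" by (simp add: span_b)
  then obtain t r where t: "finite t" "t \<subseteq> b ` (- {0})" and v: "v = (\<Sum>a\<in>t. s (r a) a)"
    unfolding span_explicit by blast
  from t obtain T where T: "T \<subseteq> - {0}" "finite T" "t = b ` T"
    by (metis finite_subset_image)
  have v': "v = (\<Sum>i\<in>T. s (r (b i)) (b i))"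
    unfolding v T(3) by (rule sum.reindex_cong[OF inj_on_subset[OF inj T(1)]]) auto
  have c: "\<phi> i v = (if i \<in> T then r (b i) else 0)" if "i \<noteq> 0" for i
  proof -
    have "\<phi> i v = (\<Sum>j\<in>T. r (b j) * \<phi> i (b j))" by (subst v') (rule coord_sum)
    also have "\<dots> = (\<Sum>j\<in>T. if i = j then r (b j) else 0)"
    proof (intro sum.cong refl)
      fix j assume "j \<in> T"
      then have "j \<noteq> 0" using T(1) by auto
      then show "r (b j) * \<phi> i (b j) = (if i = j then r (b j) else 0)"
        using that by (simp add: coord_b)
    qed
    finally show ?thesis using T(2) by simp
  qed
  have sub: "supp v \<subseteq> T" by (auto simp: supp_def c split: if_splits)
  then show "finite (supp v)" using T(2) by (rule finite_subset)
  have vT: "v = (\<Sum>i\<in>T. s (\<phi> i v) (b i))"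
  proof (subst v', intro sum.cong refl)
    fix i assume "i \<in> T"
    moreover from this have "i \<noteq> 0" using T(1) by auto
    ultimately show "s (r (b i)) (b i) = s (\<phi> i v) (b i)" by (simp add: c)
  qed
  show "v = (\<Sum>i\<in>S. s (\<phi> i v) (b i))" if S: "finite S" "0 \<notin> S" "supp v \<subseteq> S"
  proof -
    have "(\<Sum>i\<in>S. s (\<phi> i v) (b i)) = (\<Sum>i\<in>supp v. s (\<phi> i v) (b i))"
      using S by (intro sum.mono_neutral_right) (auto simp: supp_def)
    also have "\<dots> = (\<Sum>i\<in>T. s (\<phi> i v) (b i))"
      using sub T by (intro sum.mono_neutral_left) (auto simp: supp_def)
    finally show ?thesis using vT by simp
  qed
qed

lemma lookup_ptens:
  "Poly_Mapping.lookup (ptens \<phi> vs) is = (if is \<in> wordset (length vs)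
     then (\<Prod>a<length vs. \<phi> (is ! a) (vs ! a)) else 0)"
proof -
  let ?S = "\<Union> (supp ` set vs)"
  have "finite {is. (if is \<in> wordset (length vs)
     then (\<Prod>a<length vs. \<phi> (is ! a) (vs ! a)) else 0) \<noteq> 0}"
  proof (rule finite_subset)
    show "finite {is. set is \<subseteq> ?S \<and> length is = length vs}"
      by (rule finite_lists_length_eq) (simp add: finite_supp)
    show "{is. (if is \<in> wordset (length vs)
     then (\<Prod>a<length vs. \<phi> (is ! a) (vs ! a)) else 0) \<noteq> 0}
      \<subseteq> {is. set is \<subseteq> ?S \<and> length is = length vs}"
    proof clarsimp
      fix "is" x
      assume w: "is \<in> wordset (length vs)" and nz: "\<forall>a\<in>{..<length vs}. \<phi> (is ! a) (vs ! a) \<noteq> 0"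
      show "set is \<subseteq> ?S \<and> length is = length vs"
      proof
        show l: "length is = length vs" using w by (simp add: wordset_def)
        show "set is \<subseteq> ?S"
        proof
          fix x assume "x \<in> set is"
          then obtain a where a: "a < length is" "x = is ! a" by (metis in_set_conv_nth)
          then have "x \<noteq> 0" using w by (metis mem_Collect_eq nth_mem wordset_def)
          then have "x \<in> supp (vs ! a)" using nz a l by (auto simp: supp_def)
          then show "x \<in> ?S" using a l by auto
        qed
      qed
    qed
  qed
  then show ?thesis
    unfolding ptens_def by (subst Abs_poly_mapping_inverse) auto
qed

lemma multilinear_expand_aux:
  assumes s2: "vector_space (s2 :: 'k \<Rightarrow> 'm::ab_group_add \<Rightarrow> 'm)"
    and S: "finite S" "0 \<notin> S"
  shows "(\<And>v. v \<in> set vs \<Longrightarrow> supp v \<subseteq> S) \<Longrightarrow>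
    (\<And>xs a. length xs = length vs \<Longrightarrow> a < length vs \<Longrightarrow>
       Vector_Spaces.linear s s2 (\<lambda>x. g (xs[a := x]))) \<Longrightarrow>
    g vs = (\<Sum>is\<in>{is. set is \<subseteq> S \<and> length is = length vs}.
              s2 (\<Prod>a<length vs. \<phi> (is ! a) (vs ! a)) (g (map b is)))"
proof (induction vs arbitrary: g)
  case Nil
  interpret t: vector_space s2 by (rule s2)
  have "{is. set is \<subseteq> S \<and> length is = length ([]::'v list)} = {[]}" by auto
  then show ?case by simp
next
  case (Cons v vs)
  interpret t: vector_space s2 by (rule s2)
  let ?W = "\<lambda>n. {is. set is \<subseteq> S \<and> length is = n}"
  interpret l: Vector_Spaces.linear s s2 "\<lambda>x. g (x # vs)"
    using Cons.prems(2)[of "v # vs" 0] by simp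
  have IH: "g (b i # vs) = (\<Sum>is\<in>?W (length vs).
              s2 (\<Prod>a<length vs. \<phi> (is ! a) (vs ! a)) (g (b i # map b is)))" for i
  proof (rule Cons.IH)
    show "supp w \<subseteq> S" if "w \<in> set vs" for w using Cons.prems(1)[of w] that by simp
    show "Vector_Spaces.linear s s2 (\<lambda>x. g (b i # xs[a := x]))"
      if "length xs = length vs" "a < length vs" for xs a
      using Cons.prems(2)[of "b i # xs" "Suc a"] that by simp
  qed
  have bij: "bij_betw (\<lambda>(i, is). i # is) (S \<times> ?W (length vs)) (?W (length (v # vs)))"
    by (rule bij_betwI[where g = "\<lambda>is. (hd is, tl is)"]) (auto simp: length_Suc_conv)
  have "g (v # vs) = g ((\<Sum>i\<in>S. s (\<phi> i v) (b i)) # vs)"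
    using expand[OF S, of v] Cons.prems(1)[of v] by simp
  also have "\<dots> = (\<Sum>i\<in>S. s2 (\<phi> i v) (g (b i # vs)))"
    by (simp add: l.sum l.scale)
  also have "\<dots> = (\<Sum>i\<in>S. \<Sum>is\<in>?W (length vs).
      s2 (\<phi> i v * (\<Prod>a<length vs. \<phi> (is ! a) (vs ! a))) (g (map b (i # is))))"
    by (subst IH) (simp add: t.scale_sum_right)
  also have "\<dots> = (\<Sum>(i, is)\<in>S \<times> ?W (length vs).
      s2 (\<Prod>a<length (v # vs). \<phi> ((i # is) ! a) ((v # vs) ! a)) (g (map b (i # is))))"
    unfolding sum.cartesian_product
    by (intro sum.cong) (auto simp: prod.lessThan_Suc_shift simp del: prod.lessThan_Suc)
  also have "\<dots> = (\<Sum>is\<in>?W (length (v # vs)).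
      s2 (\<Prod>a<length (v # vs). \<phi> (is ! a) ((v # vs) ! a)) (g (map b is)))"
    by (subst sum.reindex_bij_betw[OF bij, symmetric]) (simp add: case_prod_unfold)
  finally show ?case .
qed

lemma multilinear_expand:
  assumes s2: "vector_space (s2 :: 'k \<Rightarrow> 'm::ab_group_add \<Rightarrow> 'm)"
    and lin: "\<And>xs a. length xs = length vs \<Longrightarrow> a < length vs \<Longrightarrow>
       Vector_Spaces.linear s s2 (\<lambda>x. g (xs[a := x]))"
  shows "(\<Sum>is\<in>Poly_Mapping.keys (ptens \<phi> vs).
            s2 (Poly_Mapping.lookup (ptens \<phi> vs) is) (g (map b is))) = g vs"
proof -
  interpret t: vector_space s2 by (rule s2)
  let ?S = "\<Union> (supp ` set vs)" and ?l = "Poly_Mapping.lookup (ptens \<phi> vs)"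
  let ?W = "{is. set is \<subseteq> ?S \<and> length is = length vs}"
  have fin: "finite ?S" "0 \<notin> ?S" by (auto simp: finite_supp) (auto simp: supp_def)
  have W: "is \<in> wordset (length vs)" if "is \<in> ?W" for "is"
    using that fin(2) by (auto simp: wordset_def)
  have "g vs = (\<Sum>is\<in>?W. s2 (\<Prod>a<length vs. \<phi> (is ! a) (vs ! a)) (g (map b is)))"
    by (rule multilinear_expand_aux[OF s2 fin]) (use lin in auto)
  also have "\<dots> = (\<Sum>is\<in>?W. s2 (?l is) (g (map b is)))"
    by (intro sum.cong) (use W in \<open>auto simp: lookup_ptens\<close>)
  also have "\<dots> = (\<Sum>is\<in>Poly_Mapping.keys (ptens \<phi> vs). s2 (?l is) (g (map b is)))"
  proof (rule sum.mono_neutral_right)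
    show "finite ?W" using fin(1) by (rule finite_lists_length_eq)
    show "Poly_Mapping.keys (ptens \<phi> vs) \<subseteq> ?W"
    proof
      fix "is" assume "is \<in> Poly_Mapping.keys (ptens \<phi> vs)"
      then have w: "is \<in> wordset (length vs)" and nz: "\<forall>a<length vs. \<phi> (is ! a) (vs ! a) \<noteq> 0"
        by (auto simp: in_keys_iff lookup_ptens split: if_splits)
      have l: "length is = length vs" using w by (simp add: wordset_def)
      have "x \<in> ?S" if x: "x \<in> set is" for x
      proof -
        obtain a where a: "a < length is" "x = is ! a" using x by (metis in_set_conv_nth)
        have "x \<noteq> 0" using w x by (metis mem_Collect_eq wordset_def)
        moreover have "\<phi> x (vs ! a) \<noteq> 0" using nz a l by simp
        ultimately have "x \<in> supp (vs ! a)" by (simp add: supp_def)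
        moreover have "vs ! a \<in> set vs" using a l by simp
        ultimately show ?thesis by (rule UN_I[rotated])
      qed
      then have "set is \<subseteq> ?S" by (rule subsetI)
      then show "is \<in> ?W" by (intro CollectI conjI l)
    qed
  qed (auto simp: in_keys_iff)
  finally show ?thesis by simp
qed

lemma lookup_ptens_basis:
  assumes "is \<in> wordset d"
  shows "ptens \<phi> (map b is) = Poly_Mapping.single is 1"
proof (rule poly_mapping_eqI)
  fix js
  show "Poly_Mapping.lookup (ptens \<phi> (map b is)) js
    = Poly_Mapping.lookup (Poly_Mapping.single is 1) js"
  proof (cases "js \<in> wordset (length is)")
    case True
    have l: "length js = length is" and z: "0 \<notin> set js" "0 \<notin> set is"
      using True assms by (simp_all add: wordset_def)
    have "\<phi> (js ! a) (map b is ! a) = (if js ! a = is ! a then 1 else 0)"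
      if a: "a < length is" for a
    proof -
      have "js ! a \<in> set js" "is ! a \<in> set is" using a l by simp_all
      then have "js ! a \<noteq> 0" "is ! a \<noteq> 0" using z by fastforce+
      then show ?thesis using a by (simp add: coord_b)
    qed
    then have "(\<Prod>a<length is. \<phi> (js ! a) (map b is ! a))
        = (\<Prod>a<length is. if js ! a = is ! a then 1 else 0)"
      by (intro prod.cong) auto
    also have "\<dots> = (if is = js then 1 else 0)"
    proof (cases "is = js")
      case False
      have "\<exists>a<length is. is ! a \<noteq> js ! a"
        using False l nth_equalityI[of "is" js] by metis
      then have "(\<Prod>a<length is. if js ! a = is ! a then 1 else 0 :: 'k) = 0"
        by (intro prod_zero) (simp, metis lessThan_iff)
      then show ?thesis using False by simp
    qed simp
    finally show ?thesis using True by (simp add: lookup_ptens lookup_single when_def)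
  next
    case False
    then show ?thesis using assms by (auto simp: lookup_ptens lookup_single when_def wordset_def)
  qed
qed

lemma linear_lookup_ptens:
  assumes "a < length vs"
  shows "Vector_Spaces.linear s (*) (\<lambda>x. Poly_Mapping.lookup (ptens \<phi> (vs[a := x])) is)"
proof -
  interpret l: Vector_Spaces.linear s "(*)" "\<phi> (is ! a)" by (rule linear_coord)
  define r where "r = (if is \<in> wordset (length vs)
     then (\<Prod>c\<in>{..<length vs} - {a}. \<phi> (is ! c) (vs ! c)) else 0)"
  have *: "Poly_Mapping.lookup (ptens \<phi> (vs[a := x])) is = r * \<phi> (is ! a) x" for x
  proof -
    have "(\<Prod>c<length vs. \<phi> (is ! c) (vs[a := x] ! c))
        = \<phi> (is ! a) (vs[a := x] ! a) * (\<Prod>c\<in>{..<length vs} - {a}. \<phi> (is ! c) (vs[a := x] ! c))"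
      by (rule prod.remove) (use assms in auto)
    also have "(\<Prod>c\<in>{..<length vs} - {a}. \<phi> (is ! c) (vs[a := x] ! c))
        = (\<Prod>c\<in>{..<length vs} - {a}. \<phi> (is ! c) (vs ! c))"
      by (intro prod.cong) auto
    finally show ?thesis using assms by (simp add: lookup_ptens r_def)
  qed
  show ?thesis
    unfolding * by unfold_locales (simp_all only: l.add l.scale ring_distribs mult.left_commute)
qed

end

lemma dual_system_coord_basis:
  assumes P: "dual_system P"
  shows "coord_basis (scV P) (xi P) (coordV P)" "coord_basis (scW P) (xid P) (coordW P)"
proof -
  have e: "coordV P i = (\<lambda>v. pair P v (xid P i))" "coordW P i = (\<lambda>w. pair P (xi P i) w)" for i
    by (rule ext, simp only: coordV_def coordW_def)+
  note D = P[unfolded dual_system_def]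
  have d: "pair P (xi P i) (xid P j) = (if i = j then 1 else 0)" if "i \<noteq> 0" "j \<noteq> 0" for i j
    using D that by blast
  show "coord_basis (scV P) (xi P) (coordV P)"
    unfolding coord_basis_def coord_basis_axioms_def e
    by (intro conjI allI impI) (use D in blast, use D in blast, use D in blast, simp add: d)
  show "coord_basis (scW P) (xid P) (coordW P)"
    unfolding coord_basis_def coord_basis_axioms_def e
    by (intro conjI allI impI) (use D in blast, use D in blast, use D in blast, simp add: d)
qed

lemma multilinear_tens:
  assumes "dual_system P"
  shows "multilinear P pscale p q (tens P)"
proof -
  interpret V: coord_basis "scV P" "xi P" "coordV P" by (rule dual_system_coord_basis[OF assms])
  interpret W: coord_basis "scW P" "xid P" "coordW P" by (rule dual_system_coord_basis[OF assms])
  show ?thesis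
    unfolding multilinear_def
  proof (intro allI impI conjI)
    fix vs :: "'b list" and ws :: "'c list" and a
    assume "length vs = p" "length ws = q" "a < p"
    then interpret l: Vector_Spaces.linear "scV P" "(*)"
      "\<lambda>x. Poly_Mapping.lookup (ptens (coordV P) (vs[a := x])) i" for i
      by (intro V.linear_lookup_ptens) simp
    show "Vector_Spaces.linear (scV P) pscale (\<lambda>x. tens P (vs[a := x]) ws)"
    proof unfold_locales
      fix x y c
      show "tens P (vs[a := x + y]) ws = tens P (vs[a := x]) ws + tens P (vs[a := y]) ws"
        by (rule poly_mapping_eqI) (simp add: tens_def lookup_add l.add ring_distribs split_paired_all)
      show "tens P (vs[a := scV P c x]) ws = pscale c (tens P (vs[a := x]) ws)"
        by (rule poly_mapping_eqI) (simp add: tens_def l.scale split_paired_all)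
    qed
  next
    fix vs :: "'b list" and ws :: "'c list" and a
    assume "length vs = p" "length ws = q" "a < q"
    then interpret l: Vector_Spaces.linear "scW P" "(*)"
      "\<lambda>x. Poly_Mapping.lookup (ptens (coordW P) (ws[a := x])) i" for i
      by (intro W.linear_lookup_ptens) simp
    show "Vector_Spaces.linear (scW P) pscale (\<lambda>y. tens P vs (ws[a := y]))"
    proof unfold_locales
      fix x y c
      show "tens P vs (ws[a := x + y]) = tens P vs (ws[a := x]) + tens P vs (ws[a := y])"
        by (rule poly_mapping_eqI) (simp add: tens_def lookup_add l.add ring_distribs split_paired_all)
      show "tens P vs (ws[a := scW P c x]) = pscale c (tens P vs (ws[a := x]))"
        by (rule poly_mapping_eqI) (simp add: tens_def l.scale split_paired_all)
    qed
  qed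
qed

lemma linear_lift:
  assumes "vector_space s"
  shows "Vector_Spaces.linear pscale s (lift P s f)"
proof -
  interpret t: vector_space s by (rule assms)
  let ?f = "\<lambda>k. f (map (xi P) (fst k)) (map (xid P) (snd k))"
  have ext: "lift P s f t = (\<Sum>k\<in>K. s (Poly_Mapping.lookup t k) (?f k))"
    if "finite K" "Poly_Mapping.keys t \<subseteq> K" for t K
    unfolding lift_def using that
    by (intro sum.mono_neutral_cong_left) (auto simp: in_keys_iff)
  show ?thesis
  proof unfold_locales
    fix x y :: "(int list \<times> int list) \<Rightarrow>\<^sub>0 'a"
    let ?K = "Poly_Mapping.keys x \<union> Poly_Mapping.keys y"
    have "Poly_Mapping.keys (x + y) \<subseteq> ?K" by (rule Poly_Mapping.keys_add)
    then show "lift P s f (x + y) = lift P s f x + lift P s f y"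
      by (simp add: ext[of ?K] lookup_add t.scale_left_distrib sum.distrib)
  next
    fix c and x :: "(int list \<times> int list) \<Rightarrow>\<^sub>0 'a"
    have "Poly_Mapping.keys (pscale c x) \<subseteq> Poly_Mapping.keys x" by (auto simp: in_keys_iff)
    then show "lift P s f (pscale c x) = s c (lift P s f x)"
      by (simp add: ext[of "Poly_Mapping.keys x"] t.scale_sum_right)
  qed
qed

lemma lift_tens:
  assumes P: "dual_system P" and s: "vector_space s" and f: "multilinear P s p q f"
    and len: "length vs = p" "length ws = q"
  shows "lift P s f (tens P vs ws) = f vs ws"
proof -
  interpret V: coord_basis "scV P" "xi P" "coordV P" by (rule dual_system_coord_basis[OF P])
  interpret W: coord_basis "scW P" "xid P" "coordW P" by (rule dual_system_coord_basis[OF P])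
  interpret t: vector_space s by (rule s)
  let ?a = "ptens (coordV P) vs" and ?b = "ptens (coordW P) ws"
  let ?f = "\<lambda>is js. f (map (xi P) is) (map (xid P) js)"
  have k: "Poly_Mapping.keys ?a \<subseteq> wordset p"
    using len by (auto simp: in_keys_iff V.lookup_ptens split: if_splits)
  have "lift P s f (tens P vs ws) = (\<Sum>(is, js)\<in>Poly_Mapping.keys ?a \<times> Poly_Mapping.keys ?b.
      s (Poly_Mapping.lookup ?a is * Poly_Mapping.lookup ?b js) (?f is js))"
    unfolding lift_def tens_def
    by (intro sum.mono_neutral_cong_left) (auto simp: in_keys_iff)
  also have "\<dots> = (\<Sum>is\<in>Poly_Mapping.keys ?a. s (Poly_Mapping.lookup ?a is)
      (\<Sum>js\<in>Poly_Mapping.keys ?b. s (Poly_Mapping.lookup ?b js) (?f is js)))"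
    by (simp add: sum.cartesian_product[symmetric] t.scale_sum_right)
  also have "\<dots> = (\<Sum>is\<in>Poly_Mapping.keys ?a. s (Poly_Mapping.lookup ?a is) (f (map (xi P) is) ws))"
  proof (intro sum.cong refl arg_cong2[where f = s])
    fix "is" assume "is \<in> Poly_Mapping.keys ?a"
    then have "length (map (xi P) is) = p" using k by (auto simp: wordset_def)
    then show "(\<Sum>js\<in>Poly_Mapping.keys ?b. s (Poly_Mapping.lookup ?b js) (?f is js))
        = f (map (xi P) is) ws"
      using f len by (intro W.multilinear_expand[OF s]) (auto simp: multilinear_def)
  qed
  also have "\<dots> = f vs ws"
    using f len by (intro V.multilinear_expand[OF s, where g = "\<lambda>xs. f xs ws"])
      (auto simp: multilinear_def)
  finally show ?thesis .
qed

lemma tens_basis: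
  assumes "dual_system P" "is \<in> wordset p" "js \<in> wordset q"
  shows "tens P (map (xi P) is) (map (xid P) js) = Poly_Mapping.single (is, js) 1"
proof -
  interpret V: coord_basis "scV P" "xi P" "coordV P" by (rule dual_system_coord_basis[OF assms(1)])
  interpret W: coord_basis "scW P" "xid P" "coordW P" by (rule dual_system_coord_basis[OF assms(1)])
  show ?thesis
    using assms(2,3) unfolding tens_def V.lookup_ptens_basis[OF assms(2)] W.lookup_ptens_basis[OF assms(3)]
    by (auto intro!: poly_mapping_eqI simp: lookup_single when_def)
qed

lemma subspace_mixed: "module.subspace pscale (mixed p q :: ((int list \<times> int list) \<Rightarrow>\<^sub>0 'k::field) set)"
proof (rule pvs.subspaceI)
  show "0 \<in> mixed p q" by (simp add: mixed_def)
next
  fix x y :: "(int list \<times> int list) \<Rightarrow>\<^sub>0 'k"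
  assume "x \<in> mixed p q" "y \<in> mixed p q"
  then show "x + y \<in> mixed p q"
    using Poly_Mapping.keys_add[of x y] unfolding mixed_def mem_Collect_eq by blast
next
  fix c :: 'k and x :: "(int list \<times> int list) \<Rightarrow>\<^sub>0 'k"
  assume "x \<in> mixed p q"
  moreover have "Poly_Mapping.keys (pscale c x) \<subseteq> Poly_Mapping.keys x"
    by (auto simp: in_keys_iff)
  ultimately show "pscale c x \<in> mixed p q"
    unfolding mixed_def mem_Collect_eq by blast
qed

lemma mixed_eq_span:
  fixes P :: "('k::field, 'v::ab_group_add, 'w::ab_group_add) dual_pair"
  assumes "dual_system P"
  shows "mixed p q = module.span pscale {tens P vs ws | vs ws. length vs = p \<and> length ws = q}"
    (is "_ = module.span _ ?T")
proof
  interpret V: coord_basis "scV P" "xi P" "coordV P" by (rule dual_system_coord_basis[OF assms])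
  interpret W: coord_basis "scW P" "xid P" "coordW P" by (rule dual_system_coord_basis[OF assms])
  show "module.span pscale ?T \<subseteq> mixed p q"
  proof (rule pvs.span_minimal)
    show "?T \<subseteq> mixed p q"
      by (auto simp: mixed_def tens_def in_keys_iff V.lookup_ptens W.lookup_ptens split: if_splits)
    show "pvs.subspace (mixed p q)"
      by (rule subspace_mixed)
  qed
  show "mixed p q \<subseteq> module.span pscale ?T"
  proof
    fix t :: "(int list \<times> int list) \<Rightarrow>\<^sub>0 'k" assume t: "t \<in> mixed p q"
    have "t = (\<Sum>k\<in>Poly_Mapping.keys t. pscale (Poly_Mapping.lookup t k) (Poly_Mapping.single k 1))"
    proof (rule poly_mapping_eqI)
      fix k
      have "(\<Sum>l\<in>Poly_Mapping.keys t. Poly_Mapping.lookup t l * (if l = k then 1 else 0))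
          = Poly_Mapping.lookup t k"
        by (simp add: if_distrib[of "(*) _"] in_keys_iff cong: if_cong)
      then show "Poly_Mapping.lookup t k = Poly_Mapping.lookup (\<Sum>k\<in>Poly_Mapping.keys t.
          pscale (Poly_Mapping.lookup t k) (Poly_Mapping.single k 1)) k"
        by (simp only: lookup_sum lookup_pscale lookup_single when_def)
    qed
    also have "\<dots> \<in> module.span pscale ?T"
    proof (intro pvs.span_sum pvs.span_scale pvs.span_base)
      fix k assume "k \<in> Poly_Mapping.keys t"
      with t have "fst k \<in> wordset p" "snd k \<in> wordset q" by (auto simp: mixed_def)
      then show "Poly_Mapping.single k 1 \<in> ?T"
        using tens_basis[OF assms, of "fst k" p "snd k" q]
        by (intro CollectI exI[of _ "map (xi P) (fst k)"] exI[of _ "map (xid P) (snd k)"])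
          (simp add: wordset_def)
    qed
    finally show "t \<in> module.span pscale ?T" .
  qed
qed
subsection \<open>The Lie algebras\<close>

definition gl :: "((int list \<times> int list) \<Rightarrow>\<^sub>0 'k::field) set" where
  "gl = mixed 1 1"

definition bracket :: "('k::field, 'v::ab_group_add, 'w::ab_group_add) dual_pair
    \<Rightarrow> ((int list \<times> int list) \<Rightarrow>\<^sub>0 'k) \<Rightarrow> ((int list \<times> int list) \<Rightarrow>\<^sub>0 'k)
    \<Rightarrow> (int list \<times> int list) \<Rightarrow>\<^sub>0 'k" where
  "bracket P X Y = lift P pscale (\<lambda>us us'. lift P pscale (\<lambda>vs vs'.
     let u = hd us; u' = hd us'; v = hd vs; v' = hd vs'
     in pscale (pair P v u') (tens P [u] [v']) - pscale (pair P u v') (tens P [v] [u'])) Y) X"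

definition sl :: "('k::field, 'v, 'w) dual_pair \<Rightarrow> ((int list \<times> int list) \<Rightarrow>\<^sub>0 'k) set" where
  "sl P = {X \<in> gl. lift P (*) (\<lambda>us us'. pair P (hd us) (hd us')) X = 0}"

definition actV :: "('k, 'v, 'w) dual_pair \<Rightarrow> 'v \<Rightarrow> 'w \<Rightarrow> 'v \<Rightarrow> 'v" where
  "actV P u u' v = scV P (pair P v u') u"

definition actW :: "('k, 'v, 'w::ab_group_add) dual_pair \<Rightarrow> 'v \<Rightarrow> 'w \<Rightarrow> 'w \<Rightarrow> 'w" where
  "actW P u u' w = - scW P (pair P u w) u'"

definition act :: "('k::field, 'v::ab_group_add, 'w::ab_group_add) dual_pair
    \<Rightarrow> ((int list \<times> int list) \<Rightarrow>\<^sub>0 'k) \<Rightarrow> ((int list \<times> int list) \<Rightarrow>\<^sub>0 'k)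
    \<Rightarrow> (int list \<times> int list) \<Rightarrow>\<^sub>0 'k" where
  "act P X t = lift P pscale (\<lambda>us us'. lift P pscale (\<lambda>vs ws.
       (\<Sum>a<length vs. tens P (vs[a := actV P (hd us) (hd us') (vs ! a)]) ws)
     + (\<Sum>b<length ws. tens P vs (ws[b := actW P (hd us) (hd us') (ws ! b)]))) t) X"

subsection \<open>Permutations and contractions\<close>

text \<open>Permutations of \<open>{..<d}\<close> act from the left: \<open>\<sigma>\<close> moves the factor in position \<open>a\<close> to
  position \<open>\<sigma> a\<close>, whence the inverse. All positions are counted from \<open>0\<close>.\<close>

definition perm_mixed :: "('k::field, 'v, 'w) dual_pair \<Rightarrow> (nat \<Rightarrow> nat) \<Rightarrow> (nat \<Rightarrow> nat)
    \<Rightarrow> ((int list \<times> int list) \<Rightarrow>\<^sub>0 'k) \<Rightarrow> (int list \<times> int list) \<Rightarrow>\<^sub>0 'k" where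
  "perm_mixed P \<sigma> \<tau> = lift P pscale (\<lambda>vs ws.
     tens P (permute_list (inv \<sigma>) vs) (permute_list (inv \<tau>) ws))"

definition omit :: "nat \<Rightarrow> 'a list \<Rightarrow> 'a list" where
  "omit i xs = take i xs @ drop (Suc i) xs"

definition contraction :: "('k::field, 'v, 'w) dual_pair \<Rightarrow> nat \<Rightarrow> nat
    \<Rightarrow> ((int list \<times> int list) \<Rightarrow>\<^sub>0 'k) \<Rightarrow> (int list \<times> int list) \<Rightarrow>\<^sub>0 'k" where
  "contraction P i j = lift P pscale (\<lambda>vs ws.
     pscale (pair P (vs ! i) (ws ! j)) (tens P (omit i vs) (omit j ws)))"

definition traceless :: "('k::field, 'v, 'w) dual_pair \<Rightarrow> nat \<Rightarrow> nat
    \<Rightarrow> ((int list \<times> int list) \<Rightarrow>\<^sub>0 'k) set" where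
  "traceless P p q = {t \<in> mixed p q. \<forall>i<p. \<forall>j<q. contraction P i j t = 0}"

section \<open>Young symmetrizers\<close>

definition partition_of :: "nat list \<Rightarrow> bool" where
  "partition_of la \<longleftrightarrow> sorted_wrt (\<ge>) la \<and> (\<forall>x\<in>set la. 0 < x)"

text \<open>The group algebra of the symmetric group on \<open>{..<d}\<close> consists of the finitely supported
  functions on permutations; \<open>gmul\<close> is its multiplication.\<close>

definition group_algebra :: "nat \<Rightarrow> ((nat \<Rightarrow> nat) \<Rightarrow>\<^sub>0 'k::field) set" where
  "group_algebra d = {x. Poly_Mapping.keys x \<subseteq> {\<sigma>. \<sigma> permutes {..<d}}}"

definition gmul :: "((nat \<Rightarrow> nat) \<Rightarrow>\<^sub>0 'k::field) \<Rightarrow> ((nat \<Rightarrow> nat) \<Rightarrow>\<^sub>0 'k) \<Rightarrow> (nat \<Rightarrow> nat) \<Rightarrow>\<^sub>0 'k" where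
  "gmul x y = (\<Sum>\<sigma>\<in>Poly_Mapping.keys x. \<Sum>\<tau>\<in>Poly_Mapping.keys y. Poly_Mapping.single (\<sigma> \<circ> \<tau>) (Poly_Mapping.lookup x \<sigma> * Poly_Mapping.lookup y \<tau>))"

text \<open>Row and column of the entry \<open>x\<close> in the tableau of shape \<open>la\<close> whose entries
  \<open>0, 1, \<dots>\<close> are written consecutively along the rows.\<close>

definition tab_row :: "nat list \<Rightarrow> nat \<Rightarrow> nat" where
  "tab_row la x = (LEAST r. x < sum_list (take (Suc r) la))"

definition tab_col :: "nat list \<Rightarrow> nat \<Rightarrow> nat" where
  "tab_col la x = x - sum_list (take (tab_row la x) la)"

definition row_stab :: "nat list \<Rightarrow> (nat \<Rightarrow> nat) set" where
  "row_stab la = {\<sigma>. \<sigma> permutes {..<sum_list la} \<and>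
     (\<forall>x<sum_list la. tab_row la (\<sigma> x) = tab_row la x)}"

definition col_stab :: "nat list \<Rightarrow> (nat \<Rightarrow> nat) set" where
  "col_stab la = {\<sigma>. \<sigma> permutes {..<sum_list la} \<and>
     (\<forall>x<sum_list la. tab_col la (\<sigma> x) = tab_col la x)}"

definition young_symmetrizer :: "nat list \<Rightarrow> (nat \<Rightarrow> nat) \<Rightarrow>\<^sub>0 'k::field" where
  "young_symmetrizer la =
     gmul (\<Sum>\<sigma>\<in>row_stab la. Poly_Mapping.single \<sigma> 1)
          (\<Sum>\<tau>\<in>col_stab la. Poly_Mapping.single \<tau> (of_int (sign \<tau>)))"

definition specht :: "nat list \<Rightarrow> ((nat \<Rightarrow> nat) \<Rightarrow>\<^sub>0 'k::field) set" where
  "specht la = (\<lambda>x. gmul x (young_symmetrizer la)) ` group_algebra (sum_list la)"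

text \<open>Action of the group algebra on tensor powers of a space with basis \<open>b\<close> and
  coordinate functions \<open>\<phi>\<close>.\<close>

definition perm_power :: "(int \<Rightarrow> 'v) \<Rightarrow> (int \<Rightarrow> 'v \<Rightarrow> 'k::field) \<Rightarrow> (nat \<Rightarrow> nat)
    \<Rightarrow> (int list \<Rightarrow>\<^sub>0 'k) \<Rightarrow> int list \<Rightarrow>\<^sub>0 'k" where
  "perm_power b \<phi> \<sigma> t =
     (\<Sum>is\<in>Poly_Mapping.keys t. pscale (Poly_Mapping.lookup t is) (ptens \<phi> (permute_list (inv \<sigma>) (map b is))))"

definition galg_act :: "(int \<Rightarrow> 'v) \<Rightarrow> (int \<Rightarrow> 'v \<Rightarrow> 'k::field) \<Rightarrow> ((nat \<Rightarrow> nat) \<Rightarrow>\<^sub>0 'k)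
    \<Rightarrow> (int list \<Rightarrow>\<^sub>0 'k) \<Rightarrow> int list \<Rightarrow>\<^sub>0 'k" where
  "galg_act b \<phi> x t = (\<Sum>\<sigma>\<in>Poly_Mapping.keys x. pscale (Poly_Mapping.lookup x \<sigma>) (perm_power b \<phi> \<sigma> t))"

definition schur :: "(int \<Rightarrow> 'v) \<Rightarrow> (int \<Rightarrow> 'v \<Rightarrow> 'k::field) \<Rightarrow> nat list \<Rightarrow> (int list \<Rightarrow>\<^sub>0 'k) set" where
  "schur b \<phi> la = galg_act b \<phi> (young_symmetrizer la) ` tensor_power (sum_list la)"

definition Gamma_mod :: "('k::field, 'v, 'w) dual_pair \<Rightarrow> nat list \<Rightarrow> nat list
    \<Rightarrow> ((int list \<times> int list) \<Rightarrow>\<^sub>0 'k) set" where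
  "Gamma_mod P la mu = traceless P (sum_list la) (sum_list mu) \<inter>
     tensor_subspace (schur (xi P) (coordV P) la) (schur (xid P) (coordW P) mu)"

section \<open>Modules over \<open>gl\<close> and products of symmetric groups\<close>

definition gl_sym_module :: "('k::field, 'v::ab_group_add, 'w::ab_group_add) dual_pair
    \<Rightarrow> nat \<Rightarrow> nat \<Rightarrow> ('k \<Rightarrow> 'm::ab_group_add \<Rightarrow> 'm)
    \<Rightarrow> (((int list \<times> int list) \<Rightarrow>\<^sub>0 'k) \<Rightarrow> 'm \<Rightarrow> 'm) \<Rightarrow> ((nat \<Rightarrow> nat) \<Rightarrow> (nat \<Rightarrow> nat) \<Rightarrow> 'm \<Rightarrow> 'm)
    \<Rightarrow> 'm set \<Rightarrow> bool" where
  "gl_sym_module P p q s a r M \<longleftrightarrow>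
     lie_module pscale (bracket P) gl s a M \<and>
     (\<forall>m\<in>M. r id id m = m) \<and>
     (\<forall>\<sigma> \<tau>. \<sigma> permutes {..<p} \<longrightarrow> \<tau> permutes {..<q} \<longrightarrow>
        (\<forall>m\<in>M. r \<sigma> \<tau> m \<in> M) \<and> linear_on s s M (r \<sigma> \<tau>) \<and>
        (\<forall>\<sigma>' \<tau>'. \<sigma>' permutes {..<p} \<longrightarrow> \<tau>' permutes {..<q} \<longrightarrow>
           (\<forall>m\<in>M. r (\<sigma> \<circ> \<sigma>') (\<tau> \<circ> \<tau>') m = r \<sigma> \<tau> (r \<sigma>' \<tau>' m))) \<and>
        (\<forall>X\<in>gl. \<forall>m\<in>M. r \<sigma> \<tau> (a X m) = a X (r \<sigma> \<tau> m)))"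

definition gl_sym_isomorphic where
  "gl_sym_isomorphic P p q s a r M s' a' r' M' \<longleftrightarrow>
     gl_sym_module P p q s a r M \<and> gl_sym_module P p q s' a' r' M' \<and>
     (\<exists>f. bij_betw f M M' \<and> linear_on s s' M f \<and>
        (\<forall>X\<in>gl. \<forall>m\<in>M. f (a X m) = a' X (f m)) \<and>
        (\<forall>\<sigma> \<tau>. \<sigma> permutes {..<p} \<longrightarrow> \<tau> permutes {..<q} \<longrightarrow> (\<forall>m\<in>M. f (r \<sigma> \<tau> m) = r' \<sigma> \<tau> (f m))))"

text \<open>The direct sum of the modules \<open>\<Gamma>\<^sub>\<lambda>\<^sub>;\<^sub>\<mu> \<otimes> (H\<^sub>\<lambda> \<otimes> H\<^sub>\<mu>)\<close> over \<open>|\<lambda>| = p\<close>, \<open>|\<mu>| = q\<close>, with the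
  action of \<open>gl\<close> on the first factor and of the two symmetric groups on the other two.\<close>

definition decomp_scale :: "'k::field \<Rightarrow> ('i \<Rightarrow>\<^sub>0 ('a \<Rightarrow>\<^sub>0 'k)) \<Rightarrow> 'i \<Rightarrow>\<^sub>0 ('a \<Rightarrow>\<^sub>0 'k)" where
  "decomp_scale c = Poly_Mapping.map (pscale c)"

definition decomp :: "('k::field, 'v, 'w) dual_pair \<Rightarrow> nat \<Rightarrow> nat \<Rightarrow> ((nat list \<times> nat list) \<Rightarrow>\<^sub>0
    (((int list \<times> int list) \<times> (nat \<Rightarrow> nat) \<times> (nat \<Rightarrow> nat)) \<Rightarrow>\<^sub>0 'k)) set" where
  "decomp P p q = direct_sum
     {(la, mu). partition_of la \<and> partition_of mu \<and> sum_list la = p \<and> sum_list mu = q}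
     (\<lambda>(la, mu). tensor_subspace (Gamma_mod P la mu) (tensor_subspace (specht la) (specht mu)))"

definition decomp_act :: "('k::field, 'v::ab_group_add, 'w::ab_group_add) dual_pair
    \<Rightarrow> ((int list \<times> int list) \<Rightarrow>\<^sub>0 'k)
    \<Rightarrow> ('i \<Rightarrow>\<^sub>0 (((int list \<times> int list) \<times> (nat \<Rightarrow> nat) \<times> (nat \<Rightarrow> nat)) \<Rightarrow>\<^sub>0 'k))
    \<Rightarrow> 'i \<Rightarrow>\<^sub>0 (((int list \<times> int list) \<times> (nat \<Rightarrow> nat) \<times> (nat \<Rightarrow> nat)) \<Rightarrow>\<^sub>0 'k)" where
  "decomp_act P X = Poly_Mapping.map (tmap (act P X) id)"

definition decomp_perm :: "(nat \<Rightarrow> nat) \<Rightarrow> (nat \<Rightarrow> nat)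
    \<Rightarrow> ('i \<Rightarrow>\<^sub>0 (((int list \<times> int list) \<times> (nat \<Rightarrow> nat) \<times> (nat \<Rightarrow> nat)) \<Rightarrow>\<^sub>0 'k::field))
    \<Rightarrow> 'i \<Rightarrow>\<^sub>0 (((int list \<times> int list) \<times> (nat \<Rightarrow> nat) \<times> (nat \<Rightarrow> nat)) \<Rightarrow>\<^sub>0 'k)" where
  "decomp_perm \<sigma> \<tau> = Poly_Mapping.map (tmap id
     (tmap (gmul (Poly_Mapping.single \<sigma> 1)) (gmul (Poly_Mapping.single \<tau> 1))))"

section \<open>Highest weight modules\<close>

definition elem :: "('k::field, 'v, 'w) dual_pair \<Rightarrow> int \<Rightarrow> int \<Rightarrow> (int list \<times> int list) \<Rightarrow>\<^sub>0 'k" where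
  "elem P i j = tens P [xi P i] [xid P j]"

definition cartan :: "('k::field, 'v, 'w) dual_pair \<Rightarrow> ((int list \<times> int list) \<Rightarrow>\<^sub>0 'k) set" where
  "cartan P = module.span pscale {elem P i i | i. i \<noteq> 0}"

text \<open>Linear functionals on the Cartan subalgebra are given by functions on all of \<open>gl\<close>, of which
  only the values on the subalgebra matter. \<open>eps i\<close> is the coefficient of \<open>elem P i i\<close>.\<close>

definition eps :: "int \<Rightarrow> ((int list \<times> int list) \<Rightarrow>\<^sub>0 'k::field) \<Rightarrow> 'k" where
  "eps i H = Poly_Mapping.lookup H ([i], [i])"

definition positive_root :: "int \<Rightarrow> int \<Rightarrow> bool" where
  "positive_root i j \<longleftrightarrow> (0 < i \<and> i < j) \<or> (i < j \<and> j < 0) \<or> (j < 0 \<and> 0 < i)"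

definition nilradical :: "('k::field, 'v, 'w) dual_pair \<Rightarrow> ((int list \<times> int list) \<Rightarrow>\<^sub>0 'k) set" where
  "nilradical P = module.span pscale {elem P i j | i j. positive_root i j}"

definition highest_weight_module :: "('k::field, 'v::ab_group_add, 'w::ab_group_add) dual_pair
    \<Rightarrow> ('k \<Rightarrow> 'm::ab_group_add \<Rightarrow> 'm) \<Rightarrow> (((int list \<times> int list) \<Rightarrow>\<^sub>0 'k) \<Rightarrow> 'm \<Rightarrow> 'm) \<Rightarrow> 'm set
    \<Rightarrow> (((int list \<times> int list) \<Rightarrow>\<^sub>0 'k) \<Rightarrow> 'k) \<Rightarrow> bool" where
  "highest_weight_module P s a M \<chi> \<longleftrightarrow>
     lie_module pscale (bracket P) gl s a M \<and>
     (\<exists>v\<in>M. v \<noteq> 0 \<and> (\<forall>X\<in>nilradical P. a X v = 0) \<and> (\<forall>H\<in>cartan P. a H v = s (\<chi> H) v) \<and>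
        \<Inter> {N. submodule gl s a M N \<and> v \<in> N} = M)"

text \<open>Parts of a partition are numbered from \<open>1\<close> here, so \<open>\<lambda>\<^sub>i\<close> is \<open>la ! (i - 1)\<close>; the parts
  beyond the length vanish.\<close>

definition weight :: "nat list \<Rightarrow> nat list \<Rightarrow> ((int list \<times> int list) \<Rightarrow>\<^sub>0 'k::field) \<Rightarrow> 'k" where
  "weight la mu H = (\<Sum>i=1..length la. of_nat (la ! (i - 1)) * eps (int i) H)
                  - (\<Sum>i=1..length mu. of_nat (mu ! (i - 1)) * eps (- int i) H)"

end

theory Submission
  imports Defs "HOL-Library.Product_Plus"
begin

text \<open>In the dual bases a mixed tensor is a combination of pairs of words, and the root vectors
  replace letters. The elements \<open>\<Sum>\<^sub>g (c g\<^sup>-\<^sup>1 m) \<otimes> g\<close>, for \<open>c\<close> the product of the Young symmetrizers of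
  \<open>\<lambda>\<close> and \<open>\<mu>\<close>, are the components of \<open>m\<close> in the direct sum. They determine \<open>m\<close> because no nonzero
  element of the group algebra is annihilated by all translates of the Young symmetrizers, and
  \<open>c x c \<in> k c\<close> together with the orthogonality for different shapes shows surjectivity.

  For the irreducibility over \<open>sl\<close>, a nonzero stable subspace contains, by replacing repeated
  letters by fresh ones, a nonzero tensor all of whose words have the same pairwise distinct
  letters. On these words the permutations act regularly, so \<open>c x c \<in> k c\<close> brings \<open>c\<close> applied to
  one word into the subspace. Conversely a traceless tensor is recovered from tensors with fresh
  letters, since the unwanted terms of the action add up to a contraction. A vector of the
  required weight that is annihilated by the positive root vectors generates by irreducibility.\<close>

section \<open>The group algebra of the finitary symmetric group\<close>

text \<open>The argument stays inside the group algebra and uses neither complete reducibility nor a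
  count of irreducible representations. What has to be supplied instead is completeness: the Young
  symmetrizers of degree d generate the whole group algebra as a two-sided ideal. The central sum of
  all transpositions acts on row sums by contents, modulo row sums for longer rows, and comparing
  the contents of rows and columns forces a Young diagram. Characteristic zero enters through
  integrality: a Young symmetrizer is a nonzero multiple of an idempotent because a sum of squares
  of integers, not all 0, stays nonzero in the field.

  The obstacle to irreducibility is that a submodule is not known to be stable under permutations of
  the tensor factors. Root vectors can however rename letters, and on words with distinct letters
  this amounts to right multiplication in the group algebra. Root vectors have trace 0, so the same
  argument serves gl and sl.\<close>

typedef sym = "{f :: nat \<Rightarrow> nat. permutation f}"
  morphisms sfun Abs_sym
  by (rule exI[of _ id]) simp

lemma permutation_sfun [simp]: "permutation (sfun s)"
  using sfun[of s] by simp

lemma sfun_inject_ext: "(\<And>x. sfun s x = sfun t x) \<Longrightarrow> s = t"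
  using sfun_inject[of s t] by auto

text \<open>Composition is written additively because the product of finitely supported functions is
  convolution over an additive monoid, commutative or not. With this instance
  \<open>sym \<Rightarrow>\<^sub>0 'k\<close> is the group algebra as a ring, and
  \<open>sing g 1\<close> are the group elements in it.\<close>

instantiation sym :: group_add
begin

definition zero_sym :: sym where "0 = Abs_sym id"
definition plus_sym :: "sym \<Rightarrow> sym \<Rightarrow> sym" where "s + t = Abs_sym (sfun s \<circ> sfun t)"
definition uminus_sym :: "sym \<Rightarrow> sym" where "- s = Abs_sym (inv (sfun s))"
definition minus_sym :: "sym \<Rightarrow> sym \<Rightarrow> sym" where "s - t = s + (- t :: sym)"

lemma sfun_zero [simp]: "sfun 0 = id"
  by (simp add: zero_sym_def Abs_sym_inverse)

lemma sfun_plus [simp]: "sfun (s + t) = sfun s \<circ> sfun t"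
  by (simp add: plus_sym_def Abs_sym_inverse permutation_compose)

lemma sfun_uminus [simp]: "sfun (- s) = inv (sfun s)"
  by (simp add: uminus_sym_def Abs_sym_inverse permutation_inverse)

instance
proof
  fix a b c :: sym
  show "a + b + c = a + (b + c)" by (rule sfun_inject_ext) simp
  show "0 + a = a" by (rule sfun_inject_ext) simp
  show "a + 0 = a" by (rule sfun_inject_ext) simp
  show "- a + a = 0"
    by (rule sfun_inject_ext) (simp add: bij_is_inj permutation_bijective)
  show "a + - b = a - b" by (simp add: minus_sym_def)
qed

end

lemma sfun_inv_simps [simp]: "inv (sfun s) (sfun s x) = x" "sfun s (inv (sfun s) x) = x"
  using permutation_bijective[OF permutation_sfun, of s]
  by (simp_all add: bij_is_inj bij_is_surj surj_f_inv_f)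

lemma sfun_eq_iff [simp]: "sfun s x = sfun s y \<longleftrightarrow> x = y"
  by (metis sfun_inv_simps(1))

text \<open>One type serves all degrees; the group of degree d is a subset, since p and q are
  variables of the statement.\<close>

definition Sy :: "nat \<Rightarrow> sym set" where
  "Sy d = {s. sfun s permutes {..<d}}"

lemma Sy_zero [simp]: "0 \<in> Sy d" by (simp add: Sy_def permutes_id[unfolded id_def] id_def)
lemma Sy_plus: "s \<in> Sy d \<Longrightarrow> t \<in> Sy d \<Longrightarrow> s + t \<in> Sy d"
  by (simp add: Sy_def permutes_compose)
lemma Sy_uminus: "s \<in> Sy d \<Longrightarrow> - s \<in> Sy d"
  by (simp add: Sy_def permutes_inv)
lemma Sy_uminus_iff [simp]: "- s \<in> Sy d \<longleftrightarrow> s \<in> Sy d"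
  using Sy_uminus[of s] Sy_uminus[of "- s"] by auto

lemma sfun_Abs_sym: "f permutes {..<d} \<Longrightarrow> sfun (Abs_sym f) = f"
  by (rule Abs_sym_inverse) (auto intro: permutes_imp_permutation[of "{..<d}"])

lemma Abs_sym_Sy: "f permutes {..<d} \<Longrightarrow> Abs_sym f \<in> Sy d"
  by (simp add: Sy_def sfun_Abs_sym)

lemma sfun_image_Sy: "sfun ` Sy d = {f. f permutes {..<d}}"
proof
  show "{f. f permutes {..<d}} \<subseteq> sfun ` Sy d"
  proof clarify
    fix f assume "f permutes {..<d}"
    then show "f \<in> sfun ` Sy d"
      by (intro image_eqI[of _ _ "Abs_sym f"] Abs_sym_Sy) (simp_all add: sfun_Abs_sym)
  qed
qed (auto simp: Sy_def)

lemma inj_on_sfun: "inj_on sfun A"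
  by (auto intro: inj_onI simp: sfun_inject)

lemma finite_Sy [simp]: "finite (Sy d)"
  by (rule finite_imageD[of sfun]) (simp_all add: sfun_image_Sy finite_permutations inj_on_sfun)

lemma Sy_less: "s \<in> Sy d \<Longrightarrow> sfun s x < d \<longleftrightarrow> x < d"
  using permutes_in_image[of "sfun s" "{..<d}" x] by (simp add: Sy_def)

lemma Sy_inv_less: "s \<in> Sy d \<Longrightarrow> inv (sfun s) x < d \<longleftrightarrow> x < d"
  using Sy_less[of "- s" d x] by simp

lemma Sy_bij: "s \<in> Sy d \<Longrightarrow> bij_betw (sfun s) {..<d} {..<d}"
  by (simp add: Sy_def permutes_imp_bij)

lemma Sy_ext: "s \<in> Sy d \<Longrightarrow> t \<in> Sy d \<Longrightarrow> (\<And>x. x < d \<Longrightarrow> sfun s x = sfun t x) \<Longrightarrow> s = t"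
  by (rule sfun_inject_ext) (metis Sy_def lessThan_iff mem_Collect_eq permutes_not_in)

definition sgn_of :: "sym \<Rightarrow> 'k::ring_1" where
  "sgn_of s = of_int (sign (sfun s))"

lemma sgn_of_plus: "sgn_of (s + t) = sgn_of s * sgn_of t"
  by (simp add: sgn_of_def sign_compose)
lemma sgn_of_zero [simp]: "sgn_of 0 = 1" by (simp add: sgn_of_def)
lemma sgn_of_uminus [simp]: "sgn_of (- s) = sgn_of s" by (simp add: sgn_of_def sign_inverse)
lemma sgn_of_square [simp]: "sgn_of s * sgn_of s = 1"
  by (simp add: sgn_of_def flip: of_int_mult)

subsection \<open>Scalars and coefficients\<close>

abbreviation lk where "lk \<equiv> Poly_Mapping.lookup"
abbreviation sing where "sing \<equiv> Poly_Mapping.single"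
abbreviation pkeys where "pkeys \<equiv> Poly_Mapping.keys"

lemma pscale_eq: "pscale c x = sing 0 c * (x :: 'g::monoid_add \<Rightarrow>\<^sub>0 'k::field)"
  by (simp add: pscale_def mult_map_scale_conv_mult)

lemma pscale_mult_left: "pscale c x * y = pscale c (x * y :: 'g::monoid_add \<Rightarrow>\<^sub>0 'k::field)"
  by (simp add: pscale_eq mult.assoc)

lemma poly_mapping_expand: "(x :: 'g \<Rightarrow>\<^sub>0 'k::field) = (\<Sum>g\<in>pkeys x. pscale (lk x g) (sing g 1))"
proof (rule poly_mapping_eqI)
  fix k
  have "(\<Sum>g\<in>pkeys x. lk x g * (if g = k then 1 else 0)) = lk x k"
    by (simp add: if_distrib[of "(*) _"] in_keys_iff cong: if_cong)
  then show "lk x k = lk (\<Sum>g\<in>pkeys x. pscale (lk x g) (sing g 1)) k"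
    by (simp only: lookup_sum lookup_pscale lookup_single when_def)
qed

lemma pscale_single [simp]: "pscale c (sing g b) = sing g (c * b)"
  by (rule poly_mapping_eqI) (simp add: lookup_single when_def)

lemma mult_pscale_right: "x * pscale c y = pscale c (x * y :: 'g::monoid_add \<Rightarrow>\<^sub>0 'k::field)"
proof -
  have s: "sing g a * pscale c y = pscale c (sing g a * y)" for g a
    by (simp add: pscale_eq mult_single mult.commute flip: mult.assoc)
  show ?thesis
    by (subst (1 2) poly_mapping_expand[of x]) (simp add: sum_distrib_right s pvs.scale_sum_right)
qed

lemmas pscale_simps = pscale_mult_left mult_pscale_right

lemma pscale_pscale [simp]: "pscale a (pscale b x) = pscale (a * b) x"
  by (rule poly_mapping_eqI) (simp add: mult.assoc)
lemma keys_pscale: "pkeys (pscale c x) \<subseteq> pkeys x"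
  by (auto simp: in_keys_iff)

lemma lookup_single_mult:
  "lk (sing g 1 * x) h = lk (x :: 'g::group_add \<Rightarrow>\<^sub>0 'k::field) (- g + h)"
proof -
  have "lk (sing g 1 * sing l b) h = lk (sing l b) (- g + h)" for l and b :: 'k
  proof -
    have "g + l = h \<longleftrightarrow> l = - g + h" by (metis add.assoc left_minus add_0 right_minus)
    then show ?thesis by (simp add: mult_single lookup_single when_def)
  qed
  then show ?thesis
    by (subst (1 2) poly_mapping_expand[of x]) (simp add: sum_distrib_left lookup_sum)
qed

lemma lookup_mult_single:
  "lk (x * sing g 1) h = lk (x :: 'g::group_add \<Rightarrow>\<^sub>0 'k::field) (h - g)"
proof -
  have "lk (sing l b * sing g 1) h = lk (sing l b) (h - g)" for l and b :: 'k
  proof -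
    have "l + g = h \<longleftrightarrow> l = h - g" by (metis add_diff_cancel diff_add_cancel)
    then show ?thesis by (simp add: mult_single lookup_single when_def)
  qed
  then show ?thesis
    by (subst (1 2) poly_mapping_expand[of x]) (simp add: sum_distrib_right lookup_sum)
qed

lemma lookup_times:
  "lk (x * y) h = (\<Sum>g\<in>pkeys x. lk x g * lk (y :: 'g::group_add \<Rightarrow>\<^sub>0 'k::field) (- g + h))"
  by (subst poly_mapping_expand[of x])
    (simp add: sum_distrib_right lookup_sum pscale_mult_left lookup_single_mult del: pscale_single)

text \<open>A product of two group elements is the identity in one order exactly if it is in the
  other. The coefficient at the identity is thus a trace, and this is how the scalars in the
  products below are computed.\<close>

lemma lookup_times_commute: "lk (x * y) 0 = lk (y * x :: 'g::group_add \<Rightarrow>\<^sub>0 'k::field) 0"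
proof -
  have "lk (x * sing g b) 0 = lk (sing g b * x) 0" for g b
  proof -
    have e: "sing g b = pscale b (sing g 1)" by simp
    show ?thesis
      unfolding e pscale_simps lookup_pscale lookup_mult_single lookup_single_mult by simp
  qed
  then show ?thesis
    by (subst (1 2) poly_mapping_expand[of y]) (simp add: sum_distrib_left sum_distrib_right lookup_sum)
qed

definition galg :: "nat \<Rightarrow> (sym \<Rightarrow>\<^sub>0 'k::field) set" where
  "galg d = {x. pkeys x \<subseteq> Sy d}"

lemma galg_single [simp]: "g \<in> Sy d \<Longrightarrow> sing g c \<in> galg d"
  by (simp add: galg_def)
lemma galg_0 [simp]: "0 \<in> galg d" by (simp add: galg_def)
lemma galg_1 [simp]: "1 \<in> galg d" by (simp add: galg_def flip: single_one)
lemma galg_add: "x \<in> galg d \<Longrightarrow> y \<in> galg d \<Longrightarrow> x + y \<in> galg d"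
  using Poly_Mapping.keys_add[of x y] unfolding galg_def mem_Collect_eq by blast
lemma galg_sum: "(\<And>i. i \<in> I \<Longrightarrow> f i \<in> galg d) \<Longrightarrow> sum f I \<in> galg d"
  by (induction I rule: infinite_finite_induct) (auto intro: galg_add)
lemma galg_mult: "x \<in> galg d \<Longrightarrow> y \<in> galg d \<Longrightarrow> x * y \<in> galg d"
proof -
  assume *: "x \<in> galg d" "y \<in> galg d"
  have "g \<in> Sy d" if g: "g \<in> pkeys (x * y)" for g
  proof -
    obtain a b where "g = a + b" "a \<in> pkeys x" "b \<in> pkeys y"
      using keys_mult[of x y] g by blast
    then show ?thesis using * by (auto simp: galg_def intro!: Sy_plus)
  qed
  then show ?thesis by (auto simp: galg_def)
qed

lemma galg_expand: "x \<in> galg d \<Longrightarrow> x = (\<Sum>g\<in>Sy d. pscale (lk x g) (sing g 1))"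
  by (subst poly_mapping_expand[of x], rule sum.mono_neutral_left)
    (auto simp: galg_def in_keys_iff)

section \<open>Young symmetrizers\<close>

text \<open>The automorphism sending g to sgn(g) g. It exchanges row sums and signed column sums, so
  that many facts have to be proved for rows only.\<close>

definition twist :: "(sym \<Rightarrow>\<^sub>0 'k::field) \<Rightarrow> sym \<Rightarrow>\<^sub>0 'k" where
  "twist = Poly_Mapping.mapp (\<lambda>g v. sgn_of g * v)"

lemma lookup_twist [simp]: "lk (twist x) g = sgn_of g * lk x g"
  by (simp add: twist_def lookup_mapp in_keys_iff when_def)

lemma twist_single [simp]: "twist (sing g b) = sing g (sgn_of g * b)"
  by (rule poly_mapping_eqI) (simp add: lookup_single when_def)
lemma twist_add [simp]: "twist (x + y) = twist x + twist y"
  by (rule poly_mapping_eqI) (simp add: lookup_add ring_distribs)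
lemma twist_diff [simp]: "twist (x - y) = twist x - twist y"
  by (rule poly_mapping_eqI) (simp add: lookup_minus ring_distribs)
lemma twist_0 [simp]: "twist 0 = 0"
  by (rule poly_mapping_eqI) simp
lemma twist_1 [simp]: "twist 1 = 1"
  by (simp flip: single_one)
lemma twist_sum: "twist (sum f A) = (\<Sum>a\<in>A. twist (f a))"
  by (induction A rule: infinite_finite_induct) simp_all
lemma twist_pscale [simp]: "twist (pscale c x) = pscale c (twist x)"
  by (rule poly_mapping_eqI) (simp add: mult.left_commute)
lemma sgn_of_nonzero [simp]: "sgn_of g \<noteq> (0 :: 'k::field)"
  using sgn_of_square[of g, where 'a = 'k] by (metis mult_zero_left zero_neq_one)

lemma twist_galg [simp]: "twist x \<in> galg d \<longleftrightarrow> x \<in> galg d"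
proof -
  have "pkeys (twist x) = pkeys x" by (auto simp: in_keys_iff)
  then show ?thesis by (simp add: galg_def)
qed

lemma twist_mult: "twist (x * y) = twist x * twist y"
proof -
  have "twist (sing g b * sing h c) = twist (sing g b) * twist (sing h c)" for g h and b c :: 'a
    by (simp add: mult_single sgn_of_plus mult_ac)
  then show ?thesis
    by (subst (1 2) poly_mapping_expand[of x], subst (1 2) poly_mapping_expand[of y])
      (simp add: sum_distrib_left sum_distrib_right twist_sum)
qed

text \<open>The anti-automorphism inverting group elements. It reverses products of row and column
  sums, and the coefficient of \<open>star x * x\<close> at the identity is a sum of
  squares.\<close>

definition star :: "(sym \<Rightarrow>\<^sub>0 'k::field) \<Rightarrow> sym \<Rightarrow>\<^sub>0 'k" where
  "star = Poly_Mapping.map_key uminus"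

lemma lookup_star [simp]: "lk (star x) g = lk x (- g)"
  by (simp add: star_def map_key.rep_eq)
lemma star_single [simp]: "star (sing g b) = sing (- g) b"
  by (rule poly_mapping_eqI) (simp add: lookup_single when_def equation_minus_iff minus_equation_iff eq_commute)
lemma star_sum: "star (sum f A) = (\<Sum>a\<in>A. star (f a))"
  by (rule poly_mapping_eqI) (simp add: lookup_sum)
lemma star_0 [simp]: "star 0 = 0"
  by (rule poly_mapping_eqI) simp
lemma star_star [simp]: "star (star x) = x"
  by (rule poly_mapping_eqI) simp
lemma star_galg [simp]: "star x \<in> galg d \<longleftrightarrow> x \<in> galg d"
  by (auto simp: galg_def in_keys_iff subset_iff) (metis Sy_uminus_iff minus_minus)

lemma star_mult: "star (x * y) = star y * star x"
proof -
  have "star (sing g b * sing h c) = star (sing h c) * star (sing g b)" for g h and b c :: 'a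
    by (simp add: mult_single minus_add mult_ac)
  then show ?thesis
    by (subst (1 2) poly_mapping_expand[of x], subst (1 2) poly_mapping_expand[of y])
      (simp add: sum_distrib_left sum_distrib_right star_sum sum.swap[of _ "pkeys x"])
qed

text \<open>A Young subgroup is described by an arbitrary labelling of the points rather than by a
  tableau: labels can then be changed one at a time, and conjugation becomes composition of the
  labelling with a permutation.\<close>

definition stabf :: "nat \<Rightarrow> (nat \<Rightarrow> nat) \<Rightarrow> sym set" where
  "stabf d r = {s \<in> Sy d. \<forall>x<d. r (sfun s x) = r x}"

lemma stabf_Sy: "s \<in> stabf d r \<Longrightarrow> s \<in> Sy d" by (simp add: stabf_def)
lemma finite_stabf [simp]: "finite (stabf d r)"
  by (rule finite_subset[OF _ finite_Sy[of d]]) (auto simp: stabf_def)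
lemma stabf_zero [simp]: "0 \<in> stabf d r" by (simp add: stabf_def)
lemma stabf_plus: "s \<in> stabf d r \<Longrightarrow> t \<in> stabf d r \<Longrightarrow> s + t \<in> stabf d r"
  by (auto simp: stabf_def Sy_plus Sy_less)
lemma stabf_uminus: "s \<in> stabf d r \<Longrightarrow> - s \<in> stabf d r"
  by (auto simp: stabf_def Sy_uminus) (metis Sy_inv_less sfun_inv_simps(2))
lemma stabf_uminus_iff [simp]: "- s \<in> stabf d r \<longleftrightarrow> s \<in> stabf d r"
  using stabf_uminus[of s] stabf_uminus[of "- s"] by auto
lemma card_stabf: "card (stabf d r) \<noteq> 0"
  using finite_stabf[of d r] stabf_zero[of d r] by (metis card_0_eq empty_iff)

lemma stabf_left_bij: "s \<in> stabf d r \<Longrightarrow> bij_betw ((+) s) (stabf d r) (stabf d r)"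
proof (rule bij_betwI[where g = "(+) (- s)"])
  assume s: "s \<in> stabf d r"
  show "(+) s \<in> stabf d r \<rightarrow> stabf d r" using s by (auto intro: stabf_plus)
  show "(+) (- s) \<in> stabf d r \<rightarrow> stabf d r" using s by (auto intro: stabf_plus)
qed (simp_all flip: add.assoc)

lemma stabf_right_bij: "s \<in> stabf d r \<Longrightarrow> bij_betw (\<lambda>t. t + s) (stabf d r) (stabf d r)"
proof (rule bij_betwI[where g = "\<lambda>t. t + (- s)"])
  assume s: "s \<in> stabf d r"
  show "(\<lambda>t. t + s) \<in> stabf d r \<rightarrow> stabf d r" using s by (auto intro: stabf_plus)
  show "(\<lambda>t. t + - s) \<in> stabf d r \<rightarrow> stabf d r" using stabf_plus[OF _ stabf_uminus[OF s]] by auto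
qed (simp_all add: add.assoc)

lemma stabf_conj_iff:
  assumes "g \<in> Sy d"
  shows "s \<in> stabf d (r \<circ> inv (sfun g)) \<longleftrightarrow> - g + s + g \<in> stabf d r"
proof -
  have 1: "- g + s + g \<in> Sy d \<longleftrightarrow> s \<in> Sy d"
  proof
    assume "- g + s + g \<in> Sy d"
    then have "g + (- g + s + g) + - g \<in> Sy d" by (rule Sy_plus[OF Sy_plus[OF assms] Sy_uminus[OF assms]])
    moreover have "g + (- g + s + g) + - g = (g + - g) + s + (g + - g)" by (simp only: add.assoc)
    ultimately show "s \<in> Sy d" by (simp only: right_minus add_0_left add_0_right)
  next
    assume "s \<in> Sy d"
    then show "- g + s + g \<in> Sy d" using assms by (intro Sy_plus Sy_uminus)
  qed
  have "(\<forall>x<d. r (inv (sfun g) (sfun s x)) = r (inv (sfun g) x)) \<longleftrightarrow>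
      (\<forall>x<d. r (inv (sfun g) (sfun s (sfun g x))) = r x)"
    using assms Sy_less[of g d] Sy_inv_less[of g d] by (metis sfun_inv_simps)
  then show ?thesis by (simp add: stabf_def 1)
qed

section \<open>Row sums and signed column sums\<close>

definition rsum :: "nat \<Rightarrow> (nat \<Rightarrow> nat) \<Rightarrow> sym \<Rightarrow>\<^sub>0 'k::field" where
  "rsum d r = (\<Sum>s\<in>stabf d r. sing s 1)"

definition csum :: "nat \<Rightarrow> (nat \<Rightarrow> nat) \<Rightarrow> sym \<Rightarrow>\<^sub>0 'k::field" where
  "csum d c = (\<Sum>s\<in>stabf d c. sing s (sgn_of s))"

lemma lookup_rsum: "lk (rsum d r) g = (if g \<in> stabf d r then 1 else 0)"
  by (simp add: rsum_def lookup_sum lookup_single when_def)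
lemma lookup_csum: "lk (csum d r) g = (if g \<in> stabf d r then sgn_of g else 0)"
  by (simp add: csum_def lookup_sum lookup_single when_def)
lemma twist_rsum [simp]: "twist (rsum d r) = csum d r"
  by (rule poly_mapping_eqI) (simp add: lookup_rsum lookup_csum)
lemma star_rsum [simp]: "star (rsum d r) = rsum d r"
  by (rule poly_mapping_eqI) (simp add: lookup_rsum)
lemma star_csum [simp]: "star (csum d r) = csum d r"
  by (rule poly_mapping_eqI) (simp add: lookup_csum)
lemma rsum_galg [simp]: "rsum d r \<in> galg d"
  by (auto simp: galg_def in_keys_iff lookup_rsum stabf_Sy split: if_splits)
lemma csum_galg [simp]: "csum d r \<in> galg d"
  by (auto simp: galg_def in_keys_iff lookup_csum stabf_Sy split: if_splits)

lemma sum_constant_pscale: "(\<Sum>s\<in>S. x) = pscale (of_nat (card S)) (x :: 'g \<Rightarrow>\<^sub>0 'k::field)"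
  by (induction S rule: infinite_finite_induct) (simp_all add: pvs.scale_left_distrib)

lemma single_rsum: "s \<in> stabf d r \<Longrightarrow> sing s 1 * rsum d r = rsum d r"
  by (simp add: rsum_def sum_distrib_left mult_single sum.reindex_bij_betw[OF stabf_left_bij, of s d r "\<lambda>t. sing t 1"])
lemma rsum_single: "s \<in> stabf d r \<Longrightarrow> rsum d r * sing s 1 = rsum d r"
  by (simp add: rsum_def sum_distrib_right mult_single sum.reindex_bij_betw[OF stabf_right_bij, of s d r "\<lambda>t. sing t 1"])
lemma single_csum: "s \<in> stabf d r \<Longrightarrow> sing s 1 * csum d r = pscale (sgn_of s) (csum d r)"
proof -
  assume s: "s \<in> stabf d r"
  have "sing s 1 * csum d r = pscale (sgn_of s) (twist (sing s 1 * rsum d r))"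
    unfolding twist_mult by (simp flip: pscale_mult_left)
  then show ?thesis by (simp add: single_rsum[OF s])
qed
lemma rsum_rsum: "rsum d r * rsum d r = pscale (of_nat (card (stabf d r))) (rsum d r)"
proof -
  have "rsum d r * rsum d r = (\<Sum>s\<in>stabf d r. sing s 1 * rsum d r)"
    by (subst (1) rsum_def) (simp add: sum_distrib_right)
  also have "\<dots> = (\<Sum>s\<in>stabf d r. rsum d r)" by (rule sum.cong) (auto simp: single_rsum)
  also have "\<dots> = pscale (of_nat (card (stabf d r))) (rsum d r)"
    by (rule sum_constant_pscale)
  finally show ?thesis .
qed

lemma rsum_conj:
  assumes "g \<in> Sy d"
  shows "sing g 1 * rsum d r * sing (- g) 1 = rsum d (r \<circ> inv (sfun g))"
proof (rule poly_mapping_eqI)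
  fix h
  show "lk (sing g 1 * rsum d r * sing (- g) 1) h = lk (rsum d (r \<circ> inv (sfun g)) :: sym \<Rightarrow>\<^sub>0 'a) h"
    by (simp add: lookup_mult_single lookup_single_mult lookup_rsum stabf_conj_iff[OF assms] add.assoc)
qed

lemma csum_conj:
  assumes "g \<in> Sy d"
  shows "sing g 1 * csum d r * sing (- g) 1 = csum d (r \<circ> inv (sfun g))"
proof -
  have "twist (sing g 1 * rsum d r * sing (- g) 1) = csum d (r \<circ> inv (sfun g))"
    by (simp add: rsum_conj[OF assms])
  also have "twist (sing g 1 * rsum d r * sing (- g) 1)
      = pscale (sgn_of g * sgn_of g) (sing g 1 * csum d r * sing (- g) 1)"
  proof -
    have e: "twist (sing h 1) = pscale (sgn_of h) (sing h 1)" for h by simp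
    show ?thesis
      unfolding twist_mult e twist_rsum by (simp only: pscale_simps pscale_pscale sgn_of_uminus)
  qed
  finally show ?thesis by (simp add: o_def)
qed

lemma single_cancel: "x * sing g 1 * sing (- g) 1 = x" "x * sing (- g) 1 * sing g 1 = x"
  for x :: "'g::group_add \<Rightarrow>\<^sub>0 'k::field"
  by (simp_all add: mult.assoc mult_single)

lemma single_csum_move: "g \<in> Sy d \<Longrightarrow> sing g 1 * csum d r = csum d (r \<circ> inv (sfun g)) * sing g 1"
  by (subst csum_conj[symmetric]) (simp_all add: single_cancel)

text \<open>The transposition of x and y lies in both stabilizers: the row sum absorbs it and the
  column sum changes sign, so the product is its own negative.\<close>

lemma rsum_csum_zero:
  fixes d :: nat
  assumes "x < d" "y < d" "x \<noteq> y" "r x = r y" "c x = c y"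
  shows "rsum d r * csum d c = (0 :: sym \<Rightarrow>\<^sub>0 'k::field_char_0)"
proof -
  define t where "t = Abs_sym (Transposition.transpose x y)"
  have p: "Transposition.transpose x y permutes {..<d}" using assms by (intro permutes_swap_id) auto
  have f: "sfun t = Transposition.transpose x y" unfolding t_def by (rule sfun_Abs_sym[OF p])
  have t: "t \<in> stabf d r" "t \<in> stabf d c"
    using assms Abs_sym_Sy[OF p] by (auto simp: stabf_def f Transposition.transpose_def t_def[symmetric])
  have s: "sgn_of t = (-1 :: 'k)" using assms by (simp add: sgn_of_def f sign_swap_id)
  have "rsum d r * csum d c = rsum d r * sing t 1 * (csum d c :: sym \<Rightarrow>\<^sub>0 'k)"
    by (simp add: rsum_single[OF t(1)])
  also have "\<dots> = pscale (-1) (rsum d r * csum d c)"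
    by (simp add: mult.assoc single_csum[OF t(2)] s mult_pscale_right del: pvs.scale_minus_left)
  finally have e: "rsum d r * csum d c = pscale (-1 :: 'k) (rsum d r * csum d c)" .
  show ?thesis
  proof (rule poly_mapping_eqI)
    fix k
    have "lk (rsum d r * csum d c) k = - (lk (rsum d r * csum d c) k :: 'k)"
      by (subst e) simp
    then show "lk (rsum d r * csum d c) k = lk (0 :: sym \<Rightarrow>\<^sub>0 'k) k" by simp
  qed
qed

text \<open>The pairs \<open>(r x, c x)\<close> are the cells of a Young diagram, counted from 0:
  they are distinct and closed under moving left and moving up. The form is symmetric in rows and
  columns and mentions no partition.\<close>

definition young :: "nat \<Rightarrow> (nat \<Rightarrow> nat) \<Rightarrow> (nat \<Rightarrow> nat) \<Rightarrow> bool" where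
  "young d r c \<longleftrightarrow> inj_on (\<lambda>x. (r x, c x)) {..<d} \<and>
     (\<forall>x<d. \<forall>j<c x. \<exists>y<d. r y = r x \<and> c y = j) \<and>
     (\<forall>x<d. \<forall>i<r x. \<exists>y<d. c y = c x \<and> r y = i)"

section \<open>Comparison of two fillings: the dominance order\<close>

lemma match_perm:
  fixes u v :: "nat \<Rightarrow> 'a"
  assumes "inj_on u {..<d}" "inj_on v {..<d}" "u ` {..<d} = v ` {..<d}"
  obtains h where "h \<in> Sy d" "\<And>x. x < d \<Longrightarrow> u (sfun h x) = v x"
proof -
  let ?f = "\<lambda>x. if x < d then inv_into {..<d} u (v x) else x"
  have b: "bij_betw (inv_into {..<d} u \<circ> v) {..<d} {..<d}"
  proof (rule bij_betw_trans)
    show "bij_betw v {..<d} (v ` {..<d})" by (rule inj_on_imp_bij_betw[OF assms(2)])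
    show "bij_betw (inv_into {..<d} u) (v ` {..<d}) {..<d}"
      unfolding assms(3)[symmetric] by (rule bij_betw_inv_into[OF inj_on_imp_bij_betw[OF assms(1)]])
  qed
  have p: "?f permutes {..<d}"
  proof (rule bij_imp_permutes)
    have "bij_betw ?f {..<d} {..<d} \<longleftrightarrow> bij_betw (inv_into {..<d} u \<circ> v) {..<d} {..<d}"
      by (rule bij_betw_cong) simp
    then show "bij_betw ?f {..<d} {..<d}" using b by simp
  qed simp
  show thesis
  proof (rule that[of "Abs_sym ?f"])
    show "Abs_sym ?f \<in> Sy d" by (rule Abs_sym_Sy[OF p])
    fix x assume "x < d"
    then show "u (sfun (Abs_sym ?f) x) = v x"
      using assms(3) by (simp add: sfun_Abs_sym[OF p] f_inv_into_f)
  qed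
qed

text \<open>The labels \<open>c'\<close> in a row are distinct, so at most m of them are below m. If
  the row of the diagram reaches column m, then \<open>c\<close> attains all m smaller values there;
  otherwise the right-hand side counts the entire row.\<close>

lemma row_count_le:
  assumes "young d r c" "inj_on (\<lambda>x. (r x, c' x)) {..<d}"
  shows "card {x. x < d \<and> r x = i \<and> c' x < m} \<le> card {x. x < d \<and> r x = i \<and> c x < m}"
proof (cases "\<exists>x<d. r x = i \<and> c x \<ge> m")
  case True
  then obtain x where x: "x < d" "r x = i" "c x \<ge> m" by blast
  have "c' ` {x. x < d \<and> r x = i \<and> c' x < m} \<subseteq> {..<m}" by auto
  moreover have "inj_on c' {x. x < d \<and> r x = i \<and> c' x < m}"
    using assms(2) by (auto simp: inj_on_def)
  ultimately have "card {x. x < d \<and> r x = i \<and> c' x < m} \<le> m"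
    by (metis card_inj_on_le card_lessThan finite_lessThan)
  moreover have "{..<m} \<subseteq> c ` {x. x < d \<and> r x = i \<and> c x < m}"
  proof
    fix j assume "j \<in> {..<m}"
    then have "j < c x" "j < m" using x by auto
    then show "j \<in> c ` {x. x < d \<and> r x = i \<and> c x < m}"
    proof -
      obtain y where "y < d" "r y = r x" "c y = j"
        using assms(1) x \<open>j < c x\<close> unfolding young_def by blast
      then show ?thesis using x \<open>j < m\<close> by (intro image_eqI[of _ _ y]) auto
    qed
  qed
  then have "m \<le> card {x. x < d \<and> r x = i \<and> c x < m}"
    using surj_card_le[of "{x. x < d \<and> r x = i \<and> c x < m}" "{..<m}" c] by simp
  ultimately show ?thesis by simp
next
  case False
  then show ?thesis by (intro card_mono) auto
qed

lemma card_rows: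
  "card {x. x < d \<and> P x} = (\<Sum>i\<in>r ` {..<d}. card {x. x < d \<and> r x = i \<and> P x})" for d :: nat
proof -
  have "(\<Sum>i\<in>r ` {..<d}. (\<Sum>x\<in>{x \<in> {x. x < d \<and> P x}. r x = i}. 1)) = (\<Sum>x\<in>{x. x < d \<and> P x}. (1::nat))"
    by (rule sum.group) auto
  then show ?thesis by (simp add: conj_commute conj_left_commute conj_assoc)
qed

text \<open>The dominance inequality: columns that meet each row at most once cannot have more
  entries in the first m of them than the diagram has.\<close>

lemma col_count_le:
  assumes "young d r c" "inj_on (\<lambda>x. (r x, c' x)) {..<d}"
  shows "card {x. x < d \<and> c' x < m} \<le> card {x. x < d \<and> c x < m}"
  unfolding card_rows[of d "\<lambda>x. c' x < m" r] card_rows[of d "\<lambda>x. c x < m" r]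
  by (intro sum_mono row_count_le[OF assms])

text \<open>The case of equality in dominance. Since the inequality holds in each row separately,
  equal totals force equality in each row, and a row then uses exactly the columns that it uses in
  the diagram.\<close>

lemma young_same_cells:
  assumes Y: "young d r c" and inj: "inj_on (\<lambda>x. (r x, c' x)) {..<d}"
    and eq: "\<And>m. card {x. x < d \<and> c' x < m} = card {x. x < d \<and> c x < m}"
  shows "(\<lambda>x. (r x, c' x)) ` {..<d} = (\<lambda>x. (r x, c x)) ` {..<d}"
proof -
  have row: "card {x. x < d \<and> r x = i \<and> c' x < m} = card {x. x < d \<and> r x = i \<and> c x < m}"
    if "i \<in> r ` {..<d}" for i m
  proof (rule sum_mono_inv[where f = "\<lambda>i. card {x. x < d \<and> r x = i \<and> c' x < m}"
        and g = "\<lambda>i. card {x. x < d \<and> r x = i \<and> c x < m}", OF _ _ that])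
    show "(\<Sum>i\<in>r ` {..<d}. card {x. x < d \<and> r x = i \<and> c' x < m})
        = (\<Sum>i\<in>r ` {..<d}. card {x. x < d \<and> r x = i \<and> c x < m})"
      using eq[of m] unfolding card_rows[of d "\<lambda>x. c' x < m" r] card_rows[of d "\<lambda>x. c x < m" r] .
  qed (auto intro: row_count_le[OF Y inj])
  have sub: "(\<lambda>x. (r x, c x)) ` {..<d} \<subseteq> (\<lambda>x. (r x, c' x)) ` {..<d}"
  proof (rule image_subsetI)
    fix x assume x: "x \<in> {..<d}"
    let ?A = "{y. y < d \<and> r y = r x \<and> c' y < Suc (c x)}" and ?B = "{y. y < d \<and> r y = r x \<and> c y < Suc (c x)}"
    have "{..<Suc (c x)} \<subseteq> c ` ?B"
    proof
      fix j assume j: "j \<in> {..<Suc (c x)}"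
      show "j \<in> c ` ?B"
      proof (cases "j = c x")
        case False
        then have "j < c x" using j by auto
        then obtain y where "y < d" "r y = r x" "c y = j" using Y x unfolding young_def by auto
        then show ?thesis using j by auto
      qed (use x in auto)
    qed
    then have "Suc (c x) \<le> card ?B"
      using surj_card_le[of ?B "{..<Suc (c x)}" c] by simp
    also have "card ?B = card ?A" using row[of "r x" "Suc (c x)"] x by simp
    also have "card ?A = card (c' ` ?A)"
      by (rule card_image[symmetric]) (use inj in \<open>auto simp: inj_on_def\<close>)
    finally have ge: "Suc (c x) \<le> card (c' ` ?A)" .
    have s: "c' ` ?A \<subseteq> {..<Suc (c x)}" by auto
    then have "card (c' ` ?A) \<le> Suc (c x)" using card_mono[OF finite_lessThan s] by simp
    then have "c' ` ?A = {..<Suc (c x)}" using ge by (intro card_subset_eq s) auto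
    then have "c x \<in> c' ` ?A" by auto
    then obtain y where "y < d" "r y = r x" "c x = c' y" by auto
    then show "(r x, c x) \<in> (\<lambda>x. (r x, c' x)) ` {..<d}" by (intro image_eqI[of _ _ y]) auto
  qed
  show ?thesis
  proof (rule card_subset_eq[symmetric, OF _ sub])
    have "inj_on (\<lambda>x. (r x, c x)) {..<d}" using Y unfolding young_def by blast
    then show "card ((\<lambda>x. (r x, c x)) ` {..<d}) = card ((\<lambda>x. (r x, c' x)) ` {..<d})"
      using inj by (simp add: card_image)
  qed simp
qed

text \<open>Von Neumann's argument. Moving g across the column sum relabels the columns. If two
  entries then share a row and a column, the product vanishes; otherwise the relabelled columns fill
  the same diagram, and g is a row permutation times a column permutation, which are absorbed up to
  sign.\<close>

lemma rsum_single_csum: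
  assumes Y: "young d r c" and g: "g \<in> Sy d"
  shows "\<exists>e. rsum d r * sing g 1 * csum d c = pscale e (rsum d r * csum d c :: sym \<Rightarrow>\<^sub>0 'k::field_char_0)"
proof -
  let ?c = "c \<circ> inv (sfun g)"
  have m: "rsum d r * sing g 1 * csum d c = rsum d r * csum d ?c * (sing g 1 :: sym \<Rightarrow>\<^sub>0 'k)"
    by (simp add: mult.assoc single_csum_move[OF g])
  show ?thesis
  proof (cases "inj_on (\<lambda>x. (r x, ?c x)) {..<d}")
    case False
    then obtain x y where "x < d" "y < d" "x \<noteq> y" "r x = r y" "?c x = ?c y"
      by (auto simp: inj_on_def)
    then have "rsum d r * csum d ?c = (0 :: sym \<Rightarrow>\<^sub>0 'k)" by (intro rsum_csum_zero) 
    then show ?thesis by (intro exI[of _ 0]) (simp add: m)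
  next
    case True
    have bij: "bij_betw (sfun g) {x. x < d \<and> c x < k} {x. x < d \<and> ?c x < k}" for k
      by (rule bij_betwI[where g = "inv (sfun g)"]) (use g in \<open>auto simp: Sy_less Sy_inv_less\<close>)
    have "card {x. x < d \<and> ?c x < k} = card {x. x < d \<and> c x < k}" for k
      using bij[of k] by (rule bij_betw_same_card[symmetric])
    then have im: "(\<lambda>x. (r x, ?c x)) ` {..<d} = (\<lambda>x. (r x, c x)) ` {..<d}"
      by (intro young_same_cells[OF Y True])
    \<comment> \<open>The permutation carrying one filling of the diagram to the other; it preserves
      rows, and composed with the inverse of g it preserves columns.\<close>
    obtain h where h: "h \<in> Sy d" "\<And>x. x < d \<Longrightarrow> (r (sfun h x), ?c (sfun h x)) = (r x, c x)"
      using match_perm[OF True _ im] Y unfolding young_def by auto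
    have hr: "h \<in> stabf d r" using h by (auto simp: stabf_def)
    have hc: "- g + h \<in> stabf d c" using h g by (auto simp: stabf_def intro!: Sy_plus Sy_uminus)
    let ?q = "- (- g + h)"
    have "g = h + ?q" by (simp add: minus_add flip: add.assoc)
    then have "rsum d r * sing g 1 * csum d c = rsum d r * (sing h 1 * sing ?q 1) * (csum d c :: sym \<Rightarrow>\<^sub>0 'k)"
      by (simp add: mult_single)
    also have "\<dots> = (rsum d r * sing h 1) * (sing ?q 1 * csum d c)" by (simp only: mult.assoc)
    also have "\<dots> = pscale (sgn_of ?q) (rsum d r * csum d c)"
      using hc by (subst single_csum) (simp_all only: rsum_single[OF hr] stabf_uminus mult_pscale_right)
    finally show ?thesis by blast
  qed
qed

section \<open>Products of row and column sums with an element in between\<close>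

lemma galg_induct_exists:
  fixes f :: "(sym \<Rightarrow>\<^sub>0 'k::field) \<Rightarrow> sym \<Rightarrow>\<^sub>0 'k"
  assumes x: "x \<in> galg d" and single: "\<And>g. g \<in> Sy d \<Longrightarrow> \<exists>e. f (sing g 1) = pscale e y"
    and f: "\<And>x y. f (x + y) = f x + f y" "\<And>c x. f (pscale c x) = pscale c (f x)" "f 0 = 0"
  shows "\<exists>e. f x = pscale e y"
proof -
  obtain e where e: "\<And>g. g \<in> Sy d \<Longrightarrow> f (sing g 1) = pscale (e g) y" using single by metis
  have s: "f (sum h A) = (\<Sum>a\<in>A. f (h a))" if "finite A" for h and A :: "sym set"
    using that by induction (simp_all add: f)
  have "f x = (\<Sum>g\<in>Sy d. pscale (lk x g) (f (sing g 1)))"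
    by (subst galg_expand[OF x]) (simp add: s f(2) del: pscale_single)
  also have "\<dots> = (\<Sum>g\<in>Sy d. pscale (lk x g * e g) y)" by (rule sum.cong) (simp_all add: e)
  also have "\<dots> = pscale (\<Sum>g\<in>Sy d. lk x g * e g) y" by (simp add: pvs.scale_sum_left)
  finally show ?thesis by blast
qed

lemma rsum_galg_csum:
  assumes Y: "young d r c" and x: "x \<in> galg d"
  shows "\<exists>e. rsum d r * x * csum d c = pscale e (rsum d r * csum d c :: sym \<Rightarrow>\<^sub>0 'k::field_char_0)"
  by (rule galg_induct_exists[OF x, of "\<lambda>x. rsum d r * x * csum d c"])
    (simp_all add: rsum_single_csum[OF Y] ring_distribs pscale_simps)

text \<open>Row and column group meet trivially, because distinct entries occupy distinct cells; so
  the identity arises in the product only as the identity times itself.\<close>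

lemma lookup_rsum_csum_0:
  assumes "young d r c"
  shows "lk (rsum d r * csum d c :: sym \<Rightarrow>\<^sub>0 'k::field) 0 = 1"
proof -
  have *: "s + t = 0 \<longleftrightarrow> t = 0 \<and> s = 0" if s: "s \<in> stabf d r" and t: "t \<in> stabf d c" for s t
  proof
    assume "s + t = 0"
    then have e: "s = - t" by (simp add: eq_neg_iff_add_eq_0)
    then have t': "t \<in> stabf d r" using s by simp
    have "t = 0"
    proof (rule Sy_ext[of _ d])
      fix x assume x: "x < d"
      have "(r (sfun t x), c (sfun t x)) = (r x, c x)" using t t' x by (simp add: stabf_def)
      moreover have "sfun t x < d" using t x by (simp add: stabf_def Sy_less)
      ultimately have "sfun t x = x"
        using assms x unfolding young_def inj_on_def by (metis lessThan_iff)
      then show "sfun t x = sfun 0 x" by simp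
    qed (use t in \<open>auto simp: stabf_def\<close>)
    then show "t = 0 \<and> s = 0" using e by simp
  qed simp
  have "lk (rsum d r * csum d c :: sym \<Rightarrow>\<^sub>0 'k) 0 =
      (\<Sum>s\<in>stabf d r. \<Sum>t\<in>stabf d c. if t = 0 \<and> s = 0 then 1 else 0)"
    unfolding rsum_def csum_def sum_distrib_left sum_distrib_right lookup_sum mult_single
    by (subst sum.swap, intro sum.cong refl) (auto simp: lookup_single when_def *)
  also have "\<dots> = (\<Sum>s\<in>stabf d r. if s = 0 then 1 else 0)"
    by (intro sum.cong refl) simp
  also have "\<dots> = 1" by simp
  finally show ?thesis .
qed

text \<open>The field carries no order. Positivity of a sum of squares is instead obtained for
  integers, and the coefficients of all products of row and column sums are integers.\<close>

lemma lookup_times_Ints: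
  assumes "\<And>g. lk x g \<in> \<int>" "\<And>g. lk (y :: 'g::group_add \<Rightarrow>\<^sub>0 'k::field) g \<in> \<int>"
  shows "lk (x * y) h \<in> \<int>"
  unfolding lookup_times by (intro Ints_sum Ints_mult assms)

lemma lookup_rsum_Ints: "lk (rsum d r :: sym \<Rightarrow>\<^sub>0 'k::field) g \<in> \<int>" 
  and lookup_csum_Ints: "lk (csum d r :: sym \<Rightarrow>\<^sub>0 'k::field) g \<in> \<int>" 
  by (simp_all add: lookup_rsum lookup_csum sgn_of_def)

definition ysym :: "nat \<Rightarrow> (nat \<Rightarrow> nat) \<Rightarrow> (nat \<Rightarrow> nat) \<Rightarrow> sym \<Rightarrow>\<^sub>0 'k::field" where
  "ysym d r c = rsum d r * csum d c"

lemma ysym_galg [simp]: "ysym d r c \<in> galg d"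
  by (simp add: ysym_def galg_mult)

text \<open>With a and b the row and the column sum, \<open>a * b * a\<close> is fixed by
  \<open>star\<close>. The coefficient of its square at the identity is therefore a sum of squares,
  and it also equals n times the square of the order of the row group. Integer coefficients, one of
  them nonzero, make this sum nonzero, hence n too.\<close>

lemma ysym_square:
  assumes Y: "young d r c"
  obtains n where "n \<noteq> 0" "ysym d r c * ysym d r c = pscale n (ysym d r c :: sym \<Rightarrow>\<^sub>0 'k::field_char_0)"
proof -
  let ?a = "rsum d r :: sym \<Rightarrow>\<^sub>0 'k" and ?b = "csum d c :: sym \<Rightarrow>\<^sub>0 'k"
  let ?P = "of_nat (card (stabf d r)) :: 'k" and ?x = "?a * ?b * ?a"
  have "?b * ?a \<in> galg d" by (simp add: galg_mult)
  from rsum_galg_csum[OF Y this] obtain n where n: "?a * (?b * ?a) * ?b = pscale n (?a * ?b)" by blast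
  \<comment> \<open>By the trace property this is the coefficient of \<open>?a * ?a * ?b\<close>,
    and \<open>?a * ?a\<close> is \<open>?P\<close> times \<open>?a\<close>.\<close>
  have l: "lk ?x 0 = ?P"
    by (subst lookup_times_commute)
      (simp add: rsum_rsum pscale_mult_left lookup_rsum_csum_0[OF Y] flip: mult.assoc)
  have "?x * ?x = ?a * ?b * (?a * ?a) * ?b * ?a" by (simp only: mult.assoc)
  also have "\<dots> = pscale ?P (?a * (?b * ?a) * ?b * ?a)"
    by (simp only: rsum_rsum pscale_simps mult.assoc)
  also have "\<dots> = pscale (?P * n) ?x" by (simp add: n pscale_mult_left)
  finally have "lk (?x * ?x) 0 = ?P * n * ?P" by (simp add: l)
  moreover have "lk (?x * ?x) 0 = (\<Sum>g\<in>pkeys ?x. (lk ?x g)\<^sup>2)"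
  proof -
    have "star ?x = ?x" by (simp add: star_mult mult.assoc)
    then have "lk ?x (- g) = lk ?x g" for g using lookup_star[of ?x g] by simp
    then show ?thesis by (simp add: lookup_times power2_eq_square)
  qed
  moreover have "(\<Sum>g\<in>pkeys ?x. (lk ?x g)\<^sup>2) \<noteq> 0"
  proof -
    have "lk ?x g \<in> \<int>" for g
      by (intro lookup_times_Ints lookup_rsum_Ints lookup_csum_Ints)
    then obtain z where z: "\<And>g. lk ?x g = of_int (z g)" unfolding Ints_def image_iff by metis
    have "0 \<in> pkeys ?x" using l card_stabf[of d r] by (simp add: in_keys_iff)
    then have "(\<Sum>g\<in>pkeys ?x. (z g)\<^sup>2) > 0"
      by (intro sum_pos2[of _ 0]) (auto simp: in_keys_iff z)
    moreover have "(\<Sum>g\<in>pkeys ?x. (lk ?x g)\<^sup>2) = of_int (\<Sum>g\<in>pkeys ?x. (z g)\<^sup>2)" by (simp add: z)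
    ultimately show ?thesis by (metis less_irrefl of_int_eq_0_iff)
  qed
  ultimately have "n \<noteq> 0" by auto
  moreover have "ysym d r c * ysym d r c = pscale n (ysym d r c :: sym \<Rightarrow>\<^sub>0 'k)"
    using n by (simp add: ysym_def mult.assoc)
  ultimately show thesis by (rule that)
qed

text \<open>Between the outermost row sum and column sum stands an element of the group algebra, to
  which \<open>rsum_galg_csum\<close> applies.\<close>

lemma ysym_sandwich:
  assumes Y: "young d r c" and x: "x \<in> galg d"
  obtains e where "ysym d r c * x * ysym d r c = pscale e (ysym d r c :: sym \<Rightarrow>\<^sub>0 'k::field_char_0)"
proof -
  have "csum d c * x * rsum d r \<in> galg d" using x by (intro galg_mult) auto
  from rsum_galg_csum[OF Y this] show thesis using that by (auto simp: ysym_def mult.assoc)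
qed

text \<open>Some group element g already gives a nonzero product. Moving g across the column sum
  yields columns of the same lengths that meet every row at most once, and dominance applies to
  them.\<close>

lemma rsum_galg_csum_le:
  assumes Y: "young d r c" and x: "x \<in> galg d"
    and nz: "rsum d r * x * csum d c' \<noteq> (0 :: sym \<Rightarrow>\<^sub>0 'k::field_char_0)"
  shows "card {x. x < d \<and> c' x < m} \<le> card {x. x < d \<and> c x < m}"
proof -
  have "\<exists>g\<in>Sy d. rsum d r * sing g 1 * csum d c' \<noteq> (0 :: sym \<Rightarrow>\<^sub>0 'k)"
  proof (rule ccontr)
    assume "\<not> ?thesis"
    then have "\<exists>e. rsum d r * x * csum d c' = pscale e 0"
      by (intro galg_induct_exists[OF x, of "\<lambda>x. rsum d r * x * csum d c'"])
        (auto simp: ring_distribs pscale_simps)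
    with nz show False by simp
  qed
  then obtain g where g: "g \<in> Sy d" "rsum d r * sing g 1 * csum d c' \<noteq> (0 :: sym \<Rightarrow>\<^sub>0 'k)" by blast
  let ?c = "c' \<circ> inv (sfun g)"
  have "rsum d r * csum d ?c \<noteq> (0 :: sym \<Rightarrow>\<^sub>0 'k)"
    using g(2) by (metis mult.assoc mult_zero_left single_csum_move[OF g(1)])
  then have inj: "inj_on (\<lambda>x. (r x, ?c x)) {..<d}"
    unfolding inj_on_def using rsum_csum_zero[of _ d _ r ?c] by (metis lessThan_iff prod.inject)
  have "bij_betw (sfun g) {x. x < d \<and> c' x < m} {x. x < d \<and> ?c x < m}"
    by (rule bij_betwI[where g = "inv (sfun g)"]) (use g in \<open>auto simp: Sy_less Sy_inv_less\<close>)
  then have "card {x. x < d \<and> c' x < m} = card {x. x < d \<and> ?c x < m}"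
    by (rule bij_betw_same_card)
  also have "\<dots> \<le> card {x. x < d \<and> c x < m}" by (rule col_count_le[OF Y inj])
  finally show ?thesis .
qed

text \<open>A nonzero product would give dominance in both directions, hence equal counts: one
  inequality is read off directly, the other after applying \<open>star\<close>, which interchanges
  the two shapes.\<close>

lemma ysym_orthogonal:
  assumes Y: "young d r c" "young d r' c'" and x: "x \<in> galg d"
    and ne: "card {x. x < d \<and> c x < m} \<noteq> card {x. x < d \<and> c' x < m}"
  shows "ysym d r c * x * ysym d r' c' = (0 :: sym \<Rightarrow>\<^sub>0 'k::field_char_0)"
proof (rule ccontr)
  assume nz: "\<not> ?thesis"
  have e: "ysym d r c * x * ysym d r' c' = rsum d r * (csum d c * x * rsum d r') * csum d c'"
    by (simp add: ysym_def mult.assoc)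
  have 1: "card {x. x < d \<and> c' x < m} \<le> card {x. x < d \<and> c x < m}"
    by (rule rsum_galg_csum_le[OF Y(1), of "csum d c * x * rsum d r'"])
      (use nz e x in \<open>auto intro!: galg_mult\<close>)
  have "csum d c * x * rsum d r' \<noteq> 0" using nz e by force
  then have "star (csum d c * x * rsum d r') \<noteq> 0" by (metis star_0 star_star)
  then have "rsum d r' * star x * csum d c \<noteq> 0" by (simp add: star_mult mult.assoc)
  then have "card {x. x < d \<and> c x < m} \<le> card {x. x < d \<and> c' x < m}"
    by (intro rsum_galg_csum_le[OF Y(2)]) (use x in auto)
  with 1 ne show False by simp
qed

subsection \<open>Completeness\<close>

text \<open>J has to absorb multiplication by elements of degree d but may contain others. This
  allows ideals to be defined by a condition on products alone.\<close>

definition gideal :: "nat \<Rightarrow> (sym \<Rightarrow>\<^sub>0 'k::field) set \<Rightarrow> bool" where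
  "gideal d J \<longleftrightarrow> 0 \<in> J \<and> (\<forall>x\<in>J. \<forall>y\<in>J. x + y \<in> J) \<and> (\<forall>x\<in>J. \<forall>y\<in>galg d. x * y \<in> J \<and> y * x \<in> J)"

lemma gideal_0: "gideal d J \<Longrightarrow> 0 \<in> J"
  and gideal_add: "gideal d J \<Longrightarrow> x \<in> J \<Longrightarrow> y \<in> J \<Longrightarrow> x + y \<in> J"
  and gideal_mult_right: "gideal d J \<Longrightarrow> x \<in> J \<Longrightarrow> y \<in> galg d \<Longrightarrow> x * y \<in> J"
  and gideal_mult_left: "gideal d J \<Longrightarrow> x \<in> J \<Longrightarrow> y \<in> galg d \<Longrightarrow> y * x \<in> J"
  by (simp_all add: gideal_def)

lemma gideal_pscale: "gideal d J \<Longrightarrow> x \<in> J \<Longrightarrow> pscale c x \<in> J"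
  using gideal_mult_left[of d J x "sing 0 c"] by (simp add: pscale_eq)

lemma gideal_diff: "gideal d J \<Longrightarrow> x \<in> J \<Longrightarrow> y \<in> J \<Longrightarrow> x - y \<in> J"
  using gideal_add[of d J x "pscale (-1) y"] gideal_pscale[of d J y "-1"]
  by (simp add: pvs.scale_minus_left)

lemma gideal_sum: "gideal d J \<Longrightarrow> (\<And>i. i \<in> I \<Longrightarrow> f i \<in> J) \<Longrightarrow> sum f I \<in> J"
  by (induction I rule: infinite_finite_induct) (auto intro: gideal_add gideal_0)

lemma gideal_sum_diff:
  "gideal d J \<Longrightarrow> (\<And>i. i \<in> I \<Longrightarrow> f i - g i \<in> J) \<Longrightarrow> sum f I - sum g I \<in> J"
  unfolding sum_subtractf[symmetric] by (rule gideal_sum)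

lemma gideal_twist:
  assumes "gideal d J"
  shows "gideal d {x. twist x \<in> J}"
  using assms unfolding gideal_def by (auto simp: twist_mult)

section \<open>The central sum of transpositions\<close>

definition tsp :: "nat \<Rightarrow> nat \<Rightarrow> sym" where
  "tsp x y = Abs_sym (Transposition.transpose x y)"

lemma sfun_tsp [simp]: "sfun (tsp x y) = Transposition.transpose x y"
  unfolding tsp_def by (rule Abs_sym_inverse) (simp add: permutation_swap_id)

lemma transp_Sy [simp]: "x < d \<Longrightarrow> y < d \<Longrightarrow> tsp x y \<in> Sy d"
  unfolding Sy_def mem_Collect_eq sfun_tsp by (rule permutes_swap_id) auto

lemma transp_commute: "tsp x y = tsp y x"
  by (rule sfun_inject_ext) (simp add: transpose_commute)

lemma transp_self [simp]: "tsp x x = 0"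
  by (rule sfun_inject_ext) simp

lemma transp_involutive [simp]: "tsp x y + tsp x y = 0"
  by (rule sfun_inject_ext) simp

lemma transp_conj: "g + tsp x y = tsp (sfun g x) (sfun g y) + g"
  by (rule sfun_inject_ext) (simp add: Transposition.transpose_def)

lemma sgn_of_transp: "x \<noteq> y \<Longrightarrow> sgn_of (tsp x y) = -1"
  by (simp add: sgn_of_def sign_swap_id)

definition offdiag :: "nat \<Rightarrow> (nat \<times> nat) set" where
  "offdiag d = {(x, y). x < d \<and> y < d \<and> x \<noteq> y}"

lemma finite_offdiag [simp]: "finite (offdiag d)"
  by (rule finite_subset[of _ "{..<d} \<times> {..<d}"]) (auto simp: offdiag_def)

text \<open>The sum over ordered pairs counts every transposition twice; the contents below are
  doubled accordingly. As a multiple of a class sum it is central.\<close>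

definition transp_sum :: "nat \<Rightarrow> sym \<Rightarrow>\<^sub>0 'k::field" where
  "transp_sum d = (\<Sum>(x, y)\<in>offdiag d. sing (tsp x y) 1)"

lemma transp_sum_central_single:
  assumes g: "g \<in> Sy d"
  shows "sing g 1 * transp_sum d = transp_sum d * (sing g 1 :: sym \<Rightarrow>\<^sub>0 'k::field)"
proof -
  have b: "bij_betw (\<lambda>(x, y). (sfun g x, sfun g y)) (offdiag d) (offdiag d)"
    by (rule bij_betwI[where g = "\<lambda>(x, y). (inv (sfun g) x, inv (sfun g) y)"])
      (use g in \<open>auto simp: offdiag_def Sy_less Sy_inv_less, metis sfun_inv_simps(2)\<close>)
  have "sing g 1 * transp_sum d = (\<Sum>(x, y)\<in>offdiag d. sing (tsp (sfun g x) (sfun g y) + g) (1 :: 'k))"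
    unfolding transp_sum_def sum_distrib_left
    by (rule sum.cong) (auto simp: mult_single transp_conj)
  also have "\<dots> = (\<Sum>(x, y)\<in>offdiag d. sing (tsp x y + g) 1)"
    by (subst sum.reindex_bij_betw[OF b, symmetric]) (simp add: case_prod_unfold)
  also have "\<dots> = transp_sum d * sing g 1"
    unfolding transp_sum_def sum_distrib_right
    by (rule sum.cong) (auto simp: mult_single)
  finally show ?thesis .
qed

lemma transp_sum_central:
  assumes x: "x \<in> galg d"
  shows "x * transp_sum d = transp_sum d * (x :: sym \<Rightarrow>\<^sub>0 'k::field)"
  by (subst (1 2) galg_expand[OF x])
    (simp add: sum_distrib_left sum_distrib_right pscale_simps transp_sum_central_single del: pscale_single)

lemma twist_transp_sum: "twist (transp_sum d) = pscale (-1) (transp_sum d)"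
  unfolding transp_sum_def twist_sum pvs.scale_sum_right
  by (rule sum.cong) (auto simp: offdiag_def sgn_of_transp single_uminus)

text \<open>Grows when an entry moves to a row that is at least as long as its own.\<close>

definition row_pairs :: "nat \<Rightarrow> (nat \<Rightarrow> nat) \<Rightarrow> nat" where
  "row_pairs d r = card {(x, y). x < d \<and> y < d \<and> r x = r y}"

definition rsize :: "nat \<Rightarrow> (nat \<Rightarrow> nat) \<Rightarrow> nat \<Rightarrow> nat" where
  "rsize d r i = card {x. x < d \<and> r x = i}"

lemma row_pairs_sum: "row_pairs d r = (\<Sum>x<d. \<Sum>y<d. if r x = r y then 1 else 0)"
proof -
  have "{(x, y). x < d \<and> y < d \<and> r x = r y} = Sigma {..<d} (\<lambda>x. {y. y < d \<and> r x = r y})" by auto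
  then have "row_pairs d r = (\<Sum>x<d. card {y. y < d \<and> r x = r y})"
    by (simp add: row_pairs_def)
  also have "\<dots> = (\<Sum>x<d. \<Sum>y<d. if r x = r y then 1 else 0)"
  proof (rule sum.cong[OF refl])
    fix x
    have e: "{y. y < d \<and> r x = r y} = {y \<in> {..<d}. r x = r y}" by auto
    show "card {y. y < d \<and> r x = r y} = (\<Sum>y<d. if r x = r y then 1 else 0)"
      unfolding e card_eq_sum by (rule sum.inter_filter) simp
  qed
  finally show ?thesis .
qed

text \<open>Pairs avoiding y do not notice a change of the label of y. The remaining ones are the
  pairs of y with its row companions, in both orders, and of y with itself.\<close>

lemma row_pairs_split:
  assumes y: "y < d"
  shows "row_pairs d r = (\<Sum>a\<in>{..<d} - {y}. \<Sum>b\<in>{..<d} - {y}. if r a = r b then 1 else 0)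
      + 2 * card {b. b < d \<and> b \<noteq> y \<and> r b = r y} + 1"
proof -
  have c: "card {b. b < d \<and> b \<noteq> y \<and> r b = r y} = (\<Sum>b\<in>{..<d} - {y}. if r b = r y then 1 else 0)"
  proof -
    have e: "{b. b < d \<and> b \<noteq> y \<and> r b = r y} = {b \<in> {..<d} - {y}. r b = r y}" by auto
    show ?thesis unfolding e card_eq_sum by (rule sum.inter_filter) simp
  qed
  have s: "(\<Sum>a<d. f a) = f y + (\<Sum>a\<in>{..<d} - {y}. f a)" for f :: "nat \<Rightarrow> nat"
    by (rule sum.remove) (use y in auto)
  let ?f = "\<lambda>a b. if r a = r b then 1 else (0::nat)" and ?D = "{..<d} - {y}"
  have "row_pairs d r = (\<Sum>b<d. ?f y b) + (\<Sum>a\<in>?D. \<Sum>b<d. ?f a b)"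
    unfolding row_pairs_sum by (rule s)
  also have "(\<Sum>b<d. ?f y b) = 1 + (\<Sum>b\<in>?D. ?f b y)"
    by (subst s) (simp add: eq_commute[of "r y"])
  also have "(\<Sum>a\<in>?D. \<Sum>b<d. ?f a b) = (\<Sum>a\<in>?D. ?f a y) + (\<Sum>a\<in>?D. \<Sum>b\<in>?D. ?f a b)"
    unfolding sum.distrib[symmetric] by (intro sum.cong refl s)
  finally show ?thesis by (simp add: c)
qed

lemma row_pairs_move:
  assumes y: "y < d" and ne: "r y \<noteq> i" and le: "rsize d r (r y) \<le> rsize d r i"
  shows "row_pairs d r < row_pairs d (r(y := i))"
proof -
  have "{b. b < d \<and> r b = r y} = insert y {b. b < d \<and> b \<noteq> y \<and> r b = r y}" using y by auto
  then have 1: "rsize d r (r y) = Suc (card {b. b < d \<and> b \<noteq> y \<and> r b = r y})"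
    by (simp add: rsize_def)
  have "{b. b < d \<and> b \<noteq> y \<and> (r(y := i)) b = (r(y := i)) y} = {b. b < d \<and> r b = i}" using ne by auto
  then have 2: "card {b. b < d \<and> b \<noteq> y \<and> (r(y := i)) b = (r(y := i)) y} = rsize d r i"
    by (simp add: rsize_def)
  have 3: "(\<Sum>a\<in>{..<d} - {y}. \<Sum>b\<in>{..<d} - {y}. if (r(y := i)) a = (r(y := i)) b then 1 else 0)
      = (\<Sum>a\<in>{..<d} - {y}. \<Sum>b\<in>{..<d} - {y}. if r a = r b then 1 else (0::nat))"
    by (intro sum.cong refl) auto
  show ?thesis
    unfolding row_pairs_split[OF y, of r] row_pairs_split[OF y, of "r(y := i)"] 2 3
    using 1 le by linarith
qed

lemma row_pairs_le: "row_pairs d r \<le> d * d"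
  unfolding row_pairs_def by (rule order_trans[OF card_mono[of "{..<d} \<times> {..<d}"]]) auto

text \<open>The row group of the enlarged labelling is sorted by the image x of y. Undoing this by
  the transposition of x and y leaves an element that fixes y and preserves r, which
  \<open>rsum d r\<close> absorbs. All classes have the same size n, the order of the stabilizer of
  y.\<close>

lemma rsum_move:
  fixes d :: nat and i :: nat
  assumes y: "y < d" and ne: "r y \<noteq> i"
  defines "r' \<equiv> r(y := i)"
  obtains n where "n \<noteq> 0"
    "rsum d r' * rsum d r =
       pscale n (rsum d r + (\<Sum>x | x < d \<and> r x = i. sing (tsp x y) 1 * rsum d r) :: sym \<Rightarrow>\<^sub>0 'k::field_char_0)"
proof -
  let ?X = "{x. x < d \<and> r' x = i}" and ?G = "stabf d r'"
  let ?H = "\<lambda>x. {p \<in> ?G. sfun p y = x}"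
  have tr: "tsp x y \<in> ?G" if "x \<in> ?X" for x
    using that y by (auto simp: stabf_def r'_def Transposition.transpose_def)
  have c: "card (?H x) = card (?H y)" if x: "x \<in> ?X" for x
  proof (rule bij_betw_same_card)
    show "bij_betw ((+) (tsp x y)) (?H x) (?H y)"
      by (rule bij_betwI[where g = "(+) (tsp x y)"])
        (use tr[OF x] in \<open>auto intro!: stabf_plus simp flip: add.assoc\<close>)
  qed
  have im: "(\<lambda>p. sfun p y) ` ?G \<subseteq> ?X"
  proof clarify
    fix p assume p: "p \<in> ?G"
    then have "r' (sfun p y) = r' y" "sfun p y < d" using y by (auto simp: stabf_def Sy_less)
    then show "sfun p y < d \<and> r' (sfun p y) = i" by (simp add: r'_def)
  qed
  have red: "sing p 1 * rsum d r = sing (tsp (sfun p y) y) 1 * (rsum d r :: sym \<Rightarrow>\<^sub>0 'k)" if p: "p \<in> ?G" for p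
  proof -
    let ?x = "sfun p y" and ?q = "tsp (sfun p y) y + p"
    have x: "?x \<in> ?X" using im p by blast
    have q: "?q \<in> ?G" using tr[OF x] p by (rule stabf_plus)
    have qy: "sfun ?q y = y" by simp
    have "?q \<in> stabf d r"
      unfolding stabf_def
    proof (intro CollectI conjI allI impI)
      show "?q \<in> Sy d" using q by (rule stabf_Sy)
      fix z assume z: "z < d"
      show "r (sfun ?q z) = r z"
      proof (cases "z = y")
        case False
        then have "sfun ?q z \<noteq> y" using qy by (metis sfun_eq_iff)
        moreover have "r' (sfun ?q z) = r' z" using q z unfolding stabf_def by blast
        ultimately show ?thesis using False by (simp add: r'_def del: sfun_plus)
      qed (simp only: qy)
    qed
    then have "sing ?q 1 * rsum d r = (rsum d r :: sym \<Rightarrow>\<^sub>0 'k)" by (rule single_rsum)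
    moreover have "sing p 1 = sing (tsp (sfun p y) y) 1 * (sing ?q 1 :: sym \<Rightarrow>\<^sub>0 'k)"
      by (simp add: mult_single flip: add.assoc)
    ultimately show ?thesis by (simp only: mult.assoc)
  qed
  let ?n = "of_nat (card (?H y)) :: 'k"
  have "rsum d r' * rsum d r = (\<Sum>p\<in>?G. sing (tsp (sfun p y) y) 1 * rsum d r :: sym \<Rightarrow>\<^sub>0 'k)"
    by (subst rsum_def) (simp add: sum_distrib_right red)
  also have "\<dots> = (\<Sum>x\<in>?X. \<Sum>p\<in>?H x. sing (tsp (sfun p y) y) 1 * rsum d r)"
    by (rule sum.group[symmetric]) (use im in auto)
  also have "\<dots> = (\<Sum>x\<in>?X. pscale ?n (sing (tsp x y) 1 * rsum d r))"
  proof (rule sum.cong[OF refl])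
    fix x assume x: "x \<in> ?X"
    have "(\<Sum>p\<in>?H x. sing (tsp (sfun p y) y) 1 * rsum d r) = (\<Sum>p\<in>?H x. sing (tsp x y) 1 * rsum d r :: sym \<Rightarrow>\<^sub>0 'k)"
      by (rule sum.cong) auto
    then show "(\<Sum>p\<in>?H x. sing (tsp (sfun p y) y) 1 * rsum d r) = pscale ?n (sing (tsp x y) 1 * rsum d r :: sym \<Rightarrow>\<^sub>0 'k)"
      unfolding sum_constant_pscale c[OF x] .
  qed
  also have "\<dots> = pscale ?n (\<Sum>x\<in>?X. sing (tsp x y) 1 * rsum d r)" by (simp add: pvs.scale_sum_right)
  also have "?X = insert y {x. x < d \<and> r x = i}" using y ne by (auto simp: r'_def)
  also have "(\<Sum>x\<in>insert y {x. x < d \<and> r x = i}. sing (tsp x y) 1 * rsum d r)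
      = rsum d r + (\<Sum>x | x < d \<and> r x = i. sing (tsp x y) 1 * rsum d r :: sym \<Rightarrow>\<^sub>0 'k)"
    using ne by simp
  finally have e: "rsum d r' * rsum d r = pscale ?n (rsum d r + (\<Sum>x | x < d \<and> r x = i. sing (tsp x y) 1 * rsum d r))" .
  have "0 \<in> ?H y" by simp
  moreover have "finite (?H y)" by simp
  ultimately have "?n \<noteq> 0" by (metis card_0_eq empty_iff of_nat_eq_0_iff)
  from that[OF this e] show thesis .
qed

text \<open>Twice the sum of the contents of the diagram with the given row lengths.\<close>

definition content2 :: "nat \<Rightarrow> (nat \<Rightarrow> nat) \<Rightarrow> int" where
  "content2 d r = int (card {(x, y) \<in> offdiag d. r x = r y})
     - (\<Sum>(i, j) | i \<in> r ` {..<d} \<and> j \<in> r ` {..<d} \<and> i \<noteq> j. int (min (rsize d r i) (rsize d r j)))"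

text \<open>Transpositions inside a row are absorbed. If y moves to another row at least as long as
  its own, the new row sum lies in J by maximality, so by \<open>rsum_move\<close> the
  transpositions of y with the entries of that row sum to -1 modulo J. An ordered pair of rows thus
  contributes minus the length of the shorter one.\<close>

lemma transp_sum_rsum:
  assumes J: "gideal d J"
    and max: "\<And>r'. row_pairs d r < row_pairs d r' \<Longrightarrow> rsum d r' \<in> J"
  shows "transp_sum d * rsum d r - pscale (of_int (content2 d r)) (rsum d r) \<in> (J :: (sym \<Rightarrow>\<^sub>0 'k::field_char_0) set)"
proof -
  let ?a = "rsum d r :: sym \<Rightarrow>\<^sub>0 'k" and ?R = "r ` {..<d}" and ?row = "\<lambda>i. {x. x < d \<and> r x = i}"
  let ?I = "{(i, j). i \<in> ?R \<and> j \<in> ?R \<and> i \<noteq> j}"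
  let ?t = "\<lambda>x y. sing (tsp x y) 1 * ?a"
  have finI: "finite ?I" by (rule finite_subset[of _ "?R \<times> ?R"]) auto
  have move: "(\<Sum>x\<in>?row i. ?t x y) - pscale (-1) ?a \<in> J"
    if y: "y < d" "r y \<noteq> i" "rsize d r (r y) \<le> rsize d r i" for y i
  proof -
    obtain n where n: "n \<noteq> 0" "rsum d (r(y := i)) * ?a = pscale n (?a + (\<Sum>x\<in>?row i. ?t x y))"
      using rsum_move[of y d r i] y by auto
    have "rsum d (r(y := i)) \<in> J" by (rule max) (rule row_pairs_move[OF y])
    then have "pscale (inverse n) (rsum d (r(y := i)) * ?a) \<in> J"
      by (intro gideal_pscale[OF J] gideal_mult_right[OF J]) auto
    then show ?thesis using n by (simp add: add.commute)
  qed
  have block: "(\<Sum>x\<in>?row i. \<Sum>y\<in>?row j. ?t x y) - pscale (- of_nat (min (rsize d r i) (rsize d r j))) ?a \<in> J"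
    if ij: "i \<noteq> j" for i j
  proof -
    have A: "(\<Sum>y\<in>?row j. \<Sum>x\<in>?row i. ?t x y) - pscale (- of_nat (min (rsize d r i) (rsize d r j))) ?a \<in> J"
      if "i \<noteq> j" "rsize d r j \<le> rsize d r i" for i j
    proof -
      have "(\<Sum>y\<in>?row j. \<Sum>x\<in>?row i. ?t x y) - (\<Sum>y\<in>?row j. pscale (-1) ?a) \<in> J"
        by (rule gideal_sum_diff[OF J], rule move) (use that in auto)
      moreover have "(\<Sum>y\<in>?row j. pscale (-1) ?a) = pscale (- of_nat (min (rsize d r i) (rsize d r j))) ?a"
        unfolding sum_constant_pscale using that by (simp add: rsize_def min_absorb2 del: pvs.scale_minus_left)
      ultimately show ?thesis by metis
    qed
    show ?thesis
    proof (cases "rsize d r j \<le> rsize d r i")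
      case True
      then show ?thesis using A[OF ij] by (subst sum.swap) auto
    next
      case False
      then show ?thesis using A[of j i] ij by (simp add: transp_commute min.commute)
    qed
  qed
  let ?S = "{(x, y) \<in> offdiag d. r x = r y}" and ?D = "{(x, y) \<in> offdiag d. r x \<noteq> r y}"
  have same: "(\<Sum>(x, y)\<in>?S. ?t x y) = pscale (of_nat (card ?S)) ?a"
  proof -
    have "(\<Sum>(x, y)\<in>?S. ?t x y) = (\<Sum>p\<in>?S. ?a)"
    proof (rule sum.cong[OF refl], clarify)
      fix x y assume "(x, y) \<in> offdiag d" "r x = r y"
      then have "tsp x y \<in> stabf d r"
        by (auto simp: stabf_def offdiag_def Transposition.transpose_def)
      then show "?t x y = ?a" by (rule single_rsum)
    qed
    then show ?thesis by (simp only: sum_constant_pscale)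
  qed
  have "(\<Sum>(x, y)\<in>?D. ?t x y) = (\<Sum>p\<in>?I. \<Sum>q\<in>{q \<in> ?D. (r (fst q), r (snd q)) = p}. ?t (fst q) (snd q))"
    unfolding case_prod_unfold
    by (rule sum.group[symmetric])
      (use finI in \<open>auto simp: offdiag_def case_prod_unfold intro: finite_subset[OF _ finite_offdiag]\<close>)
  also have "\<dots> = (\<Sum>p\<in>?I. \<Sum>x\<in>?row (fst p). \<Sum>y\<in>?row (snd p). ?t x y)"
  proof (rule sum.cong[OF refl])
    fix p assume "p \<in> ?I"
    then have "{q \<in> ?D. (r (fst q), r (snd q)) = p} = ?row (fst p) \<times> ?row (snd p)"
      by (auto simp: offdiag_def)
    then show "(\<Sum>q\<in>{q \<in> ?D. (r (fst q), r (snd q)) = p}. ?t (fst q) (snd q))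
        = (\<Sum>x\<in>?row (fst p). \<Sum>y\<in>?row (snd p). ?t x y)"
      by (simp add: sum.cartesian_product case_prod_unfold)
  qed
  finally have D: "(\<Sum>(x, y)\<in>?D. ?t x y) = (\<Sum>p\<in>?I. \<Sum>x\<in>?row (fst p). \<Sum>y\<in>?row (snd p). ?t x y)" .
  have "(\<Sum>(x, y)\<in>?D. ?t x y) - (\<Sum>p\<in>?I. pscale (- of_nat (min (rsize d r (fst p)) (rsize d r (snd p)))) ?a) \<in> J"
    unfolding D by (rule gideal_sum_diff[OF J]) (use block in auto)
  moreover have "transp_sum d * ?a = (\<Sum>(x, y)\<in>?S. ?t x y) + (\<Sum>(x, y)\<in>?D. ?t x y)"
  proof -
    have u: "offdiag d = ?S \<union> ?D" and disj: "?S \<inter> ?D = {}" by auto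
    have fin: "finite ?S" "finite ?D" by (auto intro: finite_subset[OF _ finite_offdiag])
    have "(\<Sum>(x, y)\<in>offdiag d. ?t x y) = (\<Sum>(x, y)\<in>?S. ?t x y) + (\<Sum>(x, y)\<in>?D. ?t x y)"
      by (subst u, rule sum.union_disjoint[OF fin disj])
    then show ?thesis by (simp add: transp_sum_def sum_distrib_right case_prod_unfold)
  qed
  moreover have "pscale (of_int (content2 d r)) ?a = pscale (of_nat (card ?S)) ?a
      + (\<Sum>p\<in>?I. pscale (- of_nat (min (rsize d r (fst p)) (rsize d r (snd p)))) ?a)"
    unfolding content2_def pvs.scale_sum_left[symmetric] pvs.scale_left_distrib[symmetric]
    by (simp add: sum_negf case_prod_unfold del: pvs.scale_minus_left)
  ultimately show ?thesis unfolding same by (simp add: algebra_simps)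
qed

text \<open>A row that meets a column meets all columns at least as long. For distinct cells, this
  and its mirror image give a Young diagram up to the numbering of rows and columns.\<close>

definition nested :: "nat \<Rightarrow> (nat \<Rightarrow> nat) \<Rightarrow> (nat \<Rightarrow> nat) \<Rightarrow> bool" where
  "nested d r c \<longleftrightarrow> (\<forall>x<d. \<forall>j\<in>c ` {..<d}. rsize d c (c x) \<le> rsize d c j \<longrightarrow> (\<exists>y<d. c y = j \<and> r y = r x))"

text \<open>Two entries of one row lie in different columns, and two columns share at most as many
  rows as the shorter one has entries. So the positive part of the content of r is bounded by the
  negative part of the content of c; equality says that all rows of the shorter column meet the
  longer one.\<close>

lemma same_row_pairs:
  fixes d :: nat
  assumes inj: "inj_on (\<lambda>x. (r x, c x)) {..<d}"
  defines "S \<equiv> {(x, y) \<in> offdiag d. r x = r y}"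
    and "I \<equiv> {(i, j). i \<in> c ` {..<d} \<and> j \<in> c ` {..<d} \<and> i \<noteq> j}"
  shows "int (card S) \<le> (\<Sum>(i, j)\<in>I. int (min (rsize d c i) (rsize d c j)))" (is "_ \<le> ?B")
    and "int (card S) = (\<Sum>(i, j)\<in>I. int (min (rsize d c i) (rsize d c j))) \<Longrightarrow> nested d r c"
proof -
  let ?K = "\<lambda>p. {q \<in> S. (c (fst q), c (snd q)) = p}"
  let ?m = "\<lambda>p. int (min (rsize d c (fst p)) (rsize d c (snd p)))"
  have finS: "finite S" unfolding S_def by (rule finite_subset[OF _ finite_offdiag]) auto
  have finI: "finite I" unfolding I_def by (rule finite_subset[of _ "c ` {..<d} \<times> c ` {..<d}"]) auto
  have inj': "x = y" if "x < d" "y < d" "r x = r y" "c x = c y" for x y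
    using inj that by (auto simp: inj_on_def)
  have "(\<lambda>q. (c (fst q), c (snd q))) ` S \<subseteq> I"
    using inj' by (auto simp: S_def I_def offdiag_def)
  then have "(\<Sum>p\<in>I. \<Sum>q\<in>?K p. 1) = (\<Sum>q\<in>S. 1 :: int)"
    by (intro sum.group finS finI)
  then have card_S: "int (card S) = (\<Sum>p\<in>I. int (card (?K p)))" by simp
  have fst_inj: "inj_on fst (?K p)" and snd_inj: "inj_on snd (?K p)" for p
    by (auto simp: S_def offdiag_def inj_on_def intro: inj')
  have fst_im: "fst ` ?K p \<subseteq> {x. x < d \<and> c x = fst p}"
    and snd_im: "snd ` ?K p \<subseteq> {x. x < d \<and> c x = snd p}" for p
    by (auto simp: S_def offdiag_def)
  have le: "int (card (?K p)) \<le> ?m p" for p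
  proof -
    have "card (?K p) \<le> rsize d c (fst p)" "card (?K p) \<le> rsize d c (snd p)"
      unfolding rsize_def
      by (rule card_inj_on_le[OF fst_inj fst_im] card_inj_on_le[OF snd_inj snd_im]; simp)+
    then show ?thesis by simp
  qed
  have B: "?B = (\<Sum>p\<in>I. ?m p)" by (simp add: case_prod_unfold)
  show "int (card S) \<le> ?B" unfolding B card_S by (rule sum_mono) (rule le)
  assume "int (card S) = ?B"
  then have e: "(\<Sum>p\<in>I. int (card (?K p))) = (\<Sum>p\<in>I. ?m p)" unfolding B card_S .
  have eq: "int (card (?K p)) = ?m p" if "p \<in> I" for p
    by (rule sum_mono_inv[where f = "\<lambda>p. int (card (?K p))" and g = ?m, OF e le that finI])
  show "nested d r c"
    unfolding nested_def
  proof (intro allI impI ballI)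
    fix x j assume x: "x < d" and j: "j \<in> c ` {..<d}" and le: "rsize d c (c x) \<le> rsize d c j"
    show "\<exists>y<d. c y = j \<and> r y = r x"
    proof (cases "c x = j")
      case False
      then have p: "(c x, j) \<in> I" using x j by (auto simp: I_def)
      have "card (fst ` ?K (c x, j)) = rsize d c (c x)"
        using eq[OF p] le card_image[OF fst_inj, of "(c x, j)"] by simp
      then have "fst ` ?K (c x, j) = {y. y < d \<and> c y = c x}"
        by (intro card_subset_eq) (use fst_im[of "(c x, j)"] in \<open>auto simp: rsize_def\<close>)
      then have "x \<in> fst ` ?K (c x, j)" using x by simp
      then show ?thesis by (force simp: S_def offdiag_def)
    qed (use x in auto)
  qed
qed

lemma sorted_relabel:
  fixes d :: nat and c :: "nat \<Rightarrow> nat"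
  shows "\<exists>c' (m :: nat) f. (\<forall>x<d. c' x < m \<and> f (c' x) = c x) \<and> inj_on f {..<m} \<and>
    (\<forall>i<m. f i \<in> c ` {..<d}) \<and> (\<forall>i j. i \<le> j \<longrightarrow> j < m \<longrightarrow> rsize d c (f j) \<le> rsize d c (f i))"
proof -
  define ys where "ys = sort_key (rsize d c) (sorted_list_of_set (c ` {..<d}))"
  \<comment> \<open>\<open>sort_key\<close> is increasing, whereas the longest lines shall get the
    smallest numbers.\<close>
  define f where "f i = rev ys ! i" for i
  let ?m = "length ys"
  have dist: "distinct ys" and set: "set ys = c ` {..<d}" by (simp_all add: ys_def)
  have bij: "bij_betw f {..<?m} (c ` {..<d})"
    unfolding f_def by (rule bij_betw_nth) (simp_all add: dist set)
  show ?thesis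
  proof (rule exI[of _ "\<lambda>x. inv_into {..<?m} f (c x)"], rule exI[of _ ?m], rule exI[of _ f],
      intro conjI allI impI)
    show "inv_into {..<?m} f (c x) < ?m" "f (inv_into {..<?m} f (c x)) = c x" if "x < d" for x
      using inv_into_into[of "c x" f "{..<?m}"] f_inv_into_f[of "c x" f "{..<?m}"] bij that
      by (auto simp: bij_betw_def)
    show "inj_on f {..<?m}" using bij by (rule bij_betw_imp_inj_on)
    show "f i \<in> c ` {..<d}" if "i < ?m" for i using bij that by (auto simp: bij_betw_def)
    show "rsize d c (f j) \<le> rsize d c (f i)" if "i \<le> j" "j < ?m" for i j
    proof -
      have "sorted (map (rsize d c) ys)" by (simp add: ys_def)
      then have "map (rsize d c) ys ! (?m - Suc j) \<le> map (rsize d c) ys ! (?m - Suc i)"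
        by (rule sorted_nth_mono) (use that in auto)
      then show ?thesis using that by (simp add: f_def rev_nth)
    qed
  qed
qed

lemma stabf_cong:
  assumes "\<And>x y. x < d \<Longrightarrow> y < d \<Longrightarrow> r x = r y \<longleftrightarrow> r' x = r' y"
  shows "stabf d r = stabf d r'"
  using assms by (auto simp: stabf_def Sy_less)

text \<open>Rows and columns are numbered by decreasing length. Smaller numbers then belong to lines
  at least as long, and nestedness becomes closure under moving left and up; stabilizers do not see
  the numbering.\<close>

lemma nested_relabel:
  assumes inj: "inj_on (\<lambda>x. (r x, c x)) {..<d}" and n: "nested d r c" "nested d c r"
  obtains r' c' where "young d r' c'" "stabf d r' = stabf d r" "stabf d c' = stabf d c"
proof -
  obtain c' and m :: nat and f where c'A: "\<forall>x<d. c' x < m \<and> f (c' x) = c x" and f: "inj_on f {..<m}"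
    "\<forall>i<m. f i \<in> c ` {..<d}" "\<forall>i j. i \<le> j \<longrightarrow> j < m \<longrightarrow> rsize d c (f j) \<le> rsize d c (f i)"
    using sorted_relabel[of d c] by blast
  obtain r' and k :: nat and g where r'A: "\<forall>x<d. r' x < k \<and> g (r' x) = r x" and g: "inj_on g {..<k}"
    "\<forall>i<k. g i \<in> r ` {..<d}" "\<forall>i j. i \<le> j \<longrightarrow> j < k \<longrightarrow> rsize d r (g j) \<le> rsize d r (g i)"
    using sorted_relabel[of d r] by blast
  note c' = c'A[rule_format] and r' = r'A[rule_format]
  note f = f(1) f(2,3)[rule_format] and g = g(1) g(2,3)[rule_format]
  have ce: "c' x = c' y \<longleftrightarrow> c x = c y" if "x < d" "y < d" for x y
    using c'[OF that(1)] c'[OF that(2)] f(1) by (metis inj_on_def lessThan_iff)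
  have re: "r' x = r' y \<longleftrightarrow> r x = r y" if "x < d" "y < d" for x y
    using r'[OF that(1)] r'[OF that(2)] g(1) by (metis inj_on_def lessThan_iff)
  have "young d r' c'"
    unfolding young_def
  proof (intro conjI allI impI)
    show "inj_on (\<lambda>x. (r' x, c' x)) {..<d}" using inj by (simp add: inj_on_def ce re)
  next
    fix x j assume x: "x < d" and j: "j < c' x"
    have jm: "j < m" using c'[OF x] j by simp
    have "rsize d c (c x) \<le> rsize d c (f j)" using f(3)[of j "c' x"] c'[OF x] j by simp
    then obtain y where y: "y < d" "c y = f j" "r y = r x"
      using n(1) x f(2)[OF jm] unfolding nested_def by blast
    have "c' y = j" using c'[OF y(1)] y(2) f(1) jm by (metis inj_on_def lessThan_iff)
    then show "\<exists>y<d. r' y = r' x \<and> c' y = j" using y x re by blast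
  next
    fix x i assume x: "x < d" and i: "i < r' x"
    have ik: "i < k" using r'[OF x] i by simp
    have "rsize d r (r x) \<le> rsize d r (g i)" using g(3)[of i "r' x"] r'[OF x] i by simp
    then obtain y where y: "y < d" "r y = g i" "c y = c x"
      using n(2) x g(2)[OF ik] unfolding nested_def by blast
    have "r' y = i" using r'[OF y(1)] y(2) g(1) ik by (metis inj_on_def lessThan_iff)
    then show "\<exists>y<d. c' y = c' x \<and> r' y = i" using y x ce by blast
  qed
  moreover have "stabf d r' = stabf d r" "stabf d c' = stabf d c"
    by (intro stabf_cong; simp add: ce re)+
  ultimately show thesis by (rule that)
qed

lemma rsum_stabf_cong: "stabf d r = stabf d r' \<Longrightarrow> rsum d r = rsum d r'"
  and csum_stabf_cong: "stabf d r = stabf d r' \<Longrightarrow> csum d r = csum d r'"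
  by (simp_all add: rsum_def csum_def)

lemma content2_perm:
  assumes g: "g \<in> Sy d"
  shows "content2 d (c \<circ> inv (sfun g)) = content2 d c"
proof -
  let ?c = "c \<circ> inv (sfun g)"
  have "bij_betw (inv (sfun g)) {..<d} {..<d}" using Sy_bij[of "- g" d] g by simp
  then have im: "?c ` {..<d} = c ` {..<d}" by (simp only: image_comp[symmetric] bij_betw_def)
  have bij: "bij_betw (sfun g) {x. x < d \<and> c x = i} {x. x < d \<and> ?c x = i}" for i
    by (rule bij_betwI[where g = "inv (sfun g)"]) (use g in \<open>auto simp: Sy_less Sy_inv_less\<close>)
  have s: "rsize d ?c i = rsize d c i" for i
    unfolding rsize_def using bij[of i] by (rule bij_betw_same_card[symmetric])
  have "bij_betw (\<lambda>(x, y). (sfun g x, sfun g y)) {(x, y) \<in> offdiag d. c x = c y} {(x, y) \<in> offdiag d. ?c x = ?c y}"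
    by (rule bij_betwI[where g = "\<lambda>(x, y). (inv (sfun g) x, inv (sfun g) y)"])
      (use g in \<open>auto simp: offdiag_def Sy_less Sy_inv_less, metis sfun_inv_simps(2)\<close>)
  then have "card {(x, y) \<in> offdiag d. ?c x = ?c y} = card {(x, y) \<in> offdiag d. c x = c y}"
    by (rule bij_betw_same_card[symmetric])
  then show ?thesis unfolding content2_def im s by simp
qed

text \<open>By \<open>same_row_pairs\<close>, for rows and for columns, the two contents have sum at
  most 0, and sum 0 forces equality in both estimates.\<close>

lemma content2_opposite_young:
  assumes inj: "inj_on (\<lambda>x. (r x, c x)) {..<d}" and z: "content2 d r + content2 d c = 0"
  obtains r' c' where "young d r' c'" "stabf d r' = stabf d r" "stabf d c' = stabf d c"
proof -
  have inj': "inj_on (\<lambda>x. (c x, r x)) {..<d}" using inj by (auto simp: inj_on_def)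
  note 1 = same_row_pairs[OF inj] and 2 = same_row_pairs[OF inj']
  have "nested d r c" "nested d c r"
    using 1 2 z unfolding content2_def by linarith+
  then show thesis using nested_relabel[OF inj] that by blast
qed

text \<open>The count is bounded by \<open>d * d\<close>. The discrete labelling is the starting
  point because its row sum is 1, which lies outside of the ideals considered.\<close>

lemma max_row_pairs:
  assumes "P (\<lambda>x::nat. x)"
  shows "\<exists>r. P r \<and> (\<forall>r'. row_pairs d r < row_pairs d r' \<longrightarrow> \<not> P r')"
proof -
  have "\<exists>r. P r \<and> (\<forall>r'. P r' \<longrightarrow> row_pairs d r' \<le> row_pairs d r)"
    by (rule ex_has_greatest_nat[of P "\<lambda>x. x" _ "Suc (d * d)"])
      (use assms row_pairs_le[of d] in \<open>auto simp: less_Suc_eq_le\<close>)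
  then show ?thesis by (auto simp: not_less[symmetric])
qed

lemma rsum_discrete: "rsum d (\<lambda>x. x) = 1"
proof -
  have "stabf d (\<lambda>x. x) = {0}"
    by (auto simp: stabf_def intro: Sy_ext)
  then show ?thesis by (simp add: rsum_def)
qed

text \<open>If no Young symmetrizer could be avoided, take a column function \<open>c\<close> with
  \<^term>\<open>csum d c\<close> outside of the ideal and columns as long as possible, and then a row function
  \<open>r\<close> with \<^term>\<open>rsum d r\<close> acting nontrivially on \<^term>\<open>csum d c\<close> and rows as long as possible.
  The sum of all transpositions acts on both by a content, so the two contents
  are opposite. Since some \<^term>\<open>rsum d r * sing g 1 * csum d c\<close> is nonzero,
  rows and columns meet in at most one entry, and then opposite contents force a Young diagram.\<close>

lemma gideal_young_one:
  fixes J :: "(sym \<Rightarrow>\<^sub>0 'k::field_char_0) set"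
  assumes J: "gideal d J" and Y: "\<And>r c. young d r c \<Longrightarrow> ysym d r c \<in> J"
  shows "1 \<in> J"
proof (rule ccontr)
  assume 1: "1 \<notin> J"
  have "csum d (\<lambda>x. x) = (1 :: sym \<Rightarrow>\<^sub>0 'k)" by (metis rsum_discrete twist_1 twist_rsum)
  then have "\<exists>c. csum d c \<notin> J \<and> (\<forall>c'. row_pairs d c < row_pairs d c' \<longrightarrow> \<not> csum d c' \<notin> J)"
    by (intro max_row_pairs) (use 1 in simp)
  then obtain c where c: "csum d c \<notin> J" and cmax: "\<And>c'. row_pairs d c < row_pairs d c' \<Longrightarrow> csum d c' \<in> J"
    by blast
  let ?b = "csum d c :: sym \<Rightarrow>\<^sub>0 'k" and ?T = "transp_sum d :: sym \<Rightarrow>\<^sub>0 'k"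
  \<comment> \<open>The congruence for rows is applied in the twisted ideal. As \<open>twist\<close>
    negates the sum of transpositions, columns see the opposite content.\<close>
  have "twist (?T * rsum d c - pscale (of_int (content2 d c)) (rsum d c)) \<in> J"
    using transp_sum_rsum[OF gideal_twist[OF J], of c] cmax by simp
  then have "pscale (-1) (twist (?T * rsum d c - pscale (of_int (content2 d c)) (rsum d c))) \<in> J"
    by (rule gideal_pscale[OF J])
  then have Tb: "?T * ?b + pscale (of_int (content2 d c)) ?b \<in> J"
    by (simp add: twist_mult twist_transp_sum pscale_mult_left add.commute)
  \<comment> \<open>The factor y in the middle makes this a two-sided ideal: its elements annihilate
    all translates of \<open>?b\<close> modulo J.\<close>
  define J' where "J' = {x. \<forall>y\<in>galg d. x * y * ?b \<in> J}"
  have J': "gideal d J'"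
    unfolding gideal_def
  proof (intro conjI ballI)
    show "0 \<in> J'" using gideal_0[OF J] by (simp add: J'_def)
    fix x assume x: "x \<in> J'"
    show "x + z \<in> J'" if "z \<in> J'" for z
      using x that gideal_add[OF J] by (simp add: J'_def ring_distribs)
    show "x * z \<in> J'" if "z \<in> galg d" for z
      using x that by (simp add: J'_def mult.assoc[of x] galg_mult)
    show "z * x \<in> J'" if "z \<in> galg d" for z
      using x that gideal_mult_left[OF J] by (simp add: J'_def mult.assoc)
  qed
  have "1 \<notin> J'"
  proof
    assume "1 \<in> J'"
    then have "1 * 1 * ?b \<in> J" unfolding J'_def by (blast intro: galg_1)
    then show False using c by simp
  qed
  then have "\<exists>r. rsum d r \<notin> J' \<and> (\<forall>r'. row_pairs d r < row_pairs d r' \<longrightarrow> \<not> rsum d r' \<notin> J')"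
    by (intro max_row_pairs) (simp add: rsum_discrete)
  then obtain r where r: "rsum d r \<notin> J'" and rmax: "\<And>r'. row_pairs d r < row_pairs d r' \<Longrightarrow> rsum d r' \<in> J'"
    by blast
  let ?a = "rsum d r :: sym \<Rightarrow>\<^sub>0 'k"
  \<comment> \<open>Centrality moves \<open>?T\<close> past y to \<open>?b\<close>, on which it acts
    by minus the content of c modulo J.\<close>
  have "?T + sing 0 (of_int (content2 d c)) \<in> J'"
    unfolding J'_def
  proof (intro CollectI ballI)
    fix y :: "sym \<Rightarrow>\<^sub>0 'k" assume y: "y \<in> galg d"
    have "(?T + sing 0 (of_int (content2 d c))) * y * ?b = y * (?T * ?b + pscale (of_int (content2 d c)) ?b)"
      using transp_sum_central[OF y]
      by (simp add: ring_distribs mult_pscale_right pscale_mult_left del: single_of_int flip: pscale_eq mult.assoc)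
    then show "(?T + sing 0 (of_int (content2 d c))) * y * ?b \<in> J"
      using gideal_mult_left[OF J Tb y] by simp
  qed
  then have "(?T + sing 0 (of_int (content2 d c))) * ?a \<in> J'"
    by (rule gideal_mult_right[OF J']) simp
  moreover have "?T * ?a - pscale (of_int (content2 d r)) ?a \<in> J'"
    by (rule transp_sum_rsum[OF J' rmax])
  ultimately have "(?T + sing 0 (of_int (content2 d c))) * ?a - (?T * ?a - pscale (of_int (content2 d r)) ?a) \<in> J'"
    by (rule gideal_diff[OF J'])
  then have z: "pscale (of_int (content2 d r + content2 d c)) ?a \<in> J'"
    by (simp add: ring_distribs pvs.scale_left_distrib add.commute del: single_of_int flip: pscale_eq)
  \<comment> \<open>A nonzero scalar could be divided out, which would put \<open>?a\<close> into
    \<open>J'\<close>.\<close>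
  have z0: "content2 d r + content2 d c = 0"
  proof (rule ccontr)
    let ?n = "of_int (content2 d r + content2 d c) :: 'k"
    assume "content2 d r + content2 d c \<noteq> 0"
    then have "?n \<noteq> 0" by (simp only: of_int_eq_0_iff not_False_eq_True)
    then have "pscale (inverse ?n) (pscale ?n ?a) = ?a" by (simp del: of_int_add)
    then show False using gideal_pscale[OF J' z, of "inverse ?n"] r by simp
  qed
  obtain y where y: "y \<in> galg d" "?a * y * ?b \<notin> J" using r unfolding J'_def by blast
  have "\<exists>g\<in>Sy d. ?a * sing g 1 * ?b \<notin> J"
  proof (rule ccontr)
    assume "\<not> ?thesis"
    then have "(\<Sum>g\<in>Sy d. pscale (lk y g) (?a * sing g 1 * ?b)) \<in> J"
      by (intro gideal_sum[OF J] gideal_pscale[OF J]) auto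
    moreover have "(\<Sum>g\<in>Sy d. pscale (lk y g) (?a * sing g 1 * ?b)) = ?a * y * ?b"
      by (subst (2) galg_expand[OF y(1)])
        (simp add: sum_distrib_left sum_distrib_right pscale_simps del: pscale_single)
    ultimately show False using y(2) by simp
  qed
  then obtain g where g: "g \<in> Sy d" "?a * sing g 1 * ?b \<notin> J" by blast
  let ?c = "c \<circ> inv (sfun g)"
  have e: "?a * sing g 1 * ?b = ?a * csum d ?c * sing g 1"
    by (simp only: mult.assoc single_csum_move[OF g(1)])
  have ab: "?a * csum d ?c \<notin> J"
    using g gideal_mult_right[OF J, of "?a * csum d ?c" "sing g 1"] unfolding e by auto
  then have "?a * csum d ?c \<noteq> 0" using gideal_0[OF J] by metis
  then have inj: "inj_on (\<lambda>x. (r x, ?c x)) {..<d}"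
    unfolding inj_on_def using rsum_csum_zero[of _ d _ r ?c] by (metis lessThan_iff prod.inject)
  have "content2 d r + content2 d ?c = 0" using z0 by (simp only: content2_perm[OF g(1)])
  then obtain r' c' where "young d r' c'" "stabf d r' = stabf d r" "stabf d c' = stabf d ?c"
    using content2_opposite_young[OF inj] by blast
  then have "?a * csum d ?c \<in> J"
    using Y[of r' c'] unfolding ysym_def by (metis rsum_stabf_cong csum_stabf_cong)
  with ab show False by simp
qed

subsection \<open>Tableaux of partitions\<close>

lemma sum_list_take_mono: "i \<le> j \<Longrightarrow> sum_list (take i la) \<le> sum_list (take j (la :: nat list))"
  by (metis le_add1 le_add_diff_inverse sum_list_append take_add)

lemma sum_list_take_Suc: "i < length la \<Longrightarrow> sum_list (take (Suc i) la) = sum_list (take i la) + (la ! i :: nat)"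
  by (simp add: take_Suc_conv_app_nth)

lemma tab_cell:
  assumes "i < length la" "j < la ! i"
  shows "tab_row la (sum_list (take i la) + j) = i" "tab_col la (sum_list (take i la) + j) = j"
    "sum_list (take i la) + j < sum_list la"
proof -
  let ?x = "sum_list (take i la) + j"
  show r: "tab_row la ?x = i"
    unfolding tab_row_def
  proof (rule Least_equality)
    show "?x < sum_list (take (Suc i) la)" using assms by (simp add: sum_list_take_Suc)
    fix k assume "?x < sum_list (take (Suc k) la)"
    then have "\<not> Suc k \<le> i" using sum_list_take_mono[of "Suc k" i la] by linarith
    then show "i \<le> k" by simp
  qed
  show "tab_col la ?x = j" by (simp add: tab_col_def r)
  show "?x < sum_list la"
    using assms sum_list_take_mono[of "Suc i" "length la" la] by (simp add: sum_list_take_Suc)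
qed

lemma tab_of_entry:
  assumes "x < sum_list la"
  shows "tab_row la x < length la" "tab_col la x < la ! tab_row la x"
    "x = sum_list (take (tab_row la x) la) + tab_col la x"
proof -
  let ?P = "\<lambda>r. x < sum_list (take (Suc r) la)"
  have ne: "la \<noteq> []" using assms by auto
  then have P: "?P (length la - 1)" using assms by simp
  have 1: "?P (tab_row la x)" unfolding tab_row_def by (rule LeastI[of ?P, OF P])
  have "tab_row la x \<le> length la - 1" unfolding tab_row_def by (rule Least_le[of ?P, OF P])
  then show l: "tab_row la x < length la" using ne by (cases la) auto
  have 2: "sum_list (take (tab_row la x) la) \<le> x"
  proof (cases "tab_row la x")
    case (Suc k)
    then have "\<not> ?P k" unfolding tab_row_def using not_less_Least[of k ?P] by simp
    then show ?thesis by (simp add: Suc)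
  qed simp
  then show "x = sum_list (take (tab_row la x) la) + tab_col la x" by (simp add: tab_col_def)
  show "tab_col la x < la ! tab_row la x"
    using 1 2 by (simp add: tab_col_def sum_list_take_Suc[OF l])
qed

lemma inj_tab: "inj_on (\<lambda>x. (tab_row la x, tab_col la x)) {..<sum_list la}"
  by (rule inj_onI) (metis lessThan_iff prod.inject tab_of_entry(3))

lemma tab_cells:
  "(\<lambda>x. (tab_row la x, tab_col la x)) ` {..<sum_list la} = {(i, j). i < length la \<and> j < la ! i}"
proof (intro equalityI subsetI)
  fix p assume "p \<in> {(i, j). i < length la \<and> j < la ! i}"
  then obtain i j where p: "p = (i, j)" "i < length la" "j < la ! i" by auto
  show "p \<in> (\<lambda>x. (tab_row la x, tab_col la x)) ` {..<sum_list la}"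
    by (rule image_eqI[of _ _ "sum_list (take i la) + j"]) (simp_all add: p tab_cell)
qed (auto intro: tab_of_entry)

lemma partition_nth_mono: "partition_of la \<Longrightarrow> i \<le> j \<Longrightarrow> j < length la \<Longrightarrow> la ! j \<le> la ! i"
  unfolding partition_of_def by (cases "i = j") (auto simp: sorted_wrt_iff_nth_less)

lemma young_tab:
  assumes "partition_of la"
  shows "young (sum_list la) (tab_row la) (tab_col la)"
  unfolding young_def
proof (intro conjI allI impI)
  fix x j assume x: "x < sum_list la" "j < tab_col la x"
  let ?i = "tab_row la x"
  have "?i < length la" "j < la ! ?i" using tab_of_entry[OF x(1)] x(2) by auto
  then show "\<exists>y<sum_list la. tab_row la y = ?i \<and> tab_col la y = j" using tab_cell[of ?i la j] by metis
next
  fix x i assume x: "x < sum_list la" "i < tab_row la x"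
  let ?j = "tab_col la x"
  have "i < length la" "?j < la ! i"
    using tab_of_entry[OF x(1)] x(2) partition_nth_mono[OF assms, of i "tab_row la x"] by auto
  then show "\<exists>y<sum_list la. tab_col la y = ?j \<and> tab_row la y = i" using tab_cell[of i la ?j] by metis
qed (rule inj_tab)

lemma down_closed_lessThan:
  fixes D :: "nat set"
  assumes "finite D" "\<And>x y. x \<in> D \<Longrightarrow> y < x \<Longrightarrow> y \<in> D"
  shows "D = {..<card D}"
proof -
  have "D = {..Max D}" if "D \<noteq> {}"
  proof (rule set_eqI)
    fix x
    show "x \<in> D \<longleftrightarrow> x \<in> {..Max D}"
      using that assms(1) Max_in[of D] Max_ge[of D x] assms(2)[of "Max D" x] by (cases "x = Max D") auto
  qed
  then show ?thesis
    by (cases "D = {}") (simp, metis card_atMost lessThan_Suc_atMost)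
qed

text \<open>The parts are the row lengths. Closure to the left makes every row an initial segment of
  columns, and closure upwards makes the lengths decrease.\<close>

lemma young_partition:
  assumes Y: "young d r c"
  obtains la where "partition_of la" "sum_list la = d"
    "(\<lambda>x. (r x, c x)) ` {..<d} = {(i, j). i < length la \<and> j < la ! i}"
proof -
  define m where "m = card (r ` {..<d})"
  define la where "la = map (rsize d r) [0..<m]"
  have rows: "r ` {..<d} = {..<m}"
    unfolding m_def by (rule down_closed_lessThan) (use Y in \<open>auto simp: young_def image_iff, metis lessThan_iff\<close>)
  have row: "c ` {x. x < d \<and> r x = i} = {..<rsize d r i}" for i
  proof -
    have "inj_on c {x. x < d \<and> r x = i}" using Y by (auto simp: young_def inj_on_def)
    moreover have "c ` {x. x < d \<and> r x = i} = {..<card (c ` {x. x < d \<and> r x = i})}"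
    proof (rule down_closed_lessThan)
      fix j k assume "j \<in> c ` {x. x < d \<and> r x = i}" and k: "k < j"
      then obtain x where x: "x < d" "r x = i" "j = c x" by auto
      then obtain y where "y < d" "r y = i" "c y = k" using Y k unfolding young_def by blast
      then show "k \<in> c ` {x. x < d \<and> r x = i}" by (intro image_eqI[of _ _ y]) auto
    qed simp
    ultimately show ?thesis by (simp add: card_image rsize_def)
  qed
  show thesis
  proof (rule that[of la])
    have "rsize d r j \<le> rsize d r i" if "i \<le> j" for i j
    proof -
      have "c ` {x. x < d \<and> r x = j} \<subseteq> c ` {x. x < d \<and> r x = i}"
      proof clarify
        fix x assume x: "x < d" "j = r x"
        obtain y where "y < d" "c y = c x" "r y = i"
        proof (cases "i = r x")
          case False
          then have "i < r x" using \<open>i \<le> j\<close> x by simp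
          then show thesis using Y x that unfolding young_def by blast
        qed (use x that in auto)
        then show "c x \<in> c ` {x. x < d \<and> r x = i}" by (intro image_eqI[of _ _ y]) auto
      qed
      then show ?thesis unfolding row by simp
    qed
    moreover have "0 < rsize d r i" if "i < m" for i
    proof -
      have "i \<in> r ` {..<d}" using that rows by simp
      then show ?thesis unfolding rsize_def by (auto simp: card_gt_0_iff)
    qed
    ultimately show "partition_of la"
      by (auto simp: partition_of_def la_def sorted_wrt_map sorted_wrt_iff_nth_less)
    show "sum_list la = d"
      using card_rows[of d "\<lambda>_. True" r] unfolding rows la_def
      by (simp add: interv_sum_list_conv_sum_set_nat rsize_def atLeast0LessThan)
    have cells: "(i, j) \<in> (\<lambda>x. (r x, c x)) ` {..<d} \<longleftrightarrow> i < m \<and> j < rsize d r i" for i j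
    proof -
      have "(i, j) \<in> (\<lambda>x. (r x, c x)) ` {..<d} \<longleftrightarrow> j \<in> c ` {x. x < d \<and> r x = i}" by auto
      moreover have "j < rsize d r i \<Longrightarrow> i \<in> r ` {..<d}" using row[of i] by auto
      ultimately show ?thesis unfolding row rows by auto
    qed
    have "{(i, j). i < length la \<and> j < la ! i} = {(i, j). i < m \<and> j < rsize d r i}"
      by (auto simp: la_def)
    then show "(\<lambda>x. (r x, c x)) ` {..<d} = {(i, j). i < length la \<and> j < la ! i}"
      using cells by (intro set_eqI) (metis (no_types, lifting) case_prodI2 case_prodE mem_Collect_eq)
  qed
qed

definition yla :: "nat list \<Rightarrow> sym \<Rightarrow>\<^sub>0 'k::field" where
  "yla la = ysym (sum_list la) (tab_row la) (tab_col la)"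

lemma yla_galg [simp]: "yla la \<in> galg (sum_list la)"
  by (simp add: yla_def)

lemma ysym_conj:
  assumes g: "g \<in> Sy d"
  shows "ysym d (r \<circ> inv (sfun g)) (c \<circ> inv (sfun g)) = sing g 1 * ysym d r c * sing (- g) 1"
  unfolding ysym_def rsum_conj[OF g, symmetric] csum_conj[OF g, symmetric]
  by (simp add: mult_single flip: mult.assoc) (simp add: mult_single mult.assoc)

text \<open>A filling of a diagram in arbitrary order differs from the consecutive one by a
  permutation, so its Young symmetrizer is conjugate to the standard one and lies in the same
  ideals.\<close>

lemma gideal_partition_one:
  fixes J :: "(sym \<Rightarrow>\<^sub>0 'k::field_char_0) set"
  assumes J: "gideal d J" and Y: "\<And>la. partition_of la \<Longrightarrow> sum_list la = d \<Longrightarrow> yla la \<in> J"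
  shows "1 \<in> J"
proof (rule gideal_young_one[OF J])
  fix r c assume y: "young d r c"
  from young_partition[OF y] obtain la where la: "partition_of la" "sum_list la = d"
    and im: "(\<lambda>x. (r x, c x)) ` {..<d} = {(i, j). i < length la \<and> j < la ! i}" by blast
  have "inj_on (\<lambda>x. (r x, c x)) {..<d}" using y by (simp add: young_def)
  then obtain h where h: "h \<in> Sy d" "\<And>x. x < d \<Longrightarrow> (tab_row la (sfun h x), tab_col la (sfun h x)) = (r x, c x)"
    using match_perm[of "\<lambda>x. (tab_row la x, tab_col la x)" d "\<lambda>x. (r x, c x)"] inj_tab[of la]
      tab_cells[of la] im la(2) by auto
  have "ysym d (tab_row la \<circ> inv (sfun (- h))) (tab_col la \<circ> inv (sfun (- h)))
      = sing (- h) 1 * (yla la :: sym \<Rightarrow>\<^sub>0 'k) * sing h 1"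
    using ysym_conj[of "- h" d "tab_row la" "tab_col la"] h(1) la(2) by (simp add: yla_def del: sfun_uminus)
  also have "ysym d (tab_row la \<circ> inv (sfun (- h))) (tab_col la \<circ> inv (sfun (- h))) = (ysym d r c :: sym \<Rightarrow>\<^sub>0 'k)"
    unfolding ysym_def
    by (intro arg_cong2[where f = times] rsum_stabf_cong csum_stabf_cong stabf_cong)
      (use h(2) in \<open>simp_all add: bij_imp_bij_inv permutation_bijective inv_inv_eq\<close>)
  finally show "ysym d r c \<in> J"
    using Y[OF la] h(1) by (simp add: gideal_mult_left[OF J] gideal_mult_right[OF J])
qed

text \<open>Consecutive differences of the counts are the column lengths, and these determine the
  partition; since all parts are positive, the first column is as long as the list.\<close>

lemma partition_eqI:
  assumes la: "partition_of la" "sum_list la = d" and mu: "partition_of mu" "sum_list mu = d"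
    and eq: "\<And>m. card {x. x < d \<and> tab_col la x < m} = card {x. x < d \<and> tab_col mu x < m}"
  shows "la = mu"
proof -
  have col: "{i. i < length la \<and> m < la ! i} = {..<card {x. x < d \<and> tab_col la x = m}}"
    if la: "partition_of la" "sum_list la = d" for la m
  proof -
    have inj: "inj_on (tab_row la) {x. x < d \<and> tab_col la x = m}"
      using inj_tab[of la] la by (auto simp: inj_on_def)
    have "tab_row la ` {x. x < d \<and> tab_col la x = m} = {i. i < length la \<and> m < la ! i}"
    proof (intro equalityI subsetI)
      fix i assume "i \<in> {i. i < length la \<and> m < la ! i}"
      then show "i \<in> tab_row la ` {x. x < d \<and> tab_col la x = m}"
        using tab_cell[of i la m] la(2) by (intro image_eqI[of _ _ "sum_list (take i la) + m"]) simp_all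
    qed (use tab_of_entry(1,2)[of _ la] la(2) in auto)
    then have "card {x. x < d \<and> tab_col la x = m} = card {i. i < length la \<and> m < la ! i}"
      using card_image[OF inj] by simp
    moreover have "{i. i < length la \<and> m < la ! i} = {..<card {i. i < length la \<and> m < la ! i}}"
    proof (rule down_closed_lessThan)
      fix i k assume "i \<in> {i. i < length la \<and> m < la ! i}" "k < i"
      then show "k \<in> {i. i < length la \<and> m < la ! i}"
        using partition_nth_mono[OF la(1), of k i] by simp
    qed simp
    ultimately show ?thesis by simp
  qed
  have "card {x. x < d \<and> tab_col la x = m} = card {x. x < d \<and> tab_col mu x = m}" for m
  proof -
    have "card {x. x < d \<and> c x < Suc m} = card {x. x < d \<and> c x < m} + card {x. x < d \<and> c x = m}" for c
    proof -
      have "{x. x < d \<and> c x < Suc m} = {x. x < d \<and> c x < m} \<union> {x. x < d \<and> c x = m}" by auto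
      then show ?thesis by (simp add: card_Un_disjoint disjoint_iff)
    qed
    then show ?thesis using eq[of m] eq[of "Suc m"] by simp
  qed
  then have e: "{i. i < length la \<and> m < la ! i} = {i. i < length mu \<and> m < mu ! i}" for m
    by (simp only: col[OF la] col[OF mu])
  have len: "{i. i < length la \<and> 0 < la ! i} = {..<length la}" if "partition_of la" for la
    using that by (auto simp: partition_of_def)
  have l: "length la = length mu" using e[of 0] by (simp add: len la mu)
  show ?thesis
  proof (rule nth_equalityI[OF l])
    fix i assume i: "i < length la"
    have "m < la ! i \<longleftrightarrow> m < mu ! i" for m using e[of m] i l by auto
    then show "la ! i = mu ! i" by (metis linorder_neqE_nat less_irrefl)
  qed
qed

lemma yla_orthogonal:
  assumes "partition_of la" "partition_of mu" "sum_list la = sum_list mu" "la \<noteq> mu"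
    and x: "x \<in> galg (sum_list la)"
  shows "yla la * x * yla mu = (0 :: sym \<Rightarrow>\<^sub>0 'k::field_char_0)"
proof -
  have "\<exists>m. card {x. x < sum_list la \<and> tab_col la x < m} \<noteq> card {x. x < sum_list la \<and> tab_col mu x < m}"
    using partition_eqI[OF assms(1) refl assms(2) assms(3)[symmetric]] assms(4) by blast
  then obtain m where m: "card {x. x < sum_list la \<and> tab_col la x < m} \<noteq> card {x. x < sum_list la \<and> tab_col mu x < m}" ..
  have "young (sum_list la) (tab_row mu) (tab_col mu)" using young_tab[OF assms(2)] assms(3) by simp
  from ysym_orthogonal[OF young_tab[OF assms(1)] this x m] show ?thesis
    by (simp add: yla_def assms(3))
qed

section \<open>Mixed tensors in coordinates\<close>

definition plinear :: "(('a \<Rightarrow>\<^sub>0 'k::field) \<Rightarrow> ('b \<Rightarrow>\<^sub>0 'k)) \<Rightarrow> bool" where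
  "plinear F \<longleftrightarrow> (\<forall>x y. F (x + y) = F x + F y) \<and> (\<forall>c x. F (pscale c x) = pscale c (F x))"

lemma plinear_add: "plinear F \<Longrightarrow> F (x + y) = F x + F y"
  and plinear_pscale: "plinear F \<Longrightarrow> F (pscale c x) = pscale c (F x)"
  by (simp_all add: plinear_def)

lemma plinear_0: "plinear F \<Longrightarrow> F 0 = 0"
  using plinear_pscale[of F 0 0] by simp

lemma plinear_sum: "plinear F \<Longrightarrow> F (sum f A) = (\<Sum>a\<in>A. F (f a))"
  by (induction A rule: infinite_finite_induct) (simp_all add: plinear_0 plinear_add)

lemma plinear_uminus: "plinear F \<Longrightarrow> F (- x) = - F x"
  using plinear_pscale[of F "-1" x] by (simp add: pvs.scale_minus_left)

lemma plinear_diff: "plinear F \<Longrightarrow> F (x - y) = F x - F y"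
  using plinear_add[of F x "- y"] by (simp add: plinear_uminus)

lemma plinear_expand: "plinear F \<Longrightarrow> F t = (\<Sum>a\<in>pkeys t. pscale (lk t a) (F (sing a 1)))"
  by (subst poly_mapping_expand[of t]) (simp add: plinear_sum plinear_pscale del: pscale_single)

lemma plinear_eqI:
  assumes "plinear F" "plinear G" "\<And>a. a \<in> pkeys t \<Longrightarrow> F (sing a 1) = G (sing a 1)"
  shows "F t = G t"
  unfolding plinear_expand[OF assms(1), of t] plinear_expand[OF assms(2), of t]
  by (rule sum.cong) (simp_all add: assms(3))

lemma plinear_compose: "plinear F \<Longrightarrow> plinear G \<Longrightarrow> plinear (\<lambda>x. F (G x))"
  by (simp add: plinear_def)
lemma plinear_id: "plinear (\<lambda>x. x)"
  by (simp add: plinear_def)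
lemma plinear_fdiff: "plinear F \<Longrightarrow> plinear G \<Longrightarrow> plinear (\<lambda>x. F x - G x)"
  by (simp add: plinear_def pvs.scale_right_diff_distrib algebra_simps)
lemma plinear_fpscale: "plinear F \<Longrightarrow> plinear (\<lambda>x. pscale c (F x))"
  by (simp add: plinear_def pvs.scale_right_distrib mult.commute)
lemma plinear_fsum: "(\<And>i. i \<in> I \<Longrightarrow> plinear (F i)) \<Longrightarrow> plinear (\<lambda>x. \<Sum>i\<in>I. F i x)"
  by (auto simp: plinear_def pvs.scale_sum_right sum.distrib)

text \<open>The linear extension of f from the basis. Operators are given in this form so that
  identities between them reduce to basis elements by \<open>plinear_eqI\<close>.\<close>

definition lext :: "('a \<Rightarrow> ('b \<Rightarrow>\<^sub>0 'k::field)) \<Rightarrow> ('a \<Rightarrow>\<^sub>0 'k) \<Rightarrow> ('b \<Rightarrow>\<^sub>0 'k)" where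
  "lext f t = (\<Sum>a\<in>pkeys t. pscale (lk t a) (f a))"

lemma lext_superset: "finite A \<Longrightarrow> pkeys t \<subseteq> A \<Longrightarrow> lext f t = (\<Sum>a\<in>A. pscale (lk t a) (f a))"
  unfolding lext_def by (rule sum.mono_neutral_left) (auto simp: in_keys_iff)

lemma plinear_lext: "plinear (lext f)"
  unfolding plinear_def
proof (intro conjI allI)
  fix x y
  show "lext f (x + y) = lext f x + lext f y"
    using Poly_Mapping.keys_add[of x y]
    by (simp add: lext_superset[of "pkeys x \<union> pkeys y"] lookup_add pvs.scale_left_distrib sum.distrib)
next
  fix c x
  show "lext f (pscale c x) = pscale c (lext f x)"
    using keys_pscale[of c x] by (simp add: lext_superset[of "pkeys x"] pvs.scale_sum_right)
qed

lemma lext_single [simp]: "lext f (sing a c) = pscale c (f a)"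
  by (cases "c = 0") (simp_all add: lext_def)

lemma lookup_lext: "lk (lext f t) b = (\<Sum>a\<in>pkeys t. lk t a * lk (f a) b)"
  by (simp add: lext_def lookup_sum)

lemma lookup_expand: "lk (t :: 'a \<Rightarrow>\<^sub>0 'k::field) u = (\<Sum>k\<in>pkeys t. lk t k * (if k = u then 1 else 0))"
proof -
  have "(\<Sum>k\<in>pkeys t. lk t k * (if k = u then 1 else 0)) = (\<Sum>k\<in>pkeys t. if k = u then lk t k else 0)"
    by (rule sum.cong) auto
  then show ?thesis by (simp add: in_keys_iff)
qed

text \<open>The transpose of a matrix unit acting on a tensor power: the coefficient at a word
  collects the words that reach it by replacing one letter y by x, hence x is looked for and y is
  put in.\<close>

definition lsub :: "int \<Rightarrow> int \<Rightarrow> (int list \<Rightarrow> 'k::comm_ring_1) \<Rightarrow> int list \<Rightarrow> 'k" where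
  "lsub x y f is = (\<Sum>a<length is. if is ! a = x then f (is[a := y]) else 0)"

text \<open>Replacements at two different positions commute and cancel in the commutator; two
  replacements at the same position give the right-hand side.\<close>

lemma lsub_commutator:
  "lsub x y (lsub z w f) is - lsub z w (lsub x y f) is
    = (if y = z then lsub x w f is else 0) - (if w = x then lsub z y f is else 0)"
proof -
  let ?n = "length is"
  let ?g = "\<lambda>a c. if is ! a = x \<and> is ! c = z then f (is[a := y, c := w]) else 0"
  have split: "(\<Sum>c<?n. h c) = h a + (\<Sum>c\<in>{..<?n} - {a}. h c)" if "a < ?n" for a and h :: "nat \<Rightarrow> 'a"
    by (rule sum.remove) (use that in auto)
  have A: "lsub x y (lsub z w f) is = (\<Sum>a<?n. if is ! a = x \<and> y = z then f (is[a := w]) else 0)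
      + (\<Sum>a<?n. \<Sum>c\<in>{..<?n} - {a}. if is ! a = x \<and> is ! c = z then f (is[a := y, c := w]) else 0)" for x y z w
    unfolding sum.distrib[symmetric] lsub_def[of x y]
  proof (rule sum.cong[OF refl])
    fix a assume a: "a \<in> {..<?n}"
    show "(if is ! a = x then lsub z w f (is[a := y]) else 0) =
        (if is ! a = x \<and> y = z then f (is[a := w]) else 0) +
        (\<Sum>c\<in>{..<?n} - {a}. if is ! a = x \<and> is ! c = z then f (is[a := y, c := w]) else 0)"
    proof (cases "is ! a = x")
      case True
      have "lsub z w f (is[a := y]) = (\<Sum>c<?n. if is[a := y] ! c = z then f (is[a := y, c := w]) else 0)"
        by (simp add: lsub_def)
      also have "\<dots> = (if y = z then f (is[a := w]) else 0)
          + (\<Sum>c\<in>{..<?n} - {a}. if is[a := y] ! c = z then f (is[a := y, c := w]) else 0)"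
        using a by (subst split[of a]) simp_all
      also have "(\<Sum>c\<in>{..<?n} - {a}. if is[a := y] ! c = z then f (is[a := y, c := w]) else 0)
          = (\<Sum>c\<in>{..<?n} - {a}. if is ! a = x \<and> is ! c = z then f (is[a := y, c := w]) else 0)"
        by (rule sum.cong) (use True in auto)
      finally show ?thesis using True by simp
    qed simp
  qed
  have S: "(\<Sum>a<?n. \<Sum>c\<in>{..<?n} - {a}. h a c) = (\<Sum>c<?n. \<Sum>a\<in>{..<?n} - {c}. h a c)" for h :: "nat \<Rightarrow> nat \<Rightarrow> 'a"
  proof -
    have 1: "(\<Sum>c\<in>{..<?n} - {a}. h a c) = (\<Sum>c<?n. h a c) - h a a"
      and 2: "(\<Sum>c\<in>{..<?n} - {a}. h c a) = (\<Sum>c<?n. h c a) - h a a" if "a \<in> {..<?n}" for a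
      using that split[of a "h a"] split[of a "\<lambda>c. h c a"] by simp_all
    have "(\<Sum>a<?n. \<Sum>c\<in>{..<?n} - {a}. h a c) = (\<Sum>a<?n. (\<Sum>c<?n. h a c) - h a a)"
      by (rule sum.cong[OF refl 1])
    also have "\<dots> = (\<Sum>c<?n. (\<Sum>a<?n. h a c) - h c c)"
      unfolding sum_subtractf by (subst sum.swap) simp
    also have "\<dots> = (\<Sum>c<?n. \<Sum>a\<in>{..<?n} - {c}. h a c)"
      by (rule sum.cong[OF refl 2[symmetric]])
    finally show ?thesis .
  qed
  have "(\<Sum>a<?n. \<Sum>c\<in>{..<?n} - {a}. if is ! a = x \<and> is ! c = z then f (is[a := y, c := w]) else 0)
      = (\<Sum>c<?n. \<Sum>a\<in>{..<?n} - {c}. if is ! c = z \<and> is ! a = x then f (is[c := w, a := y]) else 0)"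
    by (subst S) (intro sum.cong refl, auto simp: list_update_swap)
  then show ?thesis
    unfolding A[of x y z w] A[of z w x y] by (simp add: lsub_def)
qed

lemma lsub_diff: "lsub x y (\<lambda>u. f u - g u) is = lsub x y f is - lsub x y g is"
  by (simp add: lsub_def flip: sum_subtractf) (rule sum.cong; simp)

lemma lsub_swap: "lsub x y (\<lambda>u. lsub z w (f u) vs) us = lsub z w (\<lambda>v. lsub x y (\<lambda>u. f u v) us) vs"
proof -
  have "lsub x y (\<lambda>u. lsub z w (f u) vs) us =
     (\<Sum>a<length us. \<Sum>b<length vs. if us ! a = x \<and> vs ! b = z then f (us[a := y]) (vs[b := w]) else 0)"
    unfolding lsub_def by (intro sum.cong refl) (auto intro!: sum.cong)
  also have "\<dots> = lsub z w (\<lambda>v. lsub x y (\<lambda>u. f u v) us) vs"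
    unfolding lsub_def by (subst sum.swap, intro sum.cong refl) (auto intro!: sum.cong)
  finally show ?thesis .
qed

lemma permute_list_update:
  assumes "f permutes {..<length xs}" "a < length xs"
  shows "permute_list f (xs[f a := y]) = (permute_list f xs)[a := y]"
proof (rule nth_equalityI)
  fix i assume "i < length (permute_list f (xs[f a := y]))"
  then have i: "i < length xs" by simp
  have "f i < length xs" using permutes_in_image[OF assms(1), of i] i by simp
  moreover have "f i = f a \<longleftrightarrow> i = a" using permutes_inj[OF assms(1)] by (simp add: inj_eq)
  ultimately show "permute_list f (xs[f a := y]) ! i = (permute_list f xs)[a := y] ! i"
    using assms i by (cases "i = a") (simp_all add: permute_list_nth nth_list_update)
qed simp

lemma lsub_permute:
  assumes f: "f permutes {..<length is}"
  shows "lsub x y h (permute_list f is) = lsub x y (\<lambda>u. h (permute_list f u)) is"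
proof -
  have "lsub x y (\<lambda>u. h (permute_list f u)) is
      = (\<Sum>a<length is. if is ! (f a) = x then h (permute_list f (is[f a := y])) else 0)"
    unfolding lsub_def by (rule sum.permute[OF f, unfolded o_def])
  also have "\<dots> = lsub x y h (permute_list f is)"
    unfolding lsub_def length_permute_list
    by (rule sum.cong) (use f in \<open>auto simp: permute_list_nth permute_list_update\<close>)
  finally show ?thesis ..
qed

text \<open>The action of \<^term>\<open>elem P x y\<close> on words.\<close>

definition eword :: "int \<Rightarrow> int \<Rightarrow> int list \<times> int list \<Rightarrow> (int list \<times> int list) \<Rightarrow>\<^sub>0 'k::field" where
  "eword x y w = (\<Sum>a<length (fst w). if fst w ! a = y then sing ((fst w)[a := x], snd w) 1 else 0)
     - (\<Sum>b<length (snd w). if snd w ! b = x then sing (fst w, (snd w)[b := y]) 1 else 0)"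

definition ee :: "int \<Rightarrow> int \<Rightarrow> ((int list \<times> int list) \<Rightarrow>\<^sub>0 'k::field) \<Rightarrow> (int list \<times> int list) \<Rightarrow>\<^sub>0 'k" where
  "ee x y = lext (eword x y)"

lemma plinear_ee: "plinear (ee x y)"
  unfolding ee_def by (rule plinear_lext)

lemma ee_single [simp]: "ee x y (sing w 1) = eword x y w"
  by (simp add: ee_def)

lemma list_update_eq_iff:
  assumes "length us = length is" "a < length is"
  shows "us ! a = y \<and> us[a := x] = is \<longleftrightarrow> is ! a = x \<and> us = is[a := y]"
  using assms by (auto simp: list_update_same_conv)

lemma lookup_eword:
  "lk (eword x y w) (is, js) = lsub x y (\<lambda>u. if w = (u, js) then 1 else 0) is
     - lsub y x (\<lambda>v. if w = (is, v) then 1 else 0) js"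
proof -
  obtain us vs where w: "w = (us, vs)" by force
  have aux: "(\<Sum>a<length us. if us ! a = y \<and> us[a := x] = is \<and> Q then 1 else 0) =
      (\<Sum>a<length is. if is ! a = x \<and> us = is[a := y] \<and> Q then 1 else (0::'a))" for us "is" y x Q
  proof (cases "length us = length is")
    case True
    show ?thesis
      unfolding True by (rule sum.cong[OF refl]) (use list_update_eq_iff[OF True] in \<open>auto\<close>)
  next
    case False
    have "us[a := x] \<noteq> is" "us \<noteq> is[a := y]" for a using False by auto
    then show ?thesis by simp
  qed
  have 1: "lk (if us ! a = y then sing (us[a := x], vs) 1 else 0) (is, js) =
      (if us ! a = y \<and> us[a := x] = is \<and> vs = js then 1 else (0::'a))" for a
    by (auto simp: lookup_single when_def)
  have 2: "lk (if vs ! b = x then sing (us, vs[b := y]) 1 else 0) (is, js) =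
      (if vs ! b = x \<and> vs[b := y] = js \<and> us = is then 1 else (0::'a))" for b
    by (auto simp: lookup_single when_def)
  have 3: "lsub x y (\<lambda>u. if (us, vs) = (u, js) then 1 else 0) is =
      (\<Sum>a<length is. if is ! a = x \<and> us = is[a := y] \<and> vs = js then 1 else (0::'a))"
    unfolding lsub_def by (rule sum.cong) auto
  have 4: "lsub y x (\<lambda>v. if (us, vs) = (is, v) then 1 else 0) js =
      (\<Sum>a<length js. if js ! a = y \<and> vs = js[a := x] \<and> us = is then 1 else (0::'a))"
    unfolding lsub_def by (rule sum.cong) auto
  show ?thesis
    unfolding w 3 4 aux[symmetric] eword_def fst_conv snd_conv lookup_minus lookup_sum 1 2 ..
qed

lemma lsub_sum: "lsub x y (\<lambda>u. \<Sum>k\<in>K. h k u) is = (\<Sum>k\<in>K. lsub x y (h k) is)"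
proof -
  have "lsub x y (\<lambda>u. \<Sum>k\<in>K. h k u) is = (\<Sum>a<length is. \<Sum>k\<in>K. if is ! a = x then h k (is[a := y]) else 0)"
    unfolding lsub_def by (intro sum.cong refl) auto
  then show ?thesis unfolding lsub_def by (subst sum.swap)
qed

lemma lsub_scale: "lsub x y (\<lambda>u. c * h u) is = c * lsub x y h is"
  unfolding lsub_def sum_distrib_left by (rule sum.cong) auto

lemma lookup_ee:
  "lk (ee x y t) (is, js) = lsub x y (\<lambda>u. lk t (u, js)) is - lsub y x (\<lambda>v. lk t (is, v)) js"
proof -
  have "lk (ee x y t) (is, js) = (\<Sum>k\<in>pkeys t. lk t k * (lsub x y (\<lambda>u. if k = (u, js) then 1 else 0) is
     - lsub y x (\<lambda>v. if k = (is, v) then 1 else 0) js))"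
    unfolding ee_def lookup_lext lookup_eword ..
  also have "\<dots> = lsub x y (\<lambda>u. lk t (u, js)) is - lsub y x (\<lambda>v. lk t (is, v)) js"
    unfolding lookup_expand[of t "(_, js)"] lookup_expand[of t "(is, _)"] lsub_sum lsub_scale
      right_diff_distrib sum_subtractf ..
  finally show ?thesis .
qed

text \<open>The parts acting on V and on the dual factors commute with each other. Each satisfies
  \<open>lsub_commutator\<close>, the dual one with the two letters of each root vector
  exchanged.\<close>

lemma ee_commutator:
  "ee x y (ee z w t) - ee z w (ee x y t)
    = (if y = z then ee x w t else 0) - (if w = x then ee z y t else 0)"
proof (rule poly_mapping_eqI)
  fix k :: "int list \<times> int list"
  obtain "is" js where k: "k = (is, js)" by force
  let ?f = "\<lambda>u v. lk t (u, v)"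
  let ?V = "\<lambda>x y. lsub x y (\<lambda>u. ?f u js) is" and ?W = "\<lambda>x y. lsub x y (?f is) js"
  have e: "lk (ee x y (ee z w t)) k = lsub x y (lsub z w (\<lambda>u. ?f u js)) is
      - lsub x y (\<lambda>u. lsub w z (?f u) js) is - lsub y x (\<lambda>v. lsub z w (\<lambda>u. ?f u v) is) js
      + lsub y x (lsub w z (?f is)) js" for x y z w
    unfolding k lookup_ee lsub_diff by simp
  have "lk (ee x y (ee z w t) - ee z w (ee x y t)) k =
     (lsub x y (lsub z w (\<lambda>u. ?f u js)) is - lsub z w (lsub x y (\<lambda>u. ?f u js)) is)
     + (lsub y x (lsub w z (?f is)) js - lsub w z (lsub y x (?f is)) js)"
    unfolding lookup_minus e
      lsub_swap[of x y w z "\<lambda>u v. ?f u v" js "is"] lsub_swap[of z w y x "\<lambda>u v. ?f u v" js "is"]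
    by simp
  also have "\<dots> = lk ((if y = z then ee x w t else 0) - (if w = x then ee z y t else 0)) k"
    unfolding lsub_commutator k lookup_minus by (auto simp: lookup_ee)
  finally show "lk (ee x y (ee z w t) - ee z w (ee x y t)) k
      = lk ((if y = z then ee x w t else 0) - (if w = x then ee z y t else 0)) k" .
qed

lemma wordset_update: "is \<in> wordset p \<Longrightarrow> x \<noteq> 0 \<Longrightarrow> is[a := x] \<in> wordset p"
  using set_update_subset_insert[of "is" a x] by (auto simp: wordset_def)

lemma mixedD: "t \<in> mixed p q \<Longrightarrow> lk t (is, js) \<noteq> 0 \<Longrightarrow> is \<in> wordset p \<and> js \<in> wordset q"
  by (auto simp: mixed_def in_keys_iff subset_iff)

lemma mixedI: "(\<And>is js. lk t (is, js) \<noteq> 0 \<Longrightarrow> is \<in> wordset p \<and> js \<in> wordset q) \<Longrightarrow> t \<in> mixed p q"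
  by (auto simp: mixed_def in_keys_iff)

lemma mixed_0 [simp]: "0 \<in> mixed p q" by (simp add: mixed_def)
lemma mixed_add: "x \<in> mixed p q \<Longrightarrow> y \<in> mixed p q \<Longrightarrow> x + y \<in> mixed p q"
  using subspace_mixed pvs.subspace_add by blast
lemma mixed_diff: "x \<in> mixed p q \<Longrightarrow> y \<in> mixed p q \<Longrightarrow> x - y \<in> mixed p q"
  using subspace_mixed pvs.subspace_diff by blast
lemma mixed_pscale: "x \<in> mixed p q \<Longrightarrow> pscale c x \<in> mixed p q"
  using subspace_mixed pvs.subspace_scale by blast
lemma mixed_sum: "(\<And>i. i \<in> I \<Longrightarrow> f i \<in> mixed p q) \<Longrightarrow> sum f I \<in> mixed p q"
  using subspace_mixed pvs.subspace_sum by blast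
lemma mixed_single: "is \<in> wordset p \<Longrightarrow> js \<in> wordset q \<Longrightarrow> sing (is, js) c \<in> mixed p q"
  by (auto simp: mixed_def)
lemma mixed_lext: "(\<And>k. k \<in> pkeys t \<Longrightarrow> f k \<in> mixed p q) \<Longrightarrow> lext f t \<in> mixed p q"
  unfolding lext_def by (intro mixed_sum mixed_pscale)

lemma ee_mixed:
  assumes "t \<in> mixed p q" "x \<noteq> 0" "y \<noteq> 0"
  shows "ee x y t \<in> mixed p q"
  unfolding ee_def
proof (rule mixed_lext)
  fix k assume "k \<in> pkeys t"
  then have "fst k \<in> wordset p" "snd k \<in> wordset q" using assms(1) by (auto simp: mixed_def)
  then show "eword x y k \<in> mixed p q"
    unfolding eword_def using assms(2,3)
    by (intro mixed_diff mixed_sum) (auto intro!: mixed_single wordset_update)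
qed

subsection \<open>Permutations of the factors\<close>

definition wperm :: "sym \<times> sym \<Rightarrow> int list \<times> int list \<Rightarrow> int list \<times> int list" where
  "wperm g w = (permute_list (inv (sfun (fst g))) (fst w), permute_list (inv (sfun (snd g))) (snd w))"

definition pact :: "sym \<times> sym \<Rightarrow> ((int list \<times> int list) \<Rightarrow>\<^sub>0 'k::field) \<Rightarrow> (int list \<times> int list) \<Rightarrow>\<^sub>0 'k" where
  "pact g = lext (\<lambda>w. sing (wperm g w) 1)"

lemma plinear_pact: "plinear (pact g)"
  unfolding pact_def by (rule plinear_lext)

lemma pact_single [simp]: "pact g (sing w c) = sing (wperm g w) c"
  by (simp add: pact_def)

lemma Sy_permutes: "s \<in> Sy d \<Longrightarrow> sfun s permutes {..<d}" by (simp add: Sy_def)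
lemma Sy_inv_permutes: "s \<in> Sy d \<Longrightarrow> inv (sfun s) permutes {..<d}" by (simp add: Sy_def permutes_inv)

lemma permute_list_wordset: "f permutes {..<d} \<Longrightarrow> is \<in> wordset d \<Longrightarrow> permute_list f is \<in> wordset d"
  by (auto simp: wordset_def)

lemma permute_list_inv_eq:
  assumes "f permutes {..<d}" "length us = d" "length is = d"
  shows "permute_list (inv f) us = is \<longleftrightarrow> us = permute_list f is"
proof -
  have i: "inv f permutes {..<d}" by (rule permutes_inv[OF assms(1)])
  have "permute_list (inv f) (permute_list f is) = is"
    using permute_list_compose[of "inv f" "is" f] i assms permutes_inv_o(1)[OF assms(1)] by simp
  moreover have "permute_list f (permute_list (inv f) us) = us"
    using permute_list_compose[of f us "inv f"] assms permutes_inv_o(2)[OF assms(1)] by simp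
  ultimately show ?thesis by auto
qed

lemma pact_mixed:
  assumes "fst g \<in> Sy p" "snd g \<in> Sy q" "t \<in> mixed p q"
  shows "pact g t \<in> mixed p q"
  unfolding pact_def
proof (rule mixed_lext)
  fix k assume "k \<in> pkeys t"
  then have "fst k \<in> wordset p" "snd k \<in> wordset q" using assms(3) by (auto simp: mixed_def)
  then show "sing (wperm g k) 1 \<in> mixed p q"
    unfolding wperm_def using assms(1,2) by (intro mixed_single permute_list_wordset Sy_inv_permutes)
qed

lemma lookup_pact:
  assumes g: "fst g \<in> Sy p" "snd g \<in> Sy q" and t: "t \<in> mixed p q" and l: "length is = p" "length js = q"
  shows "lk (pact g t) (is, js) = lk t (permute_list (sfun (fst g)) is, permute_list (sfun (snd g)) js)"
proof -
  have "lk (pact g t) (is, js) = (\<Sum>k\<in>pkeys t. lk t k * (if wperm g k = (is, js) then 1 else 0))"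
    unfolding pact_def lookup_lext by (simp add: lookup_single when_def)
  also have "\<dots> = (\<Sum>k\<in>pkeys t. lk t k * (if k = (permute_list (sfun (fst g)) is, permute_list (sfun (snd g)) js) then 1 else 0))"
  proof (rule sum.cong[OF refl])
    fix k assume "k \<in> pkeys t"
    then have "length (fst k) = p" "length (snd k) = q" using t by (auto simp: mixed_def wordset_def)
    then have "wperm g k = (is, js) \<longleftrightarrow> k = (permute_list (sfun (fst g)) is, permute_list (sfun (snd g)) js)"
      unfolding wperm_def prod.inject prod_eq_iff fst_conv snd_conv
      using permute_list_inv_eq[OF Sy_permutes[OF g(1)] _ l(1), of "fst k"]
        permute_list_inv_eq[OF Sy_permutes[OF g(2)] _ l(2), of "snd k"] by simp
    then show "lk t k * (if wperm g k = (is, js) then 1 else 0) =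
      lk t k * (if k = (permute_list (sfun (fst g)) is, permute_list (sfun (snd g)) js) then 1 else 0)" by simp
  qed
  also have "\<dots> = lk t (permute_list (sfun (fst g)) is, permute_list (sfun (snd g)) js)"
    by (rule lookup_expand[symmetric])
  finally show ?thesis .
qed

lemma mixed_eqI:
  assumes "s \<in> mixed p q" "t \<in> mixed p q"
    and "\<And>is js. is \<in> wordset p \<Longrightarrow> js \<in> wordset q \<Longrightarrow> lk s (is, js) = lk t (is, js)"
  shows "s = t"
proof (rule poly_mapping_eqI)
  fix k :: "int list \<times> int list"
  obtain "is" js where k: "k = (is, js)" by force
  show "lk s k = lk t k"
    using mixedD[OF assms(1), of "is" js] mixedD[OF assms(2), of "is" js] assms(3)[of "is" js] unfolding k by metis
qed

lemma pact_ee: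
  assumes g: "fst g \<in> Sy p" "snd g \<in> Sy q" and t: "t \<in> mixed p q" and "x \<noteq> 0" "y \<noteq> 0"
  shows "pact g (ee x y t) = ee x y (pact g t)"
proof (rule mixed_eqI)
  have m: "ee x y t \<in> mixed p q" by (rule ee_mixed) fact+
  show "pact g (ee x y t) \<in> mixed p q" by (rule pact_mixed) fact+
  show "ee x y (pact g t) \<in> mixed p q" using assms by (intro ee_mixed pact_mixed)
  fix "is" js assume "is \<in> wordset p" "js \<in> wordset q"
  then have l: "length is = p" "length js = q" by (auto simp: wordset_def)
  have "lsub x y (\<lambda>u. lk (pact g t) (u, js)) is
      = lsub x y (\<lambda>u. lk t (permute_list (sfun (fst g)) u, permute_list (sfun (snd g)) js)) is"
    unfolding lsub_def by (intro sum.cong refl if_cong lookup_pact[OF g t]) (simp_all add: l)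
  moreover have "lsub y x (\<lambda>v. lk (pact g t) (is, v)) js
      = lsub y x (\<lambda>v. lk t (permute_list (sfun (fst g)) is, permute_list (sfun (snd g)) v)) js"
    unfolding lsub_def by (intro sum.cong refl if_cong lookup_pact[OF g t]) (simp_all add: l)
  ultimately show "lk (pact g (ee x y t)) (is, js) = lk (ee x y (pact g t)) (is, js)"
    unfolding lookup_pact[OF g m l] lookup_ee
    using Sy_permutes[OF g(1)] Sy_permutes[OF g(2)] l
    by (simp add: lsub_permute)
qed

lemma wperm_plus:
  assumes "fst h \<in> Sy (length (fst w))" "snd h \<in> Sy (length (snd w))"
    "fst g \<in> Sy (length (fst w))" "snd g \<in> Sy (length (snd w))"
  shows "wperm (g + h) w = wperm g (wperm h w)"
proof -
  have i: "inv (sfun (s + t)) = inv (sfun t) \<circ> inv (sfun s)" for s t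
    by (metis minus_add sfun_plus sfun_uminus)
  show ?thesis
    unfolding wperm_def fst_add snd_add i fst_conv snd_conv
    using assms by (simp add: permute_list_compose Sy_inv_permutes)
qed

lemma pact_plus:
  assumes "fst g \<in> Sy p" "snd g \<in> Sy q" "fst h \<in> Sy p" "snd h \<in> Sy q" "t \<in> mixed p q"
  shows "pact (g + h) t = pact g (pact h t)"
proof (rule plinear_eqI[OF plinear_pact plinear_compose[OF plinear_pact plinear_pact]])
  fix k assume "k \<in> pkeys t"
  then have "length (fst k) = p" "length (snd k) = q" using assms(5) by (auto simp: mixed_def wordset_def)
  then show "pact (g + h) (sing k 1) = pact g (pact h (sing k 1))"
    using assms by (simp add: wperm_plus)
qed

lemma wperm_0 [simp]: "wperm 0 w = w"
  by (simp add: wperm_def)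

lemma pact_0 [simp]: "pact 0 t = t"
  by (rule plinear_eqI[OF plinear_pact plinear_id]) simp

subsection \<open>Contractions\<close>

definition letters :: "((int list \<times> int list) \<Rightarrow>\<^sub>0 'k::field) \<Rightarrow> int set" where
  "letters t = (\<Union>k\<in>pkeys t. set (fst k) \<union> set (snd k))"

lemma finite_letters [simp]: "finite (letters t)"
  by (simp add: letters_def)

lemma letters_lookup: "lk t (is, js) \<noteq> 0 \<Longrightarrow> set is \<subseteq> letters t \<and> set js \<subseteq> letters t"
  by (force simp: letters_def in_keys_iff)

text \<open>Coefficients of a contraction, indexed by an uncontracted word whose letters at the two
  contracted positions are overwritten. So tracelessness is expressed without shortening
  words.\<close>

definition trc :: "nat \<Rightarrow> nat \<Rightarrow> ((int list \<times> int list) \<Rightarrow>\<^sub>0 'k::field) \<Rightarrow> int list \<times> int list \<Rightarrow> 'k" where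
  "trc i j t w = (\<Sum>c\<in>letters t. lk t ((fst w)[i := c], (snd w)[j := c]))"

text \<open>Any finite set containing the letters may index the contraction, so that tensors with
  different letters can be compared.\<close>

lemma trc_superset:
  assumes "finite L" "letters t \<subseteq> L" "i < length is"
  shows "trc i j t (is, js) = (\<Sum>c\<in>L. lk t (is[i := c], js[j := c]))"
  unfolding trc_def fst_conv snd_conv
proof (rule sum.mono_neutral_left[OF assms(1,2)], rule ballI)
  fix c assume "c \<in> L - letters t"
  then show "lk t (is[i := c], js[j := c]) = 0"
    using letters_lookup[of t "is[i := c]" "js[j := c]"] set_update_memI[OF assms(3)] by blast
qed

definition tless :: "nat \<Rightarrow> nat \<Rightarrow> ((int list \<times> int list) \<Rightarrow>\<^sub>0 'k::field) set" where
  "tless p q = {t \<in> mixed p q. \<forall>i<p. \<forall>j<q. \<forall>is js. length is = p \<longrightarrow> length js = q \<longrightarrow> trc i j t (is, js) = 0}"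

lemma tless_mixed: "t \<in> tless p q \<Longrightarrow> t \<in> mixed p q" by (simp add: tless_def)

lemma tlessD:
  assumes "t \<in> tless p q" "i < p" "j < q" "length is = p" "length js = q" "finite L" "letters t \<subseteq> L"
  shows "(\<Sum>c\<in>L. lk t (is[i := c], js[j := c])) = 0"
  using assms trc_superset[of L t i "is" j js] by (simp add: tless_def)

lemma tlessI:
  assumes "t \<in> mixed p q" "finite L" "letters t \<subseteq> L"
    "\<And>i j is js. i < p \<Longrightarrow> j < q \<Longrightarrow> length is = p \<Longrightarrow> length js = q \<Longrightarrow> (\<Sum>c\<in>L. lk t (is[i := c], js[j := c])) = 0"
  shows "t \<in> tless p q"
  using assms(1,4) trc_superset[OF assms(2,3)] by (simp add: tless_def)

lemma omit_eq_iff: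
  assumes "length us = length is" "i < length is"
  shows "omit i us = omit i is \<longleftrightarrow> us = is[i := us ! i]"
proof -
  have "omit i us = omit i is \<longleftrightarrow> take i us = take i is \<and> drop (Suc i) us = drop (Suc i) is"
    unfolding omit_def using assms by simp
  also have "\<dots> \<longleftrightarrow> us = is[i := us ! i]"
  proof -
    have "us = is[i := us ! i] \<longleftrightarrow> take i us @ us ! i # drop (Suc i) us = take i is @ us ! i # drop (Suc i) is"
      using assms id_take_nth_drop[of i us] upd_conv_take_nth_drop[of i "is" "us ! i"] by simp
    then show ?thesis using assms by (simp add: append_eq_append_conv)
  qed
  finally show ?thesis .
qed

lemma lookup_contraction:
  assumes P: "dual_system P" and t: "t \<in> mixed p q" and ij: "i < p" "j < q"
  shows "lk (contraction P i j t) w = (\<Sum>(is, js)\<in>pkeys t.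
      if is ! i = js ! j \<and> omit i is = fst w \<and> omit j js = snd w then lk t (is, js) else 0)"
proof -
  have d: "pair P (xi P x) (xid P y) = (if x = y then 1 else 0)" if "x \<noteq> 0" "y \<noteq> 0" for x y
    using P that unfolding dual_system_def by blast
  have om: "set (omit i is) \<subseteq> set is" "length (omit i is) = length is - 1" if "i < length is" for i and "is" :: "int list"
    using that by (auto simp: omit_def dest: in_set_takeD in_set_dropD)
  have mo: "omit i (map f is) = map f (omit i is)" for i and f :: "int \<Rightarrow> 'z" and "is"
    by (simp add: omit_def take_map drop_map)
  have "lk (contraction P i j t) w = (\<Sum>(is, js)\<in>pkeys t. lk t (is, js) *
      lk (pscale (pair P (map (xi P) is ! i) (map (xid P) js ! j))
        (tens P (omit i (map (xi P) is)) (omit j (map (xid P) js)))) w)"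
    unfolding contraction_def lift_def by (simp add: lookup_sum case_prod_unfold mult.assoc)
  also have "\<dots> = (\<Sum>(is, js)\<in>pkeys t.
      if is ! i = js ! j \<and> omit i is = fst w \<and> omit j js = snd w then lk t (is, js) else 0)"
  proof (rule sum.cong[OF refl], clarify)
    fix "is" js assume "(is, js) \<in> pkeys t"
    then have w: "is \<in> wordset p" "js \<in> wordset q" using t by (auto simp: mixed_def)
    have l: "length is = p" "length js = q" using w by (auto simp: wordset_def)
    have o: "omit i is \<in> wordset (p - 1)" "omit j js \<in> wordset (q - 1)"
      using om(1)[of i "is"] om(1)[of j js] om(2)[of i "is"] om(2)[of j js] w l ij by (auto simp: wordset_def)
    have nz: "is ! i \<noteq> 0" "js ! j \<noteq> 0" using w ij l by (metis mem_Collect_eq nth_mem wordset_def)+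
    have "lk (tens P (omit i (map (xi P) is)) (omit j (map (xid P) js))) w
        = (if omit i is = fst w \<and> omit j js = snd w then 1 else 0)"
      unfolding mo tens_basis[OF P o] by (cases w) (auto simp: lookup_single when_def)
    then show "lk t (is, js) * lk (pscale (pair P (map (xi P) is ! i) (map (xid P) js ! j))
        (tens P (omit i (map (xi P) is)) (omit j (map (xid P) js)))) w =
      (if is ! i = js ! j \<and> omit i is = fst w \<and> omit j js = snd w then lk t (is, js) else 0)"
      using d[OF nz] l ij by simp
  qed
  finally show ?thesis .
qed

text \<open>The words that contract to the given one are exactly those with a common letter c at
  both positions, one for each c.\<close>

lemma lookup_contraction_trc:
  assumes P: "dual_system P" and t: "t \<in> mixed p q" and ij: "i < p" "j < q" and l: "length is = p" "length js = q"
  shows "lk (contraction P i j t) (omit i is, omit j js) = trc i j t (is, js)"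
proof -
  let ?h = "\<lambda>c. (is[i := c], js[j := c])"
  let ?C = "{c \<in> letters t. ?h c \<in> pkeys t}"
  let ?K = "{(us, vs) \<in> pkeys t. us ! i = vs ! j \<and> omit i us = omit i is \<and> omit j vs = omit j js}"
  have K: "?K = ?h ` ?C"
  proof (intro equalityI subsetI)
    fix k assume "k \<in> ?K"
    then obtain us vs where k: "k = (us, vs)" "(us, vs) \<in> pkeys t" "us ! i = vs ! j"
      "omit i us = omit i is" "omit j vs = omit j js" by auto
    have ul: "length us = p" "length vs = q" using k(2) t by (auto simp: mixed_def wordset_def)
    have "us = is[i := us ! i]" "vs = js[j := us ! i]"
      using k omit_eq_iff[of us "is" i] omit_eq_iff[of vs js j] ul l ij by simp_all
    moreover have "us ! i \<in> letters t"
      using k(2) ul(1) ij(1) letters_lookup[of t us vs] by (metis in_keys_iff nth_mem subsetD)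
    ultimately show "k \<in> ?h ` ?C" using k(1,2) by (intro image_eqI[of _ _ "us ! i"]) auto
  next
    fix k assume "k \<in> ?h ` ?C"
    then show "k \<in> ?K" using l ij by (auto simp: omit_def)
  qed
  have "inj_on ?h ?C" using l ij by (auto intro!: inj_onI) (metis nth_list_update_eq)
  then have "(\<Sum>k\<in>?K. lk t k) = (\<Sum>c\<in>?C. lk t (?h c))"
    unfolding K by (simp add: sum.reindex)
  also have "\<dots> = trc i j t (is, js)"
    unfolding trc_def by (simp, rule sum.mono_neutral_left) (auto simp: in_keys_iff)
  also have "(\<Sum>k\<in>?K. lk t k) = lk (contraction P i j t) (omit i is, omit j js)"
  proof -
    have "?K = {k \<in> pkeys t. fst k ! i = snd k ! j \<and> omit i (fst k) = omit i is \<and> omit j (snd k) = omit j js}"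
      by auto
    then have "(\<Sum>k\<in>?K. lk t k) = (\<Sum>k\<in>pkeys t. if fst k ! i = snd k ! j \<and> omit i (fst k) = omit i is
        \<and> omit j (snd k) = omit j js then lk t k else 0)"
      by (subst sum.inter_filter[symmetric]) simp_all
    then show ?thesis
      unfolding lookup_contraction[OF P t ij] by (simp add: case_prod_unfold cong: if_cong)
  qed
  finally show ?thesis .
qed

lemma traceless_eq:
  fixes P :: "('k::field, 'v::ab_group_add, 'w::ab_group_add) dual_pair"
  assumes P: "dual_system P"
  shows "traceless P p q = tless p q"
proof (intro equalityI subsetI)
  fix t assume t: "t \<in> traceless P p q"
  then have m: "t \<in> mixed p q" by (simp add: traceless_def)
  show "t \<in> tless p q"
    unfolding tless_def
    using t m lookup_contraction_trc[OF P m, symmetric] by (simp add: traceless_def)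
next
  fix t :: "(int list \<times> int list) \<Rightarrow>\<^sub>0 'k" assume t: "t \<in> tless p q"
  then have m: "t \<in> mixed p q" by (rule tless_mixed)
  have "contraction P i j t = 0" if ij: "i < p" "j < q" for i j
  proof (rule poly_mapping_eqI)
    fix w
    show "lk (contraction P i j t) w = lk 0 w"
    proof (rule ccontr)
      assume nz: "lk (contraction P i j t) w \<noteq> lk 0 w"
      then obtain k where k: "k \<in> pkeys t" "omit i (fst k) = fst w" "omit j (snd k) = snd w"
        unfolding lookup_contraction[OF P m ij] lookup_zero
        by (force elim!: sum.not_neutral_contains_not_neutral split: if_splits)
      then have l: "length (fst k) = p" "length (snd k) = q" using m by (auto simp: mixed_def wordset_def)
      have "lk (contraction P i j t) w = trc i j t (fst k, snd k)"
        using lookup_contraction_trc[OF P m ij l] k by simp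
      moreover have "trc i j t (fst k, snd k) = 0" using t l ij unfolding tless_def by blast
      ultimately show False using nz by simp
    qed
  qed
  with m show "t \<in> traceless P p q" by (simp add: traceless_def)
qed

subsection \<open>Traceless tensors form a submodule\<close>

lemma tless_subspace: "pvs.subspace (tless p q)"
proof (rule pvs.subspaceI)
  show "0 \<in> tless p q" by (rule tlessI[of _ _ _ "{}"]) (auto simp: letters_def)
next
  fix x y :: "(int list \<times> int list) \<Rightarrow>\<^sub>0 'a" assume x: "x \<in> tless p q" and y: "y \<in> tless p q"
  show "x + y \<in> tless p q"
  proof (rule tlessI[of _ _ _ "letters x \<union> letters y \<union> letters (x + y)"])
    let ?L = "letters x \<union> letters y \<union> letters (x + y)"
    show "x + y \<in> mixed p q" using x y by (intro mixed_add tless_mixed)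
    fix i j and "is" js :: "int list" assume "i < p" "j < q" "length is = p" "length js = q"
    then show "(\<Sum>c\<in>?L. lk (x + y) (is[i := c], js[j := c])) = 0"
      using tlessD[OF x, of i j "is" js ?L] tlessD[OF y, of i j "is" js ?L]
      by (simp add: lookup_add sum.distrib sup.coboundedI1)
  qed auto
next
  fix c and x :: "(int list \<times> int list) \<Rightarrow>\<^sub>0 'a" assume x: "x \<in> tless p q"
  show "pscale c x \<in> tless p q"
    by (rule tlessI[of _ _ _ "letters x \<union> letters (pscale c x)"])
      (use tlessD[OF x] in \<open>auto simp: tless_mixed[OF x] mixed_pscale simp flip: sum_distrib_left\<close>)
qed

text \<open>A replacement away from position i commutes with the contraction and contributes 0 by
  assumption. Only the replacement at i itself survives, and there the contracted letter must be
  x.\<close>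

lemma sum_lsub_update:
  fixes h :: "int list \<Rightarrow> int list \<Rightarrow> 'k::field"
  assumes i: "i < length is" and L: "finite L" "x \<in> L"
    and z: "\<And>us. length us = length is \<Longrightarrow> (\<Sum>c\<in>L. h (us[i := c]) (js[j := c])) = 0"
  shows "(\<Sum>c\<in>L. lsub x y (\<lambda>u. h u (js[j := c])) (is[i := c])) = h (is[i := y]) (js[j := x])"
proof -
  let ?n = "length is"
  have "(\<Sum>c\<in>L. lsub x y (\<lambda>u. h u (js[j := c])) (is[i := c]))
      = (\<Sum>a<?n. \<Sum>c\<in>L. if is[i := c] ! a = x then h (is[i := c, a := y]) (js[j := c]) else 0)"
    unfolding lsub_def length_list_update by (rule sum.swap)
  also have "\<dots> = (\<Sum>c\<in>L. if is[i := c] ! i = x then h (is[i := c, i := y]) (js[j := c]) else 0)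
      + (\<Sum>a\<in>{..<?n} - {i}. \<Sum>c\<in>L. if is[i := c] ! a = x then h (is[i := c, a := y]) (js[j := c]) else 0)"
    by (rule sum.remove) (use i in auto)
  also have "(\<Sum>a\<in>{..<?n} - {i}. \<Sum>c\<in>L. if is[i := c] ! a = x then h (is[i := c, a := y]) (js[j := c]) else 0) = 0"
  proof (rule sum.neutral, rule ballI)
    fix a assume a: "a \<in> {..<?n} - {i}"
    then have "(\<Sum>c\<in>L. if is[i := c] ! a = x then h (is[i := c, a := y]) (js[j := c]) else 0)
        = (if is ! a = x then \<Sum>c\<in>L. h (is[a := y, i := c]) (js[j := c]) else 0)"
      by (auto simp: list_update_swap intro!: sum.cong)
    then show "(\<Sum>c\<in>L. if is[i := c] ! a = x then h (is[i := c, a := y]) (js[j := c]) else 0) = 0"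
      using z[of "is[a := y]"] by simp
  qed
  also have "(\<Sum>c\<in>L. if is[i := c] ! i = x then h (is[i := c, i := y]) (js[j := c]) else 0)
      = (\<Sum>c\<in>L. if c = x then h (is[i := y]) (js[j := c]) else 0)"
    using i by (intro sum.cong) auto
  finally show ?thesis using L by simp
qed

text \<open>Invariance of the pairing: the replacement in the contracted factor of V and that in the
  contracted dual factor leave the same coefficient, with opposite signs.\<close>

lemma ee_tless:
  assumes t: "t \<in> tless p q" and xy: "x \<noteq> 0" "y \<noteq> 0"
  shows "ee x y t \<in> tless p q"
proof (rule tlessI[of _ _ _ "letters t \<union> {x, y} \<union> letters (ee x y t)"])
  let ?L = "letters t \<union> {x, y} \<union> letters (ee x y t)"
  show "ee x y t \<in> mixed p q" using t xy by (intro ee_mixed tless_mixed)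
  fix i j and "is" js :: "int list" assume ij: "i < p" "j < q" and l: "length is = p" "length js = q"
  have z: "(\<Sum>c\<in>?L. lk t (us[i := c], vs[j := c])) = 0" if "length us = p" "length vs = q" for us vs
    by (rule tlessD[OF t ij that]) auto
  have "(\<Sum>c\<in>?L. lsub x y (\<lambda>u. lk t (u, js[j := c])) (is[i := c])) = lk t (is[i := y], js[j := x])"
    by (rule sum_lsub_update[where h = "\<lambda>u v. lk t (u, v)"]) (use l ij z in auto)
  moreover have "(\<Sum>c\<in>?L. lsub y x (\<lambda>v. lk t (is[i := c], v)) (js[j := c])) = lk t (is[i := y], js[j := x])"
    by (rule sum_lsub_update[where h = "\<lambda>u v. lk t (v, u)"]) (use l ij z in auto)
  ultimately show "(\<Sum>c\<in>?L. lk (ee x y t) (is[i := c], js[j := c])) = 0"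
    by (simp add: lookup_ee sum_subtractf)
qed auto

lemma pact_tless:
  assumes g: "fst g \<in> Sy p" "snd g \<in> Sy q" and t: "t \<in> tless p q"
  shows "pact g t \<in> tless p q"
proof (rule tlessI[of _ _ _ "letters t \<union> letters (pact g t)"])
  let ?L = "letters t \<union> letters (pact g t)" and ?s = "sfun (fst g)" and ?u = "sfun (snd g)"
  show "pact g t \<in> mixed p q" using g t by (intro pact_mixed tless_mixed)
  fix i j and "is" js :: "int list" assume ij: "i < p" "j < q" and l: "length is = p" "length js = q"
  have "permute_list ?s (is[i := c]) = (permute_list ?s is)[inv ?s i := c]" for c
    using permute_list_update[of ?s "is" "inv ?s i" c] Sy_permutes[OF g(1)] l ij Sy_inv_less[OF g(1)] by simp
  moreover have "permute_list ?u (js[j := c]) = (permute_list ?u js)[inv ?u j := c]" for c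
    using permute_list_update[of ?u js "inv ?u j" c] Sy_permutes[OF g(2)] l ij Sy_inv_less[OF g(2)] by simp
  ultimately have "(\<Sum>c\<in>?L. lk (pact g t) (is[i := c], js[j := c]))
      = (\<Sum>c\<in>?L. lk t ((permute_list ?s is)[inv ?s i := c], (permute_list ?u js)[inv ?u j := c]))"
    using lookup_pact[OF g tless_mixed[OF t]] l by simp
  also have "\<dots> = 0"
    by (rule tlessD[OF t]) (use l ij Sy_inv_less[OF g(1)] Sy_inv_less[OF g(2)] in auto)
  finally show "(\<Sum>c\<in>?L. lk (pact g t) (is[i := c], js[j := c])) = 0" .
qed auto

subsection \<open>Subspaces stable under root vectors\<close>

text \<open>Only root vectors occur, and these lie in sl. Submodules over gl and over sl are both of
  this kind, so one argument treats both.\<close>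

definition slstable :: "nat \<Rightarrow> nat \<Rightarrow> ((int list \<times> int list) \<Rightarrow>\<^sub>0 'k::field) set \<Rightarrow> bool" where
  "slstable p q N \<longleftrightarrow> N \<subseteq> mixed p q \<and> pvs.subspace N \<and>
     (\<forall>x y t. x \<noteq> 0 \<longrightarrow> y \<noteq> 0 \<longrightarrow> x \<noteq> y \<longrightarrow> t \<in> N \<longrightarrow> ee x y t \<in> N)"

lemma slstable_mixed: "slstable p q N \<Longrightarrow> t \<in> N \<Longrightarrow> t \<in> mixed p q"
  and slstable_subspace: "slstable p q N \<Longrightarrow> pvs.subspace N"
  and slstable_ee: "slstable p q N \<Longrightarrow> t \<in> N \<Longrightarrow> x \<noteq> 0 \<Longrightarrow> y \<noteq> 0 \<Longrightarrow> x \<noteq> y \<Longrightarrow> ee x y t \<in> N"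
  by (auto simp: slstable_def)

text \<open>Exchanges V and its dual. By \<open>flip_ee\<close> root vectors go to negatives of root
  vectors with swapped indices, so stability is preserved and results on the V part carry over to
  the dual part.\<close>

definition flip :: "((int list \<times> int list) \<Rightarrow>\<^sub>0 'k::field) \<Rightarrow> (int list \<times> int list) \<Rightarrow>\<^sub>0 'k" where
  "flip = lext (\<lambda>w. sing (snd w, fst w) 1)"

lemma plinear_flip: "plinear flip"
  unfolding flip_def by (rule plinear_lext)

lemma lookup_flip [simp]: "lk (flip t) (u, v) = lk t (v, u)"
proof -
  have "lk (flip t) (u, v) = (\<Sum>k\<in>pkeys t. lk t k * (if k = (v, u) then 1 else 0))"
    unfolding flip_def lookup_lext
    by (rule sum.cong) (auto simp: lookup_single when_def prod_eq_iff)
  then show ?thesis by (simp only: lookup_expand[of t "(v, u)"])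
qed

lemma flip_flip [simp]: "flip (flip t) = t"
  by (rule poly_mapping_eqI) (auto simp: split_paired_all)

lemma keys_flip: "(u, v) \<in> pkeys (flip t) \<longleftrightarrow> (v, u) \<in> pkeys t"
  by (simp add: in_keys_iff)

lemma flip_single [simp]: "flip (sing w c) = sing (snd w, fst w) c"
  by (simp add: flip_def)

lemma flip_ee: "flip (ee x y t) = - ee y x (flip t)"
  by (rule poly_mapping_eqI) (auto simp: lookup_ee)

lemma slstable_flip:
  assumes "slstable p q N"
  shows "slstable q p (flip ` N)"
  unfolding slstable_def
proof (intro conjI allI impI)
  show "flip ` N \<subseteq> mixed q p"
  proof clarify
    fix t assume "t \<in> N"
    then have "t \<in> mixed p q" by (rule slstable_mixed[OF assms])
    then show "flip t \<in> mixed q p" by (intro mixedI) (auto dest: mixedD)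
  qed
  note sub = slstable_subspace[OF assms]
  show "pvs.subspace (flip ` N)"
  proof (rule pvs.subspaceI)
    have "flip 0 \<in> flip ` N" by (rule imageI[OF pvs.subspace_0[OF sub]])
    then show "0 \<in> flip ` N" by (simp only: plinear_0[OF plinear_flip])
  next
    fix x y assume "x \<in> flip ` N" "y \<in> flip ` N"
    then obtain a b where ab: "a \<in> N" "b \<in> N" "x = flip a" "y = flip b" by auto
    have "flip (a + b) \<in> flip ` N" by (rule imageI[OF pvs.subspace_add[OF sub ab(1,2)]])
    then show "x + y \<in> flip ` N" by (simp only: plinear_add[OF plinear_flip] ab)
  next
    fix c x assume "x \<in> flip ` N"
    then obtain a where a: "a \<in> N" "x = flip a" by auto
    have "flip (pscale c a) \<in> flip ` N" by (rule imageI[OF pvs.subspace_scale[OF sub a(1)]])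
    then show "pscale c x \<in> flip ` N" by (simp only: plinear_pscale[OF plinear_flip] a)
  qed
  fix x y :: int and t assume xy: "x \<noteq> 0" "y \<noteq> 0" "x \<noteq> y" and "t \<in> flip ` N"
  then obtain s where s: "s \<in> N" "t = flip s" by auto
  have "- ee y x s \<in> N"
    using slstable_ee[OF assms s(1), of y x] xy pvs.subspace_neg[OF slstable_subspace[OF assms]] by simp
  moreover have "ee x y t = flip (- ee y x s)"
    by (simp add: s(2) plinear_uminus[OF plinear_flip] flip_ee)
  ultimately show "ee x y t \<in> flip ` N" by simp
qed

section \<open>Renaming letters by root vectors\<close>

lemma eword_single_pos:
  assumes "a < length is" "\<And>c. c < length is \<Longrightarrow> is ! c = y \<longleftrightarrow> c = a" "x \<notin> set js"
  shows "eword x y (is, js) = sing (is[a := x], js) (1 :: 'k::field)"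
proof -
  have "(\<Sum>b<length js. if js ! b = x then sing (is, js[b := y]) 1 else (0 :: _ \<Rightarrow>\<^sub>0 'k)) = 0"
    using assms(3) by (intro sum.neutral) auto
  moreover have "(\<Sum>c<length is. if is ! c = y then sing (is[c := x], js) 1 else (0 :: _ \<Rightarrow>\<^sub>0 'k))
      = (\<Sum>c<length is. if c = a then sing (is[c := x], js) 1 else 0)"
    by (rule sum.cong) (use assms(2) in auto)
  ultimately show ?thesis unfolding eword_def fst_conv snd_conv using assms(1) by simp
qed

definition relet :: "(int \<Rightarrow> int) \<Rightarrow> ((int list \<times> int list) \<Rightarrow>\<^sub>0 'k::field) \<Rightarrow> (int list \<times> int list) \<Rightarrow>\<^sub>0 'k" where
  "relet f = lext (\<lambda>w. sing (map f (fst w), snd w) 1)"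

lemma plinear_relet: "plinear (relet f)"
  unfolding relet_def by (rule plinear_lext)
lemma relet_single [simp]: "relet f (sing w c) = sing (map f (fst w), snd w) c"
  by (simp add: relet_def)

text \<open>A letter y that occurs once is replaced by \<open>f y\<close> through the root vector
  \<open>ee (f y) y\<close>, one letter after the other. New letters avoid A, so no letter is
  replaced twice, and they avoid the dual words, so no correction term arises. The map f may
  identify letters.\<close>

lemma slstable_relet:
  assumes N: "slstable p q N" and u: "u \<in> N" and A: "finite A"
    and keys: "\<And>is js. (is, js) \<in> pkeys u \<Longrightarrow> distinct is \<and> set is = A \<and> set js \<inter> f ` A = {}"
    and f: "f ` A \<inter> A = {}" "0 \<notin> f ` A"
  shows "relet f u \<in> N"
proof (cases "u = 0")
  case True
  then show ?thesis using u plinear_0[OF plinear_relet] by metis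
next
  case False
  then obtain k where k: "k \<in> pkeys u" by (metis ex_in_conv keys_eq_empty)
  have A0: "0 \<notin> A"
    using keys[of "fst k" "snd k"] k slstable_mixed[OF N u] by (auto simp: mixed_def wordset_def)
  let ?f = "\<lambda>S z. if z \<in> S then f z else z"
  have "S \<subseteq> A \<Longrightarrow> relet (?f S) u \<in> N" if "finite S" for S
    using that
  proof (induction S)
    case empty
    have "relet (?f {}) u = u"
      by (rule plinear_eqI[OF plinear_relet plinear_id]) simp
    then show ?case using u by simp
  next
    case (insert y S)
    then have yA: "y \<in> A" "y \<notin> S" and S: "S \<subseteq> A" by auto
    have "ee (f y) y (relet (?f S) u) = relet (?f (insert y S)) u"
    proof (rule plinear_eqI[OF plinear_compose[OF plinear_ee plinear_relet] plinear_relet])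
      fix k assume k: "k \<in> pkeys u"
      obtain "is" js where kk: "k = (is, js)" by force
      have d: "distinct is" "set is = A" "set js \<inter> f ` A = {}" using keys k kk by auto
      then obtain a where a: "a < length is" "is ! a = y" using yA by (metis in_set_conv_nth)
      have "map (?f S) is ! c = y \<longleftrightarrow> c = a" if c: "c < length is" for c
      proof -
        have "is ! c \<in> A" using c d(2) by auto
        then have "?f S (is ! c) = y \<longleftrightarrow> is ! c = y" using f(1) yA S by auto
        also have "\<dots> \<longleftrightarrow> c = a" using a c d(1) nth_eq_iff_index_eq by blast
        finally show ?thesis using c by simp
      qed
      moreover have "f y \<notin> set js" using d(3) yA by auto
      ultimately have "eword (f y) y (map (?f S) is, js) = sing ((map (?f S) is)[a := f y], js) (1 :: 'a)"
        using a by (intro eword_single_pos) auto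
      also have "(map (?f S) is)[a := f y] = map (?f (insert y S)) is"
      proof (rule nth_equalityI)
        fix c assume "c < length ((map (?f S) is)[a := f y])"
        then have c: "c < length is" by simp
        show "(map (?f S) is)[a := f y] ! c = map (?f (insert y S)) is ! c"
          using a c d(1) by (cases "c = a") (auto simp: nth_eq_iff_index_eq)
      qed simp
      finally show "ee (f y) y (relet (?f S) (sing k 1)) = relet (?f (insert y S)) (sing k (1 :: 'a))"
        by (simp add: kk)
    qed
    moreover have "ee (f y) y (relet (?f S) u) \<in> N"
      by (rule slstable_ee[OF N insert.IH[OF S]]) (use yA A0 f in auto)
    ultimately show ?case by simp
  qed
  from this[OF A subset_refl] have "relet (?f A) u \<in> N" .
  moreover have "relet (?f A) u = relet f u"
  proof (rule plinear_eqI[OF plinear_relet plinear_relet])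
    fix k assume "k \<in> pkeys u"
    then have "set (fst k) = A" using keys[of "fst k" "snd k"] by simp
    then have "map (?f A) (fst k) = map f (fst k)" by simp
    then show "relet (?f A) (sing k 1) = relet f (sing k (1 :: 'a))" unfolding relet_single by (simp only:)
  qed
  ultimately show ?thesis by simp
qed

lemma ex_letter_map:
  assumes "distinct is" "length us = length is"
  shows "\<exists>f. map f is = us"
proof (intro exI)
  show "map (\<lambda>z. the (map_of (zip is us) z)) is = us"
    using assms by (intro nth_equalityI) (simp_all add: map_of_zip_nth)
qed

lemma slstable_word:
  assumes N: "slstable p q N" and w: "sing (is, js) 1 \<in> N" and d: "distinct is"
    and us: "length us = length is" "0 \<notin> set us" "set us \<inter> set is = {}" "set us \<inter> set js = {}"
  shows "sing (us, js) (1 :: 'k::field) \<in> N"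
proof -
  obtain f where f: "map f is = us" using ex_letter_map[OF d us(1)] by blast
  then have fi: "f ` set is = set us" by (metis set_map)
  have "relet f (sing (is, js) (1 :: 'k)) \<in> N"
    by (rule slstable_relet[OF N w, of "set is"]) (use d us fi in auto)
  then show ?thesis by (simp add: f)
qed

lemma slstable_word':
  assumes N: "slstable p q N" and w: "sing (is, js) 1 \<in> N" and d: "distinct js"
    and vs: "length vs = length js" "0 \<notin> set vs" "set vs \<inter> set js = {}" "set vs \<inter> set is = {}"
  shows "sing (is, vs) (1 :: 'k::field) \<in> N"
proof -
  have "flip (sing (is, js) (1 :: 'k)) \<in> flip ` N" using w by (rule imageI)
  then have "sing (js, is) (1 :: 'k) \<in> flip ` N" by simp
  then have "sing (vs, is) (1 :: 'k) \<in> flip ` N" by (rule slstable_word[OF slstable_flip[OF N]]) (use d vs in auto)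
  then have "flip (sing (vs, is) (1 :: 'k)) \<in> N" by (metis flip_flip image_iff)
  then show ?thesis by simp
qed

lemma fresh_list:
  assumes "finite (F :: int set)"
  obtains cs where "length cs = n" "distinct cs" "0 \<notin> set cs" "set cs \<inter> F = {}"
proof -
  have "infinite (- insert 0 F)" using assms by (simp add: Compl_eq_Diff_UNIV infinite_UNIV_int)
  then obtain B where B: "finite B" "card B = n" "B \<subseteq> - insert 0 F"
    using infinite_arbitrarily_large by blast
  obtain cs where "set cs = B" "distinct cs" using finite_distinct_list[OF B(1)] by blast
  then have "length cs = n" "0 \<notin> set cs" "set cs \<inter> F = {}" using B by (auto simp: distinct_card[symmetric])
  then show thesis using that \<open>distinct cs\<close> by blast
qed

definition relet_at :: "nat \<Rightarrow> int \<Rightarrow> int \<Rightarrow> ((int list \<times> int list) \<Rightarrow>\<^sub>0 'k::field) \<Rightarrow> (int list \<times> int list) \<Rightarrow>\<^sub>0 'k" where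
  "relet_at k a c = lext (\<lambda>w. if fst w ! k = a then sing ((fst w)[k := c], snd w) 1 else 0)"

lemma lookup_relet_at:
  assumes t: "t \<in> mixed p q" and k: "k < p"
  shows "lk (relet_at k a c t) (is, js) = (if is ! k = c then lk t (is[k := a], js) else 0)"
proof -
  have "lk (relet_at k a c t) (is, js) = (\<Sum>w\<in>pkeys t. lk t w * (if is ! k = c \<and> w = (is[k := a], js) then 1 else 0))"
    unfolding relet_at_def lookup_lext
  proof (rule sum.cong[OF refl])
    fix w assume "w \<in> pkeys t"
    then have l: "length (fst w) = p" using t by (auto simp: mixed_def wordset_def)
    have *: "(fst w ! k = a \<and> (fst w)[k := c] = is) \<longleftrightarrow> (is ! k = c \<and> fst w = is[k := a])"
    proof (cases "length (fst w) = length is")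
      case True
      then show ?thesis using list_update_eq_iff[of "fst w" "is" k a c] k l by simp
    qed auto
    show "lk t w * lk (if fst w ! k = a then sing ((fst w)[k := c], snd w) 1 else 0) (is, js) =
       lk t w * (if is ! k = c \<and> w = (is[k := a], js) then 1 else 0)"
      using * by (auto simp: lookup_single when_def prod_eq_iff)
  qed
  also have "\<dots> = (if is ! k = c then lk t (is[k := a], js) else 0)"
    by (simp add: lookup_expand[of t "(is[k := a], js)"])
  finally show ?thesis .
qed

text \<open>A traceless tensor whose first \<open>k\<close> factors in \<^term>\<open>V\<close> are fixed fresh basis vectors is the sum
  over \<open>a\<close> of \<^term>\<open>ee a c\<close> applied to its part with letter \<open>a\<close> at position \<open>k\<close>, that letter being
  replaced by a fresh \<open>c\<close>: the correction terms in the dual factors add up to a contraction.\<close>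

lemma tless_in_slstable:
  fixes N :: "((int list \<times> int list) \<Rightarrow>\<^sub>0 'k::field) set"
  assumes N: "slstable p q N" and w: "sing (I, J) 1 \<in> N" and d: "distinct (I @ J)"
  shows "tless p q \<subseteq> N"
proof
  fix t0 :: "(int list \<times> int list) \<Rightarrow>\<^sub>0 'k" assume t0: "t0 \<in> tless p q"
  let ?F = "letters t0"
  have IJ: "length I = p" "length J = q" "0 \<notin> set I" "0 \<notin> set J"
    using slstable_mixed[OF N w] by (auto simp: mixed_def wordset_def)
  obtain cs where cs: "length cs = p" "distinct cs" "0 \<notin> set cs" "set cs \<inter> (?F \<union> set I \<union> set J) = {}"
    using fresh_list[of "?F \<union> set I \<union> set J" p] by auto
  \<comment> \<open>The letters of J may also occur in \<open>t0\<close>; passing through the fresh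
    word \<open>ds\<close> avoids a clash when the dual part is renamed to arbitrary letters of
    \<open>t0\<close>.\<close>
  obtain ds where ds: "length ds = q" "distinct ds" "0 \<notin> set ds" "set ds \<inter> (?F \<union> set I \<union> set J \<union> set cs) = {}"
    using fresh_list[of "?F \<union> set I \<union> set J \<union> set cs" q] by auto
  have csJ: "sing (cs, J) (1 :: 'k) \<in> N"
    by (rule slstable_word[OF N w]) (use d cs IJ in auto)
  have csds: "sing (cs, ds) (1 :: 'k) \<in> N"
    by (rule slstable_word'[OF N csJ]) (use d cs ds IJ in auto)
  have base: "sing (cs, js) (1 :: 'k) \<in> N" if "set js \<subseteq> ?F" "js \<in> wordset q" for js
    by (rule slstable_word'[OF N csds]) (use that cs ds in \<open>auto simp: wordset_def\<close>)
  have "t \<in> tless p q \<Longrightarrow> (\<And>is js. (is, js) \<in> pkeys t \<Longrightarrow> take k is = take k cs \<and> set (drop k is) \<subseteq> ?F \<and> set js \<subseteq> ?F)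
      \<Longrightarrow> t \<in> N" if "k \<le> p" for k t
    using that
  \<comment> \<open>Downward induction: at k = p the V part of every word is \<open>cs\<close>, and
    each term lies in N by the previous fact.\<close>
  proof (induction k arbitrary: t rule: inc_induct)
    case base
    have "pscale (lk t w) (sing w 1) \<in> N" if w: "w \<in> pkeys t" for w
    proof -
      obtain "is" js where ww: "w = (is, js)" by force
      have l: "length is = p" "js \<in> wordset q"
        using tless_mixed[OF base.prems(1)] w ww by (auto simp: mixed_def wordset_def)
      then have "is = cs" "set js \<subseteq> ?F" using base.prems(2)[of "is" js] w ww cs(1) by auto
      then show ?thesis
        unfolding ww using pvs.subspace_scale[OF slstable_subspace[OF N]] \<open>\<And>js. set js \<subseteq> ?F \<Longrightarrow> js \<in> wordset q \<Longrightarrow> sing (cs, js) 1 \<in> N\<close> l by blast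
    qed
    then show ?case
      by (subst poly_mapping_expand) (rule pvs.subspace_sum[OF slstable_subspace[OF N]])
  next
    case (step k)
    define c where "c = cs ! k"
    have k: "k < p" by fact
    have tm: "t \<in> mixed p q" by (rule tless_mixed) fact
    let ?S = "\<lambda>a. relet_at k a c t"
    have S: "lk (?S a) (is, js) = (if is ! k = c then lk t (is[k := a], js) else 0)" for a "is" js
      by (rule lookup_relet_at[OF tm k])
    have "c \<in> set cs" using cs(1) k by (simp add: c_def)
    then have c: "c \<in> set cs" "c \<notin> ?F" "c \<noteq> 0" using cs(3,4) by auto
    have cfresh: "c \<notin> letters t"
    proof
      assume "c \<in> letters t"
      then obtain "is" js where w: "(is, js) \<in> pkeys t" "c \<in> set is \<union> set js" by (auto simp: letters_def)
      then have "c \<in> set (take k is) \<union> set (drop k is) \<union> set js" by (metis append_take_drop_id set_append)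
      then have "c \<in> set (take k cs)" using step.prems(2)[OF w(1)] c(2) by auto
      then obtain l where "l < k" "cs ! l = cs ! k" using k cs(1) by (auto simp: in_set_conv_nth c_def)
      then show False using cs(1,2) k by (simp add: nth_eq_iff_index_eq)
    qed
    then have c0: "lk t (is, js) = 0" if "c \<in> set is \<union> set js" for "is" js
      using letters_lookup[of t "is" js] that by auto
    have keyS: "a \<in> ?F \<and> a \<noteq> 0 \<and> (is[k := a], js) \<in> pkeys t \<and> is ! k = c \<and> length is = p"
      if "(is, js) \<in> pkeys (?S a)" for a "is" js
    proof -
      have 1: "is ! k = c" "(is[k := a], js) \<in> pkeys t" using that by (auto simp: in_keys_iff S split: if_splits)
      then have m: "is[k := a] \<in> wordset p" using tm by (auto simp: mixed_def)
      then have l: "length is = p" by (simp add: wordset_def)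
      have "a \<in> set (is[k := a])" using l k by (simp add: set_update_memI)
      moreover have "is[k := a] ! k \<in> set (drop k (is[k := a]))" using l k by (metis Cons_nth_drop_Suc length_list_update list.set_intros(1))
      ultimately show ?thesis using 1 l m step.prems(2)[OF 1(2)] k by (auto simp: wordset_def)
    qed
    have Sm: "?S a \<in> mixed p q" for a
    proof (rule mixedI)
      fix "is" js assume "lk (?S a) (is, js) \<noteq> 0"
      then have "(is, js) \<in> pkeys (?S a)" by (simp add: in_keys_iff)
      from keyS[OF this] have K: "(is[k := a], js) \<in> pkeys t" "is ! k = c" "length is = p" by auto
      have "is[k := a] \<in> wordset p" "js \<in> wordset q" using K(1) tm by (auto simp: mixed_def)
      moreover have "is = (is[k := a])[k := c]" using K by (metis list_update_id list_update_overwrite)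
      ultimately show "is \<in> wordset p \<and> js \<in> wordset q" using wordset_update[OF _ c(3)] by metis
    qed
    \<comment> \<open>A contraction of the new position k would need c in the dual part too, where
      it does not occur; every other contraction is one of t.\<close>
    have St: "?S a \<in> tless p q" for a
    proof (rule tlessI[of _ _ _ "letters t \<union> letters (?S a)", OF Sm])
      let ?L = "letters t \<union> letters (?S a)"
      fix i j and "is" js :: "int list" assume ij: "i < p" "j < q" and l: "length is = p" "length js = q"
      show "(\<Sum>e\<in>?L. lk (?S a) (is[i := e], js[j := e])) = 0"
      proof (cases "i = k")
        case True
        have "lk (?S a) (is[i := e], js[j := e]) = 0" for e
          using c0[of "is[k := a]" "js[j := c]"] set_update_memI[of j js c] ij l True by (simp add: S)
        then show ?thesis by simp
      next
        case False
        have "(\<Sum>e\<in>?L. lk (?S a) (is[i := e], js[j := e]))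
            = (if is ! k = c then \<Sum>e\<in>?L. lk t (is[k := a, i := e], js[j := e]) else 0)"
          using False by (auto simp: S list_update_swap intro!: sum.cong sum.neutral)
        also have "\<dots> = 0"
          using tlessD[OF step.prems(1) ij, of "is[k := a]" js ?L] l by simp
        finally show ?thesis .
      qed
    qed auto
    have SN: "?S a \<in> N" for a
    proof (rule step.IH[OF St])
      fix "is" js assume "(is, js) \<in> pkeys (?S a)"
      from keyS[OF this] have K: "(is[k := a], js) \<in> pkeys t" "is ! k = c" "length is = p" by auto
      have "take k (is[k := a]) = take k cs" "set (drop k (is[k := a])) \<subseteq> ?F" "set js \<subseteq> ?F"
        using step.prems(2)[OF K(1)] by auto
      moreover have "drop (Suc k) (is[k := a]) = drop (Suc k) is" by simp
      moreover have "set (drop (Suc k) (is[k := a])) \<subseteq> set (drop k (is[k := a]))"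
        by (rule set_drop_subset_set_drop) simp
      ultimately show "take (Suc k) is = take (Suc k) cs \<and> set (drop (Suc k) is) \<subseteq> ?F \<and> set js \<subseteq> ?F"
        using K(2,3) k cs(1) by (auto simp: take_Suc_conv_app_nth c_def)
    qed
    have F0: "a \<noteq> 0" if "a \<in> ?F" for a
      using that tless_mixed[OF t0] by (force simp: letters_def mixed_def wordset_def)
    have eN: "ee a c (?S a) \<in> N" if "a \<in> ?F" for a
      by (rule slstable_ee[OF N SN]) (use c F0[OF that] that in auto)
    have e: "t = (\<Sum>a\<in>?F. ee a c (?S a))"
    proof (rule mixed_eqI[OF tm])
      show "(\<Sum>a\<in>?F. ee a c (?S a)) \<in> mixed p q"
        by (intro mixed_sum slstable_mixed[OF N] eN)
      fix "is" js assume "is \<in> wordset p" "js \<in> wordset q"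
      then have l: "length is = p" "length js = q" by (auto simp: wordset_def)
      have 1: "lsub a c (\<lambda>u. lk (?S a) (u, js)) is = (if is ! k = a then lk t (is, js) else 0)" for a
      proof -
        have "(if is ! m = a then lk (?S a) (is[m := c], js) else 0)
            = (if m = k then if is ! k = a then lk t (is, js) else 0 else 0)" if m: "m < length is" for m
        proof (cases "m = k")
          case True
          then show ?thesis using m by (auto simp: S)
        next
          case False
          have "c \<in> set (is[m := c, k := a])"
            using m False by (metis length_list_update nth_list_update_eq nth_list_update_neq nth_mem)
          then show ?thesis using False c0[of "is[m := c, k := a]" js] by (simp add: S)
        qed
        then have "lsub a c (\<lambda>u. lk (?S a) (u, js)) is = (\<Sum>m<length is. if m = k then if is ! k = a then lk t (is, js) else 0 else 0)"
          unfolding lsub_def by (intro sum.cong) auto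
        then show ?thesis using l k by simp
      qed
      have 2: "(\<Sum>a\<in>?F. lsub c a (\<lambda>v. lk (?S a) (is, v)) js) = 0"
      proof -
        have "(\<Sum>a\<in>?F. lsub c a (\<lambda>v. lk (?S a) (is, v)) js)
            = (\<Sum>b<q. \<Sum>a\<in>?F. if js ! b = c then lk (?S a) (is, js[b := a]) else 0)"
          unfolding lsub_def l(2) by (rule sum.swap)
        also have "\<dots> = 0"
        proof (rule sum.neutral, rule ballI)
          fix b assume b: "b \<in> {..<q}"
          \<comment> \<open>Letters of t outside of \<open>?F\<close> do not occur in its dual
            words, so the sum over \<open>?F\<close> is already a full contraction.\<close>
          have "(\<Sum>a\<in>?F. lk t (is[k := a], js[b := a])) = (\<Sum>a\<in>?F \<union> letters t. lk t (is[k := a], js[b := a]))"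
          proof (rule sum.mono_neutral_left)
            show "\<forall>a\<in>?F \<union> letters t - ?F. lk t (is[k := a], js[b := a]) = 0"
            proof
              fix a assume a: "a \<in> ?F \<union> letters t - ?F"
              have "a \<in> set (js[b := a])" using b l by (simp add: set_update_memI)
              then have "(is[k := a], js[b := a]) \<notin> pkeys t" using step.prems(2) a by blast
              then show "lk t (is[k := a], js[b := a]) = 0" by (simp add: in_keys_iff)
            qed
          qed auto
          also have "\<dots> = 0" by (rule tlessD[OF step.prems(1) k]) (use b l in auto)
          finally show "(\<Sum>a\<in>?F. if js ! b = c then lk (?S a) (is, js[b := a]) else 0) = 0"
            by (cases "js ! b = c"; cases "is ! k = c") (simp_all add: S)
        qed
        finally show ?thesis .
      qed
      have "lk (\<Sum>a\<in>?F. ee a c (?S a)) (is, js) = (\<Sum>a\<in>?F. if is ! k = a then lk t (is, js) else 0)"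
        by (simp add: lookup_sum lookup_ee sum_subtractf 1 2)
      also have "\<dots> = lk t (is, js)"
      proof (cases "lk t (is, js) = 0")
        case False
        then have "set (drop k is) \<subseteq> ?F" using step.prems(2)[of "is" js] by (simp add: in_keys_iff)
        moreover have "is ! k \<in> set (drop k is)" using l k by (metis Cons_nth_drop_Suc list.set_intros(1))
        ultimately show ?thesis by auto
      qed simp
      finally show "lk t (is, js) = lk (\<Sum>a\<in>?F. ee a c (?S a)) (is, js)" ..
    qed
    have "(\<Sum>a\<in>?F. ee a c (?S a)) \<in> N"
      by (rule pvs.subspace_sum[OF slstable_subspace[OF N] eN])
    then show ?case unfolding e[symmetric] .
  qed
  from this[of 0 t0] show "t0 \<in> N"
    using t0 letters_lookup[of t0] by (simp add: in_keys_iff)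
qed

section \<open>Passing to words with distinct letters\<close>

lemma ee_fresh:
  assumes c: "c \<notin> letters u"
  shows "lk (ee c a u) (is, js) = (\<Sum>m<length is. if is ! m = c then lk u (is[m := a], js) else 0)"
proof -
  have "lsub a c (\<lambda>v. lk u (is, v)) js = 0"
    unfolding lsub_def
  proof (rule sum.neutral, rule ballI)
    fix b assume "b \<in> {..<length js}"
    then have "c \<in> set (js[b := c])" by (simp add: set_update_memI)
    then show "(if js ! b = a then lk u (is, js[b := c]) else 0) = 0"
      using letters_lookup[of u "is" "js[b := c]"] c by auto
  qed
  then show ?thesis by (simp add: lookup_ee lsub_def)
qed

text \<open>Polarization: while a word has a letter a outside of A, \<open>ee c a\<close> with a
  fresh c replaces one occurrence of a at a time. Nothing cancels, since a word containing c comes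
  from only one word of u. The clause on dual words records that no new ones arise, so that the two
  sides can be treated in turn; F keeps their letters apart.\<close>

lemma nonzero_multilinear_V:
  fixes N :: "((int list \<times> int list) \<Rightarrow>\<^sub>0 'k::field) set"
  assumes N: "slstable p q N" and t: "t \<in> N" "t \<noteq> 0" and F: "finite F" and k: "k \<le> p"
  shows "\<exists>u\<in>N. u \<noteq> 0 \<and> (\<exists>A. finite A \<and> card A = k \<and> A \<inter> F = {} \<and>
    (\<forall>is js. (is, js) \<in> pkeys u \<longrightarrow> (\<forall>x\<in>A. count (mset is) x = 1) \<and> A \<inter> set js = {} \<and> (\<exists>us. (us, js) \<in> pkeys t)))"
  using k
proof (induction k)
  case 0
  show ?case using t by (intro bexI[of _ t] conjI exI[of _ "{}"]) auto
next
  case (Suc k)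
  then obtain u A where u: "u \<in> N" "u \<noteq> 0" and A: "finite A" "card A = k" "A \<inter> F = {}"
    and key: "\<And>is js. (is, js) \<in> pkeys u \<Longrightarrow> (\<forall>x\<in>A. count (mset is) x = 1) \<and> A \<inter> set js = {} \<and> (\<exists>us. (us, js) \<in> pkeys t)"
    by (auto simp: Suc_le_eq)
  obtain is0 js0 where w0: "(is0, js0) \<in> pkeys u" using u(2) by (metis ex_in_conv keys_eq_empty prod.exhaust)
  have w0': "is0 \<in> wordset p" using w0 slstable_mixed[OF N u(1)] by (auto simp: mixed_def)
  \<comment> \<open>Otherwise the word would consist of k letters, each occurring once, but its
    length is p and k < p.\<close>
  have "\<not> set is0 \<subseteq> A"
  proof
    assume s: "set is0 \<subseteq> A"
    have c: "count (mset is0) x = 1" if "x \<in> A" for x using key[OF w0] that by blast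
    have "set is0 = A"
    proof
      show "A \<subseteq> set is0" using c by (metis count_mset_0_iff subsetI zero_neq_one)
    qed fact
    then have "size (mset is0) = (\<Sum>x\<in>A. 1)"
      unfolding size_multiset_overloaded_eq using c by (intro sum.cong) auto
    then show False using A(2) w0' Suc.prems by (simp add: wordset_def)
  qed
  then obtain a where a: "a \<in> set is0" "a \<notin> A" by blast
  have a0: "a \<noteq> 0" using w0' a(1) by (auto simp: wordset_def)
  obtain c where c: "c \<notin> A \<union> F \<union> letters u \<union> {0}"
    using ex_new_if_finite[OF infinite_UNIV_int, of "A \<union> F \<union> letters u \<union> {0}"] A(1) F by auto
  have ca: "c \<noteq> a" using c a(1) w0 by (force simp: letters_def)
  let ?u = "ee c a u"
  have look: "lk ?u (is, js) = (\<Sum>m<length is. if is ! m = c then lk u (is[m := a], js) else 0)" for "is" js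
    by (rule ee_fresh) (use c in simp)
  have keyu: "\<exists>m<length is. is ! m = c \<and> (is[m := a], js) \<in> pkeys u" if "(is, js) \<in> pkeys ?u" for "is" js
  proof (rule ccontr)
    assume "\<not> ?thesis"
    then have "lk ?u (is, js) = 0" unfolding look by (intro sum.neutral) (auto simp: in_keys_iff)
    then show False using that by (simp add: in_keys_iff)
  qed
  have notin: "c \<notin> set is \<union> set js" if "(is, js) \<in> pkeys u" for "is" js
    using that c by (force simp: letters_def)
  show ?case
  proof (intro bexI[of _ ?u] conjI exI[of _ "insert c A"] allI impI)
    show "?u \<in> N" by (rule slstable_ee[OF N u(1)]) (use c a0 ca in auto)
    obtain l where l: "l < length is0" "is0 ! l = a" using a(1) by (metis in_set_conv_nth)
    have "lk ?u (is0[l := c], js0) = (\<Sum>m<length is0. if m = l then lk u (is0, js0) else 0)"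
      unfolding look length_list_update
    proof (rule sum.cong[OF refl])
      fix m assume m: "m \<in> {..<length is0}"
      show "(if is0[l := c] ! m = c then lk u (is0[l := c, m := a], js0) else 0) = (if m = l then lk u (is0, js0) else 0)"
        using m l notin[OF w0] by (cases "m = l") auto
    qed
    also have "\<dots> = lk u (is0, js0)" using l by simp
    finally show "?u \<noteq> 0" using w0 by (metis in_keys_iff lookup_zero)
  next
    fix "is" js assume "(is, js) \<in> pkeys ?u"
    then obtain m where m: "m < length is" "is ! m = c" "(is[m := a], js) \<in> pkeys u" using keyu by blast
    note K = key[OF m(3)] notin[OF m(3)]
    show "\<exists>us. (us, js) \<in> pkeys t" using K by blast
    show "insert c A \<inter> set js = {}" using K by auto
    have cs: "mset (is[m := a]) = add_mset a (mset is - {#c#})" using m by (simp add: mset_update)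
    have "count (mset is - {#c#}) c = 0"
    proof -
      have "count (mset (is[m := a])) c = 0" using K(2) by (simp add: count_mset_0_iff)
      then show ?thesis unfolding cs using ca by (simp del: count_diff)
    qed
    moreover have "c \<in># mset is" using m by auto
    ultimately have "count (mset is) c = 1" by (metis count_add_mset insert_DiffM One_nat_def)
    moreover have "count (mset is) x = 1" if "x \<in> A" for x
    proof -
      have "x \<noteq> c" "x \<noteq> a" using that c a by auto
      then show ?thesis using K(1) that unfolding cs by auto
    qed
    ultimately show "\<forall>x\<in>insert c A. count (mset is) x = 1" by blast
  qed (use A c in auto)
qed

text \<open>The V part is polarized, and then the dual part after \<open>flip\<close>, with the
  letters A of the first step excluded.\<close>

lemma nonzero_multilinear:
  fixes N :: "((int list \<times> int list) \<Rightarrow>\<^sub>0 'k::field) set"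
  assumes N: "slstable p q N" and t: "t \<in> N" "t \<noteq> 0"
  obtains u A B where "u \<in> N" "u \<noteq> 0" "A \<inter> B = {}"
    "\<And>is js. (is, js) \<in> pkeys u \<Longrightarrow> distinct is \<and> set is = A \<and> distinct js \<and> set js = B"
proof -
  have D: "distinct is \<and> set is = A"
    if "finite A" "card A = length is" "\<forall>x\<in>A. count (mset is) x = 1" for A and "is" :: "int list"
  proof -
    have sub: "A \<subseteq> set is" using that(3) by (metis count_mset_0_iff subsetI zero_neq_one)
    then have "card A \<le> card (set is)" by (simp add: card_mono)
    then have e: "card (set is) = length is" using that(2) card_length[of "is"] by simp
    then have "set is = A" using sub that(2) by (metis List.finite_set card_subset_eq)
    with e show ?thesis by (simp add: card_distinct)
  qed
  obtain u A where u: "u \<in> N" "u \<noteq> 0" and A: "finite A" "card A = p"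
    and key: "\<And>is js. (is, js) \<in> pkeys u \<Longrightarrow> \<forall>x\<in>A. count (mset is) x = 1"
    using nonzero_multilinear_V[OF N t finite.emptyI le_refl] by blast
  have keyA: "distinct is \<and> set is = A" if "(is, js) \<in> pkeys u" for "is" js
    using that slstable_mixed[OF N u(1)] A key[OF that] by (intro D) (auto simp: mixed_def wordset_def)
  have fu: "flip u \<in> flip ` N" "flip u \<noteq> 0"
  proof -
    show "flip u \<in> flip ` N" by (rule imageI[OF u(1)])
    show "flip u \<noteq> 0"
    proof
      assume "flip u = 0"
      then have "flip (flip u) = flip 0" by (rule arg_cong)
      then show False using u(2) by (simp only: flip_flip plinear_0[OF plinear_flip])
    qed
  qed
  note fN = slstable_flip[OF N]
  obtain v B where v: "v \<in> flip ` N" "v \<noteq> 0" and B: "finite B" "card B = q" "B \<inter> A = {}"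
    and keyv: "\<And>js is. (js, is) \<in> pkeys v \<Longrightarrow> (\<forall>x\<in>B. count (mset js) x = 1) \<and> (\<exists>us. (us, is) \<in> pkeys (flip u))"
    using nonzero_multilinear_V[OF fN fu A(1) le_refl] by blast
  obtain w where w: "w \<in> N" "v = flip w" using v(1) by auto
  show thesis
  proof (rule that[of w A B])
    show "w \<in> N" by fact
    show "w \<noteq> 0" using v(2) w(2) plinear_0[OF plinear_flip] by metis
    show "A \<inter> B = {}" using B(3) by blast
    fix "is" js assume k: "(is, js) \<in> pkeys w"
    then have "(js, is) \<in> pkeys v" by (simp add: w(2) keys_flip)
    from keyv[OF this] obtain us where 1: "\<forall>x\<in>B. count (mset js) x = 1" and 2: "(us, is) \<in> pkeys (flip u)" by blast
    have "(is, us) \<in> pkeys u" using 2 keys_flip[of us "is" u] by simp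
    moreover have "distinct js \<and> set js = B"
      using k slstable_mixed[OF N w(1)] B 1 by (intro D) (auto simp: mixed_def wordset_def)
    ultimately show "distinct is \<and> set is = A \<and> distinct js \<and> set js = B" using keyA by blast
  qed
qed

lemma keys_relet: "(is, js) \<in> pkeys (relet f u) \<Longrightarrow> \<exists>us. is = map f us \<and> (us, js) \<in> pkeys u"
proof (rule ccontr)
  assume k: "(is, js) \<in> pkeys (relet f u)" and n: "\<not> ?thesis"
  have "lk (relet f u) (is, js) = (\<Sum>w\<in>pkeys u. lk u w * lk (sing (map f (fst w), snd w) 1) (is, js))"
    unfolding relet_def lookup_lext ..
  also have "\<dots> = 0"
    by (rule sum.neutral) (use n in \<open>auto simp: lookup_single when_def\<close>)
  finally show False using k by (simp add: in_keys_iff)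
qed

text \<open>Arbitrary renamings of the letters are obtained through fresh letters.\<close>

lemma slstable_rename:
  assumes N: "slstable p q N" and u: "u \<in> N"
    and keys: "\<And>is js. (is, js) \<in> pkeys u \<Longrightarrow> distinct is \<and> set is = set I \<and> set js \<inter> set I = {}"
    and I: "distinct I" "0 \<notin> set I" and I': "length I' = length I" "set I' \<subseteq> set I"
  shows "\<exists>f. map f I = I' \<and> relet f u \<in> N"
proof -
  obtain C where C: "length C = length I" "distinct C" "0 \<notin> set C" "set C \<inter> (set I \<union> letters u) = {}"
    using fresh_list[of "set I \<union> letters u" "length I"] by auto
  obtain f where f: "map f I = C" using ex_letter_map[OF I(1) C(1)] by blast
  obtain g where g: "map g C = I'" using ex_letter_map[OF C(2), of I'] I'(1) C(1) by auto
  have fi: "f ` set I = set C" and gi: "g ` set C = set I'" using f g by (metis set_map)+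
  have lt: "set js \<subseteq> letters u" if "(is, js) \<in> pkeys u" for "is" js
    using that by (force simp: letters_def)
  have 1: "relet f u \<in> N"
  proof (rule slstable_relet[OF N u, of "set I"])
    fix "is" js assume k: "(is, js) \<in> pkeys u"
    show "distinct is \<and> set is = set I \<and> set js \<inter> f ` set I = {}"
      using keys[OF k] lt[OF k] C(4) unfolding fi by blast
  qed (use C fi in auto)
  have inj: "inj_on f (set I)" using f C(2) by (metis distinct_map)
  have 2: "relet g (relet f u) \<in> N"
  proof (rule slstable_relet[OF N 1, of "set C"])
    fix "is" js assume "(is, js) \<in> pkeys (relet f u)"
    then obtain us where us: "is = map f us" "(us, js) \<in> pkeys u" using keys_relet by blast
    then have "distinct us" "set us = set I" "set js \<inter> set I = {}" using keys by blast+
    then show "distinct is \<and> set is = set C \<and> set js \<inter> g ` set C = {}"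
      using us(1) inj fi gi I'(2) by (auto simp: distinct_map)
  qed (use C gi I I' in auto)
  have "relet g (relet f u) = relet (g \<circ> f) u"
    by (rule plinear_eqI[OF plinear_compose[OF plinear_relet plinear_relet] plinear_relet]) simp
  moreover have "map (g \<circ> f) I = I'" using f g by (simp flip: map_map)
  ultimately show ?thesis using 2 by metis
qed

section \<open>The group algebra of the product of two symmetric groups\<close>

definition balg :: "nat \<Rightarrow> nat \<Rightarrow> ((sym \<times> sym) \<Rightarrow>\<^sub>0 'k::field) set" where
  "balg p q = {x. pkeys x \<subseteq> Sy p \<times> Sy q}"

lemma balg_single: "fst g \<in> Sy p \<Longrightarrow> snd g \<in> Sy q \<Longrightarrow> sing g c \<in> balg p q"
  by (auto simp: balg_def mem_Times_iff)

lemma balg_keys: "x \<in> balg p q \<Longrightarrow> g \<in> pkeys x \<Longrightarrow> fst g \<in> Sy p" "x \<in> balg p q \<Longrightarrow> g \<in> pkeys x \<Longrightarrow> snd g \<in> Sy q"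
  unfolding balg_def by (auto dest!: subsetD)

lemma balg_mult:
  assumes "x \<in> balg p q" "y \<in> balg p q"
  shows "x * y \<in> balg p q"
proof -
  have "g \<in> Sy p \<times> Sy q" if g: "g \<in> pkeys (x * y)" for g
  proof -
    obtain a b where "g = a + b" "a \<in> pkeys x" "b \<in> pkeys y"
      using keys_mult[of x y] g by blast
    then show ?thesis using balg_keys[OF assms(1)] balg_keys[OF assms(2)] by (simp add: mem_Times_iff Sy_plus)
  qed
  then show ?thesis by (auto simp: balg_def)
qed

lemma balg_expand: "x \<in> balg p q \<Longrightarrow> x = (\<Sum>g\<in>Sy p \<times> Sy q. pscale (lk x g) (sing g 1))"
  by (subst poly_mapping_expand[of x], rule sum.mono_neutral_left)
    (auto simp: balg_def in_keys_iff)

lemma plinear_mult_left: "plinear (\<lambda>x. x * y :: 'g::monoid_add \<Rightarrow>\<^sub>0 'k::field)"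
  by (simp add: plinear_def ring_distribs pscale_mult_left)
lemma plinear_mult_right: "plinear (\<lambda>y. x * y :: 'g::monoid_add \<Rightarrow>\<^sub>0 'k::field)"
  by (simp add: plinear_def ring_distribs mult_pscale_right)

lemma plinear_tprod_left: "plinear (\<lambda>x. tprod x y)"
  unfolding plinear_def
  by (auto intro!: poly_mapping_eqI simp: lookup_add ring_distribs mult.assoc split_paired_all)
lemma plinear_tprod_right: "plinear (\<lambda>y. tprod x y)"
  unfolding plinear_def
  by (auto intro!: poly_mapping_eqI simp: lookup_add ring_distribs mult.left_commute split_paired_all)
lemma tprod_single [simp]: "tprod (sing a b) (sing c d) = sing (a, c) (b * d)"
  by (rule poly_mapping_eqI) (auto simp: lookup_single when_def split_paired_all)

lemma tprod_mult:
  fixes x x' :: "'g::monoid_add \<Rightarrow>\<^sub>0 'k::field" and y y' :: "'h::monoid_add \<Rightarrow>\<^sub>0 'k"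
  shows "tprod x y * tprod x' y' = tprod (x * x') (y * y')"
proof (rule plinear_eqI[where t = x])
  show "plinear (\<lambda>x. tprod x y * tprod x' y')" "plinear (\<lambda>x. tprod (x * x') (y * y'))"
    by (rule plinear_compose[OF plinear_mult_left plinear_tprod_left]
        plinear_compose[OF plinear_tprod_left plinear_mult_left])+
  fix a :: 'g
  show "tprod (sing a 1) y * tprod x' y' = tprod (sing a 1 * x') (y * y')"
  proof (rule plinear_eqI[where t = y])
    show "plinear (\<lambda>y. tprod (sing a 1) y * tprod x' y')" "plinear (\<lambda>y. tprod (sing a 1 * x') (y * y'))"
      by (rule plinear_compose[OF plinear_mult_left plinear_tprod_right]
          plinear_compose[OF plinear_tprod_right plinear_mult_left])+
    fix b :: 'h
    show "tprod (sing a 1) (sing b 1) * tprod x' y' = tprod (sing a 1 * x') (sing b 1 * y')"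
    proof (rule plinear_eqI[where t = x'])
      show "plinear (\<lambda>x'. tprod (sing a 1) (sing b 1) * tprod x' y')"
        "plinear (\<lambda>x'. tprod (sing a 1 * x') (sing b 1 * y'))"
        by (rule plinear_compose[OF plinear_mult_right plinear_tprod_left]
            plinear_compose[OF plinear_tprod_left plinear_mult_right])+
      fix c :: 'g
      show "tprod (sing a 1) (sing b 1) * tprod (sing c 1) y' = tprod (sing a 1 * sing c 1) (sing b 1 * y')"
      proof (rule plinear_eqI[where t = y'])
        show "plinear (\<lambda>y'. tprod (sing a 1) (sing b 1) * tprod (sing c 1) y')"
          "plinear (\<lambda>y'. tprod (sing a 1 * sing c 1) (sing b 1 * y'))"
          by (rule plinear_compose[OF plinear_mult_right plinear_tprod_right]
              plinear_compose[OF plinear_tprod_right plinear_mult_right])+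
      qed (simp add: mult_single)
    qed
  qed
qed

lemma tprod_balg: "x \<in> galg p \<Longrightarrow> y \<in> galg q \<Longrightarrow> tprod x y \<in> balg p q"
  by (auto simp: balg_def galg_def in_keys_iff subset_iff)

section \<open>Action of the product group algebra on mixed tensors\<close>

definition bact :: "((sym \<times> sym) \<Rightarrow>\<^sub>0 'k::field) \<Rightarrow> ((int list \<times> int list) \<Rightarrow>\<^sub>0 'k) \<Rightarrow> (int list \<times> int list) \<Rightarrow>\<^sub>0 'k" where
  "bact x t = lext (\<lambda>g. pact g t) x"

lemma plinear_bact_left: "plinear (\<lambda>x. bact x t)"
  unfolding bact_def by (rule plinear_lext)

lemma plinear_bact: "plinear (bact x)"
  unfolding bact_def lext_def by (intro plinear_fsum plinear_fpscale plinear_pact)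

lemma bact_single [simp]: "bact (sing g c) t = pscale c (pact g t)"
  by (simp add: bact_def)

lemma bact_mixed:
  assumes "x \<in> balg p q" "t \<in> mixed p q"
  shows "bact x t \<in> mixed p q"
  unfolding bact_def
  by (rule mixed_lext, rule pact_mixed) (use assms balg_keys[OF assms(1)] in auto)

lemma bact_mult:
  assumes x: "x \<in> balg p q" and y: "y \<in> balg p q" and t: "t \<in> mixed p q"
  shows "bact (x * y) t = bact x (bact y t)"
proof (rule plinear_eqI[where t = x])
  show "plinear (\<lambda>x. bact (x * y) t)" "plinear (\<lambda>x. bact x (bact y t))"
    by (rule plinear_compose[OF plinear_bact_left plinear_mult_left] plinear_bact_left)+
  fix g assume "g \<in> pkeys x"
  then have g: "fst g \<in> Sy p" "snd g \<in> Sy q" by (auto intro: balg_keys[OF x])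
  show "bact (sing g 1 * y) t = bact (sing g 1) (bact y t)"
  proof (rule plinear_eqI[where t = y])
    show "plinear (\<lambda>y. bact (sing g 1 * y) t)" "plinear (\<lambda>y. bact (sing g 1) (bact y t))"
      by (rule plinear_compose[OF plinear_bact_left plinear_mult_right] plinear_compose[OF plinear_bact plinear_bact_left])+
    fix h assume "h \<in> pkeys y"
    then have h: "fst h \<in> Sy p" "snd h \<in> Sy q" by (auto intro: balg_keys[OF y])
    show "bact (sing g 1 * sing h 1) t = bact (sing g 1) (bact (sing h 1) t)"
      using pact_plus[OF g h t] by (simp add: mult_single)
  qed
qed

lemma bact_ee:
  assumes "x \<in> balg p q" "t \<in> mixed p q" "a \<noteq> 0" "b \<noteq> 0"
  shows "bact x (ee a b t) = ee a b (bact x t)"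
proof (rule plinear_eqI[where t = x])
  show "plinear (\<lambda>x. bact x (ee a b t))" "plinear (\<lambda>x. ee a b (bact x t))"
    by (rule plinear_bact_left plinear_compose[OF plinear_ee plinear_bact_left])+
  fix g assume "g \<in> pkeys x"
  then have g: "fst g \<in> Sy p" "snd g \<in> Sy q" by (auto intro: balg_keys[OF assms(1)])
  show "bact (sing g 1) (ee a b t) = ee a b (bact (sing g 1) t)"
    using pact_ee[OF g assms(2,3,4)] by simp
qed

lemma bact_tless:
  assumes "x \<in> balg p q" "t \<in> tless p q"
  shows "bact x t \<in> tless p q"
  unfolding bact_def lext_def
  by (intro pvs.subspace_sum[OF tless_subspace] pvs.subspace_scale[OF tless_subspace] pact_tless)
    (use assms balg_keys[OF assms(1)] in auto)

section \<open>The regular action on words with distinct letters\<close>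

lemma wperm_eq_iff:
  assumes d: "distinct I" "distinct J" and g: "g \<in> Sy (length I) \<times> Sy (length J)" "h \<in> Sy (length I) \<times> Sy (length J)"
  shows "wperm g (I, J) = wperm h (I, J) \<longleftrightarrow> g = h"
proof -
  have "s = t" if d: "distinct xs" and st: "s \<in> Sy (length xs)" "t \<in> Sy (length xs)"
    and e: "permute_list (inv (sfun s)) xs = permute_list (inv (sfun t)) xs" for s t and xs :: "int list"
  proof -
    have "- s = - t"
    proof (rule Sy_ext[of _ "length xs"])
      fix x assume x: "x < length xs"
      have "xs ! (inv (sfun s) x) = xs ! (inv (sfun t) x)"
        using arg_cong[OF e, of "\<lambda>l. l ! x"] x st by (simp add: permute_list_nth Sy_inv_permutes)
      then show "sfun (- s) x = sfun (- t) x"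
        using d x Sy_inv_less st by (simp add: nth_eq_iff_index_eq)
    qed (use st in auto)
    then show "s = t" by simp
  qed
  then show ?thesis using assms by (auto simp: wperm_def prod_eq_iff mem_Times_iff)
qed

lemma lookup_bact_word:
  assumes d: "distinct I" "distinct J" and x: "x \<in> balg (length I) (length J)" and g: "g \<in> Sy (length I) \<times> Sy (length J)"
  shows "lk (bact x (sing (I, J) 1)) (wperm g (I, J)) = lk x g"
proof -
  have "lk (bact x (sing (I, J) 1)) (wperm g (I, J)) = (\<Sum>h\<in>pkeys x. lk x h * (if h = g then 1 else 0))"
    unfolding bact_def lookup_lext
    by (rule sum.cong) (use wperm_eq_iff[OF d _ g] x in \<open>auto simp: lookup_single when_def balg_def subset_iff\<close>)
  then show ?thesis by (simp only: lookup_expand[of x g])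
qed

lemma word_orbit:
  assumes "distinct I" "distinct is" "set is = set I"
  shows "\<exists>s\<in>Sy (length I). is = permute_list (inv (sfun s)) I"
proof -
  have "mset is = mset I" using assms set_eq_iff_mset_eq_distinct by blast
  then obtain f where f: "f permutes {..<length I}" "permute_list f I = is"
    by (rule mset_eq_permutation)
  have "- Abs_sym f \<in> Sy (length I)" using Abs_sym_Sy[OF f(1)] by simp
  moreover have "inv (sfun (- Abs_sym f)) = f"
    using sfun_uminus[of "- Abs_sym f"] sfun_Abs_sym[OF f(1)] by simp
  ultimately show ?thesis using f(2) by (intro bexI[of _ "- Abs_sym f"]) auto
qed

text \<open>The words with these letters form one free orbit, so the coefficients of u along the
  orbit are the coefficients of x.\<close>

lemma multilinear_as_bact:
  fixes u :: "(int list \<times> int list) \<Rightarrow>\<^sub>0 'k::field"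
  assumes d: "distinct I" "distinct J"
    and keys: "\<And>is js. (is, js) \<in> pkeys u \<Longrightarrow> distinct is \<and> set is = set I \<and> distinct js \<and> set js = set J"
  obtains x where "x \<in> balg (length I) (length J)" "bact x (sing (I, J) 1) = u"
proof -
  let ?G = "Sy (length I) \<times> Sy (length J)" and ?w = "\<lambda>g. wperm g (I, J)"
  define x where "x = (\<Sum>g\<in>?G. sing g (lk u (?w g)))"
  have lx: "lk x g = (if g \<in> ?G then lk u (?w g) else 0)" for g
    by (simp add: x_def lookup_sum lookup_single when_def)
  have xb: "x \<in> balg (length I) (length J)"
    by (auto simp: balg_def in_keys_iff lx split: if_splits)
  have "bact x (sing (I, J) 1) = u"
  proof (rule poly_mapping_eqI)
    fix k :: "int list \<times> int list"
    show "lk (bact x (sing (I, J) 1)) k = lk u k"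
    proof (cases "k \<in> ?w ` ?G")
      case True
      then show ?thesis using lookup_bact_word[OF d xb] by (auto simp: lx)
    next
      case False
      have "lk u k = 0"
      proof (rule ccontr)
        assume nz: "lk u k \<noteq> 0"
        obtain "is" js where k: "k = (is, js)" by force
        have "distinct is \<and> set is = set I \<and> distinct js \<and> set js = set J"
          using keys[of "is" js] nz k by (simp add: in_keys_iff)
        then obtain s t where "s \<in> Sy (length I)" "is = permute_list (inv (sfun s)) I"
          "t \<in> Sy (length J)" "js = permute_list (inv (sfun t)) J"
          using word_orbit[OF d(1), of "is"] word_orbit[OF d(2), of js] by blast
        then show False using False k by (auto simp: wperm_def image_iff)
      qed
      moreover have "lk (bact x (sing (I, J) 1)) k = 0"
        unfolding bact_def lookup_lext
        by (rule sum.neutral) (use False xb in \<open>auto simp: lookup_single when_def balg_def subset_iff\<close>)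
      ultimately show ?thesis by simp
    qed
  qed
  with xb show thesis by (rule that)
qed

subsection \<open>Products of Young symmetrizers\<close>

lemma lookup_yla_0: "partition_of la \<Longrightarrow> lk (yla la :: sym \<Rightarrow>\<^sub>0 'k::field) 0 = 1"
  unfolding yla_def ysym_def by (rule lookup_rsum_csum_0[OF young_tab])

lemma yla_square:
  assumes "partition_of la"
  obtains n where "n \<noteq> 0" "yla la * yla la = pscale n (yla la :: sym \<Rightarrow>\<^sub>0 'k::field_char_0)"
  unfolding yla_def by (rule ysym_square[OF young_tab[OF assms]])

lemma yla_sandwich:
  assumes "partition_of la" "x \<in> galg (sum_list la)"
  shows "\<exists>e. yla la * x * yla la = pscale e (yla la :: sym \<Rightarrow>\<^sub>0 'k::field_char_0)"
  unfolding yla_def by (rule ysym_sandwich[OF young_tab[OF assms(1)] assms(2)]) blast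

definition csy :: "nat list \<Rightarrow> nat list \<Rightarrow> (sym \<times> sym) \<Rightarrow>\<^sub>0 'k::field" where
  "csy la mu = tprod (yla la) (yla mu)"

text \<open>The scalar n in c c = n c. It can be read off at the identity because c has coefficient
  1 there (\<open>lookup_csy_0\<close>).\<close>

definition csy_coeff :: "nat list \<Rightarrow> nat list \<Rightarrow> 'k::field" where
  "csy_coeff la mu = lk (csy la mu * csy la mu) 0"

lemma csy_balg [simp]: "csy la mu \<in> balg (sum_list la) (sum_list mu)"
  by (simp add: csy_def tprod_balg)

lemma lookup_csy_0: "partition_of la \<Longrightarrow> partition_of mu \<Longrightarrow> lk (csy la mu) 0 = 1"
  by (simp add: csy_def zero_prod_def lookup_yla_0)

lemma tprod_pscale: "tprod (pscale a x) (pscale b y) = pscale (a * b) (tprod x y)"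
  by (simp add: plinear_pscale[OF plinear_tprod_left] plinear_pscale[OF plinear_tprod_right])

lemma csy_square:
  assumes "partition_of la" "partition_of mu"
  shows "csy la mu * csy la mu = pscale (csy_coeff la mu) (csy la mu :: (sym \<times> sym) \<Rightarrow>\<^sub>0 'k::field_char_0)"
    and "csy_coeff la mu \<noteq> (0 :: 'k)"
proof -
  obtain m where m: "m \<noteq> 0" "yla la * yla la = pscale m (yla la :: sym \<Rightarrow>\<^sub>0 'k)" by (rule yla_square[OF assms(1)])
  obtain n where n: "n \<noteq> 0" "yla mu * yla mu = pscale n (yla mu :: sym \<Rightarrow>\<^sub>0 'k)" by (rule yla_square[OF assms(2)])
  have e: "csy la mu * csy la mu = pscale (m * n) (csy la mu :: (sym \<times> sym) \<Rightarrow>\<^sub>0 'k)"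
    by (simp add: csy_def tprod_mult m n tprod_pscale)
  then have c: "csy_coeff la mu = m * n" by (simp add: csy_coeff_def lookup_csy_0 assms)
  show "csy la mu * csy la mu = pscale (csy_coeff la mu) (csy la mu :: (sym \<times> sym) \<Rightarrow>\<^sub>0 'k)"
    by (simp only: c e)
  show "csy_coeff la mu \<noteq> (0 :: 'k)" using m n by (simp add: c)
qed

lemma csy_mult_single:
  "csy la mu * sing g 1 * csy la' mu' = tprod (yla la * sing (fst g) 1 * yla la') (yla mu * sing (snd g) 1 * yla mu')"
proof -
  have "sing g 1 = tprod (sing (fst g) 1) (sing (snd g) (1 :: 'a))" by simp
  then show ?thesis by (simp only: csy_def tprod_mult)
qed

text \<open>That c x c is a multiple of c is checked on group elements, factor by factor. The scalar
  is its coefficient at the identity, where the trace property turns c x c into c c x.\<close>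

lemma csy_sandwich:
  assumes P: "partition_of la" "partition_of mu" and x: "x \<in> balg (sum_list la) (sum_list mu)"
  shows "csy la mu * x * csy la mu
    = pscale (csy_coeff la mu * lk (csy la mu * x) 0) (csy la mu :: (sym \<times> sym) \<Rightarrow>\<^sub>0 'k::field_char_0)"
proof -
  let ?c = "csy la mu :: (sym \<times> sym) \<Rightarrow>\<^sub>0 'k" and ?G = "Sy (sum_list la) \<times> Sy (sum_list mu)"
  have "\<exists>e. ?c * sing g 1 * ?c = pscale e ?c" if "g \<in> ?G" for g
  proof -
    have g: "fst g \<in> Sy (sum_list la)" "snd g \<in> Sy (sum_list mu)" using that by (auto simp: mem_Times_iff)
    obtain a where "yla la * sing (fst g) 1 * yla la = pscale a (yla la :: sym \<Rightarrow>\<^sub>0 'k)"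
      using yla_sandwich[OF P(1) galg_single[OF g(1)]] by blast
    moreover obtain b where "yla mu * sing (snd g) 1 * yla mu = pscale b (yla mu :: sym \<Rightarrow>\<^sub>0 'k)"
      using yla_sandwich[OF P(2) galg_single[OF g(2)]] by blast
    ultimately have "?c * sing g 1 * ?c = pscale (a * b) ?c"
      unfolding csy_mult_single by (simp add: tprod_pscale csy_def)
    then show ?thesis ..
  qed
  then obtain e where e: "\<And>g. g \<in> ?G \<Longrightarrow> ?c * sing g 1 * ?c = pscale (e g) ?c" by metis
  have "?c * x * ?c = (\<Sum>g\<in>?G. pscale (lk x g) (?c * sing g 1 * ?c))"
    by (subst balg_expand[OF x]) (simp add: sum_distrib_left sum_distrib_right pscale_simps del: pscale_single)
  also have "\<dots> = pscale (\<Sum>g\<in>?G. lk x g * e g) ?c" by (simp add: e pvs.scale_sum_left)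
  finally obtain a where a: "?c * x * ?c = pscale a ?c" by blast
  have "a = lk (?c * x * ?c) 0" by (simp add: a lookup_csy_0 P)
  also have "\<dots> = lk (?c * ?c * x) 0"
    by (subst lookup_times_commute) (simp add: mult.assoc)
  also have "\<dots> = csy_coeff la mu * lk (?c * x) 0" by (simp add: csy_square P pscale_mult_left)
  finally show ?thesis by (simp only: a)
qed

text \<open>Different pairs of shapes differ in at least one component, and there the product
  vanishes by orthogonality for a single symmetric group.\<close>

lemma csy_orthogonal:
  assumes "partition_of la" "partition_of mu" "partition_of la'" "partition_of mu'"
    "sum_list la' = sum_list la" "sum_list mu' = sum_list mu" "(la, mu) \<noteq> (la', mu')"
    and x: "x \<in> balg (sum_list la) (sum_list mu)"
  shows "csy la mu * x * csy la' mu' = (0 :: (sym \<times> sym) \<Rightarrow>\<^sub>0 'k::field_char_0)"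
proof -
  let ?G = "Sy (sum_list la) \<times> Sy (sum_list mu)"
  have z: "csy la mu * sing g 1 * csy la' mu' = (0 :: (sym \<times> sym) \<Rightarrow>\<^sub>0 'k)" if "g \<in> ?G" for g
  proof -
    have "yla la * sing (fst g) 1 * yla la' = (0 :: sym \<Rightarrow>\<^sub>0 'k) \<or> yla mu * sing (snd g) 1 * yla mu' = (0 :: sym \<Rightarrow>\<^sub>0 'k)"
      using assms that yla_orthogonal[of la la' "sing (fst g) 1"] yla_orthogonal[of mu mu' "sing (snd g) 1"]
      by (auto simp: mem_Times_iff)
    then show ?thesis
      unfolding csy_mult_single using plinear_0[OF plinear_tprod_left] plinear_0[OF plinear_tprod_right] by metis
  qed
  have "csy la mu * x * csy la' mu' = (\<Sum>g\<in>?G. pscale (lk x g) (csy la mu * sing g 1 * csy la' mu'))"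
    by (subst balg_expand[OF x]) (simp add: sum_distrib_left sum_distrib_right pscale_simps del: pscale_single)
  then show ?thesis by (simp add: z)
qed

text \<open>The elements all of whose two-sided translates are killed by T form an ideal. It
  contains the Young symmetrizers of all shapes, hence 1. This replaces a decomposition of 1 into
  idempotents.\<close>

lemma plinear_complete:
  fixes T :: "(sym \<Rightarrow>\<^sub>0 'k::field_char_0) \<Rightarrow> ('b \<Rightarrow>\<^sub>0 'k)"
  assumes T: "plinear T"
    and z: "\<And>la g h. partition_of la \<Longrightarrow> sum_list la = d \<Longrightarrow> g \<in> Sy d \<Longrightarrow> h \<in> Sy d \<Longrightarrow> T (sing h 1 * yla la * sing g 1) = 0"
  shows "T 1 = 0"
proof -
  define J where "J = {x. \<forall>y\<in>galg d. \<forall>w\<in>galg d. T (w * x * y) = 0}"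
  have "gideal d J"
    unfolding gideal_def
  proof (intro conjI ballI)
    show "0 \<in> J" by (simp add: J_def plinear_0[OF T])
    fix x assume x: "x \<in> J"
    show "x + y \<in> J" if "y \<in> J" for y
      using x that by (simp add: J_def ring_distribs plinear_add[OF T])
    show "x * y \<in> J" if y: "y \<in> galg d" for y
    proof -
      have "T (w * (x * y) * v) = 0" if "v \<in> galg d" "w \<in> galg d" for v w
      proof -
        have "T (w * x * (y * v)) = 0" using x galg_mult[OF y that(1)] that(2) unfolding J_def by blast
        then show ?thesis by (simp only: mult.assoc)
      qed
      then show ?thesis by (simp add: J_def)
    qed
    show "y * x \<in> J" if y: "y \<in> galg d" for y
    proof -
      have "T (w * (y * x) * v) = 0" if "v \<in> galg d" "w \<in> galg d" for v w
      proof -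
        have "T (w * y * x * v) = 0" using x galg_mult[OF that(2) y] that(1) unfolding J_def by blast
        then show ?thesis by (simp only: mult.assoc)
      qed
      then show ?thesis by (simp add: J_def)
    qed
  qed
  moreover have "yla la \<in> J" if la: "partition_of la" "sum_list la = d" for la
    unfolding J_def
  proof (intro CollectI ballI)
    fix y w :: "sym \<Rightarrow>\<^sub>0 'k" assume y: "y \<in> galg d" and w: "w \<in> galg d"
    have "T (sing h 1 * yla la * y) = 0" if h: "h \<in> Sy d" for h
      by (subst galg_expand[OF y])
        (simp add: sum_distrib_left pscale_simps plinear_sum[OF T] plinear_pscale[OF T] z[OF la _ h] del: pscale_single)
    then show "T (w * yla la * y) = 0"
      by (subst galg_expand[OF w])
        (simp add: sum_distrib_right pscale_simps plinear_sum[OF T] plinear_pscale[OF T] del: pscale_single)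
  qed
  ultimately have "1 \<in> J" by (rule gideal_partition_one)
  then have "T (1 * 1 * 1) = 0" unfolding J_def by (blast intro: galg_1)
  then show ?thesis by simp
qed

lemma tprod_1_1: "tprod 1 1 = (1 :: ('g::monoid_add \<times> 'h::monoid_add) \<Rightarrow>\<^sub>0 'k::field)"
  by (simp add: zero_prod_def flip: single_one)

lemma bact_1 [simp]: "bact 1 t = t"
  by (simp flip: single_one)

text \<open>Completeness is used in one factor at a time: with a translate of the symmetrizer kept
  fixed in the second factor, the first ranges over its group algebra. Left translations are
  harmless because they act after the symmetrizer.\<close>

lemma bact_complete:
  fixes t :: "(int list \<times> int list) \<Rightarrow>\<^sub>0 'k::field_char_0"
  assumes t: "t \<in> mixed p q"
    and z: "\<And>la mu g. partition_of la \<Longrightarrow> partition_of mu \<Longrightarrow> sum_list la = p \<Longrightarrow> sum_list mu = q \<Longrightarrow>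
      g \<in> Sy p \<times> Sy q \<Longrightarrow> bact (csy la mu) (pact g t) = 0"
  shows "t = 0"
proof -
  have b: "tprod x 1 \<in> balg p q" "tprod 1 y \<in> balg p q" if "x \<in> galg p" "y \<in> galg q"
    for x y :: "sym \<Rightarrow>\<^sub>0 'k" using that by (auto intro!: tprod_balg)
  have "bact (tprod 1 1) t = 0"
  proof (rule plinear_complete[where d = q and T = "\<lambda>y. bact (tprod 1 y) t"])
    show "plinear (\<lambda>y. bact (tprod 1 y) t)" by (rule plinear_compose[OF plinear_bact_left plinear_tprod_right])
    fix mu g h assume mu: "partition_of mu" "sum_list mu = q" and g: "g \<in> Sy q" and h: "h \<in> Sy q"
    let ?y = "sing h 1 * yla mu * sing g (1 :: 'k)"
    have y: "?y \<in> galg q" using mu g h yla_galg[of mu] by (intro galg_mult) auto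
    define s where "s = bact (tprod 1 ?y) t"
    have s: "s \<in> mixed p q" unfolding s_def by (rule bact_mixed[OF b(2)[OF galg_1 y] t])
    have "bact (tprod 1 1) s = 0"
    proof (rule plinear_complete[where d = p and T = "\<lambda>x. bact (tprod x 1) s"])
      show "plinear (\<lambda>x. bact (tprod x 1) s)" by (rule plinear_compose[OF plinear_bact_left plinear_tprod_left])
      fix la g' h' assume la: "partition_of la" "sum_list la = p" and g': "g' \<in> Sy p" and h': "h' \<in> Sy p"
      let ?x = "sing h' 1 * yla la * sing g' (1 :: 'k)"
      have x: "?x \<in> galg p" using la g' h' yla_galg[of la] by (intro galg_mult) auto
      have hb: "sing (h', h) 1 \<in> balg p q" "sing (g', g) 1 \<in> balg p q" "csy la mu \<in> balg p q"
        using g g' h h' la mu csy_balg[of la mu] by (auto intro: balg_single)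
      have e: "tprod ?x 1 * tprod 1 ?y = sing (h', h) 1 * (csy la mu * sing (g', g) 1)"
      proof -
        have "sing (h', h) 1 * (csy la mu * sing (g', g) 1) =
            tprod (sing h' 1) (sing h 1) * (tprod (yla la) (yla mu) * tprod (sing g' 1) (sing g (1 :: 'k)))"
          by (simp add: csy_def)
        then show ?thesis by (simp only: tprod_mult mult_1_left mult_1_right mult.assoc)
      qed
      have "bact (tprod ?x 1) s = bact (tprod ?x 1 * tprod 1 ?y) t"
        unfolding s_def by (rule bact_mult[OF b(1)[OF x galg_1] b(2)[OF galg_1 y] t, symmetric])
      also have "\<dots> = bact (sing (h', h) 1) (bact (csy la mu) (bact (sing (g', g) 1) t))"
        unfolding e
        by (simp only: bact_mult[OF hb(1) balg_mult[OF hb(3,2)] t] bact_mult[OF hb(3,2) t])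
      also have "\<dots> = 0"
        using z[OF la(1) mu(1) la(2) mu(2), of "(g', g)"] g g' by (simp add: plinear_0[OF plinear_pact])
      finally show "bact (tprod ?x 1) s = 0" .
    qed
    then show "bact (tprod 1 ?y) t = 0" by (simp add: tprod_1_1 s_def)
  qed
  then show ?thesis by (simp add: tprod_1_1)
qed

subsection \<open>Irreducibility\<close>

text \<open>The Schur condition as an eigenvalue equation instead of membership in an image: c is a
  nonzero multiple of an idempotent, so both agree (\<open>Gamma_mod_eq\<close>), and the equation
  passes directly through operators commuting with c.\<close>

definition gam :: "nat list \<Rightarrow> nat list \<Rightarrow> ((int list \<times> int list) \<Rightarrow>\<^sub>0 'k::field) set" where
  "gam la mu = {t \<in> tless (sum_list la) (sum_list mu). bact (csy la mu) t = pscale (csy_coeff la mu) t}"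

lemma gam_subspace: "pvs.subspace (gam la mu)"
proof (rule pvs.subspaceI)
  note b = plinear_0[OF plinear_bact] plinear_add[OF plinear_bact] plinear_pscale[OF plinear_bact]
  note s = pvs.subspace_0[OF tless_subspace] pvs.subspace_add[OF tless_subspace] pvs.subspace_scale[OF tless_subspace]
  show "0 \<in> gam la mu" by (simp add: gam_def b s)
  show "x + y \<in> gam la mu" if "x \<in> gam la mu" "y \<in> gam la mu" for x y
    using that by (simp add: gam_def b s pvs.scale_right_distrib)
  show "pscale c x \<in> gam la mu" if "x \<in> gam la mu" for c x
    using that by (simp add: gam_def b s mult.commute)
qed

lemma gam_ee: "t \<in> gam la mu \<Longrightarrow> x \<noteq> 0 \<Longrightarrow> y \<noteq> 0 \<Longrightarrow> ee x y t \<in> gam la mu"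
  by (simp add: gam_def ee_tless bact_ee[OF csy_balg tless_mixed] plinear_pscale[OF plinear_ee])

lemma bact_csy_gam:
  fixes t :: "(int list \<times> int list) \<Rightarrow>\<^sub>0 'k::field_char_0"
  assumes "partition_of la" "partition_of mu" "t \<in> tless (sum_list la) (sum_list mu)"
  shows "bact (csy la mu) t \<in> gam la mu"
  unfolding gam_def using assms bact_tless[OF csy_balg assms(3)]
  by (simp add: bact_mult[OF csy_balg csy_balg tless_mixed, symmetric] csy_square plinear_pscale[OF plinear_bact_left])

text \<open>N is not assumed stable under permuting positions, but root vectors can rename letters.
  For the word w with distinct letters, a suitable renaming turns w into g w; as renaming commutes
  with permuting positions, it turns x w into x g w, a right multiplication. The dual part is
  treated through \<open>flip\<close>.\<close>

lemma rename_factors: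
  fixes N :: "((int list \<times> int list) \<Rightarrow>\<^sub>0 'k::field) set"
  assumes N: "slstable p q N" and d: "distinct (I @ J)" and l: "length I = p" "length J = q"
    and z: "0 \<notin> set I" "0 \<notin> set J"
    and x: "x \<in> balg p q" "bact x (sing (I, J) 1) \<in> N" and g: "g \<in> Sy p \<times> Sy q"
  shows "bact (x * sing g 1) (sing (I, J) 1) \<in> N"
proof -
  let ?w = "sing (I, J) 1 :: _ \<Rightarrow>\<^sub>0 'k"
  obtain s r where g: "g = (s, r)" "s \<in> Sy p" "r \<in> Sy q" using g by auto
  have inv_plus: "inv (sfun (a + b)) = inv (sfun b) \<circ> inv (sfun a)" for a b
    by (metis minus_add sfun_plus sfun_uminus)
  have keys: "distinct is \<and> set is = set I \<and> distinct js \<and> set js = set J"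
    if x: "x \<in> balg p q" and k: "(is, js) \<in> pkeys (bact x ?w)" for x "is" js
  proof -
    have "\<exists>h\<in>pkeys x. (is, js) = wperm h (I, J)"
    proof (rule ccontr)
      assume "\<not> ?thesis"
      then have "lk (bact x ?w) (is, js) = 0"
        unfolding bact_def lookup_lext by (intro sum.neutral) (auto simp: lookup_single when_def)
      then show False using k by (simp add: in_keys_iff)
    qed
    then obtain h where h: "h \<in> pkeys x" "(is, js) = wperm h (I, J)" by blast
    then show ?thesis
      using d l balg_keys[OF x h(1)] by (simp add: wperm_def Sy_inv_permutes)
  qed
  have V: "bact (x * sing (s, 0) 1) ?w \<in> N"
  proof -
    have k: "distinct is \<and> set is = set I \<and> set js \<inter> set I = {}" if "(is, js) \<in> pkeys (bact x ?w)" for "is" js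
      using keys[OF x(1) that] d by auto
    have "\<exists>f. map f I = permute_list (inv (sfun s)) I \<and> relet f (bact x ?w) \<in> N"
      by (rule slstable_rename[OF N x(2) k]) (use d z l g(2) in \<open>simp_all add: Sy_inv_permutes\<close>)
    then obtain f where f: "map f I = permute_list (inv (sfun s)) I" "relet f (bact x ?w) \<in> N" by blast
    have "relet f (bact x ?w) = bact (x * sing (s, 0) 1) ?w"
    proof (rule plinear_eqI[where t = x])
      show "plinear (\<lambda>x. relet f (bact x ?w))" "plinear (\<lambda>x. bact (x * sing (s, 0) 1) ?w)"
        by (rule plinear_compose[OF plinear_relet plinear_bact_left] plinear_compose[OF plinear_bact_left plinear_mult_left])+
      fix h assume "h \<in> pkeys x"
      then have h: "fst h \<in> Sy p" "snd h \<in> Sy q" by (auto intro: balg_keys[OF x(1)])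
      have "map f (permute_list (inv (sfun (fst h))) I) = permute_list (inv (sfun (fst h + s))) I"
        using h g(2) l by (simp add: permute_list_map[symmetric] f(1) inv_plus permute_list_compose Sy_inv_permutes del: sfun_plus)
      then show "relet f (bact (sing h 1) ?w) = bact (sing h 1 * sing (s, 0) 1) ?w"
        by (simp add: mult_single wperm_def del: sfun_plus)
    qed
    then show ?thesis using f(2) by simp
  qed
  let ?x = "x * sing (s, 0) 1"
  have xb: "?x \<in> balg p q" using x(1) g by (intro balg_mult balg_single) auto
  have W: "bact (?x * sing (0, r) 1) ?w \<in> N"
  proof -
    have fk: "distinct js \<and> set js = set J \<and> set is \<inter> set J = {}" if "(js, is) \<in> pkeys (flip (bact ?x ?w))" for "is" js
      using that keys[OF xb, of "is" js] d by (auto simp: keys_flip)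
    have "\<exists>f. map f J = permute_list (inv (sfun r)) J \<and> relet f (flip (bact ?x ?w)) \<in> flip ` N"
      by (rule slstable_rename[OF slstable_flip[OF N] imageI[OF V] fk]) (use d z l g(3) in \<open>simp_all add: Sy_inv_permutes\<close>)
    then obtain f where f: "map f J = permute_list (inv (sfun r)) J" "relet f (flip (bact ?x ?w)) \<in> flip ` N" by blast
    have "flip (relet f (flip (bact ?x ?w))) = bact (?x * sing (0, r) 1) ?w"
    proof (rule plinear_eqI[where t = ?x])
      show "plinear (\<lambda>x. flip (relet f (flip (bact x ?w))))" "plinear (\<lambda>x. bact (x * sing (0, r) 1) ?w)"
        by (intro plinear_compose[OF plinear_flip] plinear_compose[OF plinear_relet] plinear_bact_left
            plinear_compose[OF plinear_bact_left plinear_mult_left])+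
      fix h assume "h \<in> pkeys ?x"
      then have h: "fst h \<in> Sy p" "snd h \<in> Sy q" by (auto intro: balg_keys[OF xb])
      have "map f (permute_list (inv (sfun (snd h))) J) = permute_list (inv (sfun (snd h + r))) J"
        using h g(3) l by (simp add: permute_list_map[symmetric] f(1) inv_plus permute_list_compose Sy_inv_permutes del: sfun_plus)
      then show "flip (relet f (flip (bact (sing h 1) ?w))) = bact (sing h 1 * sing (0, r) 1) ?w"
        by (simp add: mult_single wperm_def del: sfun_plus)
    qed
    moreover have "flip (relet f (flip (bact ?x ?w))) \<in> N"
    proof -
      obtain n where "n \<in> N" "relet f (flip (bact ?x ?w)) = flip n" using f(2) by blast
      then show ?thesis by simp
    qed
    ultimately show ?thesis by simp
  qed
  have "?x * sing (0, r) 1 = x * sing g 1" by (simp add: mult.assoc mult_single g(1))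
  then show ?thesis using W by simp
qed

lemma pscale_cancel: "a \<noteq> 0 \<Longrightarrow> pscale (inverse a) (pscale a x) = x"
  by simp

text \<open>For a word w with distinct letters, N contains some nonzero u = x w, then x c w by right
  multiplications, and n x c w = c x c w is a multiple of c w. This multiple is nonzero because the
  coefficient of u at w is a factor of it.\<close>

theorem gam_irreducible:
  fixes N :: "((int list \<times> int list) \<Rightarrow>\<^sub>0 'k::field_char_0) set"
  assumes la: "partition_of la" "partition_of mu"
    and N: "slstable (sum_list la) (sum_list mu) N" "N \<subseteq> gam la mu" "N \<noteq> {0}"
  shows "N = gam la mu"
proof -
  let ?p = "sum_list la" and ?q = "sum_list mu" and ?c = "csy la mu :: (sym \<times> sym) \<Rightarrow>\<^sub>0 'k"
  let ?n = "csy_coeff la mu :: 'k"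
  note sub = slstable_subspace[OF N(1)]
  have "0 \<in> N" by (rule pvs.subspace_0[OF sub])
  then obtain t where t: "t \<in> N" "t \<noteq> 0" using N(3) by blast
  obtain u A B where u: "u \<in> N" "u \<noteq> 0" "A \<inter> B = {}"
    and keys: "\<And>is js. (is, js) \<in> pkeys u \<Longrightarrow> distinct is \<and> set is = A \<and> distinct js \<and> set js = B"
    by (rule nonzero_multilinear[OF N(1) t]) blast
  \<comment> \<open>The word is taken from u itself, which makes the scalar below nonzero.\<close>
  obtain I J where IJ: "(I, J) \<in> pkeys u" using u(2) by (metis ex_in_conv keys_eq_empty prod.exhaust)
  have kIJ: "distinct I" "set I = A" "distinct J" "set J = B" using keys[OF IJ] by auto
  have l: "length I = ?p" "length J = ?q" "0 \<notin> set I" "0 \<notin> set J"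
    using IJ slstable_mixed[OF N(1) u(1)] by (auto simp: mixed_def wordset_def)
  have d: "distinct (I @ J)" using kIJ u(3) by auto
  have w: "sing (I, J) 1 \<in> mixed ?p ?q" using l by (auto intro!: mixed_single simp: wordset_def)
  let ?w = "sing (I, J) 1 :: _ \<Rightarrow>\<^sub>0 'k"
  obtain x where x: "x \<in> balg (length I) (length J)" "bact x ?w = u"
    by (rule multilinear_as_bact[OF kIJ(1,3), of u]) (use keys kIJ in auto)
  have xb: "x \<in> balg ?p ?q" using x(1) l by simp
  have gx: "bact (x * sing g 1) ?w \<in> N" if "g \<in> Sy ?p \<times> Sy ?q" for g
    by (rule rename_factors[OF N(1) d l(1,2,3,4) xb _ that]) (use x(2) u(1) in simp)
  have "bact (x * ?c) ?w = (\<Sum>g\<in>Sy ?p \<times> Sy ?q. pscale (lk ?c g) (bact (x * sing g 1) ?w))"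
    by (subst balg_expand[OF csy_balg])
      (simp add: sum_distrib_left pscale_simps plinear_sum[OF plinear_bact_left] plinear_pscale[OF plinear_bact_left]
        del: pscale_single)
  moreover have "(\<Sum>g\<in>Sy ?p \<times> Sy ?q. pscale (lk ?c g) (bact (x * sing g 1) ?w)) \<in> N"
    by (intro pvs.subspace_sum[OF sub] pvs.subspace_scale[OF sub] gx)
  ultimately have xc: "bact (x * ?c) ?w \<in> N" by simp
  have cx: "bact (?c * x) ?w = pscale ?n u"
    using u(1) N(2) bact_mult[OF csy_balg xb w] x(2) by (auto simp: gam_def)
  \<comment> \<open>The identity permutation corresponds to the word \<open>(I, J)\<close>.\<close>
  have "lk (?c * x) 0 = lk (bact (?c * x) ?w) (wperm 0 (I, J))"
    by (rule lookup_bact_word[symmetric]) (use kIJ balg_mult[OF csy_balg xb] l in \<open>simp_all add: mem_Times_iff\<close>)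
  then have coeff: "lk (?c * x) 0 = ?n * lk u (I, J)" by (simp add: cx)
  have "pscale ?n (bact (x * ?c) ?w) = bact (?c * (x * ?c)) ?w"
    using xc N(2) bact_mult[OF csy_balg balg_mult[OF xb csy_balg] w] by (auto simp: gam_def)
  also have "\<dots> = pscale (?n * (?n * lk u (I, J))) (bact ?c ?w)"
    using csy_sandwich[OF la xb] coeff by (simp add: mult.assoc plinear_pscale[OF plinear_bact_left])
  finally have e: "pscale ?n (bact (x * ?c) ?w) = pscale (?n * (?n * lk u (I, J))) (bact ?c ?w)" .
  have nz: "?n * (?n * lk u (I, J)) \<noteq> 0" using csy_square(2)[OF la, where 'k = 'k] IJ by (simp add: in_keys_iff)
  have "pscale (inverse (?n * (?n * lk u (I, J)))) (pscale ?n (bact (x * ?c) ?w)) \<in> N"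
    by (intro pvs.subspace_scale[OF sub] xc)
  then have cw: "bact ?c ?w \<in> N" unfolding e pscale_cancel[OF nz] .
  \<comment> \<open>N is only known to contain c applied to the word, so
    \<open>tless_in_slstable\<close> is applied to the preimage of N under c, which contains the
    word itself.\<close>
  define M where "M = {t \<in> mixed ?p ?q. bact ?c t \<in> N}"
  have M: "slstable ?p ?q M"
    unfolding slstable_def
  proof (intro conjI allI impI)
    show "M \<subseteq> mixed ?p ?q" by (auto simp: M_def)
    show "pvs.subspace M"
    proof (rule pvs.subspaceI)
      show "0 \<in> M" using \<open>0 \<in> N\<close> by (simp add: M_def plinear_0[OF plinear_bact])
      show "x + y \<in> M" if "x \<in> M" "y \<in> M" for x y
        using that pvs.subspace_add[OF sub] by (simp add: M_def mixed_add plinear_add[OF plinear_bact])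
      show "pscale c x \<in> M" if "x \<in> M" for c x
        using that pvs.subspace_scale[OF sub] by (simp add: M_def mixed_pscale plinear_pscale[OF plinear_bact])
    qed
    fix x y t assume "x \<noteq> (0::int)" "y \<noteq> (0::int)" "x \<noteq> y" "t \<in> M"
    then show "ee x y t \<in> M"
      using slstable_ee[OF N(1), of "bact ?c t" x y] by (simp add: M_def ee_mixed bact_ee[OF csy_balg])
  qed
  have "?w \<in> M" using w cw by (simp add: M_def)
  from tless_in_slstable[OF M this d] have sub_M: "tless ?p ?q \<subseteq> M" .
  show ?thesis
  proof (intro equalityI subsetI)
    fix t :: "(int list \<times> int list) \<Rightarrow>\<^sub>0 'k" assume t: "t \<in> gam la mu"
    then have "bact ?c t \<in> N" using sub_M by (auto simp: gam_def M_def)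
    moreover have "bact ?c t = pscale ?n t" using t by (simp add: gam_def)
    ultimately have "pscale (inverse ?n) (pscale ?n t) \<in> N" using pvs.subspace_scale[OF sub] by metis
    then show "t \<in> N" unfolding pscale_cancel[OF csy_square(2)[OF la, where 'k = 'k]] .
  qed (use N(2) in blast)
qed

section \<open>The modules of the statement in coordinates\<close>

definition actx :: "((int list \<times> int list) \<Rightarrow>\<^sub>0 'k::field) \<Rightarrow> ((int list \<times> int list) \<Rightarrow>\<^sub>0 'k) \<Rightarrow> (int list \<times> int list) \<Rightarrow>\<^sub>0 'k" where
  "actx X t = lext (\<lambda>k. ee (hd (fst k)) (hd (snd k)) t) X"

lemma plinear_actx_left: "plinear (\<lambda>X. actx X t)"
  unfolding actx_def by (rule plinear_lext)

lemma plinear_actx: "plinear (actx X)"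
  unfolding actx_def lext_def by (intro plinear_fsum plinear_fpscale plinear_ee)

lemma actx_single [simp]: "actx (sing ([x], [y]) 1) t = ee x y t"
  by (simp add: actx_def)

lemma gl_key:
  assumes "X \<in> gl" "k \<in> pkeys X"
  obtains x y where "k = ([x], [y])" "x \<noteq> 0" "y \<noteq> 0"
proof -
  have "fst k \<in> wordset 1" "snd k \<in> wordset 1" using assms by (auto simp: gl_def mixed_def)
  then obtain x y where "fst k = [x]" "snd k = [y]" "x \<noteq> 0" "y \<noteq> 0"
    by (auto simp: wordset_def length_Suc_conv)
  then show thesis using that by (metis prod.collapse)
qed

lemma dual_system_pair:
  "dual_system P \<Longrightarrow> x \<noteq> 0 \<Longrightarrow> y \<noteq> 0 \<Longrightarrow> pair P (xi P x) (xid P y) = (if x = y then 1 else 0)"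
  unfolding dual_system_def by blast

lemma lift_eq_lext: "lift P pscale f = lext (\<lambda>k. f (map (xi P) (fst k)) (map (xid P) (snd k)))"
  by (rule ext) (simp add: lift_def lext_def case_prod_unfold)

lemma wordset_nth: "is \<in> wordset d \<Longrightarrow> a < length is \<Longrightarrow> is ! a \<noteq> 0"
  by (metis mem_Collect_eq nth_mem wordset_def)

lemma act_word:
  assumes P: "dual_system P" and w: "is \<in> wordset p" "js \<in> wordset q" and xy: "x \<noteq> 0" "y \<noteq> 0"
  defines "vs \<equiv> map (xi P) is" and "ws \<equiv> map (xid P) js"
  shows "(\<Sum>a<length vs. tens P (vs[a := actV P (xi P x) (xid P y) (vs ! a)]) ws)
     + (\<Sum>b<length ws. tens P vs (ws[b := actW P (xi P x) (xid P y) (ws ! b)])) = eword x y (is, js)"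
proof -
  have l: "length is = p" "length js = q" using w by (auto simp: wordset_def)
  note ml = multilinear_tens[OF P, of p q, unfolded multilinear_def, rule_format, of vs ws]
  have V: "tens P (vs[a := actV P (xi P x) (xid P y) (vs ! a)]) ws = (if is ! a = y then sing (is[a := x], js) 1 else 0)"
    if a: "a < length vs" for a
  proof -
    interpret L: Vector_Spaces.linear "scV P" pscale "\<lambda>x. tens P (vs[a := x]) ws"
      using ml l a by (simp add: vs_def ws_def)
    have "vs[a := xi P x] = map (xi P) (is[a := x])" by (simp add: vs_def map_update)
    then have "tens P (vs[a := xi P x]) ws = sing (is[a := x], js) 1"
      using tens_basis[OF P wordset_update[OF w(1) xy(1)] w(2)] by (simp add: ws_def)
    then show ?thesis
      using a dual_system_pair[OF P wordset_nth[OF w(1)] xy(2)] dual_system_pair[OF P xy(2,2)]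
      by (simp add: actV_def L.scale) (simp add: vs_def)
  qed
  have W: "tens P vs (ws[b := actW P (xi P x) (xid P y) (ws ! b)]) = - (if js ! b = x then sing (is, js[b := y]) 1 else 0)"
    if b: "b < length ws" for b
  proof -
    interpret L: Vector_Spaces.linear "scW P" pscale "\<lambda>x. tens P vs (ws[b := x])"
      using ml l b by (simp add: vs_def ws_def)
    have "ws[b := xid P y] = map (xid P) (js[b := y])" by (simp add: ws_def map_update)
    then have "tens P vs (ws[b := xid P y]) = sing (is, js[b := y]) 1"
      using tens_basis[OF P w(1) wordset_update[OF w(2) xy(2)]] by (simp add: vs_def)
    then show ?thesis
      using b dual_system_pair[OF P xy(1) wordset_nth[OF w(2)]] dual_system_pair[OF P xy(1,1)]
      by (simp add: actW_def L.scale L.neg) (simp add: ws_def)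
  qed
  show ?thesis
    unfolding eword_def fst_conv snd_conv
    using V W by (simp add: sum_negf vs_def ws_def)
qed

text \<open>The index 0 labels no basis vector, so the coordinate form is compared with the given
  action only on words without it; membership in \<open>gl\<close> and \<open>mixed p q\<close>
  provides this.\<close>

lemma act_eq_actx:
  assumes P: "dual_system P" and X: "X \<in> gl" and t: "t \<in> mixed p q"
  shows "act P X t = actx X t"
proof -
  have "lift P pscale (\<lambda>vs ws.
       (\<Sum>a<length vs. tens P (vs[a := actV P (xi P x) (xid P y) (vs ! a)]) ws)
     + (\<Sum>b<length ws. tens P vs (ws[b := actW P (xi P x) (xid P y) (ws ! b)]))) t = ee x y t"
    if xy: "x \<noteq> 0" "y \<noteq> 0" for x y
    unfolding lift_eq_lext ee_def lext_def
  proof (rule sum.cong[OF refl])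
    fix k assume "k \<in> pkeys t"
    then have "fst k \<in> wordset p" "snd k \<in> wordset q" using t by (auto simp: mixed_def)
    from act_word[OF P this xy]
    show "pscale (lk t k) ((\<Sum>a<length (map (xi P) (fst k)). tens P ((map (xi P) (fst k))[a := actV P (xi P x) (xid P y) (map (xi P) (fst k) ! a)]) (map (xid P) (snd k)))
     + (\<Sum>b<length (map (xid P) (snd k)). tens P (map (xi P) (fst k)) ((map (xid P) (snd k))[b := actW P (xi P x) (xid P y) (map (xid P) (snd k) ! b)])))
      = pscale (lk t k) (eword x y k)" by simp
  qed
  note A = this[unfolded lift_eq_lext]
  show ?thesis
    unfolding act_def actx_def lift_eq_lext lext_def[of _ X]
  proof (rule sum.cong[OF refl], goal_cases)
    case (1 k)
    obtain x y where k: "k = ([x], [y])" "x \<noteq> 0" "y \<noteq> 0" by (rule gl_key[OF X 1])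
    show ?case using A[OF k(2,3)] by (simp add: k(1))
  qed
qed

section \<open>The bracket in coordinates\<close>

definition brw :: "int list \<times> int list \<Rightarrow> int list \<times> int list \<Rightarrow> (int list \<times> int list) \<Rightarrow>\<^sub>0 'k::field" where
  "brw k l = (if hd (snd k) = hd (fst l) then sing ([hd (fst k)], [hd (snd l)]) 1 else 0)
     - (if hd (snd l) = hd (fst k) then sing ([hd (fst l)], [hd (snd k)]) 1 else 0)"

lemma bracket_eq:
  assumes P: "dual_system P" and X: "X \<in> gl" and Y: "Y \<in> gl"
  shows "bracket P X Y = lext (\<lambda>k. lext (brw k) Y) X"
  unfolding bracket_def lift_eq_lext lext_def[of _ X]
proof (rule sum.cong[OF refl], goal_cases)
  case (1 k)
  obtain x y where k: "k = ([x], [y])" "x \<noteq> 0" "y \<noteq> 0" by (rule gl_key[OF X 1])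
  have T: "tens P [xi P a] [xid P b] = sing ([a], [b]) 1" if "a \<noteq> 0" "b \<noteq> 0" for a b
    using tens_basis[OF P, of "[a]" 1 "[b]" 1] that by (simp add: wordset_def)
  show ?case
    unfolding lext_def[of _ Y]
  proof (rule arg_cong[where f = "pscale (lk X k)"], rule sum.cong[OF refl], goal_cases)
    case (1 l)
    obtain z w where l: "l = ([z], [w])" "z \<noteq> 0" "w \<noteq> 0" by (rule gl_key[OF Y 1])
    show ?case using k l by (auto simp: Let_def brw_def T dual_system_pair[OF P])
  qed
qed

lemma bracket_gl:
  assumes P: "dual_system P" and X: "X \<in> gl" and Y: "Y \<in> gl"
  shows "bracket P X Y \<in> gl"
  unfolding bracket_eq[OF assms] gl_def
proof (rule mixed_lext, rule mixed_lext)
  fix k l assume "k \<in> pkeys X" "l \<in> pkeys Y"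
  obtain x y where k: "k = ([x], [y])" "x \<noteq> 0" "y \<noteq> 0" by (rule gl_key[OF X \<open>k \<in> pkeys X\<close>])
  obtain z w where l: "l = ([z], [w])" "z \<noteq> 0" "w \<noteq> 0" by (rule gl_key[OF Y \<open>l \<in> pkeys Y\<close>])
  show "brw k l \<in> mixed 1 1"
    unfolding brw_def using k l by (intro mixed_diff) (auto intro!: mixed_single simp: wordset_def)
qed

lemma actx_bracket:
  assumes P: "dual_system P" and X: "X \<in> gl" and Y: "Y \<in> gl"
  shows "actx (bracket P X Y) t = actx X (actx Y t) - actx Y (actx X t)"
  unfolding bracket_eq[OF assms]
proof (rule plinear_eqI[where t = X])
  show "plinear (\<lambda>X. actx (lext (\<lambda>k. lext (brw k) Y) X) t)"
    by (rule plinear_compose[OF plinear_actx_left plinear_lext])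
  show "plinear (\<lambda>X. actx X (actx Y t) - actx Y (actx X t))"
    by (intro plinear_fdiff plinear_actx_left plinear_compose[OF plinear_actx plinear_actx_left])
  fix k assume "k \<in> pkeys X"
  obtain x y where k: "k = ([x], [y])" by (rule gl_key[OF X \<open>k \<in> pkeys X\<close>])
  have "actx (lext (brw k) Y) t = actx (sing k 1) (actx Y t) - actx Y (actx (sing k 1) t)"
  proof (rule plinear_eqI[where t = Y])
    show "plinear (\<lambda>Y. actx (lext (brw k) Y) t)"
      by (rule plinear_compose[OF plinear_actx_left plinear_lext])
    show "plinear (\<lambda>Y. actx (sing k 1) (actx Y t) - actx Y (actx (sing k 1) t))"
      by (intro plinear_fdiff plinear_actx_left plinear_compose[OF plinear_actx plinear_actx_left])
    fix l assume "l \<in> pkeys Y"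
    obtain z w where l: "l = ([z], [w])" by (rule gl_key[OF Y \<open>l \<in> pkeys Y\<close>])
    show "actx (lext (brw k) (sing l 1)) t
        = actx (sing k 1) (actx (sing l 1) t) - actx (sing l 1) (actx (sing k 1) t)"
      by (simp add: k l brw_def ee_commutator plinear_diff[OF plinear_actx_left] plinear_0[OF plinear_actx_left])
  qed
  then show "actx (lext (\<lambda>k. lext (brw k) Y) (sing k 1)) t
      = actx (sing k 1) (actx Y t) - actx Y (actx (sing k 1) t)" by simp
qed

lemma gl_add: "X \<in> gl \<Longrightarrow> Y \<in> gl \<Longrightarrow> X + Y \<in> gl"
  and gl_pscale: "X \<in> gl \<Longrightarrow> pscale c X \<in> gl"
  by (simp_all add: gl_def mixed_add mixed_pscale)

lemma actx_closed:
  assumes M: "pvs.subspace M" "\<And>x y t. x \<noteq> 0 \<Longrightarrow> y \<noteq> 0 \<Longrightarrow> t \<in> M \<Longrightarrow> ee x y t \<in> M"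
    and X: "X \<in> gl" and t: "t \<in> M"
  shows "actx X t \<in> M"
  unfolding actx_def lext_def
proof (intro pvs.subspace_sum[OF M(1)] pvs.subspace_scale[OF M(1)])
  fix k assume "k \<in> pkeys X"
  obtain x y where "k = ([x], [y])" "x \<noteq> 0" "y \<noteq> 0" by (rule gl_key[OF X \<open>k \<in> pkeys X\<close>])
  then show "ee (hd (fst k)) (hd (snd k)) t \<in> M" using M(2) t by simp
qed

text \<open>L stays a variable so that gl and sl are covered together.\<close>

lemma lie_module_act:
  assumes P: "dual_system P" and M: "M \<subseteq> mixed p q" "pvs.subspace M" "\<And>x y t. x \<noteq> 0 \<Longrightarrow> y \<noteq> 0 \<Longrightarrow> t \<in> M \<Longrightarrow> ee x y t \<in> M"
    and L: "L \<subseteq> gl"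
  shows "lie_module pscale (bracket P) L pscale (act P) M"
proof -
  have a: "act P X t = actx X t" if "X \<in> gl" "t \<in> M" for X t
    using act_eq_actx[OF P that(1)] that(2) M(1) by blast
  have c: "actx X t \<in> M" if "X \<in> gl" "t \<in> M" for X t
    by (rule actx_closed[OF M(2,3) that])
  show ?thesis
    unfolding lie_module_def linear_on_def
  proof (intro conjI ballI allI)
    fix X assume "X \<in> L"
    then have X: "X \<in> gl" using L by blast
    fix m assume m: "m \<in> M"
    show "act P X m \<in> M" using a[OF X m] c[OF X m] by simp
    show "act P X (m + n) = act P X m + act P X n" if "n \<in> M" for n
      using a[OF X] m that pvs.subspace_add[OF M(2)] by (simp add: plinear_add[OF plinear_actx])
    show "act P X (pscale r m) = pscale r (act P X m)" for r
      using a[OF X] m pvs.subspace_scale[OF M(2)] by (simp add: plinear_pscale[OF plinear_actx])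
    show "act P (X + Y) m = act P X m + act P Y m" if "Y \<in> L" for Y
      using a X m gl_add[of X Y] that L by (simp add: plinear_add[OF plinear_actx_left] subset_iff)
    show "act P (pscale r X) m = pscale r (act P X m)" for r
      using a X m gl_pscale[of X r] by (simp add: plinear_pscale[OF plinear_actx_left])
    show "act P (bracket P X Y) m = act P X (act P Y m) - act P Y (act P X m)" if "Y \<in> L" for Y
    proof -
      have Y: "Y \<in> gl" using that L by blast
      show ?thesis
        using a[OF bracket_gl[OF P X Y] m] a[OF X m] a[OF Y m] a[OF X c[OF Y m]] a[OF Y c[OF X m]]
          actx_bracket[OF P X Y] by simp
    qed
  qed (use M(2) in simp_all)
qed

lemma elem_eq: "dual_system P \<Longrightarrow> x \<noteq> 0 \<Longrightarrow> y \<noteq> 0 \<Longrightarrow> elem P x y = sing ([x], [y]) 1"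
  unfolding elem_def using tens_basis[of P "[x]" 1 "[y]" 1] by (simp add: wordset_def)

lemma elem_gl: "x \<noteq> 0 \<Longrightarrow> y \<noteq> 0 \<Longrightarrow> sing ([x], [y]) c \<in> gl"
  by (auto simp: gl_def wordset_def intro!: mixed_single)

lemma elem_sl: "dual_system P \<Longrightarrow> x \<noteq> 0 \<Longrightarrow> y \<noteq> 0 \<Longrightarrow> x \<noteq> y \<Longrightarrow> sing ([x], [y]) 1 \<in> sl P"
  by (simp add: sl_def elem_gl lift_def dual_system_pair)

lemma sl_gl: "sl P \<subseteq> gl" by (auto simp: sl_def)

text \<open>A matrix unit with two different indices has trace 0, so L contains all root
  vectors.\<close>

lemma submodule_slstable:
  assumes P: "dual_system P" and M: "M \<subseteq> mixed p q" and L: "sl P \<subseteq> L"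
    and N: "submodule L pscale (act P) M N"
  shows "slstable p q N"
  unfolding slstable_def
proof (intro conjI allI impI)
  show "N \<subseteq> mixed p q" "pvs.subspace N" using N M by (auto simp: submodule_def)
  fix x y :: int and t assume xy: "x \<noteq> 0" "y \<noteq> 0" "x \<noteq> y" and t: "t \<in> N"
  have "act P (sing ([x], [y]) 1) t \<in> N" using N L elem_sl[OF P xy] t by (auto simp: submodule_def)
  moreover have "act P (sing ([x], [y]) 1) t = ee x y t"
    using act_eq_actx[OF P elem_gl[OF xy(1,2)], of t p q] t N M by (auto simp: submodule_def)
  ultimately show "ee x y t \<in> N" by simp
qed

lemma perm_mixed_eq:
  assumes P: "dual_system P" and t: "t \<in> mixed p q" and f: "f permutes {..<p}" "g permutes {..<q}"
  shows "perm_mixed P f g t = pact (Abs_sym f, Abs_sym g) t"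
  unfolding perm_mixed_def lift_eq_lext pact_def lext_def
proof (rule sum.cong[OF refl])
  fix k assume "k \<in> pkeys t"
  then have w: "fst k \<in> wordset p" "snd k \<in> wordset q" using t by (auto simp: mixed_def)
  then have l: "length (fst k) = p" "length (snd k) = q" by (auto simp: wordset_def)
  have "tens P (permute_list (inv f) (map (xi P) (fst k))) (permute_list (inv g) (map (xid P) (snd k)))
      = sing (permute_list (inv f) (fst k), permute_list (inv g) (snd k)) 1"
    using tens_basis[OF P, of "permute_list (inv f) (fst k)" p "permute_list (inv g) (snd k)" q]
      w l permutes_inv[OF f(1)] permutes_inv[OF f(2)]
    by (simp add: permute_list_map permute_list_wordset)
  then show "pscale (lk t k) (tens P (permute_list (inv f) (map (xi P) (fst k))) (permute_list (inv g) (map (xid P) (snd k))))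
      = pscale (lk t k) (sing (wperm (Abs_sym f, Abs_sym g) k) 1)"
    by (simp add: wperm_def sfun_Abs_sym[OF f(1)] sfun_Abs_sym[OF f(2)])
qed

subsection \<open>Young symmetrizers of the statement\<close>

text \<open>Translates the group algebra used here into that of the statement, which is indexed by
  functions and multiplied by \<open>gmul\<close>. It is multiplicative by
  \<open>gmul_raw\<close>.\<close>

definition raw :: "(sym \<Rightarrow>\<^sub>0 'k::field) \<Rightarrow> (nat \<Rightarrow> nat) \<Rightarrow>\<^sub>0 'k" where
  "raw = lext (\<lambda>s. sing (sfun s) 1)"

lemma plinear_raw: "plinear raw"
  unfolding raw_def by (rule plinear_lext)
lemma raw_single [simp]: "raw (sing s c) = sing (sfun s) c"
  by (simp add: raw_def)

lemma gmul_eq: "gmul x y = lext (\<lambda>s. lext (\<lambda>t. sing (s \<circ> t) 1) y) x"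
  unfolding gmul_def lext_def by (simp add: pvs.scale_sum_right)

lemma gmul_raw: "gmul (raw x) (raw y) = raw (x * y)"
proof (rule plinear_eqI[where t = x])
  show "plinear (\<lambda>x. gmul (raw x) (raw y))"
    unfolding gmul_eq by (rule plinear_compose[OF plinear_lext plinear_raw])
  show "plinear (\<lambda>x. raw (x * y))" by (rule plinear_compose[OF plinear_raw plinear_mult_left])
  fix s
  show "gmul (raw (sing s 1)) (raw y) = raw (sing s 1 * y)"
  proof (rule plinear_eqI[where t = y])
    show "plinear (\<lambda>y. gmul (raw (sing s 1)) (raw y))"
      unfolding gmul_eq by (simp add: plinear_compose[OF plinear_lext plinear_raw])
    show "plinear (\<lambda>y. raw (sing s 1 * y))" by (rule plinear_compose[OF plinear_raw plinear_mult_right])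
  qed (simp add: gmul_eq mult_single)
qed

lemma stab_image:
  "{f. f permutes {..<d} \<and> (\<forall>x<d. r (f x) = r x)} = sfun ` stabf d r"
proof (intro equalityI subsetI)
  fix f assume "f \<in> {f. f permutes {..<d} \<and> (\<forall>x<d. r (f x) = r x)}"
  then show "f \<in> sfun ` stabf d r"
    using sfun_Abs_sym[of f d] Abs_sym_Sy[of f d] by (intro image_eqI[of _ _ "Abs_sym f"]) (auto simp: stabf_def)
qed (auto simp: stabf_def Sy_permutes)

lemma young_symmetrizer_eq: "young_symmetrizer la = raw (yla la :: sym \<Rightarrow>\<^sub>0 'k::field)"
proof -
  have 1: "(\<Sum>f\<in>row_stab la. sing f (1 :: 'k)) = raw (rsum (sum_list la) (tab_row la))"
    unfolding row_stab_def stab_image rsum_def plinear_sum[OF plinear_raw] sum.reindex[OF inj_on_sfun] o_def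
    by simp
  have 2: "(\<Sum>f\<in>col_stab la. sing f (of_int (sign f) :: 'k)) = raw (csum (sum_list la) (tab_col la))"
    unfolding col_stab_def stab_image csum_def plinear_sum[OF plinear_raw] sum.reindex[OF inj_on_sfun] o_def
    by (simp add: sgn_of_def)
  show ?thesis by (simp only: young_symmetrizer_def yla_def ysym_def 1 2 gmul_raw)
qed

definition uact :: "(sym \<Rightarrow>\<^sub>0 'k::field) \<Rightarrow> (int list \<Rightarrow>\<^sub>0 'k) \<Rightarrow> int list \<Rightarrow>\<^sub>0 'k" where
  "uact y t = lext (\<lambda>s. lext (\<lambda>is. sing (permute_list (inv (sfun s)) is) 1) t) y"

lemma plinear_uact_left: "plinear (\<lambda>y. uact y t)"
  unfolding uact_def by (rule plinear_lext)
lemma plinear_uact: "plinear (uact y)"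
  unfolding uact_def lext_def[of _ y] by (intro plinear_fsum plinear_fpscale plinear_lext)

lemma tprod_uact: "tprod (uact x m) (uact y m') = bact (tprod x y) (tprod m m')"
proof (rule plinear_eqI[where t = x])
  show "plinear (\<lambda>x. tprod (uact x m) (uact y m'))" "plinear (\<lambda>x. bact (tprod x y) (tprod m m'))"
    by (rule plinear_compose[OF plinear_tprod_left plinear_uact_left]
        plinear_compose[OF plinear_bact_left plinear_tprod_left])+
  fix s
  show "tprod (uact (sing s 1) m) (uact y m') = bact (tprod (sing s 1) y) (tprod m m')"
  proof (rule plinear_eqI[where t = y])
    show "plinear (\<lambda>y. tprod (uact (sing s 1) m) (uact y m'))" "plinear (\<lambda>y. bact (tprod (sing s 1) y) (tprod m m'))"
      by (rule plinear_compose[OF plinear_tprod_right plinear_uact_left]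
          plinear_compose[OF plinear_bact_left plinear_tprod_right])+
    fix r
    show "tprod (uact (sing s 1) m) (uact (sing r 1) m') = bact (tprod (sing s 1) (sing r 1)) (tprod m m')"
    proof (rule plinear_eqI[where t = m])
      show "plinear (\<lambda>m. tprod (uact (sing s 1) m) (uact (sing r 1) m'))"
        "plinear (\<lambda>m. bact (tprod (sing s 1) (sing r 1)) (tprod m m'))"
        by (rule plinear_compose[OF plinear_tprod_left plinear_uact]
            plinear_compose[OF plinear_bact plinear_tprod_left])+
      fix "is"
      show "tprod (uact (sing s 1) (sing is 1)) (uact (sing r 1) m') = bact (tprod (sing s 1) (sing r 1)) (tprod (sing is 1) m')"
      proof (rule plinear_eqI[where t = m'])
        show "plinear (\<lambda>m'. tprod (uact (sing s 1) (sing is 1)) (uact (sing r 1) m'))"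
          "plinear (\<lambda>m'. bact (tprod (sing s 1) (sing r 1)) (tprod (sing is 1) m'))"
          by (rule plinear_compose[OF plinear_tprod_right plinear_uact]
              plinear_compose[OF plinear_bact plinear_tprod_right])+
      qed (simp add: uact_def wperm_def)
    qed
  qed
qed

lemma galg_act_eq:
  assumes b: "coord_basis s b \<phi>" and y: "y \<in> galg d" and t: "t \<in> tensor_power d"
  shows "galg_act b \<phi> (raw y) t = uact y t"
proof -
  interpret coord_basis s b \<phi> by (rule b)
  have e: "galg_act b \<phi> (raw y) t = lext (\<lambda>f. perm_power b \<phi> f t) (raw y)" for y
    by (simp add: galg_act_def lext_def)
  show ?thesis
    unfolding e
  proof (rule plinear_eqI[where t = y])
    show "plinear (\<lambda>y. lext (\<lambda>f. perm_power b \<phi> f t) (raw y))"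
      by (rule plinear_compose[OF plinear_lext plinear_raw])
    show "plinear (\<lambda>y. uact y t)" by (rule plinear_uact_left)
    fix r assume "r \<in> pkeys y"
    then have r: "r \<in> Sy d" using y by (auto simp: galg_def)
    have "perm_power b \<phi> (sfun r) t = lext (\<lambda>is. sing (permute_list (inv (sfun r)) is) 1) t"
      unfolding perm_power_def lext_def
    proof (rule sum.cong[OF refl])
      fix "is" assume "is \<in> pkeys t"
      then have "is \<in> wordset d" using t by (auto simp: tensor_power_def)
      then have "permute_list (inv (sfun r)) is \<in> wordset d" "length is = d"
        using permute_list_wordset[OF Sy_inv_permutes[OF r]] by (auto simp: wordset_def)
      then show "pscale (lk t is) (ptens \<phi> (permute_list (inv (sfun r)) (map b is)))
          = pscale (lk t is) (sing (permute_list (inv (sfun r)) is) 1)"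
        using lookup_ptens_basis Sy_inv_permutes[OF r] by (simp add: permute_list_map)
    qed
    then show "lext (\<lambda>f. perm_power b \<phi> f t) (raw (sing r 1)) = uact (sing r 1) t"
      by (simp add: uact_def)
  qed
qed

lemma schur_eq:
  assumes "coord_basis s b \<phi>"
  shows "schur b \<phi> la = uact (yla la) ` tensor_power (sum_list la)"
  unfolding schur_def young_symmetrizer_eq
  using galg_act_eq[OF assms yla_galg] by (intro image_cong) auto

lemma tprod_mixed: "m \<in> tensor_power p \<Longrightarrow> m' \<in> tensor_power q \<Longrightarrow> tprod m m' \<in> mixed p q"
  by (intro mixedI) (auto simp: tensor_power_def in_keys_iff subset_iff)

lemma tensor_schur_eq:
  "tensor_subspace (uact (yla la) ` tensor_power (sum_list la)) (uact (yla mu) ` tensor_power (sum_list mu))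
    = bact (csy la mu) ` mixed (sum_list la) (sum_list mu)" (is "?T = ?B")
proof
  have "pvs.subspace ?B"
  proof (rule pvs.subspaceI)
    show "0 \<in> ?B" by (rule image_eqI[of _ _ 0]) (simp_all add: plinear_0[OF plinear_bact])
  next
    fix x y assume "x \<in> ?B" "y \<in> ?B"
    then obtain a b where "a \<in> mixed (sum_list la) (sum_list mu)" "b \<in> mixed (sum_list la) (sum_list mu)"
      "x = bact (csy la mu) a" "y = bact (csy la mu) b" by auto
    then show "x + y \<in> ?B"
      by (intro image_eqI[of _ _ "a + b"]) (simp_all add: plinear_add[OF plinear_bact] mixed_add)
  next
    fix c x assume "x \<in> ?B"
    then obtain a where "a \<in> mixed (sum_list la) (sum_list mu)" "x = bact (csy la mu) a" by auto
    then show "pscale c x \<in> ?B"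
      by (intro image_eqI[of _ _ "pscale c a"]) (simp_all add: plinear_pscale[OF plinear_bact] mixed_pscale)
  qed
  then show "?T \<subseteq> ?B"
    unfolding tensor_subspace_def
    by (intro pvs.span_minimal) (auto simp: tprod_uact csy_def[symmetric] intro!: imageI tprod_mixed)
  show "?B \<subseteq> ?T"
  proof (rule image_subsetI)
    fix t :: "(int list \<times> int list) \<Rightarrow>\<^sub>0 'a" assume t: "t \<in> mixed (sum_list la) (sum_list mu)"
    have "bact (csy la mu) (sing k 1) \<in> ?T" if "k \<in> pkeys t" for k
    proof -
      have "fst k \<in> wordset (sum_list la)" "snd k \<in> wordset (sum_list mu)" using t that by (auto simp: mixed_def)
      then have m: "sing (fst k) 1 \<in> tensor_power (sum_list la)" "sing (snd k) 1 \<in> tensor_power (sum_list mu)"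
        by (auto simp: tensor_power_def)
      have "bact (csy la mu) (sing k 1) = tprod (uact (yla la) (sing (fst k) 1)) (uact (yla mu) (sing (snd k) 1))"
        by (simp add: tprod_uact csy_def)
      then show ?thesis
        unfolding tensor_subspace_def using m by (intro pvs.span_base) blast
    qed
    then show "bact (csy la mu) t \<in> ?T"
      unfolding tensor_subspace_def plinear_expand[OF plinear_bact, of _ t]
      by (intro pvs.span_sum pvs.span_scale)
  qed
qed

text \<open>Since c c = n c with n nonzero, an element of the image of c is an eigenvector, and an
  eigenvector t is c applied to t / n.\<close>

lemma Gamma_mod_eq:
  fixes P :: "('k::field_char_0, 'v::ab_group_add, 'w::ab_group_add) dual_pair"
  assumes P: "dual_system P" and la: "partition_of la" "partition_of mu"
  shows "Gamma_mod P la mu = gam la mu"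
proof -
  note c = dual_system_coord_basis[OF P]
  have "tless (sum_list la) (sum_list mu) \<inter> bact (csy la mu) ` mixed (sum_list la) (sum_list mu) = (gam la mu :: (_ \<Rightarrow>\<^sub>0 'k) set)"
  proof (intro equalityI subsetI)
    fix t :: "(int list \<times> int list) \<Rightarrow>\<^sub>0 'k"
    assume "t \<in> tless (sum_list la) (sum_list mu) \<inter> bact (csy la mu) ` mixed (sum_list la) (sum_list mu)"
    then obtain m where m: "m \<in> mixed (sum_list la) (sum_list mu)" "t = bact (csy la mu) m"
      and t: "t \<in> tless (sum_list la) (sum_list mu)" by auto
    have "bact (csy la mu) t = bact (csy la mu * csy la mu) m"
      unfolding m(2) by (rule bact_mult[OF csy_balg csy_balg m(1), symmetric])
    also have "\<dots> = pscale (csy_coeff la mu) t"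
      by (simp add: csy_square(1)[OF la] plinear_pscale[OF plinear_bact_left] m(2))
    finally show "t \<in> gam la mu" using t by (simp add: gam_def)
  next
    fix t :: "(int list \<times> int list) \<Rightarrow>\<^sub>0 'k" assume t: "t \<in> gam la mu"
    have "bact (csy la mu) (pscale (inverse (csy_coeff la mu)) t)
        = pscale (inverse (csy_coeff la mu)) (pscale (csy_coeff la mu) t)"
      using t by (simp add: gam_def plinear_pscale[OF plinear_bact])
    also have "\<dots> = t" by (rule pscale_cancel[OF csy_square(2)[OF la]])
    finally have e: "t = bact (csy la mu) (pscale (inverse (csy_coeff la mu)) t)" ..
    have m: "pscale (inverse (csy_coeff la mu)) t \<in> mixed (sum_list la) (sum_list mu)"
      using t by (auto simp: gam_def intro: mixed_pscale tless_mixed)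
    have "t \<in> bact (csy la mu) ` mixed (sum_list la) (sum_list mu)"
      by (rule image_eqI[where f = "bact (csy la mu)", OF e m])
    then show "t \<in> tless (sum_list la) (sum_list mu) \<inter> bact (csy la mu) ` mixed (sum_list la) (sum_list mu)"
      using t by (simp add: gam_def)
  qed
  then show ?thesis
    unfolding Gamma_mod_def traceless_eq[OF P] schur_eq[OF c(1)] schur_eq[OF c(2)] tensor_schur_eq .
qed

section \<open>Highest weight vectors\<close>

text \<open>A nonzero contraction needs a letter common to both parts.\<close>

lemma tless_disjoint_word:
  assumes "is \<in> wordset p" "js \<in> wordset q" "set is \<inter> set js = {}"
  shows "sing (is, js) (1 :: 'k::field) \<in> tless p q"
proof (rule tlessI[of _ _ _ "letters (sing (is, js) (1 :: 'k))"])
  fix i j and us vs :: "int list" assume ij: "i < p" "j < q" "length us = p" "length vs = q"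
  have "(is, js) \<noteq> (us[i := c], vs[j := c])" for c
    using assms(3) set_update_memI[of i us c] set_update_memI[of j vs c] ij by auto
  then show "(\<Sum>c\<in>letters (sing (is, js) (1 :: 'k)). lk (sing (is, js) (1 :: 'k)) (us[i := c], vs[j := c])) = 0"
    by (intro sum.neutral) (simp add: lookup_single when_def)
qed (use assms in \<open>auto intro: mixed_single\<close>)

lemma csum_single: "s \<in> stabf d c \<Longrightarrow> csum d c * sing s 1 = pscale (sgn_of s) (csum d c)"
proof -
  assume s: "s \<in> stabf d c"
  have "csum d c * sing s 1 = pscale (sgn_of s) (twist (rsum d c * sing s 1))"
    unfolding twist_mult by (simp flip: mult_pscale_right)
  then show ?thesis by (simp add: rsum_single[OF s])
qed

lemma uact_mult_single:
  assumes x: "x \<in> galg d" and s: "s \<in> Sy d" and l: "length K = d"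
  shows "uact (x * sing s 1) (sing K 1) = uact x (sing (permute_list (inv (sfun s)) K) 1)"
proof (rule plinear_eqI[where t = x])
  show "plinear (\<lambda>x. uact (x * sing s 1) (sing K 1))"
    "plinear (\<lambda>x. uact x (sing (permute_list (inv (sfun s)) K) 1))"
    by (rule plinear_compose[OF plinear_uact_left plinear_mult_left] plinear_uact_left)+
  fix r assume "r \<in> pkeys x"
  then have "r \<in> Sy d" using x by (auto simp: galg_def)
  moreover have "inv (sfun (r + s)) = inv (sfun s) \<circ> inv (sfun r)"
    by (metis minus_add sfun_plus sfun_uminus)
  ultimately show "uact (sing r 1 * sing s 1) (sing K 1) = uact (sing r 1) (sing (permute_list (inv (sfun s)) K) 1)"
    using l by (simp add: mult_single uact_def permute_list_compose Sy_inv_permutes del: sfun_plus)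
qed

text \<open>The transposition of x and y is a column permutation that fixes the word K. Multiplying
  the Young symmetrizer by it on the right changes the sign, so the result is its own
  negative.\<close>

lemma uact_yla_zero:
  assumes l: "length K = sum_list la" and xy: "x < sum_list la" "y < sum_list la" "x \<noteq> y"
    and c: "tab_col la x = tab_col la y" and K: "K ! x = K ! y"
  shows "uact (yla la) (sing K 1) = (0 :: _ \<Rightarrow>\<^sub>0 'k::field_char_0)"
proof -
  let ?d = "sum_list la" and ?y = "yla la :: sym \<Rightarrow>\<^sub>0 'k" and ?s = "tsp x y"
  have s: "?s \<in> stabf ?d (tab_col la)"
    using xy c by (auto simp: stabf_def Transposition.transpose_def)
  have "permute_list (inv (sfun ?s)) K = K"
  proof (rule nth_equalityI)
    fix i assume i: "i < length (permute_list (inv (sfun ?s)) K)"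
    have "inv (sfun ?s) permutes {..<length K}"
      using Sy_inv_permutes[of ?s ?d] xy l by simp
    then show "permute_list (inv (sfun ?s)) K ! i = K ! i"
      using i K xy by (simp add: permute_list_nth Transposition.transpose_def)
  qed simp
  then have "uact ?y (sing K 1) = uact (?y * sing ?s 1) (sing K 1)"
    using uact_mult_single[OF yla_galg, of ?s la K, where 'a = 'k] xy l by simp
  also have "?y * sing ?s 1 = pscale (-1) ?y"
    using xy(3) unfolding yla_def ysym_def mult.assoc csum_single[OF s]
    by (simp add: mult_pscale_right sgn_of_transp del: pvs.scale_minus_left)
  finally have e: "uact ?y (sing K 1) = pscale (-1) (uact ?y (sing K 1))"
    by (simp only: plinear_pscale[OF plinear_uact_left])
  show ?thesis
  proof (rule poly_mapping_eqI)
    fix k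
    have "lk (uact ?y (sing K 1)) k = - lk (uact ?y (sing K 1)) k"
      by (subst e) simp
    then show "lk (uact ?y (sing K 1)) k = lk 0 k" by simp
  qed
qed

text \<open>The permutations fixing a word that is constant along rows, with different letters in
  different rows, are the row permutations, and on these the Young symmetrizer has coefficient 1.
  The coefficient in question is thus the order of the row group.\<close>

lemma lookup_uact_row_word:
  assumes la: "partition_of la" and f: "inj f"
  defines "I \<equiv> map (\<lambda>x. f (tab_row la x)) [0..<sum_list la]"
  shows "lk (uact (yla la) (sing I 1)) I \<noteq> (0 :: 'k::field_char_0)"
proof -
  let ?d = "sum_list la" and ?y = "yla la :: sym \<Rightarrow>\<^sub>0 'k" and ?P = "stabf (sum_list la) (tab_row la)"
  have fix_iff: "permute_list (inv (sfun g)) I = I \<longleftrightarrow> g \<in> ?P" if g: "g \<in> Sy ?d" for g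
  proof -
    have "permute_list (inv (sfun g)) I = I \<longleftrightarrow> (\<forall>x<?d. I ! (inv (sfun g) x) = I ! x)"
      using Sy_inv_permutes[OF g] by (auto simp: list_eq_iff_nth_eq I_def permute_list_nth)
    also have "\<dots> \<longleftrightarrow> (\<forall>x<?d. tab_row la (inv (sfun g) x) = tab_row la x)"
      using f Sy_inv_less[OF g] by (auto simp: I_def inj_eq)
    also have "\<dots> \<longleftrightarrow> - g \<in> ?P" using g by (simp add: stabf_def)
    finally show ?thesis by simp
  qed
  have coeff: "lk ?y g = 1" if g: "g \<in> ?P" for g
  proof -
    have "lk ?y g = lk (sing (- g) 1 * ?y) 0" by (simp add: lookup_single_mult)
    also have "sing (- g) 1 * ?y = ?y"
      using g single_rsum[of "- g" ?d "tab_row la", where 'a = 'k] by (simp add: yla_def ysym_def flip: mult.assoc)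
    finally show ?thesis by (simp add: lookup_yla_0 la)
  qed
  have "lk (uact ?y (sing I 1)) I = (\<Sum>g\<in>pkeys ?y. lk ?y g * (if g \<in> ?P then 1 else 0))"
    unfolding uact_def
  proof (subst lookup_lext, rule sum.cong[OF refl])
    fix g assume "g \<in> pkeys ?y"
    then have "g \<in> Sy ?d" using yla_galg[of la, where 'a = 'k] by (auto simp: galg_def)
    then show "lk ?y g * lk (lext (\<lambda>is. sing (permute_list (inv (sfun g)) is) 1) (sing I 1)) I = lk ?y g * (if g \<in> ?P then 1 else 0)"
      using fix_iff by (simp add: lookup_single when_def)
  qed
  also have "\<dots> = (\<Sum>g\<in>?P. 1)"
    by (rule sum.mono_neutral_cong) (auto simp: coeff in_keys_iff)
  also have "\<dots> \<noteq> 0" using card_stabf[of ?d "tab_row la"] by simp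
  finally show ?thesis .
qed

text \<open>Each entry receives its row as letter; rows count from 0 and basis vectors from 1, hence
  the shift. The negative letters in \<open>hw_right\<close> are chosen because the dual vector with
  index -i has weight minus \<open>eps (- i)\<close>.\<close>

definition hw_left :: "nat list \<Rightarrow> int list" where
  "hw_left la = map (\<lambda>x. int (tab_row la x) + 1) [0..<sum_list la]"

definition hw_right :: "nat list \<Rightarrow> int list" where
  "hw_right mu = map (\<lambda>x. - (int (tab_row mu x) + 1)) [0..<sum_list mu]"

definition hw_vector :: "nat list \<Rightarrow> nat list \<Rightarrow> (int list \<times> int list) \<Rightarrow>\<^sub>0 'k::field" where
  "hw_vector la mu = bact (csy la mu) (sing (hw_left la, hw_right mu) 1)"

lemma hw_wordset: "hw_left la \<in> wordset (sum_list la)" "hw_right mu \<in> wordset (sum_list mu)"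
  by (auto simp: hw_left_def hw_right_def wordset_def)

lemma hw_tless: "sing (hw_left la, hw_right mu) 1 \<in> tless (sum_list la) (sum_list mu)"
  by (rule tless_disjoint_word[OF hw_wordset]) (auto simp: hw_left_def hw_right_def)

lemma hw_vector_gam:
  "partition_of la \<Longrightarrow> partition_of mu \<Longrightarrow> hw_vector la mu \<in> (gam la mu :: (_ \<Rightarrow>\<^sub>0 'k::field_char_0) set)"
  unfolding hw_vector_def by (rule bact_csy_gam[OF _ _ hw_tless])

lemma bact_csy_word: "bact (csy la mu) (sing (K, M) 1) = tprod (uact (yla la) (sing K 1)) (uact (yla mu) (sing M 1))"
  by (simp add: tprod_uact csy_def)

lemma hw_vector_nonzero:
  assumes "partition_of la" "partition_of mu"
  shows "hw_vector la mu \<noteq> (0 :: _ \<Rightarrow>\<^sub>0 'k::field_char_0)"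
proof -
  have "lk (hw_vector la mu) (hw_left la, hw_right mu) \<noteq> (0 :: 'k)"
    using lookup_uact_row_word[OF assms(1), of "\<lambda>i. int i + 1", where 'k = 'k]
      lookup_uact_row_word[OF assms(2), of "\<lambda>i. - (int i + 1)", where 'k = 'k]
    by (simp add: hw_vector_def bact_csy_word hw_left_def hw_right_def inj_def)
  then show ?thesis by auto
qed

text \<open>A positive root vector changes a letter, in the V part or in the dual part, to that of
  an earlier row. The entry of that row in the same column already carries the new letter, so
  \<open>uact_yla_zero\<close> applies. If j < 0 < i, the letters to be replaced do not
  occur.\<close>

lemma hw_vector_ee:
  assumes la: "partition_of la" "partition_of mu" and r: "positive_root i j"
  shows "ee i j (hw_vector la mu) = (0 :: _ \<Rightarrow>\<^sub>0 'k::field_char_0)"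
proof -
  let ?I = "hw_left la" and ?J = "hw_right mu"
  have nz: "i \<noteq> 0" "j \<noteq> 0" using r by (auto simp: positive_root_def)
  have L: "uact (yla la) (sing (?I[a := i]) 1) = (0 :: _ \<Rightarrow>\<^sub>0 'k)" if a: "a < sum_list la" "?I ! a = j" for a
  proof -
    have j: "j = int (tab_row la a) + 1" using a by (simp add: hw_left_def)
    then have i: "0 < i" "i < j" using r by (auto simp: positive_root_def)
    then have "nat (i - 1) < tab_row la a" using j by simp
    then obtain y where y: "y < sum_list la" "tab_col la y = tab_col la a" "tab_row la y = nat (i - 1)"
      using young_tab[OF la(1)] a(1) unfolding young_def by blast
    then have "?I ! y = i" "y \<noteq> a" using i j by (auto simp: hw_left_def)
    then show ?thesis
      using a y by (intro uact_yla_zero[of _ _ a y]) (auto simp: hw_left_def)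
  qed
  have R: "uact (yla mu) (sing (?J[b := j]) 1) = (0 :: _ \<Rightarrow>\<^sub>0 'k)" if b: "b < sum_list mu" "?J ! b = i" for b
  proof -
    have i: "i = - (int (tab_row mu b) + 1)" using b by (simp add: hw_right_def)
    then have j: "i < j" "j < 0" using r by (auto simp: positive_root_def)
    then have "nat (- j - 1) < tab_row mu b" using i by simp
    then obtain y where y: "y < sum_list mu" "tab_col mu y = tab_col mu b" "tab_row mu y = nat (- j - 1)"
      using young_tab[OF la(2)] b(1) unfolding young_def by blast
    then have "?J ! y = j" "y \<noteq> b" using i j by (auto simp: hw_right_def)
    then show ?thesis
      using b y by (intro uact_yla_zero[of _ _ b y]) (auto simp: hw_right_def)
  qed
  have l: "length ?I = sum_list la" "length ?J = sum_list mu" by (simp_all add: hw_left_def hw_right_def)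
  have 1: "bact (csy la mu) (if ?I ! a = j then sing (?I[a := i], ?J) 1 else 0) = (0 :: _ \<Rightarrow>\<^sub>0 'k)"
    if "a < sum_list la" for a
    using L[OF that] by (simp add: bact_csy_word plinear_0[OF plinear_bact] plinear_0[OF plinear_tprod_left])
  have 2: "bact (csy la mu) (if ?J ! b = i then sing (?I, ?J[b := j]) 1 else 0) = (0 :: _ \<Rightarrow>\<^sub>0 'k)"
    if "b < sum_list mu" for b
    using R[OF that] by (simp add: bact_csy_word plinear_0[OF plinear_bact] plinear_0[OF plinear_tprod_right])
  have "ee i j (hw_vector la mu) = (bact (csy la mu) (eword i j (?I, ?J)) :: _ \<Rightarrow>\<^sub>0 'k)"
    unfolding hw_vector_def
    by (subst bact_ee[OF csy_balg tless_mixed[OF hw_tless] nz, symmetric]) simp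
  also have "\<dots> = 0"
    unfolding eword_def fst_conv snd_conv plinear_diff[OF plinear_bact] plinear_sum[OF plinear_bact] l
    using 1 2 by simp
  finally show ?thesis .
qed

section \<open>The weight of the highest weight vector\<close>

lemma card_tab_row:
  "card {x. x < sum_list la \<and> tab_row la x = r} = (if r < length la then la ! r else 0)"
proof (cases "r < length la")
  case True
  have "{x. x < sum_list la \<and> tab_row la x = r} = (\<lambda>j. sum_list (take r la) + j) ` {..<la ! r}"
  proof (intro equalityI subsetI)
    fix x assume "x \<in> {x. x < sum_list la \<and> tab_row la x = r}"
    then show "x \<in> (\<lambda>j. sum_list (take r la) + j) ` {..<la ! r}"
      using tab_of_entry[of x la] by (intro image_eqI[of _ _ "tab_col la x"]) auto
  qed (use tab_cell[OF True] in auto)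
  then show ?thesis using True by (simp add: card_image)
next
  case False
  then have "{x. x < sum_list la \<and> tab_row la x = r} = {}" using tab_of_entry(1) by blast
  then show ?thesis using False by (simp only: card.empty if_False)
qed

lemma count_rows:
  assumes "inj f"
  shows "(\<Sum>i=1..length la. of_nat (la ! (i - 1)) * (if f i = z then 1 else 0))
    = (of_nat (card {x. x < sum_list la \<and> f (tab_row la x + 1) = z}) :: 'k::field_char_0)"
proof (cases "\<exists>r. f (r + 1) = z")
  case True
  then obtain r where r: "f (r + 1) = z" by blast
  then have e: "f i = z \<longleftrightarrow> i = r + 1" for i using assms by (auto simp: inj_eq)
  have "(\<Sum>i=1..length la. of_nat (la ! (i - 1)) * (if f i = z then 1 else 0))
      = (\<Sum>i=1..length la. if i = r + 1 then of_nat (la ! r) else (0 :: 'k))"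
    by (rule sum.cong) (auto simp: e)
  also have "\<dots> = of_nat (card {x. x < sum_list la \<and> tab_row la x = r})"
    by (simp add: card_tab_row)
  finally show ?thesis by (simp add: e)
next
  case False
  then have "f i \<noteq> z" if "i \<ge> 1" for i using that by (metis add.commute le_add_diff_inverse)
  then show ?thesis using False by simp
qed

lemma eps_single: "eps z (sing ([i], [i]) 1) = (if z = i then 1 else 0)"
  by (auto simp: eps_def lookup_single when_def)

lemma weight_single:
  "weight la mu (sing ([i], [i]) 1) = (of_nat (card {x. x < sum_list la \<and> hw_left la ! x = i})
     - of_nat (card {x. x < sum_list mu \<and> hw_right mu ! x = i}) :: 'k::field_char_0)"
proof -
  have 1: "{x. x < sum_list la \<and> hw_left la ! x = i} = {x. x < sum_list la \<and> int (tab_row la x + 1) = i}"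
    by (auto simp: hw_left_def)
  have 2: "{x. x < sum_list mu \<and> hw_right mu ! x = i} = {x. x < sum_list mu \<and> - int (tab_row mu x + 1) = i}"
    by (auto simp: hw_right_def)
  show ?thesis
    unfolding weight_def eps_single 1 2 count_rows[of int la i, symmetric, unfolded inj_def]
    using count_rows[of int la i, where 'k = 'k] count_rows[of "\<lambda>i. - int i" mu i, where 'k = 'k]
    by (simp add: inj_def)
qed

lemma hw_vector_weight:
  assumes i: "i \<noteq> 0"
  shows "ee i i (hw_vector la mu) = pscale (weight la mu (sing ([i], [i]) 1)) (hw_vector la mu :: _ \<Rightarrow>\<^sub>0 'k::field_char_0)"
proof -
  let ?I = "hw_left la" and ?J = "hw_right mu" and ?w = "sing (hw_left la, hw_right mu) (1 :: 'k)"
  have count: "(\<Sum>a<n. if K ! a = i then ?w else 0) = pscale (of_nat (card {x. x < n \<and> K ! x = i})) ?w"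
    for K :: "int list" and n
  proof -
    have "(\<Sum>a<n. if K ! a = i then ?w else 0) = (\<Sum>a\<in>{a \<in> {..<n}. K ! a = i}. ?w)"
      by (rule sum.inter_filter[symmetric]) simp
    also have "{a \<in> {..<n}. K ! a = i} = {x. x < n \<and> K ! x = i}" by auto
    finally show ?thesis by (simp only: sum_constant_pscale)
  qed
  have l: "length ?I = sum_list la" "length ?J = sum_list mu" by (simp_all add: hw_left_def hw_right_def)
  have u: "(if K ! a = i then sing (K[a := i], M) 1 else 0) = (if K ! a = i then sing (K, M) 1 else (0 :: _ \<Rightarrow>\<^sub>0 'k))"
    "(if K ! a = i then sing (M, K[a := i]) 1 else 0) = (if K ! a = i then sing (M, K) 1 else (0 :: _ \<Rightarrow>\<^sub>0 'k))"
    for K M :: "int list" and a by auto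
  have "eword i i (?I, ?J) = pscale (weight la mu (sing ([i], [i]) 1)) ?w"
    unfolding eword_def fst_conv snd_conv u count l weight_single pvs.scale_left_diff_distrib ..
  moreover have "ee i i (hw_vector la mu) = (bact (csy la mu) (eword i i (?I, ?J)) :: _ \<Rightarrow>\<^sub>0 'k)"
    unfolding hw_vector_def
    by (subst bact_ee[OF csy_balg tless_mixed[OF hw_tless] i i, symmetric]) simp
  ultimately show ?thesis by (simp only: plinear_pscale[OF plinear_bact] hw_vector_def)
qed

lemma weight_add: "weight la mu (X + Y) = weight la mu X + weight la mu Y"
  by (simp add: weight_def eps_def lookup_add ring_distribs sum.distrib)
lemma weight_pscale: "weight la mu (pscale c X) = c * weight la mu X"
  by (simp add: weight_def eps_def sum_distrib_left right_diff_distrib mult.left_commute)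
lemma weight_0: "weight la mu 0 = 0"
  by (simp add: weight_def eps_def)

lemma mixed_tless_gam: "gam la mu \<subseteq> mixed (sum_list la) (sum_list mu)"
  by (auto simp: gam_def intro: tless_mixed)

theorem Gamma_mod_irreducible:
  fixes P :: "('k::field_char_0, 'v::ab_group_add, 'w::ab_group_add) dual_pair"
  assumes P: "dual_system P" and la: "partition_of la" "partition_of mu" and L: "sl P \<subseteq> L" "L \<subseteq> gl"
  shows "irreducible_lie_module pscale (bracket P) L pscale (act P) (Gamma_mod P la mu)"
  unfolding irreducible_lie_module_def Gamma_mod_eq[OF P la]
proof (intro conjI allI impI)
  show "lie_module pscale (bracket P) L pscale (act P) (gam la mu)"
    by (rule lie_module_act[OF P mixed_tless_gam gam_subspace gam_ee L(2)])
  show "gam la mu \<noteq> {0 :: _ \<Rightarrow>\<^sub>0 'k}"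
    using hw_vector_gam[OF la, where 'k = 'k] hw_vector_nonzero[OF la, where 'k = 'k] by blast
  fix N :: "((int list \<times> int list) \<Rightarrow>\<^sub>0 'k) set" assume N: "submodule L pscale (act P) (gam la mu) N"
  then have "N \<subseteq> gam la mu" by (simp add: submodule_def)
  then show "N = {0} \<or> N = gam la mu"
    using gam_irreducible[OF la submodule_slstable[OF P mixed_tless_gam L(1) N]] by blast
qed

theorem Gamma_mod_highest_weight:
  fixes P :: "('k::field_char_0, 'v::ab_group_add, 'w::ab_group_add) dual_pair"
  assumes P: "dual_system P" and la: "partition_of la" "partition_of mu"
  shows "highest_weight_module P pscale (act P) (Gamma_mod P la mu) (weight la mu)"
proof -
  let ?v = "hw_vector la mu :: (int list \<times> int list) \<Rightarrow>\<^sub>0 'k" and ?M = "gam la mu :: ((int list \<times> int list) \<Rightarrow>\<^sub>0 'k) set"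
  have vM: "?v \<in> ?M" by (rule hw_vector_gam[OF la])
  have vm: "?v \<in> mixed (sum_list la) (sum_list mu)" using vM mixed_tless_gam by blast
  have irr: "irreducible_lie_module pscale (bracket P) gl pscale (act P) ?M"
    using Gamma_mod_irreducible[OF P la sl_gl subset_refl] by (simp add: Gamma_mod_eq[OF P la])
  have lie: "lie_module pscale (bracket P) gl pscale (act P) ?M"
    using irr by (simp add: irreducible_lie_module_def)
  have nil: "act P X ?v = 0" if X: "X \<in> nilradical P" for X
  proof -
    have "nilradical P \<subseteq> {X \<in> gl. actx X ?v = 0}"
      unfolding nilradical_def
    proof (rule pvs.span_minimal)
      show "pvs.subspace {X \<in> gl. actx X ?v = 0}"
        using pvs.subspace_0[OF subspace_mixed[of 1 1]]
        by (intro pvs.subspaceI) (auto simp: gl_add gl_pscale plinear_0[OF plinear_actx_left]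
            plinear_add[OF plinear_actx_left] plinear_pscale[OF plinear_actx_left] gl_def mixed_add mixed_pscale)
      show "{elem P i j |i j. positive_root i j} \<subseteq> {X \<in> gl. actx X ?v = 0}"
      proof
      fix Y assume "Y \<in> {elem P i j |i j. positive_root i j}"
      then obtain i j where Y: "Y = elem P i j" "positive_root i j" by blast
      then have "i \<noteq> 0" "j \<noteq> 0" by (auto simp: positive_root_def)
      then show "Y \<in> {X \<in> gl. actx X ?v = 0}"
        using Y hw_vector_ee[OF la Y(2), where 'k = 'k] by (simp add: elem_eq[OF P] elem_gl)
      qed
    qed
    then show ?thesis using act_eq_actx[OF P _ vm] X by auto
  qed
  have cart: "act P H ?v = pscale (weight la mu H) ?v" if H: "H \<in> cartan P" for H
  proof -
    have "cartan P \<subseteq> {X \<in> gl. actx X ?v = pscale (weight la mu X) ?v}"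
      unfolding cartan_def
    proof (rule pvs.span_minimal)
      show "pvs.subspace {X \<in> gl. actx X ?v = pscale (weight la mu X) ?v}"
        using pvs.subspace_0[OF subspace_mixed[of 1 1]]
        by (intro pvs.subspaceI) (auto simp: gl_add gl_pscale plinear_0[OF plinear_actx_left]
            plinear_add[OF plinear_actx_left] plinear_pscale[OF plinear_actx_left] gl_def mixed_add mixed_pscale
            weight_add weight_pscale weight_0 pvs.scale_left_distrib)
      show "{elem P i i |i. i \<noteq> 0} \<subseteq> {X \<in> gl. actx X ?v = pscale (weight la mu X) ?v}"
      proof
      fix Y assume "Y \<in> {elem P i i |i. i \<noteq> 0}"
      then obtain i where Y: "Y = elem P i i" "i \<noteq> 0" by blast
      then show "Y \<in> {X \<in> gl. actx X ?v = pscale (weight la mu X) ?v}"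
        using hw_vector_weight[OF Y(2), of la mu, where 'k = 'k] by (simp add: elem_eq[OF P] elem_gl)
      qed
    qed
    then show ?thesis using act_eq_actx[OF P _ vm] H by auto
  qed
  have gen: "\<Inter> {N. submodule gl pscale (act P) ?M N \<and> ?v \<in> N} = ?M"
  proof -
    have "N = ?M" if "submodule gl pscale (act P) ?M N" "?v \<in> N" for N
      using irr that hw_vector_nonzero[OF la, where 'k = 'k] unfolding irreducible_lie_module_def by blast
    moreover have "submodule gl pscale (act P) ?M ?M"
      using lie by (simp add: submodule_def lie_module_def)
    ultimately have "{N. submodule gl pscale (act P) ?M N \<and> ?v \<in> N} = {?M}" using vM by blast
    then show ?thesis by simp
  qed
  show ?thesis
    unfolding highest_weight_module_def Gamma_mod_eq[OF P la]
    using lie vM hw_vector_nonzero[OF la, where 'k = 'k] nil cart gen by blast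
qed

section \<open>The decomposition\<close>

lemma lookup_pmap: "f 0 = 0 \<Longrightarrow> lk (Poly_Mapping.map f p) k = f (lk p k)"
  by (simp add: map.rep_eq when_def)

lemma lookup_decomp_scale [simp]: "lk (decomp_scale c f) i = pscale c (lk f i)"
  by (simp add: decomp_scale_def lookup_pmap)

lemma module_decomp_scale: "module decomp_scale"
  by unfold_locales (auto intro!: poly_mapping_eqI simp: lookup_add pvs.scale_right_distrib pvs.scale_left_distrib)

lemma tmap_eq: "tmap F G = lext (\<lambda>k. tprod (F (sing (fst k) 1)) (G (sing (snd k) 1)))"
  by (rule ext) (simp add: tmap_def lext_def case_prod_unfold)

lemma plinear_tmap: "plinear (tmap F G)"
  unfolding tmap_eq by (rule plinear_lext)

lemma tmap_tprod:
  assumes F: "plinear F" and G: "plinear G"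
  shows "tmap F G (tprod x y) = tprod (F x) (G y)"
proof (rule plinear_eqI[where t = x])
  show "plinear (\<lambda>x. tmap F G (tprod x y))" "plinear (\<lambda>x. tprod (F x) (G y))"
    by (rule plinear_compose[OF plinear_tmap plinear_tprod_left] plinear_compose[OF plinear_tprod_left F])+
  fix a
  show "tmap F G (tprod (sing a 1) y) = tprod (F (sing a 1)) (G y)"
  proof (rule plinear_eqI[where t = y])
    show "plinear (\<lambda>y. tmap F G (tprod (sing a 1) y))" "plinear (\<lambda>y. tprod (F (sing a 1)) (G y))"
      by (rule plinear_compose[OF plinear_tmap plinear_tprod_right] plinear_compose[OF plinear_tprod_right G])+
  qed (simp add: tmap_eq)
qed

lemma plinear_act: "plinear (act P X)"
  unfolding act_def lift_eq_lext lext_def[of _ X]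
  by (intro plinear_fsum plinear_fpscale plinear_lext)

lemma pact_actx:
  assumes g: "fst g \<in> Sy p" "snd g \<in> Sy q" and X: "X \<in> gl" and t: "t \<in> mixed p q"
  shows "pact g (actx X t) = actx X (pact g t)"
proof (rule plinear_eqI[where t = X])
  show "plinear (\<lambda>X. pact g (actx X t))" "plinear (\<lambda>X. actx X (pact g t))"
    by (rule plinear_compose[OF plinear_pact plinear_actx_left] plinear_actx_left)+
  fix k assume "k \<in> pkeys X"
  obtain x y where "k = ([x], [y])" "x \<noteq> 0" "y \<noteq> 0" by (rule gl_key[OF X \<open>k \<in> pkeys X\<close>])
  then show "pact g (actx (sing k 1) t) = actx (sing k 1) (pact g t)"
    using pact_ee[OF g t] by simp
qed

lemma bact_actx:
  assumes b: "b \<in> balg p q" and X: "X \<in> gl" and t: "t \<in> mixed p q"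
  shows "bact b (actx X t) = actx X (bact b t)"
proof (rule plinear_eqI[where t = b])
  show "plinear (\<lambda>b. bact b (actx X t))" "plinear (\<lambda>b. actx X (bact b t))"
    by (rule plinear_bact_left plinear_compose[OF plinear_actx plinear_bact_left])+
  fix g assume "g \<in> pkeys b"
  then show "bact (sing g 1) (actx X t) = actx X (bact (sing g 1) t)"
    using pact_actx[OF _ _ X t] balg_keys[OF b] by simp
qed

subsection \<open>Specht modules\<close>

definition raw2 :: "((sym \<times> sym) \<Rightarrow>\<^sub>0 'k::field) \<Rightarrow> ((nat \<Rightarrow> nat) \<times> (nat \<Rightarrow> nat)) \<Rightarrow>\<^sub>0 'k" where
  "raw2 = lext (\<lambda>g. sing (sfun (fst g), sfun (snd g)) 1)"

lemma plinear_raw2: "plinear raw2"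
  unfolding raw2_def by (rule plinear_lext)
lemma raw2_single [simp]: "raw2 (sing g c) = sing (sfun (fst g), sfun (snd g)) c"
  by (simp add: raw2_def)

lemma raw2_tprod: "raw2 (tprod x y) = tprod (raw x) (raw y)"
proof (rule plinear_eqI[where t = x])
  show "plinear (\<lambda>x. raw2 (tprod x y))" "plinear (\<lambda>x. tprod (raw x) (raw y))"
    by (rule plinear_compose[OF plinear_raw2 plinear_tprod_left] plinear_compose[OF plinear_tprod_left plinear_raw])+
  fix a
  show "raw2 (tprod (sing a 1) y) = tprod (raw (sing a 1)) (raw y)"
  proof (rule plinear_eqI[where t = y])
    show "plinear (\<lambda>y. raw2 (tprod (sing a 1) y))" "plinear (\<lambda>y. tprod (raw (sing a 1)) (raw y))"
      by (rule plinear_compose[OF plinear_raw2 plinear_tprod_right] plinear_compose[OF plinear_tprod_right plinear_raw])+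
  qed simp
qed

lemma group_algebra_eq: "group_algebra d = raw ` galg d"
proof (intro equalityI subsetI)
  fix x :: "(nat \<Rightarrow> nat) \<Rightarrow>\<^sub>0 'a" assume x: "x \<in> group_algebra d"
  then have k: "f permutes {..<d}" if "f \<in> pkeys x" for f using that by (auto simp: group_algebra_def)
  have "raw (\<Sum>f\<in>pkeys x. sing (Abs_sym f) (lk x f)) = (\<Sum>f\<in>pkeys x. sing f (lk x f))"
    unfolding plinear_sum[OF plinear_raw] by (rule sum.cong) (simp_all add: sfun_Abs_sym[OF k])
  also have "\<dots> = x" using poly_mapping_expand[of x] by simp
  finally show "x \<in> raw ` galg d"
    using k by (intro image_eqI[of _ _ "\<Sum>f\<in>pkeys x. sing (Abs_sym f) (lk x f)"])
      (auto intro!: galg_sum galg_single Abs_sym_Sy)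
next
  fix x :: "(nat \<Rightarrow> nat) \<Rightarrow>\<^sub>0 'a" assume "x \<in> raw ` galg d"
  then obtain y where y: "x = raw y" "y \<in> galg d" by auto
  have "f permutes {..<d}" if f: "f \<in> pkeys x" for f
  proof (rule ccontr)
    assume n: "\<not> f permutes {..<d}"
    have "lk x f = 0"
      unfolding y(1) raw_def lookup_lext
      by (rule sum.neutral) (use n y(2) in \<open>auto simp: lookup_single when_def galg_def dest!: Sy_permutes subsetD\<close>)
    then show False using f by (simp add: in_keys_iff)
  qed
  then show "x \<in> group_algebra d" by (auto simp: group_algebra_def)
qed

lemma specht_eq: "specht la = raw ` (\<lambda>x. x * yla la) ` galg (sum_list la)"
  unfolding specht_def group_algebra_eq image_image young_symmetrizer_eq gmul_raw ..

text \<open>The tensor product of two left ideals generated by Young symmetrizers, as a single left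
  ideal for the product group (\<open>tensor_specht_eq\<close>).\<close>

definition hmod :: "nat list \<Rightarrow> nat list \<Rightarrow> (((nat \<Rightarrow> nat) \<times> (nat \<Rightarrow> nat)) \<Rightarrow>\<^sub>0 'k::field) set" where
  "hmod la mu = (\<lambda>x. raw2 (x * csy la mu)) ` balg (sum_list la) (sum_list mu)"

lemma balg_subspace: "pvs.subspace (balg p q)"
proof (rule pvs.subspaceI)
  show "0 \<in> balg p q" by (simp add: balg_def)
  show "x + y \<in> balg p q" if "x \<in> balg p q" "y \<in> balg p q" for x y
    using that Poly_Mapping.keys_add[of x y] unfolding balg_def mem_Collect_eq by blast
  show "pscale c x \<in> balg p q" if "x \<in> balg p q" for c x
    using that keys_pscale[of c x] unfolding balg_def mem_Collect_eq by blast
qed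

lemma plinear_image_subspace:
  assumes "plinear F" "pvs.subspace S"
  shows "pvs.subspace (F ` S)"
proof (rule pvs.subspaceI)
  show "0 \<in> F ` S" using pvs.subspace_0[OF assms(2)] by (intro image_eqI[of _ _ 0]) (simp_all add: plinear_0[OF assms(1)])
next
  fix x y assume "x \<in> F ` S" "y \<in> F ` S"
  then obtain a b where "a \<in> S" "b \<in> S" "x = F a" "y = F b" by auto
  then show "x + y \<in> F ` S"
    by (intro image_eqI[of _ _ "a + b"]) (simp_all add: plinear_add[OF assms(1)] pvs.subspace_add[OF assms(2)])
next
  fix c x assume "x \<in> F ` S"
  then obtain a where "a \<in> S" "x = F a" by auto
  then show "pscale c x \<in> F ` S"
    by (intro image_eqI[of _ _ "pscale c a"]) (simp_all add: plinear_pscale[OF assms(1)] pvs.subspace_scale[OF assms(2)])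
qed

lemma plinear_hmod: "plinear (\<lambda>x. raw2 (x * c))"
  by (rule plinear_compose[OF plinear_raw2 plinear_mult_left])

lemma tensor_specht_eq: "tensor_subspace (specht la) (specht mu) = (hmod la mu :: (_ \<Rightarrow>\<^sub>0 'a::field) set)" (is "?T = ?H")
proof
  show "?T \<subseteq> ?H"
    unfolding tensor_subspace_def
  proof (rule pvs.span_minimal)
    show "pvs.subspace ?H"
      unfolding hmod_def by (rule plinear_image_subspace[OF plinear_hmod balg_subspace])
    show "{tprod m n |m n. m \<in> specht la \<and> n \<in> specht mu} \<subseteq> ?H"
    proof
      fix z :: "((nat \<Rightarrow> nat) \<times> (nat \<Rightarrow> nat)) \<Rightarrow>\<^sub>0 'a" assume "z \<in> {tprod m n |m n. m \<in> specht la \<and> n \<in> specht mu}"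
      then obtain m n where z: "z = tprod m n" and "m \<in> specht la" "n \<in> specht mu" by blast
      then obtain x y where xy: "x \<in> galg (sum_list la)" "y \<in> galg (sum_list mu)" "m = raw (x * yla la)" "n = raw (y * yla mu)"
        unfolding specht_eq by auto
      show "z \<in> ?H"
        unfolding hmod_def z
        by (rule image_eqI[of _ _ "tprod x y"]) (use xy in \<open>simp_all add: csy_def tprod_mult raw2_tprod tprod_balg\<close>)
    qed
  qed
  show "?H \<subseteq> ?T"
    unfolding hmod_def
  proof (rule image_subsetI)
    fix x :: "(sym \<times> sym) \<Rightarrow>\<^sub>0 'a" assume x: "x \<in> balg (sum_list la) (sum_list mu)"
    have "raw2 (sing g (1 :: 'a) * csy la mu) \<in> tensor_subspace (specht la) (specht mu)" if "g \<in> pkeys x" for g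
    proof -
      have "sing g 1 = tprod (sing (fst g) (1 :: 'a)) (sing (snd g) (1 :: 'a))" by simp
      then have "raw2 (sing g (1 :: 'a) * csy la mu) = tprod (raw (sing (fst g) 1 * yla la)) (raw (sing (snd g) (1 :: 'a) * yla mu))"
        by (simp only: csy_def tprod_mult raw2_tprod)
      moreover have "raw (sing (fst g) 1 * yla la) \<in> (specht la :: (_ \<Rightarrow>\<^sub>0 'a) set)" "raw (sing (snd g) 1 * yla mu) \<in> (specht mu :: (_ \<Rightarrow>\<^sub>0 'a) set)"
        unfolding specht_eq using balg_keys[OF x that] by (auto intro!: imageI galg_single)
      ultimately show ?thesis unfolding tensor_subspace_def by (intro pvs.span_base) blast
    qed
    moreover have "raw2 (x * csy la mu) = (\<Sum>g\<in>pkeys x. pscale (lk x g) (raw2 (sing g 1 * csy la mu)))"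
      by (rule plinear_expand[OF plinear_hmod])
    ultimately show "raw2 (x * csy la mu) \<in> tensor_subspace (specht la) (specht mu)"
      unfolding tensor_subspace_def by (simp only:) (intro pvs.span_sum pvs.span_scale)
  qed
qed

subsection \<open>The components of the isomorphism\<close>

text \<open>Up to the scalar, this is the component of \<open>m\<close> in \<^term>\<open>tensor_subspace (gam la mu) (hmod la mu)\<close>:
  the inverse of \<open>y \<otimes> h \<mapsto> h y\<close> is read off the coefficients of \<open>c g\<^sup>-\<^sup>1 h\<close> for the Young symmetrizer \<open>c\<close>.\<close>

definition cmp :: "nat list \<Rightarrow> nat list \<Rightarrow> ((int list \<times> int list) \<Rightarrow>\<^sub>0 'k::field)
    \<Rightarrow> ((int list \<times> int list) \<times> (nat \<Rightarrow> nat) \<times> (nat \<Rightarrow> nat)) \<Rightarrow>\<^sub>0 'k" where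
  "cmp la mu m = pscale (inverse (csy_coeff la mu * csy_coeff la mu))
     (\<Sum>g\<in>Sy (sum_list la) \<times> Sy (sum_list mu). tprod (bact (csy la mu) (pact (- g) m)) (raw2 (sing g 1)))"

lemma plinear_cmp: "plinear (cmp la mu)"
  unfolding cmp_def
  by (intro plinear_fpscale plinear_fsum plinear_compose[OF plinear_tprod_left]
      plinear_compose[OF plinear_bact] plinear_pact)

lemma pair_uminus_Sy: "g \<in> Sy p \<times> Sy q \<Longrightarrow> - g \<in> Sy p \<times> Sy q"
  by (auto simp: mem_Times_iff)

text \<open>The group elements in the second factor are linearly independent, so the component
  remembers every single term of the sum. Injectivity of the decomposition rests on this.\<close>

lemma lookup_cmp:
  assumes g: "g \<in> Sy (sum_list la) \<times> Sy (sum_list mu)"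
  shows "lk (cmp la mu m) (w, sfun (fst g), sfun (snd g))
    = inverse (csy_coeff la mu * csy_coeff la mu) * lk (bact (csy la mu) (pact (- g) m)) w"
proof -
  have "(\<Sum>h\<in>Sy (sum_list la) \<times> Sy (sum_list mu). lk (bact (csy la mu) (pact (- h) m)) w
      * lk (sing (sfun (fst h), sfun (snd h)) 1) (sfun (fst g), sfun (snd g)))
    = (\<Sum>h\<in>Sy (sum_list la) \<times> Sy (sum_list mu). if h = g then lk (bact (csy la mu) (pact (- g) m)) w else 0)"
    by (rule sum.cong) (auto simp: lookup_single when_def sfun_inject prod_eq_iff)
  also have "\<dots> = lk (bact (csy la mu) (pact (- g) m)) w" using g by simp
  finally show ?thesis by (simp add: cmp_def lookup_sum)
qed

lemma sum_translate:
  assumes s: "s \<in> Sy p \<times> Sy q"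
  shows "(\<Sum>g\<in>Sy p \<times> Sy q. f (g + s)) = (\<Sum>g\<in>Sy p \<times> Sy q. f g)" "(\<Sum>g\<in>Sy p \<times> Sy q. f (s + g)) = (\<Sum>g\<in>Sy p \<times> Sy q. f g)"
proof -
  have "bij_betw (\<lambda>g. g + s) (Sy p \<times> Sy q) (Sy p \<times> Sy q)"
    by (rule bij_betwI[where g = "\<lambda>g. g - s"]) (use s in \<open>auto simp: mem_Times_iff diff_conv_add_uminus add.assoc intro!: Sy_plus Sy_uminus simp del: add_uminus_conv_diff\<close>)
  then show "(\<Sum>g\<in>Sy p \<times> Sy q. f (g + s)) = (\<Sum>g\<in>Sy p \<times> Sy q. f g)" by (rule sum.reindex_bij_betw)
  have "bij_betw (\<lambda>g. s + g) (Sy p \<times> Sy q) (Sy p \<times> Sy q)"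
    by (rule bij_betwI[where g = "\<lambda>g. - s + g"]) (use s in \<open>auto simp: mem_Times_iff intro!: Sy_plus Sy_uminus simp flip: add.assoc\<close>)
  then show "(\<Sum>g\<in>Sy p \<times> Sy q. f (s + g)) = (\<Sum>g\<in>Sy p \<times> Sy q. f g)" by (rule sum.reindex_bij_betw)
qed

text \<open>The second tensor factors g of the sum need not lie in the left ideal generated by c.
  But n times the sum has c c in place of c, and after translating the summation index one factor c
  can be carried over to the second component, which becomes g c.\<close>

lemma cmp_in_tensor:
  fixes m :: "(int list \<times> int list) \<Rightarrow>\<^sub>0 'k::field_char_0"
  assumes la: "partition_of la" "partition_of mu" and m: "m \<in> tless (sum_list la) (sum_list mu)"
  shows "cmp la mu m \<in> tensor_subspace (gam la mu) (hmod la mu)"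
proof -
  let ?p = "sum_list la" and ?q = "sum_list mu" and ?c = "csy la mu :: (sym \<times> sym) \<Rightarrow>\<^sub>0 'k"
  let ?G = "Sy ?p \<times> Sy ?q" and ?n = "csy_coeff la mu :: 'k"
  note mm = tless_mixed[OF m]
  have gb: "sing g 1 \<in> balg ?p ?q" if "g \<in> ?G" for g using that by (auto intro: balg_single)
  let ?K = "\<lambda>y. \<Sum>g\<in>?G. tprod (bact (?c * sing (- g) 1) m) (raw2 (sing g 1 * y))"
  let ?L = "\<lambda>y. \<Sum>g\<in>?G. tprod (bact (?c * y * sing (- g) 1) m) (raw2 (sing g 1))"
  have KL: "?K ?c = ?L ?c"
  proof (rule plinear_eqI[where F = ?K and G = ?L and t = ?c])
    show "plinear ?K"
      by (intro plinear_fsum plinear_compose[OF plinear_tprod_right] plinear_compose[OF plinear_raw2] plinear_mult_right)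
    show "plinear ?L"
      by (intro plinear_fsum plinear_compose[OF plinear_tprod_left] plinear_compose[OF plinear_bact_left]
          plinear_compose[OF plinear_mult_left] plinear_mult_right)
    fix s assume "s \<in> pkeys ?c"
    then have s: "s \<in> ?G" using csy_balg[of la mu, where 'a = 'k] by (auto simp: balg_def)
    have e: "s - (g + s) = - g" for g
      by (simp only: diff_conv_add_uminus minus_add add.assoc[symmetric] right_minus add_0_left)
    have "?K (sing s 1) = (\<Sum>g\<in>?G. (\<lambda>h. tprod (bact (?c * sing (s + - h) 1) m) (raw2 (sing h 1))) (g + s))"
      by (intro sum.cong refl) (simp add: mult_single e)
    also have "\<dots> = (\<Sum>h\<in>?G. tprod (bact (?c * sing (s + - h) 1) m) (raw2 (sing h 1)))"
      by (rule sum_translate(1)[OF s])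
    also have "\<dots> = ?L (sing s 1)"
      by (intro sum.cong refl) (simp add: mult.assoc mult_single)
    finally show "?K (sing s 1) = ?L (sing s 1)" .
  qed
  have pc: "bact (?c * sing (- g) 1) m = bact ?c (pact (- g) m)" if "g \<in> ?G" for g
    using bact_mult[OF csy_balg gb[OF pair_uminus_Sy[OF that]] mm] by simp
  have "?L ?c = pscale ?n (\<Sum>g\<in>?G. tprod (bact ?c (pact (- g) m)) (raw2 (sing g 1)))"
    unfolding pvs.scale_sum_right
    by (intro sum.cong refl) (simp add: csy_square(1)[OF la] pscale_mult_left
        plinear_pscale[OF plinear_bact_left] plinear_pscale[OF plinear_tprod_left] pc)
  then have "pscale (inverse ?n) (pscale ?n (\<Sum>g\<in>?G. tprod (bact ?c (pact (- g) m)) (raw2 (sing g 1)))) = pscale (inverse ?n) (?K ?c)"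
    using KL by simp
  then have S: "(\<Sum>g\<in>?G. tprod (bact ?c (pact (- g) m)) (raw2 (sing g 1))) = pscale (inverse ?n) (?K ?c)"
    unfolding pscale_cancel[OF csy_square(2)[OF la]] .
  have "?K ?c \<in> tensor_subspace (gam la mu) (hmod la mu)"
    unfolding tensor_subspace_def
  proof (intro pvs.span_sum pvs.span_base CollectI exI conjI)
    fix g assume g: "g \<in> ?G"
    show "tprod (bact (?c * sing (- g) 1) m) (raw2 (sing g 1 * ?c)) = tprod (bact (?c * sing (- g) 1) m) (raw2 (sing g 1 * ?c))" ..
    have "pact (- g) m \<in> tless ?p ?q" using pair_uminus_Sy[OF g] by (intro pact_tless m) (simp_all only: mem_Times_iff)
    then show "bact (?c * sing (- g) 1) m \<in> gam la mu" unfolding pc[OF g] by (rule bact_csy_gam[OF la])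
    show "raw2 (sing g 1 * ?c) \<in> hmod la mu" unfolding hmod_def by (rule imageI[OF gb[OF g]])
  qed
  then show ?thesis
    unfolding cmp_def S tensor_subspace_def by (intro pvs.span_scale)
qed

text \<open>The terms of the sum are c' g' x c y with c' the symmetrizer of the second pair and g'
  inverse to g. For different shapes they vanish by orthogonality. For equal shapes
  \<open>csy_sandwich\<close> gives n times the coefficient of x c at g, and c y = n y gives another
  n; this is the square of n in the definition of \<open>cmp\<close>.\<close>

lemma cmp_generator:
  fixes y :: "(int list \<times> int list) \<Rightarrow>\<^sub>0 'k::field_char_0"
  assumes la: "partition_of la" "partition_of mu" and la': "partition_of la'" "partition_of mu'"
    and s: "sum_list la' = sum_list la" "sum_list mu' = sum_list mu"
    and y: "y \<in> gam la mu" and x: "x \<in> balg (sum_list la) (sum_list mu)"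
  shows "cmp la' mu' (bact (x * csy la mu) y) = (if (la', mu') = (la, mu) then tprod y (raw2 (x * csy la mu)) else 0)"
proof -
  let ?p = "sum_list la" and ?q = "sum_list mu" and ?c = "csy la mu :: (sym \<times> sym) \<Rightarrow>\<^sub>0 'k" and ?d = "csy la' mu' :: (sym \<times> sym) \<Rightarrow>\<^sub>0 'k"
  let ?G = "Sy ?p \<times> Sy ?q" and ?n = "csy_coeff la mu :: 'k"
  have ym: "y \<in> mixed ?p ?q" using y mixed_tless_gam by blast
  have d: "?d \<in> balg ?p ?q" using csy_balg[of la' mu', where 'a = 'k] s by simp
  have gb: "sing g 1 \<in> balg ?p ?q" if "g \<in> ?G" for g using that by (auto intro: balg_single)
  have b: "bact ?d (pact (- g) (bact (x * ?c) y)) = bact (?d * (sing (- g) 1 * x) * ?c) y" if g: "g \<in> ?G" for g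
  proof -
    note g' = gb[OF pair_uminus_Sy[OF g]] and xc = balg_mult[OF x csy_balg]
    have "bact (?d * (sing (- g) 1 * (x * ?c))) y = bact ?d (bact (sing (- g) 1) (bact (x * ?c) y))"
      by (simp only: bact_mult[OF d balg_mult[OF g' xc] ym] bact_mult[OF g' xc ym])
    then show ?thesis by (simp add: mult.assoc)
  qed
  show ?thesis
  proof (cases "(la', mu') = (la, mu)")
    case False
    have "?d * (sing (- g) 1 * x) * ?c = 0" if "g \<in> ?G" for g
      using csy_orthogonal[OF la'(1,2) la, of "sing (- g) 1 * x"] s False
        balg_mult[OF gb[OF pair_uminus_Sy[OF that]] x] by simp
    then show ?thesis
      unfolding if_not_P[OF False] by (simp add: cmp_def s b plinear_0[OF plinear_bact_left] plinear_0[OF plinear_tprod_left])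
  next
    case True
    have cy: "bact ?c y = pscale ?n y" using y by (simp add: gam_def)
    have e: "bact (?c * (sing (- g) 1 * x) * ?c) y = pscale (?n * ?n * lk (x * ?c) g) y" if g: "g \<in> ?G" for g
    proof -
      have "lk (?c * (sing (- g) 1 * x)) 0 = lk (sing (- g) 1 * (x * ?c)) 0"
        by (subst lookup_times_commute) (simp add: mult.assoc)
      also have "\<dots> = lk (x * ?c) g" by (simp add: lookup_single_mult)
      finally show ?thesis
        using csy_sandwich[OF la balg_mult[OF gb[OF pair_uminus_Sy[OF g]] x]] cy
        by (simp add: plinear_pscale[OF plinear_bact_left] mult_ac)
    qed
    have b': "bact ?c (pact (- g) (bact (x * ?c) y)) = bact (?c * (sing (- g) 1 * x) * ?c) y" if "g \<in> ?G" for g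
      using b[OF that] True by simp
    have nz: "?n * ?n \<noteq> 0" using csy_square(2)[OF la, where 'k = 'k] by simp
    have t: "tprod (pscale (?n * ?n * lk (x * ?c) g) y) (raw2 (sing g 1))
        = pscale (?n * ?n) (tprod y (pscale (lk (x * ?c) g) (raw2 (sing g 1))))" for g
      by (simp only: plinear_pscale[OF plinear_tprod_left] plinear_pscale[OF plinear_tprod_right] pscale_pscale)
    have rx: "raw2 (x * ?c) = (\<Sum>g\<in>?G. pscale (lk (x * ?c) g) (raw2 (sing g 1)))"
      using arg_cong[OF balg_expand[OF balg_mult[OF x csy_balg]], of raw2]
      by (simp only: plinear_sum[OF plinear_raw2] plinear_pscale[OF plinear_raw2])
    have "(\<Sum>g\<in>?G. tprod (bact ?c (pact (- g) (bact (x * ?c) y))) (raw2 (sing g 1)))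
        = (\<Sum>g\<in>?G. pscale (?n * ?n) (tprod y (pscale (lk (x * ?c) g) (raw2 (sing g 1)))))"
      by (rule sum.cong[OF refl]) (simp only: b' e t)
    also have "\<dots> = pscale (?n * ?n) (tprod y (raw2 (x * ?c)))"
      unfolding pvs.scale_sum_right[symmetric] rx plinear_sum[OF plinear_tprod_right] ..
    finally show ?thesis using True by (simp only: cmp_def pscale_cancel[OF nz] prod.inject if_True simp_thms)
  qed
qed

text \<open>The symmetric groups commute with gl, so the action reaches the first tensor factor of
  each term.\<close>

lemma cmp_act:
  assumes P: "dual_system P" and X: "X \<in> gl" and m: "m \<in> mixed (sum_list la) (sum_list mu)"
  shows "cmp la mu (act P X m) = tmap (act P X) id (cmp la mu m)"
proof -
  let ?G = "Sy (sum_list la) \<times> Sy (sum_list mu)"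
  have "bact (csy la mu) (pact (- g) (act P X m)) = act P X (bact (csy la mu) (pact (- g) m))" if "g \<in> ?G" for g
  proof -
    have g: "fst (- g) \<in> Sy (sum_list la)" "snd (- g) \<in> Sy (sum_list mu)" using that by auto
    note pm = pact_mixed[OF g m]
    show ?thesis
      by (simp only: act_eq_actx[OF P X m] pact_actx[OF g X m] bact_actx[OF csy_balg X pm]
          act_eq_actx[OF P X bact_mixed[OF csy_balg pm]])
  qed
  then show ?thesis
    by (simp add: cmp_def plinear_pscale[OF plinear_tmap] plinear_sum[OF plinear_tmap]
        tmap_tprod[OF plinear_act plinear_id[folded id_def]])
qed

text \<open>Translating the summation variable by h moves h from m to the second tensor
  factor.\<close>

lemma cmp_pact:
  assumes h: "h \<in> Sy (sum_list la) \<times> Sy (sum_list mu)" and m: "m \<in> mixed (sum_list la) (sum_list mu)"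
  shows "cmp la mu (pact h m)
    = tmap id (tmap (gmul (sing (sfun (fst h)) 1)) (gmul (sing (sfun (snd h)) 1))) (cmp la mu m)"
proof -
  let ?G = "Sy (sum_list la) \<times> Sy (sum_list mu)" and ?c = "csy la mu :: (sym \<times> sym) \<Rightarrow>\<^sub>0 'a"
  let ?T = "tmap (gmul (sing (sfun (fst h)) (1 :: 'a))) (gmul (sing (sfun (snd h)) 1))"
  have T: "?T (raw2 (sing g 1)) = raw2 (sing (h + g) 1)" for g
    by (simp add: tmap_eq gmul_eq)
  have "(\<Sum>g\<in>?G. tprod (bact ?c (pact (- g) (pact h m))) (raw2 (sing g 1)))
      = (\<Sum>g\<in>?G. (\<lambda>k. tprod (bact ?c (pact (- k) (pact h m))) (raw2 (sing k 1))) (h + g))"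
    by (rule sum_translate(2)[OF h, symmetric])
  also have "\<dots> = (\<Sum>g\<in>?G. tmap id ?T (tprod (bact ?c (pact (- g) m)) (raw2 (sing g 1))))"
  proof (rule sum.cong[OF refl])
    fix g assume g: "g \<in> ?G"
    have hg: "h + g \<in> ?G" using h g by (auto simp: mem_Times_iff intro!: Sy_plus)
    have "pact (- (h + g)) (pact h m) = pact (- (h + g) + h) m"
      by (rule pact_plus[symmetric]) (use pair_uminus_Sy[OF hg] h m in \<open>simp_all only: mem_Times_iff\<close>)
    also have "- (h + g) + h = - g" by (simp add: minus_add add.assoc)
    finally show "tprod (bact ?c (pact (- (h + g)) (pact h m))) (raw2 (sing (h + g) 1))
        = tmap id ?T (tprod (bact ?c (pact (- g) m)) (raw2 (sing g 1)))"
      by (simp only: tmap_tprod[OF plinear_id[folded id_def] plinear_tmap] T id_apply)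
  qed
  finally show ?thesis
    by (simp add: cmp_def plinear_pscale[OF plinear_tmap] plinear_sum[OF plinear_tmap])
qed

subsection \<open>The isomorphism\<close>

definition shapes :: "nat \<Rightarrow> nat \<Rightarrow> (nat list \<times> nat list) set" where
  "shapes p q = {(la, mu). partition_of la \<and> partition_of mu \<and> sum_list la = p \<and> sum_list mu = q}"

lemma finite_shapes: "finite (shapes p q)"
proof -
  have "finite {la. partition_of la \<and> sum_list la = d}" for d
  proof (rule finite_subset)
    show "finite {la. set la \<subseteq> {..d} \<and> length la \<le> d}" by (rule finite_lists_length_le) simp
    show "{la. partition_of la \<and> sum_list la = d} \<subseteq> {la. set la \<subseteq> {..d} \<and> length la \<le> d}"
    proof clarify
      fix la assume "partition_of la"
      then have "\<forall>x\<in>set la. 1 \<le> x" by (auto simp: partition_of_def Suc_le_eq)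
      then have "length la \<le> sum_list la" by (induction la) auto
      then show "set la \<subseteq> {..sum_list la} \<and> length la \<le> sum_list la" by (auto intro: member_le_sum_list)
    qed
  qed
  then have "finite ({la. partition_of la \<and> sum_list la = p} \<times> {mu. partition_of mu \<and> sum_list mu = q})" by simp
  then show ?thesis by (rule rev_finite_subset) (auto simp: shapes_def)
qed

definition decomp_iso :: "nat \<Rightarrow> nat \<Rightarrow> ((int list \<times> int list) \<Rightarrow>\<^sub>0 'k::field)
    \<Rightarrow> (nat list \<times> nat list) \<Rightarrow>\<^sub>0 (((int list \<times> int list) \<times> (nat \<Rightarrow> nat) \<times> (nat \<Rightarrow> nat)) \<Rightarrow>\<^sub>0 'k)" where
  "decomp_iso p q m = (\<Sum>nu\<in>shapes p q. sing nu (cmp (fst nu) (snd nu) m))"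

lemma lookup_decomp_iso: "lk (decomp_iso p q m) nu = (if nu \<in> shapes p q then cmp (fst nu) (snd nu) m else 0)"
  using finite_shapes by (simp add: decomp_iso_def lookup_sum lookup_single when_def)

lemma decomp_iso_add: "decomp_iso p q (x + y) = decomp_iso p q x + decomp_iso p q y"
  by (rule poly_mapping_eqI) (simp add: lookup_decomp_iso lookup_add plinear_add[OF plinear_cmp])
lemma decomp_iso_scale: "decomp_iso p q (pscale c x) = decomp_scale c (decomp_iso p q x)"
  by (rule poly_mapping_eqI) (simp add: lookup_decomp_iso plinear_pscale[OF plinear_cmp])
lemma decomp_iso_0: "decomp_iso p q 0 = 0"
  by (rule poly_mapping_eqI) (simp add: lookup_decomp_iso plinear_0[OF plinear_cmp])

lemma decomp_eq:
  fixes P :: "('k::field_char_0, 'v::ab_group_add, 'w::ab_group_add) dual_pair"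
  assumes P: "dual_system P"
  shows "decomp P p q = {f. pkeys f \<subseteq> shapes p q \<and>
    (\<forall>nu\<in>shapes p q. lk f nu \<in> tensor_subspace (gam (fst nu) (snd nu)) (hmod (fst nu) (snd nu)))}"
  unfolding decomp_def direct_sum_def shapes_def[symmetric]
  by (auto simp: shapes_def Gamma_mod_eq[OF P] tensor_specht_eq)

lemma bij_decomp_iso:
  fixes P :: "('k::field_char_0, 'v::ab_group_add, 'w::ab_group_add) dual_pair"
  assumes P: "dual_system P"
  shows "bij_betw (decomp_iso p q) (tless p q) (decomp P p q)"
  unfolding bij_betw_def
proof
  show "inj_on (decomp_iso p q) (tless p q :: (_ \<Rightarrow>\<^sub>0 'k) set)"
  proof (rule inj_onI)
    fix x y :: "(int list \<times> int list) \<Rightarrow>\<^sub>0 'k"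
    assume x: "x \<in> tless p q" and y: "y \<in> tless p q" and e: "decomp_iso p q x = decomp_iso p q y"
    \<comment> \<open>The components determine c applied to every translate of the difference, so
      completeness applies.\<close>
    have "x - y = 0"
    proof (rule bact_complete)
      show "x - y \<in> mixed p q" using x y by (intro mixed_diff tless_mixed)
      fix la mu g assume la: "partition_of la" "partition_of mu" "sum_list la = p" "sum_list mu = q" and g: "g \<in> Sy p \<times> Sy q"
      have "cmp la mu x = cmp la mu y"
        using arg_cong[OF e, of "\<lambda>f. lk f (la, mu)"] la by (simp add: lookup_decomp_iso shapes_def)
      then have z: "cmp la mu (x - y) = 0" by (simp add: plinear_diff[OF plinear_cmp])
      have nz: "csy_coeff la mu \<noteq> (0 :: 'k)" by (rule csy_square(2)[OF la(1,2)])
      show "bact (csy la mu) (pact g (x - y)) = 0"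
      proof (rule poly_mapping_eqI)
        fix w
        show "lk (bact (csy la mu) (pact g (x - y))) w = lk 0 w"
          using lookup_cmp[of "- g" la mu "x - y" w] pair_uminus_Sy[OF g] la nz by (simp add: z del: sfun_uminus)
      qed
    qed
    then show "x = y" by simp
  qed
  show "decomp_iso p q ` tless p q = decomp P p q"
  proof
    show "decomp_iso p q ` tless p q \<subseteq> decomp P p q"
      unfolding decomp_eq[OF P]
      by (auto simp: in_keys_iff lookup_decomp_iso shapes_def split: if_splits intro!: cmp_in_tensor)
    let ?I = "decomp_iso p q ` (tless p q :: (_ \<Rightarrow>\<^sub>0 'k) set)"
    have add: "x + y \<in> ?I" if x: "x \<in> ?I" and y: "y \<in> ?I" for x y
    proof -
      obtain a where a: "a \<in> tless p q" "x = decomp_iso p q a" using x by (elim imageE)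
      obtain b where b: "b \<in> tless p q" "y = decomp_iso p q b" using y by (elim imageE)
      from a b show ?thesis
        by (intro image_eqI[of _ _ "a + b"]) (simp_all add: decomp_iso_add pvs.subspace_add[OF tless_subspace])
    qed
    have zero: "0 \<in> ?I"
      by (rule image_eqI[of _ _ 0]) (simp_all add: decomp_iso_0 pvs.subspace_0[OF tless_subspace])
    have comp: "sing (la, mu) z \<in> ?I"
      if nu: "(la, mu) \<in> shapes p q" and z: "z \<in> tensor_subspace (gam la mu) (hmod la mu)" for la mu z
    proof -
      have la: "partition_of la" "partition_of mu" "sum_list la = p" "sum_list mu = q" using nu by (auto simp: shapes_def)
      let ?Z = "{z. sing (la, mu) z \<in> ?I}"
      have "tensor_subspace (gam la mu) (hmod la mu) \<subseteq> ?Z"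
        unfolding tensor_subspace_def
      proof (rule pvs.span_minimal)
        show "pvs.subspace ?Z"
        proof (rule pvs.subspaceI)
          show "0 \<in> ?Z" using zero by simp
          show "x + y \<in> ?Z" if "x \<in> ?Z" "y \<in> ?Z" for x y
            using add that by (simp add: single_add)
          fix c x assume "x \<in> ?Z"
          then obtain a where a: "a \<in> tless p q" "sing (la, mu) x = decomp_iso p q a" by auto
          have "sing (la, mu) (pscale c x) = decomp_scale c (sing (la, mu) x)"
            by (rule poly_mapping_eqI) (simp add: lookup_single when_def)
          also have "\<dots> = decomp_iso p q (pscale c a)" by (simp add: a decomp_iso_scale)
          finally show "pscale c x \<in> ?Z"
            using a(1) by (auto intro!: image_eqI[of _ _ "pscale c a"] simp: pvs.subspace_scale[OF tless_subspace])
        qed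
        show "{tprod (m :: _ \<Rightarrow>\<^sub>0 'k) n |m n. m \<in> gam la mu \<and> n \<in> hmod la mu} \<subseteq> ?Z"
        proof clarify
          fix y :: "(int list \<times> int list) \<Rightarrow>\<^sub>0 'k" and n :: "((nat \<Rightarrow> nat) \<times> (nat \<Rightarrow> nat)) \<Rightarrow>\<^sub>0 'k" assume y: "y \<in> gam la mu" and "n \<in> hmod la mu"
          then obtain x where x: "x \<in> balg (sum_list la) (sum_list mu)" "n = raw2 (x * csy la mu)" by (auto simp: hmod_def)
          \<comment> \<open>The preimage of the pure tensor of y and h = x c is h y; by
            \<open>cmp_generator\<close> it has no other component.\<close>
          have "decomp_iso p q (bact (x * csy la mu) y) = sing (la, mu) (tprod y n)"
          proof (rule poly_mapping_eqI)
            fix nu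
            show "lk (decomp_iso p q (bact (x * csy la mu) y)) nu = lk (sing (la, mu) (tprod y n)) nu"
            proof (cases "nu \<in> shapes p q")
              case True
              then show ?thesis
                using cmp_generator[OF la(1,2) _ _ _ _ y x(1), of "fst nu" "snd nu"] la
                by (auto simp: lookup_decomp_iso shapes_def lookup_single when_def x(2) split: if_splits)
            next
              case False
              then show ?thesis using nu by (auto simp: lookup_decomp_iso lookup_single when_def)
            qed
          qed
          moreover have "bact (x * csy la mu) y \<in> tless p q"
            using bact_tless[OF balg_mult[OF x(1) csy_balg], of y] y la by (simp add: gam_def)
          ultimately show "sing (la, mu) (tprod y n) \<in> ?I" by (metis imageI)
        qed
      qed
      then show ?thesis using z by blast
    qed
    show "decomp P p q \<subseteq> ?I"
    proof
      fix f assume f: "f \<in> decomp P p q"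
      have "(\<Sum>nu\<in>A. sing nu (lk f nu)) \<in> ?I" if "finite A" "A \<subseteq> shapes p q" for A
        using that
      proof (induction A)
        case (insert nu A)
        have "sing nu (lk f nu) \<in> ?I"
          using comp[of "fst nu" "snd nu" "lk f nu"] insert.prems f by (auto simp: decomp_eq[OF P])
        then show ?case using insert add by simp
      qed (use zero in simp)
      then have "(\<Sum>nu\<in>shapes p q. sing nu (lk f nu)) \<in> ?I" using finite_shapes by blast
      moreover have "(\<Sum>nu\<in>shapes p q. sing nu (lk f nu)) = f"
      proof (rule poly_mapping_eqI)
        fix nu
        have "lk f nu = 0" if "nu \<notin> shapes p q"
          using that f by (auto simp: decomp_eq[OF P] in_keys_iff)
        then show "lk (\<Sum>nu\<in>shapes p q. sing nu (lk f nu)) nu = lk f nu"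
          using finite_shapes[of p q] by (simp add: lookup_sum lookup_single when_def)
      qed
      ultimately show "f \<in> ?I" by simp
    qed
  qed
qed

text \<open>The module axioms on the target are transported along the bijection f, so that only the
  compatibility of f with the operations has to be checked, and not the axioms on the direct
  sum.\<close>

lemma gl_sym_isomorphicI:
  assumes P: "dual_system P" and M: "gl_sym_module P p q s a r M" and s: "module s" "module s'"
    and f: "bij_betw f M M'"
      "\<And>x y. x \<in> M \<Longrightarrow> y \<in> M \<Longrightarrow> f (x + y) = f x + f y" "\<And>c x. x \<in> M \<Longrightarrow> f (s c x) = s' c (f x)"
      "\<And>X m. X \<in> gl \<Longrightarrow> m \<in> M \<Longrightarrow> f (a X m) = a' X (f m)"
      "\<And>\<sigma> \<tau> m. \<sigma> permutes {..<p} \<Longrightarrow> \<tau> permutes {..<q} \<Longrightarrow> m \<in> M \<Longrightarrow> f (r \<sigma> \<tau> m) = r' \<sigma> \<tau> (f m)"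
  shows "gl_sym_isomorphic P p q s a r M s' a' r' M'"
proof -
  have M': "M' = f ` M" using f(1) by (simp add: bij_betw_def)
  have lie: "lie_module pscale (bracket P) gl s a M" using M by (simp add: gl_sym_module_def)
  have sub: "module.subspace s M" using lie by (simp add: lie_module_def)
  note subM = module.subspace_0[OF s(1) sub] module.subspace_add[OF s(1) sub] module.subspace_scale[OF s(1) sub]
    module.subspace_diff[OF s(1) sub]
  have a: "a X m \<in> M" "a X (m + n) = a X m + a X n" "a X (s c m) = s c (a X m)"
    if "X \<in> gl" "m \<in> M" "n \<in> M" for X m n c
    using lie that unfolding lie_module_def linear_on_def by blast+
  have aX: "a (X + Y) m = a X m + a Y m" "a (pscale c X) m = s c (a X m)"
    "a (bracket P X Y) m = a X (a Y m) - a Y (a X m)"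
    if "X \<in> gl" "Y \<in> gl" "m \<in> M" for X Y m c
    using lie that unfolding lie_module_def linear_on_def by blast+
  have r: "r \<sigma> \<tau> m \<in> M" "r \<sigma> \<tau> (m + n) = r \<sigma> \<tau> m + r \<sigma> \<tau> n" "r \<sigma> \<tau> (s c m) = s c (r \<sigma> \<tau> m)"
    if "\<sigma> permutes {..<p}" "\<tau> permutes {..<q}" "m \<in> M" "n \<in> M" for \<sigma> \<tau> m n c
    using M that unfolding gl_sym_module_def linear_on_def by blast+
  have rr: "r (\<sigma> \<circ> \<sigma>') (\<tau> \<circ> \<tau>') m = r \<sigma> \<tau> (r \<sigma>' \<tau>' m)"
    if "\<sigma> permutes {..<p}" "\<tau> permutes {..<q}" "\<sigma>' permutes {..<p}" "\<tau>' permutes {..<q}" "m \<in> M" for \<sigma> \<tau> \<sigma>' \<tau>' m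
    using M that unfolding gl_sym_module_def by blast
  have ra: "r \<sigma> \<tau> (a X m) = a X (r \<sigma> \<tau> m)"
    if "\<sigma> permutes {..<p}" "\<tau> permutes {..<q}" "X \<in> gl" "m \<in> M" for \<sigma> \<tau> X m
    using M that unfolding gl_sym_module_def by blast
  have r0: "r id id m = m" if "m \<in> M" for m using M that by (simp add: gl_sym_module_def)
  have f0: "0 = f 0" using f(2)[OF subM(1) subM(1)] by simp
  have fd: "f x - f y = f (x - y)" if "x \<in> M" "y \<in> M" for x y
    using f(2)[OF subM(4)[OF that] that(2)] by (simp add: algebra_simps)
  note f' = f(2)[symmetric] f(3)[symmetric] f(4)[symmetric] f(5)[symmetric] fd
  have id: "id permutes {..<n}" for n :: nat by (rule permutes_id)
  have sub': "module.subspace s' (f ` M)"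
    unfolding module.subspace_def[OF s(2)]
    by (auto simp: f' subM intro: image_eqI[of 0 f 0, OF f0])
  have lie': "lie_module pscale (bracket P) gl s' a' M'"
    unfolding lie_module_def linear_on_def M'
    by (simp add: sub' f' a aX subM gl_add gl_pscale bracket_gl[OF P])
  have "gl_sym_module P p q s' a' r' M'"
    unfolding gl_sym_module_def linear_on_def
    by (simp add: lie'[unfolded M'] M' f' r rr ra r0 a id permutes_compose subM)
  then show ?thesis
    unfolding gl_sym_isomorphic_def linear_on_def using M f by blast
qed

lemma gl_sym_module_tless:
  assumes P: "dual_system P"
  shows "gl_sym_module P p q pscale (act P) (perm_mixed P) (tless p q)"
  unfolding gl_sym_module_def linear_on_def
proof (intro conjI ballI allI impI)
  have T: "tless p q \<subseteq> mixed p q" using tless_mixed by blast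
  show "lie_module pscale (bracket P) gl pscale (act P) (tless p q)"
    by (rule lie_module_act[OF P T tless_subspace ee_tless subset_refl])
  note [simp] = perm_mixed_eq[OF P tless_mixed]
  have z: "Abs_sym id = 0" by (simp add: zero_sym_def)
  show "perm_mixed P id id m = m" if "m \<in> tless p q" for m
    using perm_mixed_eq[OF P tless_mixed[OF that] permutes_id permutes_id]
    by (simp add: z flip: zero_prod_def)
  fix f g assume f: "f permutes {..<p}" and g: "g permutes {..<q}"
  let ?h = "(Abs_sym f, Abs_sym g)"
  have h: "fst ?h \<in> Sy p" "snd ?h \<in> Sy q" by (simp_all add: Abs_sym_Sy[OF f] Abs_sym_Sy[OF g])
  have e: "perm_mixed P f g m = pact ?h m" if "m \<in> tless p q" for m
    by (rule perm_mixed_eq[OF P tless_mixed[OF that] f g])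
  show c: "perm_mixed P f g m \<in> tless p q" if "m \<in> tless p q" for m
    unfolding e[OF that] by (rule pact_tless[OF h that])
  show "perm_mixed P f g (x + y) = perm_mixed P f g x + perm_mixed P f g y" if "x \<in> tless p q" "y \<in> tless p q" for x y
    by (simp only: e that pvs.subspace_add[OF tless_subspace] plinear_add[OF plinear_pact])
  show "perm_mixed P f g (pscale c x) = pscale c (perm_mixed P f g x)" if "x \<in> tless p q" for c x
    by (simp only: e that pvs.subspace_scale[OF tless_subspace] plinear_pscale[OF plinear_pact])
  show "perm_mixed P (f \<circ> f') (g \<circ> g') m = perm_mixed P f g (perm_mixed P f' g' m)"
    if f': "f' permutes {..<p}" and g': "g' permutes {..<q}" and m: "m \<in> tless p q" for f' g' m
  proof -
    let ?k = "(Abs_sym f', Abs_sym g')"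
    have k: "fst ?k \<in> Sy p" "snd ?k \<in> Sy q" by (simp_all add: Abs_sym_Sy[OF f'] Abs_sym_Sy[OF g'])
    have "(Abs_sym (f \<circ> f'), Abs_sym (g \<circ> g')) = ?h + ?k"
      by (simp add: plus_sym_def sfun_Abs_sym[OF f] sfun_Abs_sym[OF g] sfun_Abs_sym[OF f'] sfun_Abs_sym[OF g'])
    then show ?thesis
      by (simp only: perm_mixed_eq[OF P tless_mixed[OF m] f' g'] e[OF pact_tless[OF k m]]
          perm_mixed_eq[OF P tless_mixed[OF m] permutes_compose[OF f' f] permutes_compose[OF g' g]]
          pact_plus[OF h k tless_mixed[OF m]])
  qed
  show "perm_mixed P f g (act P X m) = act P X (perm_mixed P f g m)" if X: "X \<in> gl" and m: "m \<in> tless p q" for X m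
  proof -
    have "act P X m \<in> mixed p q"
      using lie_module_act[OF P T tless_subspace ee_tless subset_refl] X m T unfolding lie_module_def by blast
    then show ?thesis
      using perm_mixed_eq[OF P _ f g] act_eq_actx[OF P X] pact_actx[OF h X tless_mixed[OF m]]
        pact_mixed[OF h tless_mixed[OF m]] tless_mixed[OF m] by simp
  qed
qed

theorem theorem2p1:
  fixes P :: "('k::field_char_0, 'v::ab_group_add, 'w::ab_group_add) dual_pair"
  assumes "dual_system P"
  shows "(\<forall>p q. gl_sym_isomorphic P p q
            pscale (act P) (perm_mixed P) (traceless P p q)
            decomp_scale (decomp_act P) decomp_perm (decomp P p q))
       \<and> (\<forall>la mu. partition_of la \<longrightarrow> partition_of mu \<longrightarrow>
            irreducible_lie_module pscale (bracket P) gl pscale (act P) (Gamma_mod P la mu)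
          \<and> highest_weight_module P pscale (act P) (Gamma_mod P la mu) (weight la mu)
          \<and> irreducible_lie_module pscale (bracket P) (sl P) pscale (act P) (Gamma_mod P la mu))"
proof (intro conjI allI impI)
  fix p q
  show "gl_sym_isomorphic P p q pscale (act P) (perm_mixed P) (traceless P p q)
      decomp_scale (decomp_act P) decomp_perm (decomp P p q)"
    unfolding traceless_eq[OF assms]
  proof (rule gl_sym_isomorphicI[OF assms gl_sym_module_tless[OF assms] _ module_decomp_scale bij_decomp_iso[OF assms]])
    show "module (pscale :: 'k \<Rightarrow> ((int list \<times> int list) \<Rightarrow>\<^sub>0 'k) \<Rightarrow> _)" by (rule pvs.module_axioms)
    show "decomp_iso p q (x + y) = decomp_iso p q x + decomp_iso p q y" for x y :: "(int list \<times> int list) \<Rightarrow>\<^sub>0 'k"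
      by (rule decomp_iso_add)
    show "decomp_iso p q (pscale c x) = decomp_scale c (decomp_iso p q x)" for c and x :: "(int list \<times> int list) \<Rightarrow>\<^sub>0 'k"
      by (rule decomp_iso_scale)
  next
    fix X m :: "(int list \<times> int list) \<Rightarrow>\<^sub>0 'k" assume X: "X \<in> gl" and m: "m \<in> tless p q"
    show "decomp_iso p q (act P X m) = decomp_act P X (decomp_iso p q m)"
    proof (rule poly_mapping_eqI)
      fix nu
      show "lk (decomp_iso p q (act P X m)) nu = lk (decomp_act P X (decomp_iso p q m)) nu"
        using cmp_act[OF assms X, of m "fst nu" "snd nu"] tless_mixed[OF m]
        by (auto simp: decomp_act_def lookup_pmap plinear_0[OF plinear_tmap] lookup_decomp_iso shapes_def)
    qed
  next
    fix f g and m :: "(int list \<times> int list) \<Rightarrow>\<^sub>0 'k"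
    assume f: "f permutes {..<p}" and g: "g permutes {..<q}" and m: "m \<in> tless p q"
    show "decomp_iso p q (perm_mixed P f g m) = decomp_perm f g (decomp_iso p q m)"
    proof (rule poly_mapping_eqI)
      fix nu
      show "lk (decomp_iso p q (perm_mixed P f g m)) nu = lk (decomp_perm f g (decomp_iso p q m)) nu"
        using cmp_pact[of "(Abs_sym f, Abs_sym g)" "fst nu" "snd nu" m] tless_mixed[OF m] Abs_sym_Sy[OF f] Abs_sym_Sy[OF g]
        by (auto simp: decomp_perm_def lookup_pmap plinear_0[OF plinear_tmap] lookup_decomp_iso shapes_def
            perm_mixed_eq[OF assms tless_mixed[OF m] f g] sfun_Abs_sym[OF f] sfun_Abs_sym[OF g])
    qed
  qed
next
  fix la mu assume la: "partition_of la" "partition_of mu"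
  show "irreducible_lie_module pscale (bracket P) gl pscale (act P) (Gamma_mod P la mu)"
    by (rule Gamma_mod_irreducible[OF assms la sl_gl subset_refl])
  show "highest_weight_module P pscale (act P) (Gamma_mod P la mu) (weight la mu)"
    by (rule Gamma_mod_highest_weight[OF assms la])
  show "irreducible_lie_module pscale (bracket P) (sl P) pscale (act P) (Gamma_mod P la mu)"
    by (rule Gamma_mod_irreducible[OF assms la subset_refl sl_gl])
qed

end
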